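(* Let $M$ be an oriented $7$-manifold with a torsion-free $G_2$-structure $\phi$, let $N\subset M$ be a $6$-dimensional submanifold with a chosen unit normal vector field $\nu$, and let $\rho=\phi|_N$ be the induced closed $SL(3,\mathbf{C})$-structure and $\omega=(i_\nu\phi)|_N$ the induced positive $(1,1)$-form on $N$. Let $\beta_{1,1}$ be the $(1,1)$-form corresponding to the Hermitian component $B_{1,1}$ of the second fundamental form $B$ of $N$ in $M$, and let $\mu$ be the mean curvature of $N$ in $M$. Then $$\beta_{1,1}\wedge\omega=\tfrac12\, d\tilde\rho ,$$ so $$\mu=\tfrac12\,(d\tilde\rho\wedge\omega)\,(\mathrm{vol})^{-1},$$ where $\mathrm{vol}=\mathrm{vol}_\rho$. In particular, if the induced $SL(3,\mathbf{C})$-structure $\rho$ is mean-convex then the mean curvature $\mu$ is positive with respect to the normal direction $\nu$.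
   Context: **Definite 3-forms in dimension 6.** A $3$-form $\rho$ on a $6$-dimensional real vector space $V$ is definite if $i_v\rho$ has rank $4$ for every non-zero $v\in V$. If $V$ is oriented, a definite $\rho$ determines a unique complex structure $I_\rho$ on $V$, compatible with the orientation, for which $\rho$ is the real part of a non-zero form of type $(3,0)$; the form $\tilde\rho$ is the unique real $3$-form such that $\rho+i\tilde\rho$ has type $(3,0)$ for $I_\rho$. Model: $\rho+i\tilde\rho=dz_1dz_2dz_3$ on $\mathbf{C}^3$. The volume form is $\mathrm{vol}_\rho=\frac14\rho\wedge\tilde\rho$. A closed $SL(3,\mathbf{C})$-structure on an oriented $6$-manifold is a $3$-form $\rho$, definite at each point, with $d\rho=0$; in this case $d\tilde\rho$ has type $(2,2)$ for $I_\rho$. **Positive 3-forms in dimension 7.** A $3$-form $\phi$ on an oriented $7$-dimensional vector space $U$ is positive if $(i_u\phi)^2\wedge\phi>0$ for all non-zero $u$. The quadratic form $u\mapsto (i_u\phi)^2\wedge\phi$ defines a conformal class, and $g_\phi$ is the Euclidean metric in this class with $|\phi|^2_{g_\phi}=7$. Model: $\phi_0=\omega_0\wedge dt+\mathrm{Re}(dz_1dz_2dz_3)$ on $\mathbf{R}\times\mathbf{C}^3$, with $\omega_0=\sum dx_i dy_i$. A torsion-free $G_2$-structure on an oriented $7$-manifold is a pointwise positive $3$-form $\phi$ with $d\phi=0$ and $d{*_\phi}\phi=0$, where $*_\phi$ is the Hodge operator of $g_\phi$; the manifold then carries the metric $g_\phi$. **Hypersurfaces.** $N$ is oriented by $\nu$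 and the orientation of $M$, i.e. so that $\omega^3>0$. Then $\rho=\phi|_N$ is definite and closed, $\omega=(i_\nu\phi)|_N$ is a positive $(1,1)$-form for $I=I_\rho$, and $\mathrm{vol}_\rho=\frac16\omega^3$ is the Riemannian volume form of $N$. $B$ is the second fundamental form of $N$ in $M$ defined, as in standard Riemannian theory, using the unit normal $\nu$; it is a symmetric bilinear form on each tangent space of $N$. The mean curvature $\mu$ is the trace of $B$ with respect to the induced metric. Write $B=B_{1,1}+B_{\mathbf{C}}$, where $B_{1,1}(u,v)=\frac12(B(u,v)+B(Iu,Iv))$ is the real part of a Hermitian form and $B_{\mathbf{C}}$ is the real part of a complex quadratic form. The corresponding $(1,1)$-form is $\beta_{1,1}(u,v)=B_{1,1}(Iu,v)$ (so the Euclidean metric on $\mathbf{C}^3$ corresponds to $\omega_0$); then $\mu=\beta_{1,1}\wedge\omega^2\,(\mathrm{vol})^{-1}$, where dividing a $6$-form by $\mathrm{vol}$ gives a function. **Mean-convexity.** A real $(2,2)$-form $\sigma$ is semi-positive at a point if $\omega'\wedge\sigma>0$ (relative to $\mathrm{vol}_\rho$) for every positive $(1,1)$-form $\omega'$ at that point. The closed structure $\rho$ is mean-convex if $d\tilde\rho$ is semi-positive at each point. *)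

theory Defs
  imports "HOL-Analysis.Analysis" "HOL-Combinatorics.Permutations"
begin

section \<open>Exterior algebra of a real vector space\<close>

text \<open>
  A \<open>k\<close>-form takes an infinite sequence of vectors, of which only the entries \<open>0, \<dots>, k - 1\<close> count.
  The degree is not part of the type and is passed explicitly where it is needed.
\<close>

type_synonym 'v form = "(nat \<Rightarrow> 'v) \<Rightarrow> real"

definition is_form :: "nat \<Rightarrow> 'v::real_vector form \<Rightarrow> bool" where
  "is_form k \<alpha> \<longleftrightarrow>
     (\<forall>v w. (\<forall>i<k. v i = w i) \<longrightarrow> \<alpha> v = \<alpha> w) \<and>
     (\<forall>i<k. \<forall>v. linear (\<lambda>x. \<alpha> (v(i := x)))) \<and>
     (\<forall>v i j. i < j \<and> j < k \<and> v i = v j \<longrightarrow> \<alpha> v = 0)"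

text \<open>
  The normalisation is the one with \<open>(dx \<and> dy)(\<partial>\<^sub>x, \<partial>\<^sub>y) = 1\<close>.
\<close>

definition wedge :: "nat \<Rightarrow> nat \<Rightarrow> 'v form \<Rightarrow> 'v form \<Rightarrow> 'v form" where
  "wedge k l \<alpha> \<beta> = (\<lambda>v.
     (\<Sum>p | p permutes {..<k + l}.
        of_int (sign p) * \<alpha> (\<lambda>i. v (p i)) * \<beta> (\<lambda>i. v (p (k + i))))
     / (fact k * fact l))"

definition interior_prod :: "'v \<Rightarrow> 'v form \<Rightarrow> 'v form" where
  "interior_prod u \<alpha> = (\<lambda>v. \<alpha> (case_nat u v))"

definition pullback :: "('v \<Rightarrow> 'w) \<Rightarrow> 'w form \<Rightarrow> 'v form" where
  "pullback L \<alpha> = (\<lambda>v. \<alpha> (\<lambda>i. L (v i)))"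


section \<open>Orientation and metrics on coordinate space\<close>

text \<open>
  For a numeral type \<open>'n\<close> the frame \<open>std_frame 0, std_frame 1, \<dots>\<close> is the list of axes with indices
  \<open>1, 2, \<dots>, CARD('n)\<close>, the last index being equal to \<open>0\<close> in \<open>'n\<close>. It defines the orientation of
  \<open>real ^ 'n\<close>.
\<close>

definition std_frame :: "nat \<Rightarrow> real ^ 'n::{finite,comm_ring_1}" where
  "std_frame k = axis (of_nat (Suc k)) 1"

definition positively_oriented :: "(nat \<Rightarrow> real ^ 'n::{finite,comm_ring_1}) \<Rightarrow> bool" where
  "positively_oriented b \<longleftrightarrow>
     (\<exists>L :: real ^ 'n::{finite,comm_ring_1} \<Rightarrow> real ^ 'n::{finite,comm_ring_1}. linear L \<and>
        (\<forall>k<CARD('n). L (std_frame k) = b k) \<and> 0 < det (matrix L))"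

text \<open>
  A form of top degree is a multiple of the standard one, the factor being its value on
  \<open>std_frame\<close>. So its sign relative to the orientation is the sign of \<open>top_coeff\<close>, and the
  quotient of two top forms is the quotient of their coefficients.
\<close>

definition top_coeff :: "(real ^ 'n::{finite,comm_ring_1}) form \<Rightarrow> real" where
  "top_coeff \<sigma> = \<sigma> std_frame"

definition top_quotient ::
    "(real ^ 'n::{finite,comm_ring_1}) form \<Rightarrow> (real ^ 'n::{finite,comm_ring_1}) form \<Rightarrow> real" where
  "top_quotient \<sigma> \<tau> = top_coeff \<sigma> / top_coeff \<tau>"

definition is_metric :: "('v::real_vector \<Rightarrow> 'v \<Rightarrow> real) \<Rightarrow> bool" where
  "is_metric g \<longleftrightarrow>
     (\<forall>u. linear (g u)) \<and> (\<forall>u v. g u v = g v u) \<and> (\<forall>u. u \<noteq> 0 \<longrightarrow> 0 < g u u)"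

definition orthonormal_frame ::
    "(real ^ 'n \<Rightarrow> real ^ 'n \<Rightarrow> real) \<Rightarrow> (nat \<Rightarrow> real ^ 'n) \<Rightarrow> bool" where
  "orthonormal_frame g e \<longleftrightarrow>
     (\<forall>i<CARD('n). \<forall>j<CARD('n). g (e i) (e j) = (if i = j then 1 else 0))"

text \<open>
  The two notions below do not depend on the orthonormal frame that is chosen. The inner product of
  forms is the one for which the products \<open>e\<^sup>i \<and> e\<^sup>j \<and> \<dots>\<close> with \<open>i < j < \<dots>\<close> are orthonormal; the factor
  \<open>1 / fact k\<close> compensates for summing over all index sequences.
\<close>

definition form_inner ::
    "(real ^ 'n \<Rightarrow> real ^ 'n \<Rightarrow> real) \<Rightarrow> nat \<Rightarrow> (real ^ 'n) form \<Rightarrow> (real ^ 'n) form \<Rightarrow> real" where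
  "form_inner g k \<alpha> \<beta> =
     (let e = (SOME e. orthonormal_frame g e) in
        (\<Sum>s \<in> {..<k} \<rightarrow>\<^sub>E {..<CARD('n)}. \<alpha> (\<lambda>i. e (s i)) * \<beta> (\<lambda>i. e (s i))) / fact k)"

definition metric_trace ::
    "(real ^ 'n \<Rightarrow> real ^ 'n \<Rightarrow> real) \<Rightarrow> (real ^ 'n \<Rightarrow> real ^ 'n \<Rightarrow> real) \<Rightarrow> real" where
  "metric_trace g B =
     (let e = (SOME e. orthonormal_frame g e) in \<Sum>i<CARD('n). B (e i) (e i))"

definition volume_form ::
    "(real ^ 'n::{finite,comm_ring_1} \<Rightarrow> real ^ 'n::{finite,comm_ring_1} \<Rightarrow> real) \<Rightarrow> (real ^ 'n::{finite,comm_ring_1}) form" where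
  "volume_form g = (THE \<eta>. is_form CARD('n) \<eta> \<and>
     (\<forall>e. orthonormal_frame g e \<and> positively_oriented e \<longrightarrow> \<eta> e = 1))"

definition hodge ::
    "(real ^ 'n::{finite,comm_ring_1} \<Rightarrow> real ^ 'n::{finite,comm_ring_1} \<Rightarrow> real) \<Rightarrow> nat
       \<Rightarrow> (real ^ 'n::{finite,comm_ring_1}) form \<Rightarrow> (real ^ 'n::{finite,comm_ring_1}) form" where
  "hodge g k \<alpha> = (THE \<eta>. is_form (CARD('n) - k) \<eta> \<and>
     (\<forall>\<gamma>. is_form k \<gamma> \<longrightarrow>
        wedge k (CARD('n) - k) \<gamma> \<eta> = (\<lambda>v. form_inner g k \<gamma> \<alpha> * volume_form g v)))"


section \<open>Definite 3-forms in dimension 6\<close>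

definition rank_2form :: "(real ^ 'n) form \<Rightarrow> nat" where
  "rank_2form \<alpha> = rank (\<chi> i j. \<alpha> (case_nat (axis i 1) (\<lambda>_. axis j 1)))"

definition definite_3form :: "(real ^ 6) form \<Rightarrow> bool" where
  "definite_3form \<rho> \<longleftrightarrow>
     is_form 3 \<rho> \<and> (\<forall>v. v \<noteq> 0 \<longrightarrow> rank_2form (interior_prod v \<rho>) = 4)"

definition complex_structure :: "('v::real_vector \<Rightarrow> 'v) \<Rightarrow> bool" where
  "complex_structure I \<longleftrightarrow> linear I \<and> (\<forall>v. I (I v) = - v)"

text \<open>
  All frames \<open>(a, I a, b, I b, c, I c)\<close> define the same orientation, so one of them suffices.
\<close>

definition orientation_compatible :: "(real ^ 6 \<Rightarrow> real ^ 6) \<Rightarrow> bool" where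
  "orientation_compatible I \<longleftrightarrow>
     (\<exists>a b c. positively_oriented (\<lambda>k. [a, I a, b, I b, c, I c] ! k))"

text \<open>
  \<open>type_3_0 I \<rho> \<tau>\<close>: the complex-valued 3-form \<open>\<rho> + i \<tau>\<close> is complex multilinear for \<open>I\<close>.
\<close>

definition type_3_0 ::
    "('v::real_vector \<Rightarrow> 'v) \<Rightarrow> 'v form \<Rightarrow> 'v form \<Rightarrow> bool" where
  "type_3_0 I \<rho> \<tau> \<longleftrightarrow> is_form 3 \<rho> \<and> is_form 3 \<tau> \<and>
     (\<forall>j<3. \<forall>v. Complex (\<rho> (v(j := I (v j)))) (\<tau> (v(j := I (v j)))) = \<i> * Complex (\<rho> v) (\<tau> v))"

definition complex_structure_of :: "(real ^ 6) form \<Rightarrow> real ^ 6 \<Rightarrow> real ^ 6" where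
  "complex_structure_of \<rho> = (THE I. complex_structure I \<and> orientation_compatible I \<and>
     (\<exists>\<tau>. type_3_0 I \<rho> \<tau> \<and> (\<exists>v. Complex (\<rho> v) (\<tau> v) \<noteq> 0)))"

definition tilde :: "(real ^ 6) form \<Rightarrow> (real ^ 6) form" where
  "tilde \<rho> = (THE \<tau>. type_3_0 (complex_structure_of \<rho>) \<rho> \<tau>)"

definition vol_3form :: "(real ^ 6) form \<Rightarrow> (real ^ 6) form" where
  "vol_3form \<rho> = (\<lambda>v. wedge 3 3 \<rho> (tilde \<rho>) v / 4)"

definition positive_1_1_form :: "('v::real_vector \<Rightarrow> 'v) \<Rightarrow> 'v form \<Rightarrow> bool" where
  "positive_1_1_form I \<omega> \<longleftrightarrow> is_form 2 \<omega> \<and>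
     (\<forall>v. \<omega> (\<lambda>i. I (v i)) = \<omega> v) \<and>
     (\<forall>u. u \<noteq> 0 \<longrightarrow> 0 < \<omega> (case_nat u (\<lambda>_. I u)))"

definition semi_positive :: "(real ^ 6) form \<Rightarrow> (real ^ 6) form \<Rightarrow> bool" where
  "semi_positive \<rho> \<sigma> \<longleftrightarrow>
     (\<forall>\<omega>'. positive_1_1_form (complex_structure_of \<rho>) \<omega>' \<longrightarrow>
        0 < top_quotient (wedge 2 4 \<omega>' \<sigma>) (vol_3form \<rho>))"

definition hermitian_part :: "('v \<Rightarrow> 'v) \<Rightarrow> ('v \<Rightarrow> 'v \<Rightarrow> real) \<Rightarrow> 'v \<Rightarrow> 'v \<Rightarrow> real" where
  "hermitian_part I B u v = (B u v + B (I u) (I v)) / 2"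

definition form_of_hermitian :: "('v \<Rightarrow> 'v) \<Rightarrow> ('v \<Rightarrow> 'v \<Rightarrow> real) \<Rightarrow> 'v form" where
  "form_of_hermitian I H = (\<lambda>v. H (I (v 0)) (v 1))"


section \<open>Positive 3-forms in dimension 7\<close>

definition positive_3form_density :: "(real ^ 7) form \<Rightarrow> real ^ 7 \<Rightarrow> (real ^ 7) form" where
  "positive_3form_density \<phi> u =
     wedge 4 3 (wedge 2 2 (interior_prod u \<phi>) (interior_prod u \<phi>)) \<phi>"

definition positive_3form :: "(real ^ 7) form \<Rightarrow> bool" where
  "positive_3form \<phi> \<longleftrightarrow>
     is_form 3 \<phi> \<and> (\<forall>u. u \<noteq> 0 \<longrightarrow> 0 < top_coeff (positive_3form_density \<phi> u))"

definition G2_metric :: "(real ^ 7) form \<Rightarrow> real ^ 7 \<Rightarrow> real ^ 7 \<Rightarrow> real" where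
  "G2_metric \<phi> = (THE g. is_metric g \<and>
     (\<exists>c>0. \<forall>u. g u u = c * top_coeff (positive_3form_density \<phi> u)) \<and>
     form_inner g 3 \<phi> \<phi> = 7)"


section \<open>Smooth functions, and calculus on open subsets of coordinate space\<close>

text \<open>
  For open \<open>S\<close> only. Since the domain is finite-dimensional, \<open>C\<^sup>k\<^sup>+\<^sup>1\<close> means: differentiable, with all
  directional derivatives \<open>C\<^sup>k\<close>.
\<close>

primrec Ck_on :: "nat \<Rightarrow> 'a::euclidean_space set \<Rightarrow> ('a \<Rightarrow> 'b::real_normed_vector) \<Rightarrow> bool" where
  "Ck_on 0 S f = continuous_on S f"
| "Ck_on (Suc k) S f =
     ((\<forall>x\<in>S. f differentiable at x) \<and> (\<forall>v. Ck_on k S (\<lambda>x. frechet_derivative f (at x) v)))"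

definition smooth_on :: "'a::euclidean_space set \<Rightarrow> ('a \<Rightarrow> 'b::real_normed_vector) \<Rightarrow> bool" where
  "smooth_on S f \<longleftrightarrow> (\<forall>k. Ck_on k S f)"

text \<open>
  Exterior derivative of a \<open>k\<close>-form on an open set, at the point \<open>x\<close>:
  \<open>(d\<alpha>)(v\<^sub>0, \<dots>, v\<^sub>k)\<close> is the alternating sum of the derivatives of \<open>\<alpha>(v\<^sub>0, \<dots>, omit v\<^sub>i, \<dots>, v\<^sub>k)\<close> in the
  direction \<open>v\<^sub>i\<close>, the vectors \<open>v\<^sub>i\<close> being extended as constant fields.
\<close>

definition ext_deriv_at ::
    "nat \<Rightarrow> ('a::real_normed_vector \<Rightarrow> 'a form) \<Rightarrow> 'a \<Rightarrow> 'a form" where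
  "ext_deriv_at k \<alpha> x = (\<lambda>v. \<Sum>i\<le>k. (-1) ^ i *
     frechet_derivative (\<lambda>y. \<alpha> y (\<lambda>j. if j < i then v j else v (Suc j))) (at x) (v i))"

text \<open>
  The Christoffel symbols of the Levi-Civita connection of \<open>G\<close> (Koszul formula for constant fields).
\<close>

definition christoffel ::
    "('a::real_normed_vector \<Rightarrow> 'a \<Rightarrow> 'a \<Rightarrow> real) \<Rightarrow> 'a \<Rightarrow> 'a \<Rightarrow> 'a \<Rightarrow> 'a" where
  "christoffel G x u v = (THE w. \<forall>z. 2 * G x w z =
     frechet_derivative (\<lambda>y. G y v z) (at x) u + frechet_derivative (\<lambda>y. G y u z) (at x) v
     - frechet_derivative (\<lambda>y. G y u v) (at x) z)"

text \<open>
  Levi-Civita covariant derivative, at \<open>y\<close> in the direction \<open>u\<close>, of a vector field \<open>Y\<close> along a map \<open>f\<close>.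
\<close>

definition covariant_deriv_along ::
    "('a::real_normed_vector \<Rightarrow> 'a \<Rightarrow> 'a \<Rightarrow> real) \<Rightarrow> ('b::real_normed_vector \<Rightarrow> 'a)
       \<Rightarrow> ('b \<Rightarrow> 'a) \<Rightarrow> 'b \<Rightarrow> 'b \<Rightarrow> 'a" where
  "covariant_deriv_along G f Y y u =
     frechet_derivative Y (at y) u
     + christoffel G (f y) (frechet_derivative f (at y) u) (Y y)"


section \<open>Oriented manifolds and tensor fields\<close>

text \<open>
  A chart is a domain together with a coordinate map. Manifolds are subsets of a Hausdorff, second
  countable type, with the subspace topology; the orientation is part of the atlas.
\<close>

type_synonym ('m, 'n) chart = "'m set \<times> ('m \<Rightarrow> real ^ 'n)"

abbreviation chart_dom :: "('m, 'n) chart \<Rightarrow> 'm set" where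
  "chart_dom c \<equiv> fst c"

abbreviation chart_fun :: "('m, 'n) chart \<Rightarrow> 'm \<Rightarrow> real ^ 'n" where
  "chart_fun c \<equiv> snd c"

definition chart_inv :: "('m, 'n) chart \<Rightarrow> real ^ 'n \<Rightarrow> 'm" where
  "chart_inv c = inv_into (chart_dom c) (chart_fun c)"

definition is_chart :: "'m::topological_space set \<Rightarrow> ('m, 'n::finite) chart \<Rightarrow> bool" where
  "is_chart S c \<longleftrightarrow>
     openin (top_of_set S) (chart_dom c) \<and>
     open (chart_fun c ` chart_dom c) \<and>
     homeomorphism (chart_dom c) (chart_fun c ` chart_dom c) (chart_fun c) (chart_inv c)"

text \<open>
  The map from the coordinates of \<open>c\<close> to those of \<open>d\<close> where both are defined. The charts may belong to
  different manifolds; then this is the coordinate expression of the inclusion.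
\<close>

definition coord_map :: "('m, 'k::finite) chart \<Rightarrow> ('m, 'n::finite) chart \<Rightarrow> real ^ 'k \<Rightarrow> real ^ 'n" where
  "coord_map c d = (\<lambda>x. chart_fun d (chart_inv c x))"

definition oriented_manifold ::
    "'m::{t2_space,second_countable_topology} set \<Rightarrow> ('m, 'n::finite) chart set \<Rightarrow> bool" where
  "oriented_manifold S A \<longleftrightarrow>
     (\<forall>c\<in>A. is_chart S c) \<and> (\<Union>c\<in>A. chart_dom c) = S \<and>
     (\<forall>c\<in>A. \<forall>d\<in>A.
        smooth_on (chart_fun c ` (chart_dom c \<inter> chart_dom d)) (coord_map c d) \<and>
        (\<forall>p \<in> chart_dom c \<inter> chart_dom d.
           0 < det (matrix (frechet_derivative (coord_map c d) (at (chart_fun c p))))))"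

text \<open>
  An embedded submanifold \<open>N\<close> of \<open>M\<close>: the charts of \<open>N\<close> are charts for the subspace topology
  and the inclusion is a smooth immersion.
\<close>

definition embedded_submanifold ::
    "'m::{t2_space,second_countable_topology} set \<Rightarrow> ('m, 'k::finite) chart set
       \<Rightarrow> 'm set \<Rightarrow> ('m, 'n::finite) chart set \<Rightarrow> bool" where
  "embedded_submanifold N AN M AM \<longleftrightarrow>
     N \<subseteq> M \<and> oriented_manifold N AN \<and>
     (\<forall>d\<in>AN. \<forall>c\<in>AM.
        smooth_on (chart_fun d ` (chart_dom d \<inter> chart_dom c)) (coord_map d c) \<and>
        (\<forall>p \<in> chart_dom d \<inter> chart_dom c.
           inj (frechet_derivative (coord_map d c) (at (chart_fun d p)))))"

text \<open>
  Every point \<open>p\<close> has a preferred chart \<open>chart_at A p\<close>, and the tangent space at \<open>p\<close> is identified with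
  coordinate space by means of it. A tensor field therefore assigns to every point a tensor on
  coordinate space, and \<open>tangent_coord A c p\<close> translates tangent vectors at \<open>p\<close> from the
  coordinates of an arbitrary chart \<open>c\<close> around \<open>p\<close> to those of the preferred one.
\<close>

definition chart_at :: "('m, 'n) chart set \<Rightarrow> 'm \<Rightarrow> ('m, 'n) chart" where
  "chart_at A p = (SOME c. c \<in> A \<and> p \<in> chart_dom c)"

definition tangent_coord ::
    "('m, 'n::finite) chart set \<Rightarrow> ('m, 'n) chart \<Rightarrow> 'm \<Rightarrow> real ^ 'n \<Rightarrow> real ^ 'n" where
  "tangent_coord A c p = frechet_derivative (coord_map c (chart_at A p)) (at (chart_fun c p))"

definition local_form ::
    "('m, 'n::finite) chart set \<Rightarrow> ('m, 'n) chart \<Rightarrow> ('m \<Rightarrow> (real ^ 'n) form)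
       \<Rightarrow> real ^ 'n \<Rightarrow> (real ^ 'n) form" where
  "local_form A c \<alpha> x =
     (let p = chart_inv c x in pullback (tangent_coord A c p) (\<alpha> p))"

definition local_metric ::
    "('m, 'n::finite) chart set \<Rightarrow> ('m, 'n) chart \<Rightarrow> ('m \<Rightarrow> real ^ 'n \<Rightarrow> real ^ 'n \<Rightarrow> real)
       \<Rightarrow> real ^ 'n \<Rightarrow> real ^ 'n \<Rightarrow> real ^ 'n \<Rightarrow> real" where
  "local_metric A c g x u v =
     (let p = chart_inv c x in g p (tangent_coord A c p u) (tangent_coord A c p v))"

definition smooth_form_field ::
    "'m set \<Rightarrow> ('m, 'n::finite) chart set \<Rightarrow> nat \<Rightarrow> ('m \<Rightarrow> (real ^ 'n) form) \<Rightarrow> bool" where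
  "smooth_form_field M A k \<alpha> \<longleftrightarrow>
     (\<forall>p\<in>M. is_form k (\<alpha> p)) \<and>
     (\<forall>c\<in>A. \<forall>v. smooth_on (chart_fun c ` chart_dom c) (\<lambda>x. local_form A c \<alpha> x v))"

definition ext_deriv ::
    "('m, 'n::finite) chart set \<Rightarrow> nat \<Rightarrow> ('m \<Rightarrow> (real ^ 'n) form) \<Rightarrow> 'm \<Rightarrow> (real ^ 'n) form" where
  "ext_deriv A k \<alpha> p =
     (let c = chart_at A p in ext_deriv_at k (local_form A c \<alpha>) (chart_fun c p))"

definition torsion_free_G2 ::
    "'m set \<Rightarrow> ('m, 7) chart set \<Rightarrow> ('m \<Rightarrow> (real ^ 7) form) \<Rightarrow> bool" where
  "torsion_free_G2 M A \<phi> \<longleftrightarrow>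
     smooth_form_field M A 3 \<phi> \<and>
     (\<forall>p\<in>M. positive_3form (\<phi> p)) \<and>
     (\<forall>p\<in>M. ext_deriv A 3 \<phi> p = (\<lambda>_. 0)) \<and>
     (\<forall>p\<in>M. ext_deriv A 4 (\<lambda>q. hodge (G2_metric (\<phi> q)) 3 (\<phi> q)) p = (\<lambda>_. 0))"

definition mean_convex ::
    "'m set \<Rightarrow> ('m, 6) chart set \<Rightarrow> ('m \<Rightarrow> (real ^ 6) form) \<Rightarrow> bool" where
  "mean_convex N A \<rho> \<longleftrightarrow>
     (\<forall>p\<in>N. semi_positive (\<rho> p) (ext_deriv A 3 (\<lambda>q. tilde (\<rho> q)) p))"


section \<open>Riemannian geometry of submanifolds\<close>

definition incl_deriv ::
    "('m, 'k::finite) chart set \<Rightarrow> ('m, 'n::finite) chart set \<Rightarrow> 'm \<Rightarrow> real ^ 'k \<Rightarrow> real ^ 'n" where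
  "incl_deriv AN AM p =
     frechet_derivative (coord_map (chart_at AN p) (chart_at AM p)) (at (chart_fun (chart_at AN p) p))"

definition restrict_form ::
    "('m, 'k::finite) chart set \<Rightarrow> ('m, 'n::finite) chart set
       \<Rightarrow> ('m \<Rightarrow> (real ^ 'n) form) \<Rightarrow> 'm \<Rightarrow> (real ^ 'k) form" where
  "restrict_form AN AM \<alpha> p = pullback (incl_deriv AN AM p) (\<alpha> p)"

definition induced_metric ::
    "('m, 'k::finite) chart set \<Rightarrow> ('m, 'n::finite) chart set
       \<Rightarrow> ('m \<Rightarrow> real ^ 'n \<Rightarrow> real ^ 'n \<Rightarrow> real) \<Rightarrow> 'm \<Rightarrow> real ^ 'k \<Rightarrow> real ^ 'k \<Rightarrow> real" where
  "induced_metric AN AM g p u v = g p (incl_deriv AN AM p u) (incl_deriv AN AM p v)"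

text \<open>
  A smooth field along \<open>N\<close> of unit vectors of \<open>M\<close> normal to \<open>N\<close>. In a chart \<open>c\<close> of \<open>M\<close> the vector \<open>\<nu> p\<close>
  is the image of \<open>\<nu> p\<close> under the derivative of the coordinate change from the preferred chart to \<open>c\<close>.
\<close>

definition unit_normal_field ::
    "'m set \<Rightarrow> ('m, 'k::finite) chart set \<Rightarrow> ('m, 'n::finite) chart set
       \<Rightarrow> ('m \<Rightarrow> real ^ 'n \<Rightarrow> real ^ 'n \<Rightarrow> real) \<Rightarrow> ('m \<Rightarrow> real ^ 'n) \<Rightarrow> bool" where
  "unit_normal_field N AN AM g \<nu> \<longleftrightarrow>
     (\<forall>p\<in>N. g p (\<nu> p) (\<nu> p) = 1 \<and> (\<forall>u. g p (\<nu> p) (incl_deriv AN AM p u) = 0)) \<and>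
     (\<forall>d\<in>AN. \<forall>c\<in>AM. smooth_on (chart_fun d ` (chart_dom d \<inter> chart_dom c))
        (\<lambda>y. let p = chart_inv d y; c0 = chart_at AM p in
           frechet_derivative (coord_map c0 c) (at (chart_fun c0 p)) (\<nu> p)))"

text \<open>
  \<open>B(u, v) = g(\<nabla>\<^sub>u V, \<nu>)\<close> for a tangent field \<open>V\<close> of \<open>N\<close> extending \<open>v\<close>; here \<open>V\<close> is the field with
  constant components in the chart of \<open>N\<close>, regarded as a field along the inclusion. With this sign a
  round sphere has positive mean curvature with respect to the inward normal.
\<close>

definition second_fundamental_form ::
    "('m, 'k::finite) chart set \<Rightarrow> ('m, 'n::finite) chart set
       \<Rightarrow> ('m \<Rightarrow> real ^ 'n \<Rightarrow> real ^ 'n \<Rightarrow> real) \<Rightarrow> ('m \<Rightarrow> real ^ 'n)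
       \<Rightarrow> 'm \<Rightarrow> real ^ 'k \<Rightarrow> real ^ 'k \<Rightarrow> real" where
  "second_fundamental_form AN AM g \<nu> p u v =
     (let d = chart_at AN p; c = chart_at AM p; f = coord_map d c;
          V = (\<lambda>y. frechet_derivative f (at y) v)
      in g p (covariant_deriv_along (local_metric AM c g) f V (chart_fun d p) u) (\<nu> p))"

definition mean_curvature ::
    "('m, 'k::finite) chart set \<Rightarrow> ('m, 'n::finite) chart set
       \<Rightarrow> ('m \<Rightarrow> real ^ 'n \<Rightarrow> real ^ 'n \<Rightarrow> real) \<Rightarrow> ('m \<Rightarrow> real ^ 'n) \<Rightarrow> 'm \<Rightarrow> real" where
  "mean_curvature AN AM g \<nu> p =
     metric_trace (induced_metric AN AM g p) (second_fundamental_form AN AM g \<nu> p)"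

end

theory Submission
  imports Defs
begin

text \<open>
  Put \<open>\<psi> = *\<phi>\<close>, so that \<open>\<rho>t\<close> is the restriction of \<open>- i\<^sub>\<nu> \<psi>\<close> to \<open>N\<close>. In coordinates, the terms of \<open>d \<rho>t\<close> are
  covariant derivatives of \<open>\<psi>(\<nu>, v\<^sub>1, v\<^sub>2, v\<^sub>3)\<close> along \<open>N\<close>. Those that fall on the tangent fields cancel, since
  the second derivative of the inclusion is symmetric. Those that fall on \<open>\<psi>\<close> add up, by \<open>d \<psi> = 0\<close>, to
  \<open>\<nabla>\<^sub>\<nu> \<psi>\<close> restricted to \<open>N\<close>; this vanishes because \<open>d \<phi> = 0\<close> and \<open>d \<psi> = 0\<close> already force, by linear algebra
  at one point, the relevant components of \<open>\<nabla> \<psi>\<close> to be zero. Since \<open>\<nabla>\<^sub>u \<nu> = - \<Sum>\<^sub>j B(u, e\<^sub>j) e\<^sub>j\<close>, what remains is the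
  derivation by \<open>B\<close> applied to the restriction \<open>\<omega>\<^sup>2 / 2\<close> of \<open>\<psi>\<close>. It only sees the Hermitian part of \<open>B\<close>, and it
  equals \<open>2 \<beta> \<and> \<omega>\<close> by evaluation in a frame in which \<open>\<phi>\<close> has its standard form. Such a frame exists for every
  positive form: maximise \<open>\<phi>\<close> over orthonormal triples.
\<close>

section \<open>Forms and wedge products\<close>

text \<open>Metric, dual form and complex structure are all given by definite descriptions, so they
  can be neither evaluated nor differentiated directly. Pointwise, the bridge is an adapted frame,
  in which every object has a fixed table of values; but such frames need not vary smoothly and are
  never differentiated. Derivatives go through the frame-free identity \<psi>(u,v,w,z) = \<phi>(u
  \<times> v,w,z) - g(u,w) g(v,z) + g(u,z) g(v,w), with an algebraic formula (a ninth root) for g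
  and Cramer's rule for the cross product. As g is parallel, the identity expresses \<nabla>\<psi>
  through \<nabla>\<phi>. Since \<nabla>\<psi> is alternating, only 7 of the 35 components of
  \<nabla>\<phi> in each direction stay free, and closedness of both forms removes those that
  \<nabla>\<psi>, in the normal direction, shows on N. So the full theorem that closed and coclosed
  structures are parallel is bypassed.\<close>

abbreviation vcons :: "'v \<Rightarrow> (nat \<Rightarrow> 'v) \<Rightarrow> nat \<Rightarrow> 'v" (infixr "##" 65) where
  "u ## v \<equiv> case_nat u v"

lemma interior_prod_apply: "interior_prod u \<alpha> v = \<alpha> (u ## v)"
  by (simp add: interior_prod_def)

lemma form_cong: "is_form k \<alpha> \<Longrightarrow> (\<And>i. i < k \<Longrightarrow> v i = w i) \<Longrightarrow> \<alpha> v = \<alpha> w"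
  unfolding is_form_def by blast

lemma form_linear: "is_form k \<alpha> \<Longrightarrow> i < k \<Longrightarrow> linear (\<lambda>x. \<alpha> (v(i := x)))"
  unfolding is_form_def by blast

lemma form_eq_0: "is_form k \<alpha> \<Longrightarrow> i < k \<Longrightarrow> j < k \<Longrightarrow> i \<noteq> j \<Longrightarrow> v i = v j \<Longrightarrow> \<alpha> v = 0"
  unfolding is_form_def by (metis linorder_neqE_nat)

text \<open>Polarisation: expand the vanishing value on \<open>v i + v j\<close> placed in both
  slots.\<close>

lemma form_swap:
  assumes a: "is_form k \<alpha>" and ij: "i < k" "j < k" "i \<noteq> j"
  shows "\<alpha> (\<lambda>m. v (Transposition.transpose i j m)) = - \<alpha> v"
proof -
  let ?f = "\<lambda>x y. \<alpha> (v(i := x, j := y))"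
  have li: "linear (\<lambda>x. ?f x y)" for y
  proof -
    have "(\<lambda>x. ?f x y) = (\<lambda>x. \<alpha> ((v(j := y))(i := x)))"
      using ij by (simp add: fun_upd_twist)
    then show ?thesis using form_linear[OF a ij(1), of "v(j := y)"] by simp
  qed
  have lj: "linear (\<lambda>y. ?f x y)" for x by (rule form_linear[OF a ij(2)])
  have z: "?f x x = 0" for x
    using ij by (intro form_eq_0[OF a, of i j]) auto
  have "?f (v i + v j) (v i + v j) = ?f (v i) (v i) + ?f (v i) (v j) + ?f (v j) (v i) + ?f (v j) (v j)"
    unfolding linear_add[OF li] linear_add[OF lj] by simp
  then have "?f (v j) (v i) = - ?f (v i) (v j)" unfolding z by simp
  moreover have "v(i := v j, j := v i) = (\<lambda>m. v (Transposition.transpose i j m))"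
    using ij by (auto simp: Transposition.transpose_def fun_eq_iff)
  moreover have "v(i := v i, j := v j) = v" by auto
  ultimately show ?thesis by simp
qed

lemma form_permute:
  assumes a: "is_form k \<alpha>" and p: "p permutes {..<k}"
  shows "\<alpha> (\<lambda>i. v (p i)) = of_int (sign p) * \<alpha> v"
  using p finite_lessThan
proof (induction arbitrary: v rule: permutes_induct)
  case id
  then show ?case by simp
next
  case (swap x y p)
  have "\<alpha> (\<lambda>i. v ((Transposition.transpose x y \<circ> p) i)) = of_int (sign p) * \<alpha> (\<lambda>i. v (Transposition.transpose x y i))"
    using swap.IH[of "\<lambda>i. v (Transposition.transpose x y i)"] by simp
  also have "\<dots> = of_int (sign p) * (if x = y then \<alpha> v else - \<alpha> v)"
    using form_swap[OF a, of x y v] swap.hyps by auto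
  also have "\<dots> = of_int (sign (Transposition.transpose x y \<circ> p)) * \<alpha> v"
    using swap.hyps by (subst sign_compose) (auto simp: permutation_swap_id sign_swap_id intro: permutation_permutes[THEN iffD2])
  finally show ?case by (simp add: o_def)
qed

lemma is_form_interior:
  assumes "is_form (Suc k) \<alpha>"
  shows "is_form k (interior_prod u \<alpha>)"
  unfolding is_form_def interior_prod_apply
proof (intro conjI allI impI)
  fix v w :: "nat \<Rightarrow> 'a" assume "\<forall>i<k. v i = w i"
  then show "\<alpha> (u ## v) = \<alpha> (u ## w)"
    by (intro form_cong[OF assms]) (auto split: nat.split)
next
  fix i and v :: "nat \<Rightarrow> 'a" assume i: "i < k"
  have "(u ## v(i := x)) = (u ## v)(Suc i := x)" for x
    by (auto simp: fun_eq_iff split: nat.split)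
  then show "linear (\<lambda>x. \<alpha> (u ## v(i := x)))"
    using form_linear[OF assms, of "Suc i" "u ## v"] i by simp
next
  fix v :: "nat \<Rightarrow> 'a" and i j assume "i < j \<and> j < k \<and> v i = v j"
  then show "\<alpha> (u ## v) = 0" by (intro form_eq_0[OF assms, of "Suc i" "Suc j"]) auto
qed

lemma is_form_scale: "is_form k \<alpha> \<Longrightarrow> is_form k (\<lambda>v. c * \<alpha> v)"
  unfolding is_form_def by (auto simp: linear_iff algebra_simps)

lemma is_form_divide: "is_form k \<alpha> \<Longrightarrow> is_form k (\<lambda>v. \<alpha> v / c)"
  using is_form_scale[of k \<alpha> "1 / c"] by simp

lemma is_form_minus: "is_form k \<alpha> \<Longrightarrow> is_form k (\<lambda>v. - \<alpha> v)"
  using is_form_scale[of k \<alpha> "- 1"] by simp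

lemma is_form_add:
  assumes "is_form k \<alpha>" "is_form k \<beta>" shows "is_form k (\<lambda>v. \<alpha> v + \<beta> v)"
  unfolding is_form_def
proof (intro conjI allI impI)
  show "\<alpha> v + \<beta> v = \<alpha> w + \<beta> w" if "\<forall>i<k. v i = w i" for v w
    using that form_cong[OF assms(1), of v w] form_cong[OF assms(2), of v w] by auto
  show "linear (\<lambda>x. \<alpha> (v(i := x)) + \<beta> (v(i := x)))" if "i < k" for v i
    using that by (intro linear_compose_add form_linear[OF assms(1)] form_linear[OF assms(2)]) auto
  show "\<alpha> v + \<beta> v = 0" if "i < j \<and> j < k \<and> v i = v j" for v i j
    using that form_eq_0[OF assms(1), of i j v] form_eq_0[OF assms(2), of i j v] by auto
qed

lemma is_form_diff: "is_form k \<alpha> \<Longrightarrow> is_form k \<beta> \<Longrightarrow> is_form k (\<lambda>v. \<alpha> v - \<beta> v)"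
  using is_form_add[OF _ is_form_minus, of k \<alpha> \<beta>] by simp

lemma is_form_zero: "is_form k (\<lambda>v. 0)"
  unfolding is_form_def by (auto simp: linear_iff)

lemma is_form_sum: "(\<And>i. i \<in> A \<Longrightarrow> is_form k (\<alpha> i)) \<Longrightarrow> is_form k (\<lambda>v. \<Sum>i\<in>A. \<alpha> i v)"
  by (induction A rule: infinite_finite_induct) (auto intro: is_form_zero is_form_add)

lemma is_form_pullback:
  assumes "linear L" "is_form k \<alpha>" shows "is_form k (pullback L \<alpha>)"
  unfolding is_form_def pullback_def
proof (intro conjI allI impI)
  fix v w :: "nat \<Rightarrow> 'a" assume "\<forall>i<k. v i = w i"
  then show "\<alpha> (\<lambda>i. L (v i)) = \<alpha> (\<lambda>i. L (w i))"
    by (intro form_cong[OF assms(2)]) auto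
next
  fix i and v :: "nat \<Rightarrow> 'a" assume i: "i < k"
  have "(\<lambda>j. L ((v(i := x)) j)) = (\<lambda>j. L (v j))(i := L x)" for x by auto
  then show "linear (\<lambda>x. \<alpha> (\<lambda>j. L ((v(i := x)) j)))"
    using linear_compose[OF assms(1) form_linear[OF assms(2) i, of "\<lambda>j. L (v j)"]]
    by (simp add: o_def)
next
  fix v :: "nat \<Rightarrow> 'a" and i j assume "i < j \<and> j < k \<and> v i = v j"
  then show "\<alpha> (\<lambda>i. L (v i)) = 0" by (intro form_eq_0[OF assms(2), of i j]) auto
qed

lemma is_form_1: "linear f \<Longrightarrow> is_form 1 (\<lambda>v. f (v 0))"
  unfolding is_form_def by auto

lemma is_form_wedge:
  assumes a: "is_form k \<alpha>" and b: "is_form l \<beta>"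
  shows "is_form (k + l) (wedge k l \<alpha> \<beta>)"
proof -
  let ?P = "{p. p permutes {..<k + l}}"
  let ?T = "\<lambda>v p. of_int (sign p) * \<alpha> (\<lambda>i. v (p i)) * \<beta> (\<lambda>i. v (p (k + i)))"
  have lt: "p i < k + l" if "p \<in> ?P" "i < k + l" for p i
    using that permutes_in_image[of p "{..<k + l}" i] by auto
  have "is_form (k + l) (\<lambda>v. \<Sum>p\<in>?P. ?T v p)"
    unfolding is_form_def
  proof (intro conjI allI impI)
    fix v w :: "nat \<Rightarrow> 'a" assume vw: "\<forall>i<k + l. v i = w i"
    have "\<alpha> (\<lambda>i. v (p i)) = \<alpha> (\<lambda>i. w (p i))" "\<beta> (\<lambda>i. v (p (k + i))) = \<beta> (\<lambda>i. w (p (k + i)))"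
      if "p \<in> ?P" for p
      using vw lt[OF that] by (auto intro: form_cong[OF a] form_cong[OF b])
    then show "(\<Sum>p\<in>?P. ?T v p) = (\<Sum>p\<in>?P. ?T w p)" by (intro sum.cong) auto
  next
    fix i and v :: "nat \<Rightarrow> 'a" assume i: "i < k + l"
    have "linear (\<lambda>x. ?T (v(i := x)) p)" if p: "p \<in> ?P" for p
    proof -
      obtain j where j: "j < k + l" "p j = i"
        using p i permutes_surj[of p] permutes_in_image[of p "{..<k + l}"]
        by (metis lessThan_iff mem_Collect_eq surj_def)
      have inj: "p m = i \<longleftrightarrow> m = j" for m
        using p j permutes_inj[of p] by (auto dest: injD)
      show ?thesis
      proof (cases "j < k")
        case True
        have 1: "(\<lambda>m. (v(i := x)) (p m)) = (\<lambda>m. v (p m))(j := x)" for x using inj by auto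
        have 2: "(\<lambda>m. (v(i := x)) (p (k + m))) = (\<lambda>m. v (p (k + m)))" for x
          using inj True by (auto simp: fun_eq_iff)
        show ?thesis unfolding 1 2
          using form_linear[OF a True, of "\<lambda>m. v (p m)"] by (simp add: linear_iff algebra_simps)
      next
        case False
        then have k: "j - k < l" "k + (j - k) = j" using j by auto
        have 1: "\<alpha> (\<lambda>m. (v(i := x)) (p m)) = \<alpha> (\<lambda>m. v (p m))" for x
          using inj False by (intro form_cong[OF a]) auto
        have 2: "(\<lambda>m. (v(i := x)) (p (k + m))) = (\<lambda>m. v (p (k + m)))(j - k := x)" for x
          using inj k by (auto simp: fun_eq_iff)
        show ?thesis unfolding 1 2
          using form_linear[OF b k(1), of "\<lambda>m. v (p (k + m))"] by (simp add: linear_iff algebra_simps)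
      qed
    qed
    then show "linear (\<lambda>x. \<Sum>p\<in>?P. ?T (v(i := x)) p)"
      by (intro linear_compose_sum) auto
  next
    fix v :: "nat \<Rightarrow> 'a" and i j assume ij: "i < j \<and> j < k + l \<and> v i = v j"
    \<comment> \<open>Composing with this transposition leaves the arguments unchanged, because
      \<open>v i = v j\<close>, and reverses the sign; so the sum equals its own negative.\<close>
    let ?t = "Transposition.transpose i j"
    have t: "?t permutes {..<k + l}" using ij by (intro permutes_swap_id) auto
    have vt: "v (?t m) = v m" for m using ij by (auto simp: Transposition.transpose_def)
    have "(\<Sum>p\<in>?P. ?T v p) = (\<Sum>p\<in>?P. ?T v (?t \<circ> p))"
      by (rule setum_permutations_compose_left[OF t])
    also have "\<dots> = (\<Sum>p\<in>?P. - ?T v p)"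
    proof (rule sum.cong[OF refl])
      fix p assume "p \<in> ?P"
      then have "permutation p" by (auto intro: permutation_permutes[THEN iffD2])
      then have "sign (?t \<circ> p) = - sign p"
        using ij by (subst sign_compose) (auto simp: permutation_swap_id sign_swap_id)
      then show "?T v (?t \<circ> p) = - ?T v p" by (simp add: vt)
    qed
    finally show "(\<Sum>p\<in>?P. ?T v p) = 0" by (simp add: sum_negf)
  qed
  then show ?thesis unfolding wedge_def by (rule is_form_divide)
qed

section \<open>Recursive evaluation of the wedge product\<close>

lemma wedge_0_left:
  assumes a: "is_form 0 \<alpha>" and b: "is_form l \<beta>"
  shows "wedge 0 l \<alpha> \<beta> v = \<alpha> v * \<beta> v"
proof -
  have "of_int (sign p) * \<alpha> (\<lambda>i. v (p i)) * \<beta> (\<lambda>i. v (p i)) = \<alpha> v * \<beta> v" if "p permutes {..<l}" for p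
    using form_cong[OF a, of "\<lambda>i. v (p i)" v] form_permute[OF b that, of v]
    by (simp add: sign_def)
  then have "wedge 0 l \<alpha> \<beta> v = (\<Sum>p | p permutes {..<l}. \<alpha> v * \<beta> v) / fact l"
    by (simp add: wedge_def)
  then show ?thesis by (simp add: card_permutations[of "{..<l}" l])
qed

lemma wedge_0_right:
  assumes a: "is_form k \<alpha>" and b: "is_form 0 \<beta>"
  shows "wedge k 0 \<alpha> \<beta> v = \<alpha> v * \<beta> v"
proof -
  have "of_int (sign p) * \<alpha> (\<lambda>i. v (p i)) * \<beta> (\<lambda>i. v (p (k + i))) = \<alpha> v * \<beta> v" if "p permutes {..<k}" for p
    using form_cong[OF b, of "\<lambda>i. v (p (k + i))" v] form_permute[OF a that, of v]
    by (simp add: sign_def)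
  then have "wedge k 0 \<alpha> \<beta> v = (\<Sum>p | p permutes {..<k}. \<alpha> v * \<beta> v) / fact k"
    by (simp add: wedge_def)
  then show ?thesis by (simp add: card_permutations[of "{..<k}" k])
qed

text \<open>The entry with index \<open>m\<close> reaches the front by \<open>m\<close> adjacent
  transpositions.\<close>

lemma form_rotate:
  assumes a: "is_form (Suc m) \<alpha>"
  shows "\<alpha> (x m ## x) = (- 1) ^ m * \<alpha> x"
proof -
  \<comment> \<open>\<open>?ins j\<close> is the sequence \<open>x\<close> with the entry
    \<open>x m\<close> moved to place \<open>j\<close>; consecutive ones differ by one adjacent
    swap.\<close>
  let ?ins = "\<lambda>j i. if i < j then x i else if i = j then x m else x (i - 1)"
  have "\<alpha> (?ins 0) = (- 1) ^ j * \<alpha> (?ins j)" if "j \<le> m" for j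
    using that
  proof (induction j)
    case (Suc j)
    have "(\<lambda>i. ?ins j (Transposition.transpose j (Suc j) i)) = ?ins (Suc j)"
      by (auto simp: fun_eq_iff Transposition.transpose_def)
    then have "\<alpha> (?ins (Suc j)) = - \<alpha> (?ins j)"
      using form_swap[OF a, of j "Suc j" "?ins j"] Suc.prems by simp
    then show ?case using Suc by simp
  qed simp
  then have "\<alpha> (?ins 0) = (- 1) ^ m * \<alpha> (?ins m)" by simp
  moreover have "\<alpha> (?ins m) = \<alpha> x" by (intro form_cong[OF a]) (auto simp: less_Suc_eq)
  moreover have "?ins 0 = x m ## x" by (auto simp: fun_eq_iff split: nat.split)
  ultimately show ?thesis by simp
qed

text \<open>The permutation \<open>r\<close> acting on \<open>1, 2, ...\<close> instead of
  \<open>0, 1, ...\<close>. It identifies the permutations of a smaller index set with those that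
  fix \<open>0\<close>, the place of the contracted vector.\<close>

definition shift_perm :: "(nat \<Rightarrow> nat) \<Rightarrow> nat \<Rightarrow> nat" where
  "shift_perm r = (0 ## (\<lambda>i. Suc (r i)))"

lemma shift_perm_simps [simp]: "shift_perm r 0 = 0" "shift_perm r (Suc i) = Suc (r i)"
  by (simp_all add: shift_perm_def)

lemma shift_perm_transpose: "shift_perm (Transposition.transpose a b \<circ> p) = Transposition.transpose (Suc a) (Suc b) \<circ> shift_perm p"
proof
  show "shift_perm (Transposition.transpose a b \<circ> p) i = (Transposition.transpose (Suc a) (Suc b) \<circ> shift_perm p) i" for i
    by (cases i) (auto simp: Transposition.transpose_def)
qed

lemma shift_perm_permutes:
  assumes "r permutes {..<m}"
  shows "shift_perm r permutes {1..<Suc m}" and "sign (shift_perm r) = sign r"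
proof -
  have "shift_perm r permutes {1..<Suc m} \<and> sign (shift_perm r) = sign r"
    using assms finite_lessThan
  proof (induction rule: permutes_induct)
    case id
    have "shift_perm id = id" by (auto simp: shift_perm_def fun_eq_iff split: nat.split)
    then show ?case using permutes_id[of "{1..<Suc m}"] by (simp add: id_def)
  next
    case (swap a b p)
    have p: "permutation p" "permutation (shift_perm p)"
      using swap by (auto intro: permutation_permutes[THEN iffD2])
    have "Transposition.transpose (Suc a) (Suc b) \<circ> shift_perm p permutes {1..<Suc m}"
      using swap by (intro permutes_compose permutes_swap_id) auto
    moreover have "sign (Transposition.transpose (Suc a) (Suc b) \<circ> shift_perm p) = sign (Transposition.transpose a b \<circ> p)"
      using p swap by (simp add: sign_compose permutation_swap_id sign_swap_id)
    ultimately show ?case unfolding shift_perm_transpose by blast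
  qed
  then show "shift_perm r permutes {1..<Suc m}" "sign (shift_perm r) = sign r" by auto
qed

lemma bij_betw_shift_perm: "bij_betw shift_perm {r. r permutes {..<m}} {q. q permutes {1..<Suc m}}"
proof -
  have inj: "inj_on shift_perm {r. r permutes {..<m}}"
  proof (rule inj_onI)
    fix r s assume "shift_perm r = shift_perm s"
    then have "shift_perm r (Suc i) = shift_perm s (Suc i)" for i by simp
    then show "r = s" by auto
  qed
  have "shift_perm ` {r. r permutes {..<m}} = {q. q permutes {1..<Suc m}}"
  \<comment> \<open>Surjectivity by counting: both sets have \<open>fact m\<close> elements.\<close>
  proof (rule card_subset_eq)
    show "finite {q. q permutes {1..<Suc m}}" by (simp add: finite_permutations)
    show "shift_perm ` {r. r permutes {..<m}} \<subseteq> {q. q permutes {1..<Suc m}}"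
      using shift_perm_permutes by blast
    show "card (shift_perm ` {r. r permutes {..<m}}) = card {q. q permutes {1..<Suc m}}"
      unfolding card_image[OF inj]
      by (subst card_permutations[of _ m], simp, simp, subst card_permutations[of _ m], auto)
  qed
  then show ?thesis using inj by (simp add: bij_betw_def)
qed

text \<open>The permutations are sorted by the place \<open>b\<close> at which they take the value
  \<open>0\<close>; the remaining factor \<open>q\<close> fixes \<open>0\<close>.\<close>

lemma sum_permutations_split_0:
  fixes F :: "(nat \<Rightarrow> nat) \<Rightarrow> real"
  shows "(\<Sum>p | p permutes {..<Suc m}. F p)
    = (\<Sum>b<Suc m. \<Sum>q | q permutes {1..<Suc m}. F (q \<circ> Transposition.transpose 0 b))"
proof -
  have ins: "{..<Suc m} = insert 0 {1..<Suc m}" by auto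
  have inv_eq: "inv (Transposition.transpose 0 b \<circ> q) = inv q \<circ> Transposition.transpose 0 b" if "q permutes {1..<Suc m}" for q b
    using that by (simp add: o_inv_distrib permutes_bij)
  \<comment> \<open>Passing to inverses moves the transposition from the left factor to the right
    one.\<close>
  have "(\<Sum>p | p permutes {..<Suc m}. F p) = (\<Sum>p | p permutes {..<Suc m}. F (inv p))"
    by (rule sum_permutations_inverse)
  also have "\<dots> = (\<Sum>b\<in>insert 0 {1..<Suc m}. \<Sum>q | q permutes {1..<Suc m}. F (inv (Transposition.transpose 0 b \<circ> q)))"
    unfolding ins by (rule sum_over_permutations_insert) auto
  also have "\<dots> = (\<Sum>b\<in>insert 0 {1..<Suc m}. \<Sum>q | q permutes {1..<Suc m}. F (inv q \<circ> Transposition.transpose 0 b))"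
    using inv_eq by (intro sum.cong refl) auto
  also have "\<dots> = (\<Sum>b\<in>insert 0 {1..<Suc m}. \<Sum>q | q permutes {1..<Suc m}. F (q \<circ> Transposition.transpose 0 b))"
    by (intro sum.cong refl sum_permutations_inverse[symmetric])
  finally show ?thesis unfolding ins .
qed

text \<open>Contraction is an antiderivation. The permutations are sorted by the place that receives
  \<open>u\<close>: the \<open>Suc k\<close> places of the \<alpha> block contribute equal sums, as
  do the \<open>Suc l\<close> places of the \<beta> block, and these multiplicities cancel against
  the factorials. Iterating the rule evaluates a wedge product without listing permutations.\<close>

lemma wedge_vcons:
  assumes a: "is_form (Suc k) \<alpha>" and b: "is_form (Suc l) \<beta>"
  shows "wedge (Suc k) (Suc l) \<alpha> \<beta> (u ## w)
    = wedge k (Suc l) (interior_prod u \<alpha>) \<beta> w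
      + (- 1) ^ Suc k * wedge (Suc k) l \<alpha> (interior_prod u \<beta>) w"
proof -
  define K where "K = Suc k"
  define m where "m = k + Suc l"
  define v where "v = (u ## w)"
  define F where "F p = of_int (sign p) * \<alpha> (\<lambda>i. v (p i)) * \<beta> (\<lambda>i. v (p (K + i)))" for p
  let ?Q = "{q. q permutes {1..<Suc m}}"
  have n: "Suc k + Suc l = Suc m" by (simp add: m_def)
  have perm: "permutation q" if "q \<in> ?Q" for q
    using that by (auto intro: permutation_permutes[THEN iffD2])
  have sgn: "of_int (sign (Transposition.transpose x y)) * of_int (sign (Transposition.transpose x y)) = (1::real)" for x y :: nat
    by (simp add: sign_def)
  \<comment> \<open>A swap inside the \<alpha> block changes the sign of the permutation and the
    sign of \<alpha>, so the summand is invariant; \<open>inv2\<close> is the same for the \<beta>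
    block.\<close>
  have inv1: "F (p \<circ> Transposition.transpose 0 b) = F p" if p: "permutation p" and b: "b < K" for p b
  proof -
    have "Transposition.transpose 0 b permutes {..<Suc k}" using b by (intro permutes_swap_id) (auto simp: K_def)
    from form_permute[OF a this, of "\<lambda>i. v (p i)"]
    have 1: "\<alpha> (\<lambda>i. v (p (Transposition.transpose 0 b i))) = of_int (sign (Transposition.transpose 0 b)) * \<alpha> (\<lambda>i. v (p i))" .
    have 2: "Transposition.transpose 0 b (K + i) = K + i" for i using b by (auto simp: Transposition.transpose_def)
    show ?thesis
      using sgn[of 0 b] by (simp add: F_def 1 2 sign_compose[OF p permutation_swap_id])
  qed
  have inv2: "F (p \<circ> Transposition.transpose K b) = F p" if p: "permutation p" and b: "K \<le> b" "b < Suc m" for p b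
  proof -
    have "Transposition.transpose 0 (b - K) permutes {..<Suc l}"
      using b by (intro permutes_swap_id) (auto simp: K_def m_def)
    from form_permute[OF assms(2) this, of "\<lambda>i. v (p (K + i))"]
    have 1: "\<beta> (\<lambda>i. v (p (K + Transposition.transpose 0 (b - K) i))) = of_int (sign (Transposition.transpose 0 (b - K))) * \<beta> (\<lambda>i. v (p (K + i)))" .
    have 2: "Transposition.transpose K b (K + i) = K + Transposition.transpose 0 (b - K) i" for i
      using b by (auto simp: Transposition.transpose_def)
    have 3: "\<alpha> (\<lambda>i. v (p (Transposition.transpose K b i))) = \<alpha> (\<lambda>i. v (p i))"
      using b by (intro form_cong[OF a]) (auto simp: Transposition.transpose_def K_def)
    have 4: "sign (Transposition.transpose 0 (b - K)) = sign (Transposition.transpose K b)"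
      using b by (simp add: sign_swap_id)
    show ?thesis
      using sgn[of K b] by (simp add: F_def 1 2 3 4 sign_compose[OF p permutation_swap_id])
  qed
  have low: "(\<Sum>q\<in>?Q. F (q \<circ> Transposition.transpose 0 b)) = (\<Sum>q\<in>?Q. F q)" if "b < K" for b
    using inv1 perm that by (intro sum.cong) auto
  \<comment> \<open>A place \<open>b\<close> in the \<beta> block is reduced to the first place
    \<open>K\<close> of that block.\<close>
  have high: "(\<Sum>q\<in>?Q. F (q \<circ> Transposition.transpose 0 b)) = (\<Sum>q\<in>?Q. F (q \<circ> Transposition.transpose 0 K))" if b: "b \<in> {K..<Suc m}" for b
  proof -
    have t: "Transposition.transpose K b permutes {1..<Suc m}"
      using b by (intro permutes_swap_id) (auto simp: K_def m_def)
    have "(\<Sum>q\<in>?Q. F (q \<circ> Transposition.transpose 0 K)) = (\<Sum>q\<in>?Q. F ((q \<circ> Transposition.transpose K b) \<circ> Transposition.transpose 0 K))"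
      by (rule sum_permutations_compose_right[OF t])
    also have "\<dots> = (\<Sum>q\<in>?Q. F (q \<circ> Transposition.transpose 0 b))"
    proof (rule sum.cong[OF refl])
      fix q assume q: "q \<in> ?Q"
      have eq: "(q \<circ> Transposition.transpose K b) \<circ> Transposition.transpose 0 K = (q \<circ> Transposition.transpose 0 b) \<circ> Transposition.transpose K b"
        using b by (auto simp: fun_eq_iff Transposition.transpose_def K_def)
      show "F ((q \<circ> Transposition.transpose K b) \<circ> Transposition.transpose 0 K) = F (q \<circ> Transposition.transpose 0 b)"
        unfolding eq using b perm[OF q] by (intro inv2 permutation_compose permutation_swap_id) auto
    qed
    finally show ?thesis by simp
  qed
  let ?R = "{r. r permutes {..<m}}"
  let ?A = "\<Sum>r\<in>?R. of_int (sign r) * interior_prod u \<alpha> (\<lambda>i. w (r i)) * \<beta> (\<lambda>i. w (r (k + i)))"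
  let ?B = "\<Sum>r\<in>?R. of_int (sign r) * \<alpha> (\<lambda>i. w (r i)) * interior_prod u \<beta> (\<lambda>i. w (r (Suc k + i)))"
  have v_shift: "(\<lambda>i. v (shift_perm r i)) = u ## (\<lambda>i. w (r i))" for r
    by (auto simp: v_def shift_perm_def fun_eq_iff split: nat.split)
  have sum1: "(\<Sum>q\<in>?Q. F q) = ?A"
  proof -
    have "(\<Sum>q\<in>?Q. F q) = (\<Sum>r\<in>?R. F (shift_perm r))"
      by (rule sum.reindex_bij_betw[OF bij_betw_shift_perm, symmetric])
    also have "\<dots> = ?A"
      by (intro sum.cong refl)
        (auto simp: F_def v_shift shift_perm_permutes(2) interior_prod_apply K_def v_def[THEN fun_cong, symmetric]; simp add: v_def)
    finally show ?thesis .
  qed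
  have sum2: "(\<Sum>q\<in>?Q. F (q \<circ> Transposition.transpose 0 K)) = (- 1) ^ Suc k * ?B"
  proof -
    have "(\<Sum>q\<in>?Q. F (q \<circ> Transposition.transpose 0 K)) = (\<Sum>r\<in>?R. F (shift_perm r \<circ> Transposition.transpose 0 K))"
      by (rule sum.reindex_bij_betw[OF bij_betw_shift_perm, symmetric])
    also have "\<dots> = (\<Sum>r\<in>?R. (- 1) ^ Suc k *
        (of_int (sign r) * \<alpha> (\<lambda>i. w (r i)) * interior_prod u \<beta> (\<lambda>i. w (r (Suc k + i)))))"
    proof (rule sum.cong[OF refl])
      fix r assume r: "r \<in> ?R"
      have sp: "permutation (shift_perm r)"
        using shift_perm_permutes(1)[of r m] r by (auto intro: permutation_permutes[THEN iffD2])
      have s: "sign (shift_perm r \<circ> Transposition.transpose 0 K) = - sign r"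
        using r by (simp add: sign_compose[OF sp permutation_swap_id] sign_swap_id shift_perm_permutes(2) K_def)
      \<comment> \<open>With \<open>u\<close> at place \<open>K\<close>, the vector
        \<open>w (r k)\<close> displaced from there sits in the first slot of \<alpha>. Rotating it
        to the end costs \<open>(- 1) ^ k\<close>, and the transposition contributes the remaining
        sign.\<close>
      have "\<alpha> (\<lambda>i. v ((shift_perm r \<circ> Transposition.transpose 0 K) i)) = \<alpha> (w (r k) ## (\<lambda>i. w (r i)))"
        by (intro form_cong[OF a]) (auto simp: v_def K_def Transposition.transpose_def split: nat.split)
      also have "\<dots> = (- 1) ^ k * \<alpha> (\<lambda>i. w (r i))"
        by (rule form_rotate[OF a])
      finally have 1: "\<alpha> (\<lambda>i. v ((shift_perm r \<circ> Transposition.transpose 0 K) i)) = (- 1) ^ k * \<alpha> (\<lambda>i. w (r i))" .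
      have 2: "(\<lambda>i. v ((shift_perm r \<circ> Transposition.transpose 0 K) (K + i))) = u ## (\<lambda>i. w (r (Suc k + i)))"
        by (auto simp: v_def K_def Transposition.transpose_def fun_eq_iff split: nat.split)
      show "F (shift_perm r \<circ> Transposition.transpose 0 K) = (- 1) ^ Suc k *
          (of_int (sign r) * \<alpha> (\<lambda>i. w (r i)) * interior_prod u \<beta> (\<lambda>i. w (r (Suc k + i))))"
        unfolding F_def s 1 2 by (simp add: interior_prod_apply)
    qed
    finally show ?thesis by (simp add: sum_distrib_left)
  qed
  have "(\<Sum>p | p permutes {..<Suc m}. F p) = (\<Sum>b<Suc m. \<Sum>q\<in>?Q. F (q \<circ> Transposition.transpose 0 b))"
    by (rule sum_permutations_split_0)
  also have "\<dots> = (\<Sum>b<K. \<Sum>q\<in>?Q. F (q \<circ> Transposition.transpose 0 b)) + (\<Sum>b\<in>{K..<Suc m}. \<Sum>q\<in>?Q. F (q \<circ> Transposition.transpose 0 b))"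
  proof -
    have un: "{..<Suc m} = {..<K} \<union> {K..<Suc m}" by (auto simp: K_def m_def)
    show ?thesis unfolding un by (rule sum.union_disjoint) auto
  qed
  also have "(\<Sum>b<K. \<Sum>q\<in>?Q. F (q \<circ> Transposition.transpose 0 b)) = (\<Sum>b<K. ?A)"
    using low unfolding sum1 by (intro sum.cong[OF refl]) blast
  also have "(\<Sum>b\<in>{K..<Suc m}. \<Sum>q\<in>?Q. F (q \<circ> Transposition.transpose 0 b))
      = (\<Sum>b\<in>{K..<Suc m}. (- 1) ^ Suc k * ?B)"
    using high unfolding sum2 by (rule sum.cong[OF refl])
  also have "(\<Sum>b<K. ?A) = real (Suc k) * ?A" by (simp add: K_def)
  also have "(\<Sum>b\<in>{K..<Suc m}. (- 1) ^ Suc k * ?B) = real (Suc l) * ((- 1) ^ Suc k * ?B)"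
    by (simp add: K_def m_def)
  finally have main: "(\<Sum>p | p permutes {..<Suc m}. F p) = real (Suc k) * ?A + real (Suc l) * ((- 1) ^ Suc k * ?B)" .
  have W: "wedge (Suc k) (Suc l) \<alpha> \<beta> (u ## w) = (\<Sum>p | p permutes {..<Suc m}. F p) / (fact (Suc k) * fact (Suc l))"
    unfolding wedge_def n F_def v_def K_def ..
  have WA: "wedge k (Suc l) (interior_prod u \<alpha>) \<beta> w = ?A / (fact k * fact (Suc l))"
    unfolding wedge_def m_def ..
  have WB: "wedge (Suc k) l \<alpha> (interior_prod u \<beta>) w = ?B / (fact (Suc k) * fact l)"
    unfolding wedge_def m_def by simp
  have "(c * x + d * (e * y)) / ((c * f) * (d * h)) = x / (f * (d * h)) + e * (y / ((c * f) * h))"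
    if "c \<noteq> 0" "d \<noteq> 0" for c d e f h x y :: real
  proof -
    have "(c * x) / ((c * f) * (d * h)) = x / (f * (d * h))"
      using that by (simp add: mult.assoc)
    moreover have "(d * (e * y)) / ((c * f) * (d * h)) = e * (y / ((c * f) * h))"
      using that by (simp add: mult.left_commute[of _ d])
    ultimately show ?thesis by (simp only: add_divide_distrib)
  qed
  from this[of "real (Suc k)" "real (Suc l)" ?A "(- 1) ^ Suc k" ?B "fact k" "fact l"]
  show ?thesis unfolding W main WA WB fact_Suc by (simp only: of_nat_Suc[symmetric])
qed

section \<open>Values of forms on explicit pairs, triples and quadruples\<close>

definition val2 :: "'v::zero form \<Rightarrow> 'v \<Rightarrow> 'v \<Rightarrow> real" where
  "val2 \<alpha> x y = \<alpha> (x ## y ## (\<lambda>_. 0))"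

definition val3 :: "'v::zero form \<Rightarrow> 'v \<Rightarrow> 'v \<Rightarrow> 'v \<Rightarrow> real" where
  "val3 \<alpha> x y z = \<alpha> (x ## y ## z ## (\<lambda>_. 0))"

definition val4 :: "'v::zero form \<Rightarrow> 'v \<Rightarrow> 'v \<Rightarrow> 'v \<Rightarrow> 'v \<Rightarrow> real" where
  "val4 \<alpha> x y z w = \<alpha> (x ## y ## z ## w ## (\<lambda>_. 0))"

text \<open>Replacing an arbitrary tail by zeros makes equal values syntactically equal, whatever
  tail the contraction rule has left behind.\<close>

lemma val2: "is_form 2 \<alpha> \<Longrightarrow> \<alpha> (x ## y ## t) = val2 \<alpha> x y"
  unfolding val2_def by (rule form_cong) (auto simp: less_Suc_eq eval_nat_numeral split: nat.split)

lemma val3: "is_form 3 \<alpha> \<Longrightarrow> \<alpha> (x ## y ## z ## t) = val3 \<alpha> x y z"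
  unfolding val3_def by (rule form_cong) (auto simp: less_Suc_eq eval_nat_numeral split: nat.split)

lemma val4: "is_form 4 \<alpha> \<Longrightarrow> \<alpha> (x ## y ## z ## w ## t) = val4 \<alpha> x y z w"
  unfolding val4_def by (rule form_cong) (auto simp: less_Suc_eq eval_nat_numeral split: nat.split)

lemma form_val2: "is_form 2 \<alpha> \<Longrightarrow> \<alpha> v = val2 \<alpha> (v 0) (v 1)"
  unfolding val2_def by (rule form_cong) (auto simp: less_Suc_eq eval_nat_numeral split: nat.split)

lemma form_val3: "is_form 3 \<alpha> \<Longrightarrow> \<alpha> v = val3 \<alpha> (v 0) (v 1) (v 2)"
  unfolding val3_def by (rule form_cong) (auto simp: less_Suc_eq eval_nat_numeral split: nat.split)

lemma form_val4: "is_form 4 \<alpha> \<Longrightarrow> \<alpha> v = val4 \<alpha> (v 0) (v 1) (v 2) (v 3)"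
  unfolding val4_def by (rule form_cong) (auto simp: less_Suc_eq eval_nat_numeral split: nat.split)

lemma val2_linear:
  assumes "is_form 2 \<alpha>"
  shows "linear (\<lambda>x. val2 \<alpha> x y)" "linear (\<lambda>y. val2 \<alpha> x y)"
proof -
  have "(\<lambda>x. val2 \<alpha> x y) = (\<lambda>x. \<alpha> ((0 ## y ## (\<lambda>_. 0))(0 := x)))"
    "(\<lambda>y. val2 \<alpha> x y) = (\<lambda>y. \<alpha> ((x ## 0 ## (\<lambda>_. 0))(1 := y)))"
    by (auto simp: val2_def fun_eq_iff intro!: arg_cong[of _ _ \<alpha>] split: nat.split)
  then show "linear (\<lambda>x. val2 \<alpha> x y)" "linear (\<lambda>y. val2 \<alpha> x y)"
    using form_linear[OF assms] by auto
qed

lemma val3_linear: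
  assumes "is_form 3 \<alpha>"
  shows "linear (\<lambda>x. val3 \<alpha> x y z)" "linear (\<lambda>y. val3 \<alpha> x y z)" "linear (\<lambda>z. val3 \<alpha> x y z)"
proof -
  have "(\<lambda>x. val3 \<alpha> x y z) = (\<lambda>x. \<alpha> ((0 ## y ## z ## (\<lambda>_. 0))(0 := x)))"
    "(\<lambda>y. val3 \<alpha> x y z) = (\<lambda>y. \<alpha> ((x ## 0 ## z ## (\<lambda>_. 0))(1 := y)))"
    "(\<lambda>z. val3 \<alpha> x y z) = (\<lambda>z. \<alpha> ((x ## y ## 0 ## (\<lambda>_. 0))(2 := z)))"
    by (auto simp: val3_def fun_eq_iff eval_nat_numeral intro!: arg_cong[of _ _ \<alpha>] split: nat.split)
  then show "linear (\<lambda>x. val3 \<alpha> x y z)" "linear (\<lambda>y. val3 \<alpha> x y z)" "linear (\<lambda>z. val3 \<alpha> x y z)"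
    using form_linear[OF assms] by auto
qed

lemma val4_linear:
  assumes "is_form 4 \<alpha>"
  shows "linear (\<lambda>x. val4 \<alpha> x y z w)" "linear (\<lambda>y. val4 \<alpha> x y z w)"
    "linear (\<lambda>z. val4 \<alpha> x y z w)" "linear (\<lambda>w. val4 \<alpha> x y z w)"
proof -
  have "(\<lambda>x. val4 \<alpha> x y z w) = (\<lambda>x. \<alpha> ((0 ## y ## z ## w ## (\<lambda>_. 0))(0 := x)))"
    "(\<lambda>y. val4 \<alpha> x y z w) = (\<lambda>y. \<alpha> ((x ## 0 ## z ## w ## (\<lambda>_. 0))(1 := y)))"
    "(\<lambda>z. val4 \<alpha> x y z w) = (\<lambda>z. \<alpha> ((x ## y ## 0 ## w ## (\<lambda>_. 0))(2 := z)))"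
    "(\<lambda>w. val4 \<alpha> x y z w) = (\<lambda>w. \<alpha> ((x ## y ## z ## 0 ## (\<lambda>_. 0))(3 := w)))"
    by (auto simp: val4_def fun_eq_iff eval_nat_numeral intro!: arg_cong[of _ _ \<alpha>] split: nat.split)
  then show "linear (\<lambda>x. val4 \<alpha> x y z w)" "linear (\<lambda>y. val4 \<alpha> x y z w)"
    "linear (\<lambda>z. val4 \<alpha> x y z w)" "linear (\<lambda>w. val4 \<alpha> x y z w)"
    using form_linear[OF assms] by auto
qed

lemma val2_alt:
  assumes "is_form 2 \<alpha>"
  shows "val2 \<alpha> x x = 0" "val2 \<alpha> y x = - val2 \<alpha> x y"
proof -
  show "val2 \<alpha> x x = 0" unfolding val2_def by (rule form_eq_0[OF assms, of 0 1]) auto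
  have "(\<lambda>m. (x ## y ## (\<lambda>_. 0)) (Transposition.transpose 0 1 m)) = (y ## x ## (\<lambda>_. 0))"
    by (auto simp: fun_eq_iff Transposition.transpose_def split: nat.split)
  then show "val2 \<alpha> y x = - val2 \<alpha> x y"
    using form_swap[OF assms, of 0 1 "x ## y ## (\<lambda>_. 0)"] by (simp add: val2_def)
qed

lemma val3_alt:
  assumes "is_form 3 \<alpha>"
  shows "val3 \<alpha> x x z = 0" "val3 \<alpha> x z z = 0" "val3 \<alpha> x z x = 0"
    "val3 \<alpha> y x z = - val3 \<alpha> x y z" "val3 \<alpha> x z y = - val3 \<alpha> x y z"
proof -
  show "val3 \<alpha> x x z = 0" unfolding val3_def by (rule form_eq_0[OF assms, of 0 1]) auto
  show "val3 \<alpha> x z z = 0" unfolding val3_def by (rule form_eq_0[OF assms, of 1 2]) auto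
  show "val3 \<alpha> x z x = 0" unfolding val3_def by (rule form_eq_0[OF assms, of 0 2]) auto
  have "(\<lambda>m. (x ## y ## z ## (\<lambda>_. 0)) (Transposition.transpose 0 1 m)) = (y ## x ## z ## (\<lambda>_. 0))"
    "(\<lambda>m. (x ## y ## z ## (\<lambda>_. 0)) (Transposition.transpose 1 2 m)) = (x ## z ## y ## (\<lambda>_. 0))"
    by (auto simp: fun_eq_iff Transposition.transpose_def eval_nat_numeral split: nat.split)
  then show "val3 \<alpha> y x z = - val3 \<alpha> x y z" "val3 \<alpha> x z y = - val3 \<alpha> x y z"
    using form_swap[OF assms, of 0 1 "x ## y ## z ## (\<lambda>_. 0)"]
      form_swap[OF assms, of 1 2 "x ## y ## z ## (\<lambda>_. 0)"] by (simp_all add: val3_def)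
qed

lemma val4_alt:
  assumes "is_form 4 \<alpha>"
  shows "val4 \<alpha> x x z w = 0" "val4 \<alpha> x z z w = 0" "val4 \<alpha> x y z z = 0"
    "val4 \<alpha> x y x w = 0" "val4 \<alpha> x y z y = 0" "val4 \<alpha> x y z x = 0"
    "val4 \<alpha> y x z w = - val4 \<alpha> x y z w" "val4 \<alpha> x z y w = - val4 \<alpha> x y z w"
    "val4 \<alpha> x y w z = - val4 \<alpha> x y z w"
proof -
  show "val4 \<alpha> x x z w = 0" unfolding val4_def by (rule form_eq_0[OF assms, of 0 1]) auto
  show "val4 \<alpha> x z z w = 0" unfolding val4_def by (rule form_eq_0[OF assms, of 1 2]) auto
  show "val4 \<alpha> x y z z = 0" unfolding val4_def by (rule form_eq_0[OF assms, of 2 3]) (auto simp: eval_nat_numeral)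
  show "val4 \<alpha> x y x w = 0" unfolding val4_def by (rule form_eq_0[OF assms, of 0 2]) auto
  show "val4 \<alpha> x y z y = 0" unfolding val4_def by (rule form_eq_0[OF assms, of 1 3]) (auto simp: eval_nat_numeral)
  show "val4 \<alpha> x y z x = 0" unfolding val4_def by (rule form_eq_0[OF assms, of 0 3]) (auto simp: eval_nat_numeral)
  have "(\<lambda>m. (x ## y ## z ## w ## (\<lambda>_. 0)) (Transposition.transpose 0 1 m)) = (y ## x ## z ## w ## (\<lambda>_. 0))"
    "(\<lambda>m. (x ## y ## z ## w ## (\<lambda>_. 0)) (Transposition.transpose 1 2 m)) = (x ## z ## y ## w ## (\<lambda>_. 0))"
    "(\<lambda>m. (x ## y ## z ## w ## (\<lambda>_. 0)) (Transposition.transpose 2 3 m)) = (x ## y ## w ## z ## (\<lambda>_. 0))"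
    by (auto simp: fun_eq_iff Transposition.transpose_def eval_nat_numeral split: nat.split)
  then show "val4 \<alpha> y x z w = - val4 \<alpha> x y z w" "val4 \<alpha> x z y w = - val4 \<alpha> x y z w"
    "val4 \<alpha> x y w z = - val4 \<alpha> x y z w"
    using form_swap[OF assms, of 0 1 "x ## y ## z ## w ## (\<lambda>_. 0)"]
      form_swap[OF assms, of 1 2 "x ## y ## z ## w ## (\<lambda>_. 0)"]
      form_swap[OF assms, of 2 3 "x ## y ## z ## w ## (\<lambda>_. 0)"] by (simp_all add: val4_def)
qed

section \<open>Forms are determined by their values on a spanning family\<close>

lemma strict_mono_sorting_permutation:
  fixes s :: "nat \<Rightarrow> nat"
  assumes "inj_on s {..<k}"
  obtains p where "p permutes {..<k}" "\<And>i j. i < j \<Longrightarrow> j < k \<Longrightarrow> s (p i) < s (p j)"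
proof -
  let ?l = "sorted_list_of_set (s ` {..<k})"
  have len: "length ?l = k" by (simp add: card_image[OF assms])
  have set: "set ?l = s ` {..<k}" by simp
  define p where "p i = (if i < k then the_inv_into {..<k} s (?l ! i) else i)" for i
  have mem: "?l ! i \<in> s ` {..<k}" if "i < k" for i
    using that nth_mem[of i ?l] unfolding len set by blast
  have sp: "s (p i) = ?l ! i" "p i < k" if "i < k" for i
    using that f_the_inv_into_f[OF assms mem[OF that]] the_inv_into_into[OF assms mem[OF that], of "{..<k}"]
    by (auto simp: p_def)
  have lt: "s (p i) < s (p j)" if "i < j" "j < k" for i j
    using that sp sorted_wrt_nth_less[OF sorted_list_of_set.strict_sorted_key_list_of_set, of i j "s ` {..<k}"]
    by (simp add: card_image[OF assms])
  have inj: "inj_on p {..<k}"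
    by (rule inj_onI) (metis lt lessThan_iff linorder_neqE_nat order_less_irrefl)
  have "p ` {..<k} = {..<k}"
    using inj sp(2) by (intro endo_inj_surj) auto
  then have "bij_betw p {..<k} {..<k}" using inj by (simp add: bij_betw_def)
  then have "p permutes {..<k}" by (rule bij_imp_permutes) (simp add: p_def)
  then show ?thesis using that lt by blast
qed

text \<open>Repeated indices give zero and sorting costs only a sign, so increasing index sequences
  determine all values on the family; multilinearity then extends them one slot at a time.\<close>

lemma form_ext:
  fixes e :: "nat \<Rightarrow> 'v::real_vector" and n :: nat
  assumes a: "is_form k \<alpha>" and b: "is_form k \<beta>" and sp: "span (e ` {..<n}) = UNIV"
    and eq: "\<And>s. (\<And>i. i < k \<Longrightarrow> s i < n) \<Longrightarrow> (\<And>i j. i < j \<Longrightarrow> j < k \<Longrightarrow> s i < s j)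
      \<Longrightarrow> \<alpha> (\<lambda>i. e (s i)) = \<beta> (\<lambda>i. e (s i))"
  shows "\<alpha> = \<beta>"
proof -
  let ?g = "\<lambda>v. \<alpha> v - \<beta> v"
  have g: "is_form k ?g" by (rule is_form_diff[OF a b])
  have basis: "?g (\<lambda>i. e (s i)) = 0" if s: "\<And>i. i < k \<Longrightarrow> s i < n" for s :: "nat \<Rightarrow> nat"
  proof (cases "inj_on s {..<k}")
    case True
    then obtain p where p: "p permutes {..<k}" "\<And>i j. i < j \<Longrightarrow> j < k \<Longrightarrow> s (p i) < s (p j)"
      using strict_mono_sorting_permutation[OF True] by metis
    have "p i < k" if "i < k" for i using permutes_in_image[OF p(1), of i] that by simp
    then have "?g (\<lambda>i. e (s (p i))) = 0" using eq[of "\<lambda>i. s (p i)"] s p(2) by simp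
    moreover have "?g (\<lambda>i. e (s (p i))) = of_int (sign p) * ?g (\<lambda>i. e (s i))"
      by (rule form_permute[OF g p(1), of "\<lambda>i. e (s i)"])
    ultimately show ?thesis by (auto simp: sign_def split: if_splits)
  next
    case False
    then obtain i j where "i < k" "j < k" "i \<noteq> j" "s i = s j" by (auto simp: inj_on_def)
    then show ?thesis by (intro form_eq_0[OF g, of i j]) auto
  qed
  \<comment> \<open>Induction on the number \<open>m\<close> of leading slots that may hold
    arbitrary vectors, the others holding members of the family.\<close>
  have "?g v = 0" if "m \<le> k" "\<And>i. m \<le> i \<Longrightarrow> i < k \<Longrightarrow> v i \<in> e ` {..<n}" for m v
    using that
  proof (induction m arbitrary: v)
    case 0
    then have "\<forall>i. \<exists>j. i < k \<longrightarrow> j < n \<and> v i = e j" by blast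
    then obtain s where s: "\<And>i. i < k \<Longrightarrow> s i < n \<and> v i = e (s i)" by metis
    have "?g v = ?g (\<lambda>i. e (s i))" using s by (intro form_cong[OF g]) auto
    then show ?case using basis[of s] s by simp
  next
    case (Suc m)
    have lin: "linear (\<lambda>x. ?g (v(m := x)))" using form_linear[OF g, of m v] Suc.prems by simp
    have "?g (v(m := x)) = 0" if "x \<in> e ` {..<n}" for x
      using that Suc.prems by (intro Suc.IH) auto
    then have "?g (v(m := v m)) = 0"
      using linear_eq_0_on_span[OF lin, of "e ` {..<n}" "v m"] sp by simp
    then show ?case by simp
  qed
  from this[of k] have "?g v = 0" for v by simp
  then show ?thesis by (simp add: fun_eq_iff)
qed

lemma form2_ext:
  fixes e :: "nat \<Rightarrow> 'v::real_vector" and n :: nat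
  assumes "is_form 2 \<alpha>" "is_form 2 \<beta>" "span (e ` {..<n}) = UNIV"
    and "\<forall>j<n. \<forall>i<j. val2 \<alpha> (e i) (e j) = val2 \<beta> (e i) (e j)"
  shows "\<alpha> = \<beta>"
  using assms by (intro form_ext[OF assms(1-3)]) (simp add: form_val2[of \<alpha>] form_val2[of \<beta>])

lemma form4_ext:
  fixes e :: "nat \<Rightarrow> 'v::real_vector" and n :: nat
  assumes "is_form 4 \<alpha>" "is_form 4 \<beta>" "span (e ` {..<n}) = UNIV"
    and "\<forall>l<n. \<forall>k<l. \<forall>j<k. \<forall>i<j. val4 \<alpha> (e i) (e j) (e k) (e l) = val4 \<beta> (e i) (e j) (e k) (e l)"
  shows "\<alpha> = \<beta>"
  using assms by (intro form_ext[OF assms(1-3)]) (simp add: form_val4[of \<alpha>] form_val4[of \<beta>])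

text \<open>The only strictly increasing map of \<open>{..<n}\<close> into itself is the identity,
  so one value decides.\<close>

lemma top_form_ext:
  fixes e :: "nat \<Rightarrow> 'v::real_vector" and n :: nat
  assumes "is_form n \<alpha>" "is_form n \<beta>" "span (e ` {..<n}) = UNIV" "\<alpha> e = \<beta> e"
  shows "\<alpha> = \<beta>"
proof (rule form_ext[OF assms(1-3)])
  fix s :: "nat \<Rightarrow> nat"
  assume s: "\<And>i. i < n \<Longrightarrow> s i < n" "\<And>i j. i < j \<Longrightarrow> j < n \<Longrightarrow> s i < s j"
  have ge: "i \<le> s i" if "i < n" for i
    using that by (induction i) (use s(2) in \<open>auto simp: Suc_le_eq intro: le_less_trans[OF _ s(2)]\<close>)
  have "s i = i" if "i < n" for i
  proof -
    \<comment> \<open>The upper bound is proved downwards from the largest index.\<close>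
    have "s (n - 1 - d) \<le> n - 1 - d" if "d < n" for d
      using that
    proof (induction d)
      case 0 then show ?case using s(1)[of "n - 1"] by simp
    next
      case (Suc d)
      then have "s (n - 1 - Suc d) < s (n - 1 - d)" by (intro s(2)) auto
      then show ?case using Suc by simp
    qed
    from this[of "n - 1 - i"] that ge[OF that] show ?thesis by simp
  qed
  then have "\<alpha> (\<lambda>i. e (s i)) = \<alpha> e" "\<beta> (\<lambda>i. e (s i)) = \<beta> e"
    using form_cong[OF assms(1), of "\<lambda>i. e (s i)" e] form_cong[OF assms(2), of "\<lambda>i. e (s i)" e] by auto
  then show "\<alpha> (\<lambda>i. e (s i)) = \<beta> (\<lambda>i. e (s i))" using assms(4) by simp
qed

section \<open>Wedge products as sums over shuffles\<close>

lemma numeral_nat: "2 = Suc (Suc 0)" "3 = Suc (Suc (Suc 0))" "4 = Suc (Suc (Suc (Suc 0)))"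
  by simp_all

lemmas val2_Suc = val2[unfolded numeral_nat]
lemmas val3_Suc = val3[unfolded numeral_nat]
lemmas val4_Suc = val4[unfolded numeral_nat]

text \<open>Peeling off the vectors one by one with \<open>wedge_vcons\<close> produces one term per
  shuffle. The degrees are written with \<open>Suc\<close> so that the rule matches at each
  stage.\<close>

lemma wedge_2_2_eval:
  assumes "is_form 2 \<alpha>" "is_form 2 \<beta>"
  shows "wedge 2 2 \<alpha> \<beta> (a ## b ## c ## d ## t) =
      val2 \<alpha> a b * val2 \<beta> c d - val2 \<alpha> a c * val2 \<beta> b d
      + val2 \<alpha> a d * val2 \<beta> b c + val2 \<alpha> b c * val2 \<beta> a d
      - val2 \<alpha> b d * val2 \<beta> a c + val2 \<alpha> c d * val2 \<beta> a b"
proof -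
  have "is_form (Suc (Suc (0))) \<alpha>" "is_form (Suc (Suc (0))) \<beta>"
    using assms by (simp_all add: eval_nat_numeral)
  then show ?thesis
    unfolding numeral_nat
    by (simp add: wedge_vcons wedge_0_left wedge_0_right is_form_interior interior_prod_apply
      val2_Suc)
qed

lemma wedge_3_3_eval:
  assumes "is_form 3 \<alpha>" "is_form 3 \<beta>"
  shows "wedge 3 3 \<alpha> \<beta> (a ## b ## c ## d ## e ## f ## t) =
      val3 \<alpha> a b c * val3 \<beta> d e f - val3 \<alpha> a b d * val3 \<beta> c e f
      + val3 \<alpha> a b e * val3 \<beta> c d f - val3 \<alpha> a b f * val3 \<beta> c d e
      + val3 \<alpha> a c d * val3 \<beta> b e f - val3 \<alpha> a c e * val3 \<beta> b d f
      + val3 \<alpha> a c f * val3 \<beta> b d e + val3 \<alpha> a d e * val3 \<beta> b c f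
      - val3 \<alpha> a d f * val3 \<beta> b c e + val3 \<alpha> a e f * val3 \<beta> b c d
      - val3 \<alpha> b c d * val3 \<beta> a e f + val3 \<alpha> b c e * val3 \<beta> a d f
      - val3 \<alpha> b c f * val3 \<beta> a d e - val3 \<alpha> b d e * val3 \<beta> a c f
      + val3 \<alpha> b d f * val3 \<beta> a c e - val3 \<alpha> b e f * val3 \<beta> a c d
      + val3 \<alpha> c d e * val3 \<beta> a b f - val3 \<alpha> c d f * val3 \<beta> a b e
      + val3 \<alpha> c e f * val3 \<beta> a b d - val3 \<alpha> d e f * val3 \<beta> a b c"
proof -
  have "is_form (Suc (Suc (Suc (0)))) \<alpha>" "is_form (Suc (Suc (Suc (0)))) \<beta>"
    using assms by (simp_all add: eval_nat_numeral)
  then show ?thesis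
    unfolding numeral_nat
    by (simp add: wedge_vcons wedge_0_left wedge_0_right is_form_interior interior_prod_apply
      val3_Suc)
qed

lemma wedge_2_4_eval:
  assumes "is_form 2 \<alpha>" "is_form 4 \<beta>"
  shows "wedge 2 4 \<alpha> \<beta> (a ## b ## c ## d ## e ## f ## t) =
      val2 \<alpha> a b * val4 \<beta> c d e f - val2 \<alpha> a c * val4 \<beta> b d e f
      + val2 \<alpha> a d * val4 \<beta> b c e f - val2 \<alpha> a e * val4 \<beta> b c d f
      + val2 \<alpha> a f * val4 \<beta> b c d e + val2 \<alpha> b c * val4 \<beta> a d e f
      - val2 \<alpha> b d * val4 \<beta> a c e f + val2 \<alpha> b e * val4 \<beta> a c d f
      - val2 \<alpha> b f * val4 \<beta> a c d e + val2 \<alpha> c d * val4 \<beta> a b e f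
      - val2 \<alpha> c e * val4 \<beta> a b d f + val2 \<alpha> c f * val4 \<beta> a b d e
      + val2 \<alpha> d e * val4 \<beta> a b c f - val2 \<alpha> d f * val4 \<beta> a b c e
      + val2 \<alpha> e f * val4 \<beta> a b c d"
proof -
  have "is_form (Suc (Suc (0))) \<alpha>" "is_form (Suc (Suc (Suc (Suc (0))))) \<beta>"
    using assms by (simp_all add: eval_nat_numeral)
  then show ?thesis
    unfolding numeral_nat
    by (simp add: wedge_vcons wedge_0_left wedge_0_right is_form_interior interior_prod_apply
      val2_Suc val4_Suc)
qed

lemma wedge_4_2_eval:
  assumes "is_form 4 \<alpha>" "is_form 2 \<beta>"
  shows "wedge 4 2 \<alpha> \<beta> (a ## b ## c ## d ## e ## f ## t) =
      val4 \<alpha> a b c d * val2 \<beta> e f - val4 \<alpha> a b c e * val2 \<beta> d f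
      + val4 \<alpha> a b c f * val2 \<beta> d e + val4 \<alpha> a b d e * val2 \<beta> c f
      - val4 \<alpha> a b d f * val2 \<beta> c e + val4 \<alpha> a b e f * val2 \<beta> c d
      - val4 \<alpha> a c d e * val2 \<beta> b f + val4 \<alpha> a c d f * val2 \<beta> b e
      - val4 \<alpha> a c e f * val2 \<beta> b d + val4 \<alpha> a d e f * val2 \<beta> b c
      + val4 \<alpha> b c d e * val2 \<beta> a f - val4 \<alpha> b c d f * val2 \<beta> a e
      + val4 \<alpha> b c e f * val2 \<beta> a d - val4 \<alpha> b d e f * val2 \<beta> a c
      + val4 \<alpha> c d e f * val2 \<beta> a b"
proof -
  have "is_form (Suc (Suc (Suc (Suc (0))))) \<alpha>" "is_form (Suc (Suc (0))) \<beta>"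
    using assms by (simp_all add: eval_nat_numeral)
  then show ?thesis
    unfolding numeral_nat
    by (simp add: wedge_vcons wedge_0_left wedge_0_right is_form_interior interior_prod_apply
      val4_Suc val2_Suc)
qed

lemma wedge_3_4_eval:
  assumes "is_form 3 \<alpha>" "is_form 4 \<beta>"
  shows "wedge 3 4 \<alpha> \<beta> (a ## b ## c ## d ## e ## f ## g ## t) =
      val3 \<alpha> a b c * val4 \<beta> d e f g - val3 \<alpha> a b d * val4 \<beta> c e f g
      + val3 \<alpha> a b e * val4 \<beta> c d f g - val3 \<alpha> a b f * val4 \<beta> c d e g
      + val3 \<alpha> a b g * val4 \<beta> c d e f + val3 \<alpha> a c d * val4 \<beta> b e f g
      - val3 \<alpha> a c e * val4 \<beta> b d f g + val3 \<alpha> a c f * val4 \<beta> b d e g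
      - val3 \<alpha> a c g * val4 \<beta> b d e f + val3 \<alpha> a d e * val4 \<beta> b c f g
      - val3 \<alpha> a d f * val4 \<beta> b c e g + val3 \<alpha> a d g * val4 \<beta> b c e f
      + val3 \<alpha> a e f * val4 \<beta> b c d g - val3 \<alpha> a e g * val4 \<beta> b c d f
      + val3 \<alpha> a f g * val4 \<beta> b c d e - val3 \<alpha> b c d * val4 \<beta> a e f g
      + val3 \<alpha> b c e * val4 \<beta> a d f g - val3 \<alpha> b c f * val4 \<beta> a d e g
      + val3 \<alpha> b c g * val4 \<beta> a d e f - val3 \<alpha> b d e * val4 \<beta> a c f g
      + val3 \<alpha> b d f * val4 \<beta> a c e g - val3 \<alpha> b d g * val4 \<beta> a c e f
      - val3 \<alpha> b e f * val4 \<beta> a c d g + val3 \<alpha> b e g * val4 \<beta> a c d f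
      - val3 \<alpha> b f g * val4 \<beta> a c d e + val3 \<alpha> c d e * val4 \<beta> a b f g
      - val3 \<alpha> c d f * val4 \<beta> a b e g + val3 \<alpha> c d g * val4 \<beta> a b e f
      + val3 \<alpha> c e f * val4 \<beta> a b d g - val3 \<alpha> c e g * val4 \<beta> a b d f
      + val3 \<alpha> c f g * val4 \<beta> a b d e - val3 \<alpha> d e f * val4 \<beta> a b c g
      + val3 \<alpha> d e g * val4 \<beta> a b c f - val3 \<alpha> d f g * val4 \<beta> a b c e
      + val3 \<alpha> e f g * val4 \<beta> a b c d"
proof -
  have "is_form (Suc (Suc (Suc (0)))) \<alpha>" "is_form (Suc (Suc (Suc (Suc (0))))) \<beta>"
    using assms by (simp_all add: eval_nat_numeral)
  then show ?thesis
    unfolding numeral_nat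
    by (simp add: wedge_vcons wedge_0_left wedge_0_right is_form_interior interior_prod_apply
      val3_Suc val4_Suc)
qed

lemma wedge_4_3_eval:
  assumes "is_form 4 \<alpha>" "is_form 3 \<beta>"
  shows "wedge 4 3 \<alpha> \<beta> (a ## b ## c ## d ## e ## f ## g ## t) =
      val4 \<alpha> a b c d * val3 \<beta> e f g - val4 \<alpha> a b c e * val3 \<beta> d f g
      + val4 \<alpha> a b c f * val3 \<beta> d e g - val4 \<alpha> a b c g * val3 \<beta> d e f
      + val4 \<alpha> a b d e * val3 \<beta> c f g - val4 \<alpha> a b d f * val3 \<beta> c e g
      + val4 \<alpha> a b d g * val3 \<beta> c e f + val4 \<alpha> a b e f * val3 \<beta> c d g
      - val4 \<alpha> a b e g * val3 \<beta> c d f + val4 \<alpha> a b f g * val3 \<beta> c d e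
      - val4 \<alpha> a c d e * val3 \<beta> b f g + val4 \<alpha> a c d f * val3 \<beta> b e g
      - val4 \<alpha> a c d g * val3 \<beta> b e f - val4 \<alpha> a c e f * val3 \<beta> b d g
      + val4 \<alpha> a c e g * val3 \<beta> b d f - val4 \<alpha> a c f g * val3 \<beta> b d e
      + val4 \<alpha> a d e f * val3 \<beta> b c g - val4 \<alpha> a d e g * val3 \<beta> b c f
      + val4 \<alpha> a d f g * val3 \<beta> b c e - val4 \<alpha> a e f g * val3 \<beta> b c d
      + val4 \<alpha> b c d e * val3 \<beta> a f g - val4 \<alpha> b c d f * val3 \<beta> a e g
      + val4 \<alpha> b c d g * val3 \<beta> a e f + val4 \<alpha> b c e f * val3 \<beta> a d g
      - val4 \<alpha> b c e g * val3 \<beta> a d f + val4 \<alpha> b c f g * val3 \<beta> a d e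
      - val4 \<alpha> b d e f * val3 \<beta> a c g + val4 \<alpha> b d e g * val3 \<beta> a c f
      - val4 \<alpha> b d f g * val3 \<beta> a c e + val4 \<alpha> b e f g * val3 \<beta> a c d
      + val4 \<alpha> c d e f * val3 \<beta> a b g - val4 \<alpha> c d e g * val3 \<beta> a b f
      + val4 \<alpha> c d f g * val3 \<beta> a b e - val4 \<alpha> c e f g * val3 \<beta> a b d
      + val4 \<alpha> d e f g * val3 \<beta> a b c"
proof -
  have "is_form (Suc (Suc (Suc (Suc (0))))) \<alpha>" "is_form (Suc (Suc (Suc (0)))) \<beta>"
    using assms by (simp_all add: eval_nat_numeral)
  then show ?thesis
    unfolding numeral_nat
    by (simp add: wedge_vcons wedge_0_left wedge_0_right is_form_interior interior_prod_apply
      val4_Suc val3_Suc)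
qed

lemma val2_interior: "is_form 3 \<alpha> \<Longrightarrow> val2 (interior_prod u \<alpha>) x y = val3 \<alpha> u x y"
  by (simp add: val2_def interior_prod_apply val3)

lemma val3_interior: "is_form 4 \<alpha> \<Longrightarrow> val3 (interior_prod u \<alpha>) x y z = val4 \<alpha> u x y z"
  by (simp add: val3_def interior_prod_apply val4)

lemma is_form_interior_3: "is_form 3 \<alpha> \<Longrightarrow> is_form 2 (interior_prod u \<alpha>)"
  using is_form_interior[of 2 \<alpha> u] by simp

lemma is_form_interior_4: "is_form 4 \<alpha> \<Longrightarrow> is_form 3 (interior_prod u \<alpha>)"
  using is_form_interior[of 3 \<alpha> u] by simp

lemma is_form_wedge_2_2: "is_form 2 \<alpha> \<Longrightarrow> is_form 2 \<beta> \<Longrightarrow> is_form 4 (wedge 2 2 \<alpha> \<beta>)"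
  using is_form_wedge[of 2 \<alpha> 2 \<beta>] by simp

lemma val4_wedge:
  assumes "is_form 2 \<alpha>" "is_form 2 \<beta>"
  shows "val4 (wedge 2 2 \<alpha> \<beta>) a b c d =
    val2 \<alpha> a b * val2 \<beta> c d - val2 \<alpha> a c * val2 \<beta> b d + val2 \<alpha> a d * val2 \<beta> b c
    + val2 \<alpha> b c * val2 \<beta> a d - val2 \<alpha> b d * val2 \<beta> a c + val2 \<alpha> c d * val2 \<beta> a b"
  unfolding val4_def by (simp add: wedge_2_2_eval[OF assms])

section \<open>Top forms and determinants on coordinate space\<close>

definition index_bij :: "'n::{finite,comm_ring_1} itself \<Rightarrow> bool" where
  "index_bij _ \<longleftrightarrow> bij_betw (\<lambda>k. of_nat (Suc k) :: 'n::{finite,comm_ring_1}) {..<CARD('n::{finite,comm_ring_1})} UNIV"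

text \<open>That the multiples of 1 exhaust the index type is special to cyclic rings such as the
  numeral types. For a general finite commutative ring \<open>std_frame\<close> would repeat axes,
  which is why the property appears as a hypothesis.\<close>

lemma index_bij_6: "index_bij TYPE(6)" and index_bij_7: "index_bij TYPE(7)"
proof -
  have "inj_on (\<lambda>k. of_nat (Suc k) :: 6) {..<6}" "inj_on (\<lambda>k. of_nat (Suc k) :: 7) {..<7}"
    by (simp_all add: lessThan_nat_numeral lessThan_Suc)
  moreover have "card ((\<lambda>k. of_nat (Suc k) :: 6) ` {..<6}) = CARD(6)" "card ((\<lambda>k. of_nat (Suc k) :: 7) ` {..<7}) = CARD(7)"
    using calculation by (simp_all add: card_image del: of_nat_Suc)
  ultimately show "index_bij TYPE(6)" "index_bij TYPE(7)"
    unfolding index_bij_def bij_betw_def by (simp_all add: card_eq_UNIV_imp_eq_UNIV del: of_nat_Suc)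
qed

lemma std_frame_range:
  assumes "index_bij TYPE('n::{finite,comm_ring_1})"
  shows "std_frame ` {..<CARD('n::{finite,comm_ring_1})} = range (\<lambda>i::'n::{finite,comm_ring_1}. axis i (1::real))"
proof -
  have "range (\<lambda>i::'n::{finite,comm_ring_1}. axis i (1::real)) = (\<lambda>i. axis i 1) ` ((\<lambda>k. of_nat (Suc k)) ` {..<CARD('n::{finite,comm_ring_1})})"
    using assms by (simp add: index_bij_def bij_betw_def)
  then show ?thesis by (simp add: image_image std_frame_def)
qed

lemma span_std_frame:
  assumes "index_bij TYPE('n::{finite,comm_ring_1})"
  shows "span (std_frame ` {..<CARD('n::{finite,comm_ring_1})} :: (real ^ 'n::{finite,comm_ring_1}) set) = UNIV"
proof -
  have "(Basis :: (real ^ 'n::{finite,comm_ring_1}) set) = range (\<lambda>i. axis i 1)" by (auto simp: Basis_vec_def)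
  then show ?thesis unfolding std_frame_range[OF assms] by (metis span_Basis)
qed

text \<open>Top forms are multiples of the determinant form \<delta>, for which the scaling factor
  is the multiplicativity of determinants.\<close>

lemma top_form_det:
  fixes L :: "real ^ 'n::{finite,comm_ring_1} \<Rightarrow> real ^ 'n::{finite,comm_ring_1}"
  assumes bij: "index_bij TYPE('n::{finite,comm_ring_1})" and form: "is_form CARD('n::{finite,comm_ring_1}) \<eta>" and L: "linear L"
  shows "\<eta> (\<lambda>i. L (v i)) = det (matrix L) * \<eta> v"
proof -
  \<comment> \<open>Inverse of the enumeration used by \<open>std_frame\<close>; it attaches a
    position in the frame to each row index.\<close>
  define num where "num i = the_inv_into {..<CARD('n::{finite,comm_ring_1})} (\<lambda>k. of_nat (Suc k) :: 'n::{finite,comm_ring_1}) i" for i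
  have inj: "inj_on (\<lambda>k. of_nat (Suc k) :: 'n::{finite,comm_ring_1}) {..<CARD('n::{finite,comm_ring_1})}"
    and surj: "(\<lambda>k. of_nat (Suc k) :: 'n::{finite,comm_ring_1}) ` {..<CARD('n::{finite,comm_ring_1})} = UNIV"
    using bij by (auto simp: index_bij_def bij_betw_def)
  have num: "num i < CARD('n::{finite,comm_ring_1})" "of_nat (Suc (num i)) = i" for i
    using the_inv_into_into[OF inj, of i "{..<CARD('n::{finite,comm_ring_1})}"] f_the_inv_into_f[OF inj, of i] surj
    unfolding num_def by auto
  have num_inj: "num i = num j \<longleftrightarrow> i = j" for i j using num(2) by metis
  have num_of_nat: "num (of_nat (Suc k)) = k" if "k < CARD('n::{finite,comm_ring_1})" for k
    using the_inv_into_f_f[OF inj, of k] that by (simp add: num_def)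
  define \<delta> where "\<delta> w = det (\<chi> i. w (num i))" for w :: "nat \<Rightarrow> real ^ 'n::{finite,comm_ring_1}"
  have \<delta>: "is_form CARD('n::{finite,comm_ring_1}) \<delta>"
    unfolding is_form_def
  proof (intro conjI allI impI)
    show "\<delta> v = \<delta> w" if "\<forall>i<CARD('n::{finite,comm_ring_1}). v i = w i" for v w
      using that num by (simp add: \<delta>_def)
    show "linear (\<lambda>x. \<delta> (v(i := x)))" if i: "i < CARD('n::{finite,comm_ring_1})" for v i
    proof -
      have ni: "num j = i \<longleftrightarrow> j = of_nat (Suc i)" for j
        using num(2)[of j] num_of_nat[OF i] by auto
      have e: "\<delta> (v(i := x)) = det (\<chi> j. if j = of_nat (Suc i) then x else v (num j))" for x
        unfolding \<delta>_def by (intro arg_cong[of _ _ det]) (auto simp: vec_eq_iff ni simp del: of_nat_Suc)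
      show ?thesis unfolding e linear_iff
        using det_row_mul[of "of_nat (Suc i)" _ "\<lambda>_. _" "\<lambda>j. v (num j)", unfolded scalar_mult_eq_scaleR]
        by (simp add: det_row_add del: of_nat_Suc)
    qed
    show "\<delta> v = 0" if ij: "i < j \<and> j < CARD('n::{finite,comm_ring_1}) \<and> v i = v j" for v i j
      unfolding \<delta>_def
    proof (rule det_identical_rows)
      show "(of_nat (Suc i) :: 'n::{finite,comm_ring_1}) \<noteq> of_nat (Suc j)"
        using num_of_nat[of i] num_of_nat[of j] ij by auto
      show "row (of_nat (Suc i)) (\<chi> i. v (num i)) = row (of_nat (Suc j)) (\<chi> i. v (num i))"
        using num_of_nat[of i] num_of_nat[of j] ij by (simp add: row_def del: of_nat_Suc)
    qed
  qed
  have std: "std_frame (num i) = axis i 1" for i using num(2)[of i] by (simp add: std_frame_def del: of_nat_Suc)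
  have "(\<chi> i. std_frame (num i)) = (mat 1 :: real ^ 'n::{finite,comm_ring_1} ^ 'n::{finite,comm_ring_1})"
    by (simp add: std vec_eq_iff mat_def axis_def)
  then have \<delta>1: "\<delta> std_frame = 1" by (simp add: \<delta>_def)
  have "(\<chi> i. L (std_frame (num i))) = Finite_Cartesian_Product.transpose (matrix L)"
    by (simp add: std vec_eq_iff Finite_Cartesian_Product.transpose_def matrix_def)
  then have \<delta>L: "\<delta> (\<lambda>i. L (std_frame i)) = det (matrix L)" by (simp add: \<delta>_def)
  have eta: "\<eta> = (\<lambda>w. \<eta> std_frame * \<delta> w)"
    by (rule top_form_ext[OF form is_form_scale[OF \<delta>] span_std_frame[OF bij]]) (simp add: \<delta>1)
  have "pullback L \<eta> = (\<lambda>w. det (matrix L) * \<eta> w)"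
  proof (rule top_form_ext[OF is_form_pullback[OF L form] is_form_scale[OF form] span_std_frame[OF bij]])
    show "pullback L \<eta> std_frame = det (matrix L) * \<eta> std_frame"
      unfolding pullback_def using \<delta>L fun_cong[OF eta, of "\<lambda>i. L (std_frame i)"] by simp
  qed
  then show ?thesis by (simp add: pullback_def fun_eq_iff)
qed

section \<open>Frames and orientation\<close>

lemma wedge_add_left: "wedge k l (\<lambda>v. \<alpha> v + \<alpha>' v) \<beta> = (\<lambda>v. wedge k l \<alpha> \<beta> v + wedge k l \<alpha>' \<beta> v)"
  by (simp add: wedge_def fun_eq_iff algebra_simps sum.distrib add_divide_distrib)

lemma wedge_scale_left: "wedge k l (\<lambda>v. c * \<alpha> v) \<beta> = (\<lambda>v. c * wedge k l \<alpha> \<beta> v)"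
  by (simp add: wedge_def fun_eq_iff algebra_simps sum_distrib_left)

lemma interior_prod_add:
  fixes \<alpha> :: "'v::real_vector form"
  assumes "is_form (Suc k) \<alpha>"
  shows "interior_prod (u + v) \<alpha> = (\<lambda>w. interior_prod u \<alpha> w + interior_prod v \<alpha> w)"
proof
  fix w :: "nat \<Rightarrow> 'v"
  have e: "(x ## w) = (0 ## w)(0 := x)" for x by (auto split: nat.split)
  have "(\<lambda>x. \<alpha> (x ## w)) = (\<lambda>x. \<alpha> ((0 ## w)(0 := x)))"
    by (rule ext, rule arg_cong[of _ _ \<alpha>], rule e)
  then have "linear (\<lambda>x. \<alpha> (x ## w))" using form_linear[OF assms, of 0 "0 ## w"] by simp
  then show "interior_prod (u + v) \<alpha> w = interior_prod u \<alpha> w + interior_prod v \<alpha> w"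
    using linear_add[of "\<lambda>x. \<alpha> (x ## w)" u v] by (simp add: interior_prod_apply)
qed

lemma interior_prod_scale:
  fixes \<alpha> :: "'v::real_vector form"
  assumes "is_form (Suc k) \<alpha>"
  shows "interior_prod (c *\<^sub>R u) \<alpha> = (\<lambda>w. c * interior_prod u \<alpha> w)"
proof
  fix w :: "nat \<Rightarrow> 'v"
  have e: "(x ## w) = (0 ## w)(0 := x)" for x by (auto split: nat.split)
  have "(\<lambda>x. \<alpha> (x ## w)) = (\<lambda>x. \<alpha> ((0 ## w)(0 := x)))"
    by (rule ext, rule arg_cong[of _ _ \<alpha>], rule e)
  then have "linear (\<lambda>x. \<alpha> (x ## w))" using form_linear[OF assms, of 0 "0 ## w"] by simp
  then show "interior_prod (c *\<^sub>R u) \<alpha> w = c * interior_prod u \<alpha> w"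
    using linear_scale[of "\<lambda>x. \<alpha> (x ## w)" c u] by (simp add: interior_prod_apply)
qed

text \<open>Polarisation of \<open>positive_3form_density\<close>: a symmetric bilinear form with
  values in top forms, proportional to the metric.\<close>

definition bform :: "(real ^ 7) form \<Rightarrow> real ^ 7 \<Rightarrow> real ^ 7 \<Rightarrow> (real ^ 7) form" where
  "bform \<phi> u v = wedge 4 3 (wedge 2 2 (interior_prod u \<phi>) (interior_prod v \<phi>)) \<phi>"

lemma positive_3form_density_eq: "positive_3form_density \<phi> u = bform \<phi> u u"
  by (simp add: positive_3form_density_def bform_def)

lemma is_form_bform: "is_form 3 \<phi> \<Longrightarrow> is_form 7 (bform \<phi> u v)"
  using is_form_wedge[of 4 "wedge 2 2 (interior_prod u \<phi>) (interior_prod v \<phi>)" 3 \<phi>]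
  by (simp add: bform_def is_form_wedge_2_2 is_form_interior_3)

lemma wedge_2_2_commute:
  assumes "is_form 2 \<alpha>" "is_form 2 \<beta>" shows "wedge 2 2 \<alpha> \<beta> = wedge 2 2 \<beta> \<alpha>"
  by (rule ext) (simp add: form_val4[OF is_form_wedge_2_2] val4_wedge assms)

lemma bform_commute: "is_form 3 \<phi> \<Longrightarrow> bform \<phi> u v = bform \<phi> v u"
  by (simp add: bform_def wedge_2_2_commute[of "interior_prod u \<phi>"] is_form_interior_3)

lemma bform_linear: "is_form 3 \<phi> \<Longrightarrow> linear (\<lambda>u. bform \<phi> u v w)"
  by (simp add: linear_iff bform_def interior_prod_add[of 2] interior_prod_scale[of 2]
      wedge_add_left wedge_scale_left)

lemma bform_linear_right: "is_form 3 \<phi> \<Longrightarrow> linear (\<lambda>v. bform \<phi> u v w)"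
  using bform_linear[of \<phi> u w] by (simp add: bform_commute[of \<phi> u])

lemma bform_eval:
  assumes "is_form 3 \<phi>"
  shows "bform \<phi> u v (a ## b ## c ## d ## e ## f ## g ## t) =
    wedge 4 3 (wedge 2 2 (interior_prod u \<phi>) (interior_prod v \<phi>)) \<phi> (a ## b ## c ## d ## e ## f ## g ## t)"
  by (simp add: bform_def)

lemma frame_map:
  fixes e :: "nat \<Rightarrow> real ^ 'n::{finite,comm_ring_1}"
  assumes "index_bij TYPE('n::{finite,comm_ring_1})"
  shows "\<exists>L :: real ^ 'n::{finite,comm_ring_1} \<Rightarrow> real ^ 'n::{finite,comm_ring_1}.
    linear L \<and> (\<forall>k<CARD('n::{finite,comm_ring_1}). L (std_frame k) = e k)"
proof -
  have inj: "inj_on (std_frame :: nat \<Rightarrow> real ^ 'n::{finite,comm_ring_1}) {..<CARD('n::{finite,comm_ring_1})}"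
  proof (rule inj_onI)
    fix x y assume xy: "x \<in> {..<CARD('n::{finite,comm_ring_1})}" "y \<in> {..<CARD('n::{finite,comm_ring_1})}"
      "(std_frame x :: real ^ 'n::{finite,comm_ring_1}) = std_frame y"
    then have "(of_nat (Suc x) :: 'n::{finite,comm_ring_1}) = of_nat (Suc y)"
      by (simp add: std_frame_def axis_eq_axis del: of_nat_Suc)
    then show "x = y"
      using assms xy unfolding index_bij_def bij_betw_def inj_on_def by blast
  qed
  have "independent (std_frame ` {..<CARD('n::{finite,comm_ring_1})} :: (real ^ 'n::{finite,comm_ring_1}) set)"
  proof -
    have "(Basis :: (real ^ 'n::{finite,comm_ring_1}) set) = range (\<lambda>i. axis i 1)"
      by (auto simp: Basis_vec_def)
    then show ?thesis unfolding std_frame_range[OF assms] by (metis independent_Basis)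
  qed
  from linear_independent_extend[OF this, of "\<lambda>x. e (the_inv_into {..<CARD('n::{finite,comm_ring_1})} std_frame x)"]
  obtain L :: "real ^ 'n::{finite,comm_ring_1} \<Rightarrow> real ^ 'n::{finite,comm_ring_1}"
    where "linear L" "\<forall>x\<in>std_frame ` {..<CARD('n::{finite,comm_ring_1})}. L x = e (the_inv_into {..<CARD('n::{finite,comm_ring_1})} std_frame x)"
    by blast
  then show ?thesis using the_inv_into_f_f[OF inj] by auto
qed

text \<open>One determinant, that of the linear map from \<open>std_frame\<close> to
  \<open>e\<close>, governs the scaling of top forms, spanning and orientation. Since
  \<open>positively_oriented\<close> asks for some map, the converse uses that the map is determined
  on a spanning family.\<close>

lemma top_form_frame:
  fixes e :: "nat \<Rightarrow> real ^ 'n::{finite,comm_ring_1}"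
  assumes "index_bij TYPE('n::{finite,comm_ring_1})"
  shows "\<exists>d. (\<forall>\<eta>. is_form CARD('n::{finite,comm_ring_1}) \<eta> \<longrightarrow> \<eta> e = d * top_coeff \<eta>) \<and>
    (d \<noteq> 0 \<longleftrightarrow> span (e ` {..<CARD('n::{finite,comm_ring_1})}) = UNIV) \<and> (0 < d \<longleftrightarrow> positively_oriented e)"
proof -
  obtain L :: "real ^ 'n::{finite,comm_ring_1} \<Rightarrow> real ^ 'n::{finite,comm_ring_1}"
    where L: "linear L" "\<And>k. k < CARD('n::{finite,comm_ring_1}) \<Longrightarrow> L (std_frame k) = e k"
    using frame_map[OF assms, of e] by auto
  show ?thesis
  proof (intro exI[of _ "det (matrix L)"] conjI allI impI)
    show "\<eta> e = det (matrix L) * top_coeff \<eta>" if "is_form CARD('n::{finite,comm_ring_1}) \<eta>" for \<eta>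
      using form_cong[OF that, of "\<lambda>i. L (std_frame i)" e] L(2) top_form_det[OF assms that L(1), of std_frame]
      by (simp add: top_coeff_def)
    have "range L = span (L ` std_frame ` {..<CARD('n::{finite,comm_ring_1})})"
      using span_std_frame[OF assms] by (metis L(1) linear_span_image)
    also have "L ` std_frame ` {..<CARD('n::{finite,comm_ring_1})} = e ` {..<CARD('n::{finite,comm_ring_1})}" using L(2) by force
    finally have "range L = UNIV \<longleftrightarrow> span (e ` {..<CARD('n::{finite,comm_ring_1})}) = UNIV" by simp
    then show "det (matrix L) \<noteq> 0 \<longleftrightarrow> span (e ` {..<CARD('n::{finite,comm_ring_1})}) = UNIV"
      using det_nz_iff_inj[OF L(1)] linear_injective_imp_surjective[OF L(1)] linear_surjective_imp_injective[OF L(1)]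
      by blast
    have "positively_oriented e" if "0 < det (matrix L)"
      using that L unfolding positively_oriented_def by blast
    moreover have "0 < det (matrix L)" if po: "positively_oriented e"
    proof -
      obtain L' where L': "linear L'" "\<And>k. k < CARD('n::{finite,comm_ring_1}) \<Longrightarrow> L' (std_frame k) = e k" "0 < det (matrix L')"
        using po unfolding positively_oriented_def by blast
      have "L' x = L x" for x
        by (rule linear_eq_on_span[OF L'(1) L(1), of "std_frame ` {..<CARD('n::{finite,comm_ring_1})}"])
          (use L(2) L'(2) span_std_frame[OF assms] in auto)
      then have "L' = L" by auto
      then show ?thesis using L'(3) by simp
    qed
    ultimately show "0 < det (matrix L) \<longleftrightarrow> positively_oriented e" by blast
  qed
qed

lemma seq7: "is_form 7 \<alpha> \<Longrightarrow> \<alpha> e = \<alpha> (e 0 ## e 1 ## e 2 ## e 3 ## e 4 ## e 5 ## e 6 ## (\<lambda>_. 0))"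
  by (rule form_cong) (auto simp: less_Suc_eq eval_nat_numeral split: nat.split)

lemma seq6: "is_form 6 \<alpha> \<Longrightarrow> \<alpha> e = \<alpha> (e 0 ## e 1 ## e 2 ## e 3 ## e 4 ## e 5 ## (\<lambda>_. 0))"
  by (rule form_cong) (auto simp: less_Suc_eq eval_nat_numeral split: nat.split)

section \<open>Normal form of positive 3-forms\<close>

text \<open>Gram-Schmidt, one vector at a time. With \<open>m = 0\<close> it also yields the
  existence of an orthonormal frame.\<close>

lemma gram_schmidt_extend:
  fixes g :: "real ^ 'n \<Rightarrow> real ^ 'n \<Rightarrow> real"
  assumes g: "is_metric g" and m: "m \<le> CARD('n)"
    and e: "\<And>i j. i < m \<Longrightarrow> j < m \<Longrightarrow> g (e i) (e j) = (if i = j then 1 else 0)"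
  shows "\<exists>e'. orthonormal_frame g e' \<and> (\<forall>i<m. e' i = e i)"
proof -
  have lin: "linear (g u)" and sym: "g u v = g v u" and pos: "u \<noteq> 0 \<Longrightarrow> 0 < g u u" for u v
    using g by (auto simp: is_metric_def)
  have "\<exists>e'. (\<forall>i<k. \<forall>j<k. g (e' i) (e' j) = (if i = j then 1 else 0)) \<and> (\<forall>i<m. e' i = e i)"
    if "m \<le> k" "k \<le> CARD('n)" for k
    using that
  proof (induction k rule: dec_induct)
    case base
    then show ?case using e by blast
  next
    case (step k)
    then obtain f where f: "\<forall>i<k. \<forall>j<k. g (f i) (f j) = (if i = j then 1 else 0)" "\<forall>i<m. f i = e i"
      by auto
    have "dim (span (f ` {..<k})) < CARD('n)"
      using dim_le_card[of "f ` {..<k}" "f ` {..<k}"] card_image_le[of "{..<k}" f] step.prems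
      by (simp add: span_superset)
    then have "span (f ` {..<k}) \<noteq> UNIV" by (metis dim_UNIV DIM_cart DIM_real less_irrefl mult.right_neutral)
    then obtain v where v: "v \<notin> span (f ` {..<k})" by auto
    define w where "w = v - (\<Sum>i<k. g v (f i) *\<^sub>R f i)"
    have "(\<Sum>i<k. g v (f i) *\<^sub>R f i) \<in> span (f ` {..<k})"
      by (intro span_sum span_scale span_base) auto
    then have "w \<noteq> 0" using v unfolding w_def by auto
    then have w: "0 < g w w" by (rule pos)
    have orth: "g w (f j) = 0" if "j < k" for j
    proof -
      have s: "g (f j) v = g v (f j)" "g w (f j) = g (f j) w" by (rule sym)+
      have "g (f j) w = g (f j) v - (\<Sum>i<k. g v (f i) * g (f j) (f i))"
        unfolding w_def by (simp add: linear_diff[OF lin] linear_sum[OF lin] linear_scale[OF lin])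
      also have "(\<Sum>i<k. g v (f i) * g (f j) (f i)) = (\<Sum>i<k. if i = j then g v (f j) else 0)"
        using f(1) that by (intro sum.cong) auto
      finally show ?thesis using that s by simp
    qed
    define f' where "f' = f(k := (1 / sqrt (g w w)) *\<^sub>R w)"
    have s2: "g (c *\<^sub>R w) x = c * g w x" for c x
      using sym[of "c *\<^sub>R w" x] sym[of w x] by (simp add: linear_scale[OF lin])
    have "g (f' i) (f' j) = (if i = j then 1 else 0)" if "i < Suc k" "j < Suc k" for i j
      using that f(1) w orth orth[unfolded sym[of w]]
      by (auto simp: f'_def less_Suc_eq s2 linear_scale[OF lin])
    moreover have "\<forall>i<m. f' i = e i" using f(2) step.hyps by (simp add: f'_def)
    ultimately show ?case by blast
  qed
  from this[of "CARD('n)"] m show ?thesis unfolding orthonormal_frame_def by simp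
qed

text \<open>The vanishing hypotheses are the calibration property of a maximal triple. On the span
  of the last four vectors each \<phi>(x_i, ., .) is a 2-form; the values found are the Pfaffian of
  the first one, its polarised pairing with the second, a contraction that detects \<phi> on the
  last four vectors, and the 3x3 determinant of the numbers \<phi>(x_i, f, f_j).\<close>

lemma split_frame_values:
  assumes \<phi>: "is_form 3 \<phi>"
    and z: "val3 \<phi> x0 x1 f = 0" "val3 \<phi> x0 x1 f1 = 0" "val3 \<phi> x0 x1 f2 = 0" "val3 \<phi> x0 x1 f3 = 0"
      "val3 \<phi> x0 x2 f = 0" "val3 \<phi> x0 x2 f1 = 0" "val3 \<phi> x0 x2 f2 = 0" "val3 \<phi> x0 x2 f3 = 0"
      "val3 \<phi> x1 x2 f = 0" "val3 \<phi> x1 x2 f1 = 0" "val3 \<phi> x1 x2 f2 = 0" "val3 \<phi> x1 x2 f3 = 0"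
  shows "bform \<phi> x0 x0 (x0 ## x1 ## x2 ## f ## f1 ## f2 ## f3 ## t) = 6 * val3 \<phi> x0 x1 x2 *
      (val3 \<phi> x0 f f1 * val3 \<phi> x0 f2 f3 - val3 \<phi> x0 f f2 * val3 \<phi> x0 f1 f3 + val3 \<phi> x0 f f3 * val3 \<phi> x0 f1 f2)" (is ?A)
   and "bform \<phi> x0 x1 (x0 ## x1 ## x2 ## f ## f1 ## f2 ## f3 ## t) = 3 * val3 \<phi> x0 x1 x2 *
      (val3 \<phi> x0 f f1 * val3 \<phi> x1 f2 f3 - val3 \<phi> x0 f f2 * val3 \<phi> x1 f1 f3 + val3 \<phi> x0 f f3 * val3 \<phi> x1 f1 f2
      + val3 \<phi> x0 f1 f2 * val3 \<phi> x1 f f3 - val3 \<phi> x0 f1 f3 * val3 \<phi> x1 f f2 + val3 \<phi> x0 f2 f3 * val3 \<phi> x1 f f1)" (is ?A')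
   and "bform \<phi> x0 f (x0 ## x1 ## x2 ## f ## f1 ## f2 ## f3 ## t) = 3 * val3 \<phi> x0 x1 x2 *
      (val3 \<phi> x0 f f1 * val3 \<phi> f f2 f3 - val3 \<phi> x0 f f2 * val3 \<phi> f f1 f3 + val3 \<phi> x0 f f3 * val3 \<phi> f f1 f2)" (is ?C)
   and "val3 \<phi> f f1 f2 = 0 \<Longrightarrow> val3 \<phi> f f1 f3 = 0 \<Longrightarrow> val3 \<phi> f f2 f3 = 0 \<Longrightarrow> val3 \<phi> f1 f2 f3 = 0 \<Longrightarrow>
    bform \<phi> f f (x0 ## x1 ## x2 ## f ## f1 ## f2 ## f3 ## t) =
      - 6 * (val3 \<phi> x0 f f1 * (val3 \<phi> x1 f f2 * val3 \<phi> x2 f f3 - val3 \<phi> x1 f f3 * val3 \<phi> x2 f f2)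
        - val3 \<phi> x0 f f2 * (val3 \<phi> x1 f f1 * val3 \<phi> x2 f f3 - val3 \<phi> x1 f f3 * val3 \<phi> x2 f f1)
        + val3 \<phi> x0 f f3 * (val3 \<phi> x1 f f1 * val3 \<phi> x2 f f2 - val3 \<phi> x1 f f2 * val3 \<phi> x2 f f1))"
    (is "_ \<Longrightarrow> _ \<Longrightarrow> _ \<Longrightarrow> _ \<Longrightarrow> ?B")
proof -
  have m: "val3 \<phi> x1 x0 y = - val3 \<phi> x0 x1 y" "val3 \<phi> x2 x0 y = - val3 \<phi> x0 x2 y" "val3 \<phi> x2 x1 y = - val3 \<phi> x1 x2 y"
    "val3 \<phi> f x0 y = - val3 \<phi> x0 f y" "val3 \<phi> f x1 y = - val3 \<phi> x1 f y" "val3 \<phi> f x2 y = - val3 \<phi> x2 f y"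
    "val3 \<phi> y f x0 = - val3 \<phi> y x0 f" "val3 \<phi> y f x1 = - val3 \<phi> y x1 f" "val3 \<phi> y f x2 = - val3 \<phi> y x2 f" for y
    using val3_alt[OF \<phi>] by metis+
  note v = val3_alt(1,2,3)[OF \<phi>]
  note ev = bform_eval[OF \<phi>] wedge_4_3_eval[OF is_form_wedge_2_2[OF is_form_interior_3[OF \<phi>] is_form_interior_3[OF \<phi>]] \<phi>]
    val4_wedge[OF is_form_interior_3[OF \<phi>] is_form_interior_3[OF \<phi>]] val2_interior[OF \<phi>]
  \<comment> \<open>Only zero and sign rules at first: most of the expansion disappears before the
    polynomial arithmetic starts.\<close>
  note ar = mult_zero_left mult_zero_right add_0 add_0_right diff_0 diff_0_right minus_zero diff_self
     mult_minus_left mult_minus_right minus_minus diff_minus_eq_add add_uminus_conv_diff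
  show ?A by (simp only: ev m v z ar) (simp add: algebra_simps)
  show ?A' by (simp only: ev m v z ar) (simp add: algebra_simps)
  show ?C by (simp only: ev m v z ar) (simp add: algebra_simps)
  assume h: "val3 \<phi> f f1 f2 = 0" "val3 \<phi> f f1 f3 = 0" "val3 \<phi> f f2 f3 = 0" "val3 \<phi> f1 f2 f3 = 0"
  show ?B by (simp only: ev m v z h ar) (simp add: algebra_simps)
qed

text \<open>The right side is flat at \<open>t = 0\<close>, so a slope would violate the bound. The
  choice \<open>t = c / K\<close> with \<open>K > \<bar>m\<bar>\<close> makes the linear term equal
  to \<open>K * t\<^sup>2\<close>, while the right side gains at most half of that.\<close>

lemma first_cousin:
  fixes c m :: real
  assumes "\<And>t. m + t * c \<le> m * sqrt (1 + t\<^sup>2)"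
  shows "c = 0"
proof (rule ccontr)
  assume c: "c \<noteq> 0"
  define K where "K = \<bar>m\<bar> + 1"
  have K: "K > 0" "m \<le> K" by (auto simp: K_def)
  define t where "t = c / K"
  have s: "1 \<le> sqrt (1 + t\<^sup>2)" "sqrt (1 + t\<^sup>2) \<le> 1 + t\<^sup>2 / 2"
  proof -
    have "1 + t\<^sup>2 \<le> (1 + t\<^sup>2 / 2)\<^sup>2"
      using zero_le_power2[of "t\<^sup>2 / 2"] by (simp add: power2_sum)
    then show "sqrt (1 + t\<^sup>2) \<le> 1 + t\<^sup>2 / 2" by (intro real_le_lsqrt) auto
  qed simp
  have "t * c \<le> m * (sqrt (1 + t\<^sup>2) - 1)" using assms[of t] by (simp add: algebra_simps)
  also have "\<dots> \<le> K * (sqrt (1 + t\<^sup>2) - 1)" using K s by (intro mult_right_mono) auto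
  also have "\<dots> \<le> K * (t\<^sup>2 / 2)" using K s by (intro mult_left_mono) auto
  also have "K * (t\<^sup>2 / 2) = (t * c) / 2" using K by (simp add: t_def power2_eq_square)
  finally have "t * c \<le> 0" by linarith
  moreover have "0 < t * c" using c K by (simp add: t_def power2_eq_square[symmetric])
  ultimately show False by simp
qed

lemma bilinear_metric: "is_metric g \<Longrightarrow> bilinear g"
proof -
  assume g: "is_metric g"
  have "(\<lambda>u. g u v) = g v" for v
    by (rule ext) (use g in \<open>simp add: is_metric_def\<close>)
  then show ?thesis using g by (simp add: bilinear_def is_metric_def)
qed

text \<open>The constant is the minimum of \<open>g u u\<close> on the unit sphere. It bounds
  orthonormal triples, so that their set is compact.\<close>

lemma metric_lower_bound:
  fixes g :: "'a::euclidean_space \<Rightarrow> 'a \<Rightarrow> real"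
  assumes g: "is_metric g"
  shows "\<exists>m>0. \<forall>u. m * (norm u)\<^sup>2 \<le> g u u"
proof -
  have bl: "bounded_bilinear g" using bilinear_metric[OF g] by (simp add: bilinear_conv_bounded_bilinear)
  have cont: "continuous_on S (\<lambda>u. g u u)" for S
    by (intro bounded_bilinear.continuous_on[OF bl] continuous_on_id)
  have ne: "sphere (0::'a) 1 \<noteq> {}" by simp
  obtain x where x: "x \<in> sphere 0 1" "\<And>y. y \<in> sphere 0 1 \<Longrightarrow> g x x \<le> g y y"
    using continuous_attains_inf[OF compact_sphere ne cont] by blast
  have "x \<noteq> 0" using x(1) by auto
  then have pos: "0 < g x x" using g by (auto simp: is_metric_def)
  have "g x x * (norm u)\<^sup>2 \<le> g u u" for u
  proof (cases "u = 0")
    case True then show ?thesis using bilinear_lzero[OF bilinear_metric[OF g]] by simp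
  next
    case False
    let ?v = "(1 / norm u) *\<^sub>R u"
    have "?v \<in> sphere 0 1" using False by simp
    then have "g x x \<le> g ?v ?v" by (rule x(2))
    also have "g ?v ?v = g u u / (norm u)\<^sup>2"
      using bilinear_lmul[OF bilinear_metric[OF g]] bilinear_rmul[OF bilinear_metric[OF g]]
      by (simp add: power2_eq_square)
    finally show ?thesis using False by (simp add: field_simps)
  qed
  then show ?thesis using pos by blast
qed

text \<open>Expanding the first argument in a basis leaves finitely many bilinear functions, which
  are continuous in finite dimension.\<close>

lemma continuous_on_val3:
  fixes \<phi> :: "'a::euclidean_space form" and f g h :: "'c::topological_space \<Rightarrow> 'a"
  assumes \<phi>: "is_form 3 \<phi>" and c: "continuous_on S f" "continuous_on S g" "continuous_on S h"
  shows "continuous_on S (\<lambda>p. val3 \<phi> (f p) (g p) (h p))"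
proof -
  have e: "val3 \<phi> x y z = (\<Sum>i\<in>Basis. (x \<bullet> i) * val3 \<phi> i y z)" for x y z
  proof -
    have "val3 \<phi> (\<Sum>i\<in>Basis. (x \<bullet> i) *\<^sub>R i) y z = (\<Sum>i\<in>Basis. (x \<bullet> i) * val3 \<phi> i y z)"
      by (simp add: linear_sum[OF val3_linear(1)[OF \<phi>]] linear_scale[OF val3_linear(1)[OF \<phi>]])
    then show ?thesis by (simp add: euclidean_representation)
  qed
  have "continuous_on S (\<lambda>p. \<Sum>i\<in>Basis. (f p \<bullet> i) * val3 \<phi> i (g p) (h p))"
  proof (intro continuous_intros c)
    fix i :: 'a
    have "bounded_bilinear (val3 \<phi> i)"
      unfolding bilinear_conv_bounded_bilinear[symmetric] bilinear_def using val3_linear[OF \<phi>] by blast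
    then show "continuous_on S (\<lambda>p. val3 \<phi> i (g p) (h p))"
      by (rule bounded_bilinear.continuous_on) (use c in auto)
  qed
  moreover have "(\<lambda>p. val3 \<phi> (f p) (g p) (h p)) = (\<lambda>p. \<Sum>i\<in>Basis. (f p \<bullet> i) * val3 \<phi> i (g p) (h p))"
    by (rule ext) (rule e)
  ultimately show ?thesis by (simp only:)
qed

text \<open>
  A triple that maximises the form among orthonormal triples is calibrated: the form vanishes on two
  vectors of the triple and one vector orthogonal to it.
\<close>

lemma maximal_triple:
  fixes g :: "real ^ 'n \<Rightarrow> real ^ 'n \<Rightarrow> real"
  assumes g: "is_metric g" and \<phi>: "is_form 3 \<phi>" and n: "3 \<le> CARD('n)"
  obtains x y z where "g x x = 1" "g y y = 1" "g z z = 1" "g x y = 0" "g x z = 0" "g y z = 0"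
    "0 \<le> val3 \<phi> x y z"
    "\<And>w. g w x = 0 \<Longrightarrow> g w y = 0 \<Longrightarrow> g w z = 0 \<Longrightarrow>
      val3 \<phi> x y w = 0 \<and> val3 \<phi> x z w = 0 \<and> val3 \<phi> y z w = 0"
proof -
  have lin: "linear (g u)" and sym: "g u v = g v u" and pos: "u \<noteq> 0 \<Longrightarrow> 0 < g u u" for u v
    using g by (auto simp: is_metric_def)
  have lin': "linear (\<lambda>u. g u v)" for v 
  proof -
    have "(\<lambda>u. g u v) = g v" by (rule ext) (rule sym)
    then show ?thesis using lin by simp
  qed
  have bl: "bounded_bilinear g" using bilinear_metric[OF g] by (simp add: bilinear_conv_bounded_bilinear)
  define T where "T = {(x, y, z). g x x = 1 \<and> g y y = 1 \<and> g z z = 1 \<and> g x y = 0 \<and> g x z = 0 \<and> g y z = 0}"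
  define F where "F = (\<lambda>(x, y, z). val3 \<phi> x y z)"
  have cg: "continuous_on UNIV (\<lambda>p. g (a p) (b p))" if "continuous_on UNIV a" "continuous_on UNIV b"
    for a b :: "(real ^ 'n) \<times> (real ^ 'n) \<times> (real ^ 'n) \<Rightarrow> real ^ 'n"
    by (rule bounded_bilinear.continuous_on[OF bl that])
  have Teq: "T = {p. g (fst p) (fst p) = 1} \<inter> {p. g (fst (snd p)) (fst (snd p)) = 1}
      \<inter> {p. g (snd (snd p)) (snd (snd p)) = 1} \<inter> {p. g (fst p) (fst (snd p)) = 0}
      \<inter> {p. g (fst p) (snd (snd p)) = 0} \<inter> {p. g (fst (snd p)) (snd (snd p)) = 0}"
    by (auto simp: T_def)
  have "closed T"
    unfolding Teq by (intro closed_Int closed_Collect_eq cg continuous_intros)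
  moreover have "bounded T"
  proof -
    obtain m where m: "m > 0" "\<And>u. m * (norm u)\<^sup>2 \<le> g u u" using metric_lower_bound[OF g] by auto
    have "norm u \<le> sqrt (1 / m)" if "g u u = 1" for u
    proof -
      have "(norm u)\<^sup>2 \<le> 1 / m" using m(2)[of u] m(1) that by (simp add: field_simps)
      then show ?thesis by (rule real_le_rsqrt)
    qed
    then have "T \<subseteq> cball 0 (sqrt (1 / m)) \<times> cball 0 (sqrt (1 / m)) \<times> cball 0 (sqrt (1 / m))"
      by (auto simp: T_def)
    then show ?thesis by (rule bounded_subset[rotated]) (intro bounded_Times bounded_cball)
  qed
  ultimately have "compact T" by (simp add: compact_eq_bounded_closed)
  moreover have "T \<noteq> {}"
  proof -
    obtain e where "orthonormal_frame g e" using gram_schmidt_extend[OF g, of 0] by auto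
    then have "(e 0, e 1, e 2) \<in> T" using n by (simp add: T_def orthonormal_frame_def)
    then show ?thesis by blast
  qed
  moreover have "continuous_on T F"
    unfolding F_def case_prod_beta by (intro continuous_on_val3[OF \<phi>] continuous_intros)
  ultimately have "\<exists>p\<in>T. \<forall>q\<in>T. F q \<le> F p" by (rule continuous_attains_sup)
  then obtain p where p: "p \<in> T" "\<And>q. q \<in> T \<Longrightarrow> F q \<le> F p" by auto
  obtain x y z where xyz: "p = (x, y, z)" by (metis prod_cases3)
  have o: "g x x = 1" "g y y = 1" "g z z = 1" "g x y = 0" "g x z = 0" "g y z = 0"
    using p(1) by (auto simp: T_def xyz)
  have max: "val3 \<phi> a b c \<le> val3 \<phi> x y z" if "(a, b, c) \<in> T" for a b c
    using p(2)[OF that] by (simp add: F_def xyz)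
  \<comment> \<open>Exchanging two vectors of the triple reverses the value and stays in
    \<open>T\<close>.\<close>
  have "0 \<le> val3 \<phi> x y z"
    using max[of y x z] o val3_alt(4)[OF \<phi>, of y x z] by (simp add: T_def sym)
  \<comment> \<open>First-order condition: \<open>c\<close> is turned towards the unit vector
    \<open>w1\<close> and renormalised by \<open>sqrt (1 + t\<^sup>2)\<close>; maximality is then
    the hypothesis of \<open>first_cousin\<close>.\<close>
  have step: "val3 \<phi> a b w = 0"
    if abc: "g a a = 1" "g b b = 1" "g c c = 1" "g a b = 0" "g a c = 0" "g b c = 0"
      and mx: "\<And>a' b' c'. (a', b', c') \<in> T \<Longrightarrow> val3 \<phi> a' b' c' \<le> val3 \<phi> a b c"
      and w: "g w a = 0" "g w b = 0" "g w c = 0" for a b c w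
  proof (cases "w = 0")
    case True
    then show ?thesis using linear_0[OF val3_linear(3)[OF \<phi>]] by simp
  next
    case False
    then have gw: "0 < g w w" by (rule pos)
    define w1 where "w1 = (1 / sqrt (g w w)) *\<^sub>R w"
    have w': "g a w = 0" "g b w = 0" "g c w = 0" using w sym by metis+
    have w1: "g w1 w1 = 1" "g a w1 = 0" "g b w1 = 0" "g c w1 = 0" "g w1 c = 0"
      using gw w w'
      by (simp_all add: w1_def linear_scale[OF lin] linear_scale[OF lin'])
    have "val3 \<phi> a b c + t * val3 \<phi> a b w1 \<le> val3 \<phi> a b c * sqrt (1 + t\<^sup>2)" for t
    proof -
      define s where "s = sqrt (1 + t\<^sup>2)"
      have pos2: "1 + t\<^sup>2 > 0" using zero_le_power2[of t] by linarith
      then have s: "s > 0" "s * s = 1 + t\<^sup>2" by (auto simp: s_def)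
      have gs: "g (c + t *\<^sub>R w1) (c + t *\<^sub>R w1) = s * s"
        unfolding s using abc w1
        by (simp add: linear_add[OF lin] linear_add[OF lin'] linear_scale[OF lin] linear_scale[OF lin'] power2_eq_square)
      have "g ((1 / s) *\<^sub>R (c + t *\<^sub>R w1)) ((1 / s) *\<^sub>R (c + t *\<^sub>R w1)) = 1"
        unfolding linear_scale[OF lin] linear_scale[OF lin'] gs using s(1) by simp
      then have "(a, b, (1 / s) *\<^sub>R (c + t *\<^sub>R w1)) \<in> T"
        using abc w1 by (simp add: T_def linear_add[OF lin] linear_scale[OF lin])
      from mx[OF this] have "(1 / s) * (val3 \<phi> a b c + t * val3 \<phi> a b w1) \<le> val3 \<phi> a b c"
        by (simp add: linear_add[OF val3_linear(3)[OF \<phi>]] linear_scale[OF val3_linear(3)[OF \<phi>]])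
      then show ?thesis using s(1) by (simp add: s_def field_simps)
    qed
    then have "val3 \<phi> a b w1 = 0" by (rule first_cousin)
    then show ?thesis using gw by (simp add: w1_def linear_scale[OF val3_linear(3)[OF \<phi>]])
  qed
  \<comment> \<open>Cyclic shifts preserve the maximal value, so \<open>step\<close> applies to each
    pair of the triple.\<close>
  have cyc: "val3 \<phi> y z x = val3 \<phi> x y z" "val3 \<phi> z x y = val3 \<phi> x y z"
    using val3_alt(4,5)[OF \<phi>] by metis+
  have sy: "g y x = 0" "g z x = 0" "g z y = 0" using o sym by metis+
  have "val3 \<phi> x y w = 0 \<and> val3 \<phi> x z w = 0 \<and> val3 \<phi> y z w = 0"
    if w: "g w x = 0" "g w y = 0" "g w z = 0" for w
  proof -
    have "val3 \<phi> x y w = 0" using step[of x y z w] o w max by blast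
    moreover have "val3 \<phi> y z w = 0" using step[of y z x w] o sy w max cyc by simp
    moreover have "val3 \<phi> z x w = 0" using step[of z x y w] o sy w max cyc by simp
    ultimately show ?thesis using val3_alt(4)[OF \<phi>, of x z w] by simp
  qed
  then show ?thesis using that o \<open>0 \<le> val3 \<phi> x y z\<close> by blast
qed

text \<open>The model with coordinates ordered x1, y1, x2, y2, x3, y3, t: the entries ending in 6
  are those of \<omega> \<and> dt, the others those of Re(dz1 dz2 dz3).\<close>

definition g2c :: "nat \<Rightarrow> nat \<Rightarrow> nat \<Rightarrow> real" where
  "g2c i j k = (if (i, j, k) \<in> {(0,1,6), (2,3,6), (4,5,6), (0,2,4)} then 1
     else if (i, j, k) \<in> {(0,3,5), (1,2,5), (1,3,4)} then - 1 else 0)"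

definition g2_frame :: "(real ^ 7) form \<Rightarrow> (nat \<Rightarrow> real ^ 7) \<Rightarrow> bool" where
  "g2_frame \<phi> e \<longleftrightarrow> is_form 3 \<phi> \<and> span (e ` {..<7}) = UNIV \<and>
     (\<forall>k<7. \<forall>j<k. \<forall>i<j. val3 \<phi> (e i) (e j) (e k) = g2c i j k)"

lemma all_less_7:
  "(\<forall>k<(7::nat). P k) \<longleftrightarrow> P 0 \<and> P 1 \<and> P 2 \<and> P 3 \<and> P 4 \<and> P 5 \<and> P 6"
  "(\<forall>k<(6::nat). P k) \<longleftrightarrow> P 0 \<and> P 1 \<and> P 2 \<and> P 3 \<and> P 4 \<and> P 5"
  "(\<forall>k<(5::nat). P k) \<longleftrightarrow> P 0 \<and> P 1 \<and> P 2 \<and> P 3 \<and> P 4"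
  "(\<forall>k<(4::nat). P k) \<longleftrightarrow> P 0 \<and> P 1 \<and> P 2 \<and> P 3"
  "(\<forall>k<(3::nat). P k) \<longleftrightarrow> P 0 \<and> P 1 \<and> P 2"
  "(\<forall>k<(2::nat). P k) \<longleftrightarrow> P 0 \<and> P 1"
  "(\<forall>k<(1::nat). P k) \<longleftrightarrow> P 0"
  "(\<forall>k<(0::nat). P k) \<longleftrightarrow> True"
proof -
  have s: "(\<forall>k<Suc n. P k) \<longleftrightarrow> (\<forall>k<n. P k) \<and> P n" for n by (auto simp: less_Suc_eq)
  show 1: "(\<forall>k<(1::nat). P k) \<longleftrightarrow> P 0" by simp
  show 2: "(\<forall>k<(2::nat). P k) \<longleftrightarrow> P 0 \<and> P 1" by (auto simp: less_2_cases_iff)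
  show 3: "(\<forall>k<(3::nat). P k) \<longleftrightarrow> P 0 \<and> P 1 \<and> P 2" using s[of 2] 2 by simp
  show 4: "(\<forall>k<(4::nat). P k) \<longleftrightarrow> P 0 \<and> P 1 \<and> P 2 \<and> P 3" using s[of 3] 3 by simp
  show 5: "(\<forall>k<(5::nat). P k) \<longleftrightarrow> P 0 \<and> P 1 \<and> P 2 \<and> P 3 \<and> P 4" using s[of 4] 4 by simp
  show 6: "(\<forall>k<(6::nat). P k) \<longleftrightarrow> P 0 \<and> P 1 \<and> P 2 \<and> P 3 \<and> P 4 \<and> P 5" using s[of 5] 5 by simp
  show "(\<forall>k<(7::nat). P k) \<longleftrightarrow> P 0 \<and> P 1 \<and> P 2 \<and> P 3 \<and> P 4 \<and> P 5 \<and> P 6" using s[of 6] 6 by simp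
qed simp

lemma orthonormal_frame_span:
  fixes g :: "real ^ 'n \<Rightarrow> real ^ 'n \<Rightarrow> real"
  assumes g: "is_metric g" and e: "orthonormal_frame g e"
  shows "span (e ` {..<CARD('n)}) = UNIV"
proof -
  have lin: "linear (g u)" for u using g by (simp add: is_metric_def)
  have ge: "g (e i) (e j) = (if i = j then 1 else 0)" if "i < CARD('n)" "j < CARD('n)" for i j
    using e that by (simp add: orthonormal_frame_def)
  have inj: "inj_on e {..<CARD('n)}"
  proof (rule inj_onI)
    fix i j assume ij: "i \<in> {..<CARD('n)}" "j \<in> {..<CARD('n)}" "e i = e j"
    then show "i = j" using ge[of i j] ge[of i i] by (auto split: if_splits)
  qed
  have "independent (e ` {..<CARD('n)})"
  proof
    assume "dependent (e ` {..<CARD('n)})"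
    then obtain u where u: "\<exists>v\<in>e ` {..<CARD('n)}. u v \<noteq> 0" "(\<Sum>v\<in>e ` {..<CARD('n)}. u v *\<^sub>R v) = 0"
      using dependent_finite[of "e ` {..<CARD('n)}"] by auto
    have "u (e j) = 0" if j: "j < CARD('n)" for j
    proof -
      have "0 = g (e j) (\<Sum>i<CARD('n). u (e i) *\<^sub>R e i)"
        using u(2) by (simp add: sum.reindex[OF inj] linear_0[OF lin])
      also have "\<dots> = (\<Sum>i<CARD('n). u (e i) * g (e j) (e i))"
        by (simp add: linear_sum[OF lin] linear_scale[OF lin])
      also have "\<dots> = (\<Sum>i<CARD('n). if i = j then u (e j) else 0)"
        using j by (intro sum.cong) (auto simp: ge)
      finally show ?thesis using j by simp
    qed
    then show False using u(1) by auto
  qed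
  moreover have "card (e ` {..<CARD('n)}) = CARD('n)" by (simp add: card_image[OF inj])
  ultimately show ?thesis
    using card_ge_dim_independent[of "e ` {..<CARD('n)}" UNIV] by auto
qed

text \<open>Cramer's rule.\<close>

lemma solve_3x3:
  fixes a :: "nat \<Rightarrow> nat \<Rightarrow> real"
  assumes "a 0 0 * (a 1 1 * a 2 2 - a 1 2 * a 2 1) - a 0 1 * (a 1 0 * a 2 2 - a 1 2 * a 2 0)
    + a 0 2 * (a 1 0 * a 2 1 - a 1 1 * a 2 0) \<noteq> 0"
  shows "\<exists>x y z. a 0 0 * x + a 0 1 * y + a 0 2 * z = r \<and> a 1 0 * x + a 1 1 * y + a 1 2 * z = s
    \<and> a 2 0 * x + a 2 1 * y + a 2 2 * z = t"
proof -
  define d where "d = a 0 0 * (a 1 1 * a 2 2 - a 1 2 * a 2 1) - a 0 1 * (a 1 0 * a 2 2 - a 1 2 * a 2 0)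
    + a 0 2 * (a 1 0 * a 2 1 - a 1 1 * a 2 0)"
  define x where "x = (r * (a 1 1 * a 2 2 - a 1 2 * a 2 1) - a 0 1 * (s * a 2 2 - a 1 2 * t)
    + a 0 2 * (s * a 2 1 - a 1 1 * t))"
  define y where "y = (a 0 0 * (s * a 2 2 - a 1 2 * t) - r * (a 1 0 * a 2 2 - a 1 2 * a 2 0)
    + a 0 2 * (a 1 0 * t - s * a 2 0))"
  define z where "z = (a 0 0 * (a 1 1 * t - s * a 2 1) - a 0 1 * (a 1 0 * t - s * a 2 0)
    + r * (a 1 0 * a 2 1 - a 1 1 * a 2 0))"
  have d: "d \<noteq> 0" using assms by (simp add: d_def)
  have e: "a 0 0 * x + a 0 1 * y + a 0 2 * z = d * r" "a 1 0 * x + a 1 1 * y + a 1 2 * z = d * s"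
    "a 2 0 * x + a 2 1 * y + a 2 2 * z = d * t"
    unfolding x_def y_def z_def d_def by algebra+
  have "u * (x / d) + v * (y / d) + w * (z / d) = (u * x + v * y + w * z) / d" for u v w
    by (simp add: add_divide_distrib)
  then have "a 0 0 * (x / d) + a 0 1 * (y / d) + a 0 2 * (z / d) = r"
    "a 1 0 * (x / d) + a 1 1 * (y / d) + a 1 2 * (z / d) = s"
    "a 2 0 * (x / d) + a 2 1 * (y / d) + a 2 2 * (z / d) = t"
    using e d by simp_all
  then show ?thesis by blast
qed

text \<open>The pairings of the triple with the dual vectors form the identity matrix, so the
  determinant value gives \<open>D = - 6\<close> from \<open>b f f = 1\<close>. Inserting this in
  the Pfaffian value and its polarisation gives the other two relations.\<close>

lemma split_frame_relations:
  assumes \<phi>: "is_form 3 \<phi>"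
    and b: "\<And>u v. bform \<phi> u v (x0 ## x1 ## x2 ## f ## f1 ## f2 ## f3 ## (\<lambda>_. 0)) = D * b u v"
    and o: "b x0 x0 = 1" "b f f = 1" "b x0 x1 = (0::real)"
    and z: "val3 \<phi> x0 x1 f = 0" "val3 \<phi> x0 x1 f1 = 0" "val3 \<phi> x0 x1 f2 = 0" "val3 \<phi> x0 x1 f3 = 0"
      "val3 \<phi> x0 x2 f = 0" "val3 \<phi> x0 x2 f1 = 0" "val3 \<phi> x0 x2 f2 = 0" "val3 \<phi> x0 x2 f3 = 0"
      "val3 \<phi> x1 x2 f = 0" "val3 \<phi> x1 x2 f1 = 0" "val3 \<phi> x1 x2 f2 = 0" "val3 \<phi> x1 x2 f3 = 0"
    and h: "val3 \<phi> f f1 f2 = 0" "val3 \<phi> f f1 f3 = 0" "val3 \<phi> f f2 f3 = 0" "val3 \<phi> f1 f2 f3 = 0"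
    and d: "val3 \<phi> x0 f f1 = 1" "val3 \<phi> x0 f f2 = 0" "val3 \<phi> x0 f f3 = 0"
      "val3 \<phi> x1 f f1 = 0" "val3 \<phi> x1 f f2 = 1" "val3 \<phi> x1 f f3 = 0"
      "val3 \<phi> x2 f f1 = 0" "val3 \<phi> x2 f f2 = 0" "val3 \<phi> x2 f f3 = 1"
  shows "D = - 6" "val3 \<phi> x0 x1 x2 * val3 \<phi> x0 f2 f3 = - 1"
    "val3 \<phi> x1 f2 f3 = val3 \<phi> x0 f1 f3"
proof -
  note v = split_frame_values[OF \<phi> z, where t = "\<lambda>_. 0", unfolded b o d]
  show D: "D = - 6" using v(4)[OF h] by simp
  show 1: "val3 \<phi> x0 x1 x2 * val3 \<phi> x0 f2 f3 = - 1" using v(1) D by (simp add: mult.commute)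
  then have "val3 \<phi> x0 x1 x2 \<noteq> 0" by auto
  then show "val3 \<phi> x1 f2 f3 = val3 \<phi> x0 f1 f3" using v(2) by simp
qed

text \<open>Orthonormality refers to the density itself, before any normalisation. The maximal
  triple splits off a complement \<open>U\<close> on which \<phi> vanishes; vectors of
  \<open>U\<close> dual to the triple with respect to a fixed one are then adjusted, and all values
  are determined up to the number \<open>l\<close>, which scaling removes.\<close>

lemma positive_normal_form:
  assumes pos: "positive_3form \<phi>"
  obtains e where "g2_frame \<phi> e"
proof -
  have \<phi>: "is_form 3 \<phi>" using pos by (simp add: positive_3form_def)
  define b where "b u v = top_coeff (bform \<phi> u v)" for u v
  have bpos: "u \<noteq> 0 \<Longrightarrow> 0 < b u u" for u
    using pos by (simp add: positive_3form_def b_def positive_3form_density_eq)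
  have bsym: "b u v = b v u" for u v by (simp add: b_def bform_commute[OF \<phi>, of u])
  have met: "is_metric b"
  proof -
    have "linear (b u)" for u
      using bform_linear_right[OF \<phi>, of u std_frame] by (simp add: b_def[abs_def] top_coeff_def)
    then show ?thesis unfolding is_metric_def using bsym bpos by blast
  qed
  note alt = val3_alt[OF \<phi>] and lin = val3_linear[OF \<phi>]
  obtain x y z where xyz: "b x x = 1" "b y y = 1" "b z z = 1" "b x y = 0" "b x z = 0" "b y z = 0"
    and l0: "0 \<le> val3 \<phi> x y z"
    and cal: "\<And>w. b w x = 0 \<Longrightarrow> b w y = 0 \<Longrightarrow> b w z = 0 \<Longrightarrow>
      val3 \<phi> x y w = 0 \<and> val3 \<phi> x z w = 0 \<and> val3 \<phi> y z w = 0"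
    using maximal_triple[OF met \<phi>] by auto
  have three: "\<forall>i<3. \<forall>j<3. b (([x, y, z] ! i)) ([x, y, z] ! j) = (if i = j then 1 else 0)"
    using xyz bsym[of y x] bsym[of z x] bsym[of z y] by (simp add: all_less_7)
  obtain e where e: "orthonormal_frame b e" and e3: "\<forall>i<3. e i = [x, y, z] ! i"
    using gram_schmidt_extend[OF met, of 3 "\<lambda>i. [x, y, z] ! i"] three by auto
  have exyz: "e 0 = x" "e 1 = y" "e 2 = z" "e (Suc 0) = y" using e3 by (simp_all add: all_less_7)
  have be: "b (e i) (e j) = (if i = j then 1 else 0)" if "i < 7" "j < 7" for i j
    using e that by (simp add: orthonormal_frame_def)
  define U where "U = span {e 3, e 4, e 5, e 6}"
  have eU: "e 3 \<in> U" "e 4 \<in> U" "e 5 \<in> U" "e 6 \<in> U" by (auto simp: U_def span_base)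
  have zero: "val3 \<phi> (e 0) (e 1) w = 0 \<and> val3 \<phi> (e 0) (e 2) w = 0 \<and> val3 \<phi> (e 1) (e 2) w = 0"
    if "w \<in> U" for w
  proof -
    have *: "val3 \<phi> (e 0) (e 1) u = 0 \<and> val3 \<phi> (e 0) (e 2) u = 0 \<and> val3 \<phi> (e 1) (e 2) u = 0"
      if "u \<in> {e 3, e 4, e 5, e 6}" for u
      unfolding exyz by (rule cal) (use that in \<open>auto simp: be exyz[symmetric] simp del: One_nat_def\<close>)
    show ?thesis
      using linear_eq_0_on_span[OF lin(3), of "{e 3, e 4, e 5, e 6}" "e 0" "e 1" w]
        linear_eq_0_on_span[OF lin(3), of "{e 3, e 4, e 5, e 6}" "e 0" "e 2" w]
        linear_eq_0_on_span[OF lin(3), of "{e 3, e 4, e 5, e 6}" "e 1" "e 2" w] * that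
      unfolding U_def by blast
  qed
  obtain d where d: "\<And>\<eta>. is_form 7 \<eta> \<Longrightarrow> \<eta> e = d * top_coeff \<eta>"
    "d \<noteq> 0 \<longleftrightarrow> span (e ` {..<7}) = UNIV"
    using top_form_frame[OF index_bij_7, of e] by auto
  have bf: "bform \<phi> u v e = d * b u v" for u v
    using d(1)[OF is_form_bform[OF \<phi>]] by (simp add: b_def)
  have bf0: "bform \<phi> u v = (\<lambda>_. 0)" if "b u v = 0" for u v
    using that top_form_ext[OF is_form_bform[OF \<phi>] is_form_zero, of std_frame] span_std_frame[OF index_bij_7]
    by (simp add: b_def top_coeff_def)
  note bfe = bf[unfolded seq7[OF is_form_bform[OF \<phi>], where e = e]]
  have A: "6 * val3 \<phi> (e 0) (e 1) (e 2) * (val3 \<phi> (e 0) (e 3) (e 4) * val3 \<phi> (e 0) (e 5) (e 6)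
      - val3 \<phi> (e 0) (e 3) (e 5) * val3 \<phi> (e 0) (e 4) (e 6) + val3 \<phi> (e 0) (e 3) (e 6) * val3 \<phi> (e 0) (e 4) (e 5)) = d"
    using split_frame_values(1)[OF \<phi>, of "e 0" "e 1" "e 3" "e 4" "e 5" "e 6" "e 2" "\<lambda>_. 0"] zero eU bfe[of "e 0" "e 0"]
    by (simp add: be)
  have dne: "d \<noteq> 0" using d(2) orthonormal_frame_span[OF met e] by simp
  define l where "l = val3 \<phi> (e 0) (e 1) (e 2)"
  define P where "P = val3 \<phi> (e 0) (e 3) (e 4) * val3 \<phi> (e 0) (e 5) (e 6)
      - val3 \<phi> (e 0) (e 3) (e 5) * val3 \<phi> (e 0) (e 4) (e 6) + val3 \<phi> (e 0) (e 3) (e 6) * val3 \<phi> (e 0) (e 4) (e 5)"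
  have lP: "l \<noteq> 0" "P \<noteq> 0" using A dne by (auto simp: l_def P_def)
  have l: "l > 0" using l0 lP(1) by (simp add: l_def exyz)
  \<comment> \<open>Orthogonality of \<open>e 0\<close> and \<open>f\<close> makes the third value
    of \<open>split_frame_values\<close> vanish, and its factor \<open>l\<close> is nonzero.\<close>
  have C: "val3 \<phi> (e 0) f f1 * val3 \<phi> f f2 f3 - val3 \<phi> (e 0) f f2 * val3 \<phi> f f1 f3 + val3 \<phi> (e 0) f f3 * val3 \<phi> f f1 f2 = 0"
    if "f \<in> U" "f1 \<in> U" "f2 \<in> U" "f3 \<in> U" "b (e 0) f = 0" for f f1 f2 f3
    using split_frame_values(3)[OF \<phi>, of "e 0" "e 1" f f1 f2 f3 "e 2" "\<lambda>_. 0"] zero that bf0[OF that(5)] lP(1)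
    by (simp add: l_def)
  define h where "h i j k = val3 \<phi> (e i) (e j) (e k)" for i j k
  \<comment> \<open>Taking each of the four basis vectors of \<open>U\<close> for \<open>f\<close>
    gives a linear system for the four components of \<phi> on \<open>U\<close>. Its matrix is, up
    to signs, skew with Pfaffian \<open>P\<close>, so \<open>P\<close> times each component is
    zero.\<close>
  have chi: "h 4 5 6 = 0" "h 3 5 6 = 0" "h 3 4 6 = 0" "h 3 4 5 = 0"
  proof -
    have E: "h 0 3 4 * h 3 5 6 - h 0 3 5 * h 3 4 6 + h 0 3 6 * h 3 4 5 = 0"
      "h 0 4 3 * h 4 5 6 - h 0 4 5 * h 4 3 6 + h 0 4 6 * h 4 3 5 = 0"
      "h 0 5 3 * h 5 4 6 - h 0 5 4 * h 5 3 6 + h 0 5 6 * h 5 3 4 = 0"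
      "h 0 6 3 * h 6 4 5 - h 0 6 4 * h 6 3 5 + h 0 6 5 * h 6 3 4 = 0"
      unfolding h_def by (intro C eU; simp add: be)+
    have sw: "h j i k = - h i j k" "h i k j = - h i j k" for i j k unfolding h_def by (rule alt)+
    have s: "h 0 4 3 = - h 0 3 4" "h 0 5 3 = - h 0 3 5" "h 0 5 4 = - h 0 4 5" "h 0 6 3 = - h 0 3 6"
      "h 0 6 4 = - h 0 4 6" "h 0 6 5 = - h 0 5 6" "h 4 3 6 = - h 3 4 6" "h 4 3 5 = - h 3 4 5"
      "h 5 4 6 = - h 4 5 6" "h 5 3 6 = - h 3 5 6" "h 5 3 4 = h 3 4 5" "h 6 4 5 = h 4 5 6"
      "h 6 3 5 = h 3 5 6" "h 6 3 4 = h 3 4 6"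
      using sw by (metis minus_minus)+
    have P: "P = h 0 3 4 * h 0 5 6 - h 0 3 5 * h 0 4 6 + h 0 3 6 * h 0 4 5" by (simp add: P_def h_def)
    have "P * h 4 5 6 = 0" "P * h 3 5 6 = 0" "P * h 3 4 6 = 0" "P * h 3 4 5 = 0"
      using E unfolding s P by algebra+
    then show "h 4 5 6 = 0" "h 3 5 6 = 0" "h 3 4 6 = 0" "h 3 4 5 = 0" using lP by auto
  qed
  have chiU: "val3 \<phi> u v w = 0" if "u \<in> U" "v \<in> U" "w \<in> U" for u v w
  proof -
    let ?S = "{e 3, e 4, e 5, e 6}"
    have 1: "val3 \<phi> u v w = 0" if "u \<in> ?S" "v \<in> ?S" "w \<in> ?S" for u v w
    proof -
      have "h i j k = 0" if "i \<in> {3,4,5,6}" "j \<in> {3,4,5,6}" "k \<in> {3,4,5,6}" for i j k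
      proof -
        have sw: "h j i k = - h i j k" "h i k j = - h i j k" "h i i k = 0" "h i k k = 0" "h i k i = 0" for i j k
          unfolding h_def by (rule alt)+
        show ?thesis using that chi
          sw(1)[of 3] sw(1)[of 4] sw(1)[of 5] sw(1)[of 6] sw(2)[of _ 3] sw(2)[of _ 4] sw(2)[of _ 5] sw(2)[of _ 6] sw(3-5)
          by (smt (verit, best) insertE singletonD)
      qed
      then show ?thesis using that unfolding h_def by auto
    qed
    have 2: "val3 \<phi> u v w = 0" if "u \<in> ?S" "v \<in> ?S" for u v
      using linear_eq_0_on_span[OF lin(3), of ?S u v w] 1 that \<open>w \<in> U\<close> unfolding U_def by blast
    have 3: "val3 \<phi> u v w = 0" if "u \<in> ?S" for u
      using linear_eq_0_on_span[OF lin(2), of ?S u w v] 2 that \<open>v \<in> U\<close> unfolding U_def by blast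
    show ?thesis
      using linear_eq_0_on_span[OF lin(1), of ?S v w u] 3 \<open>u \<in> U\<close> unfolding U_def by blast
  qed
  let ?f = "e 3"
  define a where "a i j = h i 3 (4 + j)" for i j
  \<comment> \<open>Up to the factor -6 this determinant is \<open>bform\<close> on
    \<open>e 3\<close>, whose value in the frame is \<open>d\<close>.\<close>
  have det: "a 0 0 * (a 1 1 * a 2 2 - a 1 2 * a 2 1) - a 0 1 * (a 1 0 * a 2 2 - a 1 2 * a 2 0)
    + a 0 2 * (a 1 0 * a 2 1 - a 1 1 * a 2 0) \<noteq> 0"
    using split_frame_values(4)[OF \<phi>, of "e 0" "e 1" "e 3" "e 4" "e 5" "e 6" "e 2" "\<lambda>_. 0"] zero eU bfe[of "e 3" "e 3"] chiU dne
    by (auto simp: be a_def h_def)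
  have "\<exists>v\<in>U. val3 \<phi> (e 0) ?f v = r \<and> val3 \<phi> (e 1) ?f v = s \<and> val3 \<phi> (e 2) ?f v = t" for r s t
  proof -
    obtain p q m where pqm: "a 0 0 * p + a 0 1 * q + a 0 2 * m = r" "a 1 0 * p + a 1 1 * q + a 1 2 * m = s"
      "a 2 0 * p + a 2 1 * q + a 2 2 * m = t"
      using solve_3x3[OF det] by blast
    have "p *\<^sub>R e 4 + q *\<^sub>R e 5 + m *\<^sub>R e 6 \<in> U"
      using eU unfolding U_def by (intro span_add span_scale)
    moreover have "val3 \<phi> w ?f (p *\<^sub>R e 4 + q *\<^sub>R e 5 + m *\<^sub>R e 6) = p * val3 \<phi> w ?f (e 4) + q * val3 \<phi> w ?f (e 5) + m * val3 \<phi> w ?f (e 6)" for w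
      by (simp add: linear_add[OF lin(3)] linear_scale[OF lin(3)])
    ultimately show ?thesis using pqm by (auto simp: a_def h_def algebra_simps intro!: bexI)
  qed
  then obtain p1 p2 p3 where p: "p1 \<in> U" "p2 \<in> U" "p3 \<in> U"
     "val3 \<phi> (e 0) ?f p1 = 1" "val3 \<phi> (e 1) ?f p1 = 0" "val3 \<phi> (e 2) ?f p1 = 0"
     "val3 \<phi> (e 0) ?f p2 = 0" "val3 \<phi> (e 1) ?f p2 = 1" "val3 \<phi> (e 2) ?f p2 = 0"
     "val3 \<phi> (e 0) ?f p3 = 0" "val3 \<phi> (e 1) ?f p3 = 0" "val3 \<phi> (e 2) ?f p3 = 1"
    by metis
  \<comment> \<open>Multiples of \<open>?f\<close> do not affect the pairings with
    \<open>?f\<close>; the coefficients are chosen to produce the three zeros in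
    \<open>sh\<close>.\<close>
  define f1 where "f1 = p1 - val3 \<phi> (e 1) p1 p2 *\<^sub>R ?f"
  define f2 where "f2 = p2 + val3 \<phi> (e 0) p1 p2 *\<^sub>R ?f"
  define f3 where "f3 = p3 + val3 \<phi> (e 0) p1 p3 *\<^sub>R ?f"
  have fU: "f1 \<in> U" "f2 \<in> U" "f3 \<in> U"
    using p eU unfolding f1_def f2_def f3_def U_def by (auto intro: span_add span_scale span_diff)
  note exp = linear_add[OF lin(1)] linear_add[OF lin(2)] linear_add[OF lin(3)] linear_diff[OF lin(1)]
    linear_diff[OF lin(2)] linear_diff[OF lin(3)] linear_scale[OF lin(1)] linear_scale[OF lin(2)]
    linear_scale[OF lin(3)] alt(1-3)
  have pf: "val3 \<phi> w u ?f = - val3 \<phi> w ?f u" for w u by (rule alt)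
  have dl: "val3 \<phi> (e 0) ?f f1 = 1" "val3 \<phi> (e 1) ?f f1 = 0" "val3 \<phi> (e 2) ?f f1 = 0"
     "val3 \<phi> (e 0) ?f f2 = 0" "val3 \<phi> (e 1) ?f f2 = 1" "val3 \<phi> (e 2) ?f f2 = 0"
     "val3 \<phi> (e 0) ?f f3 = 0" "val3 \<phi> (e 1) ?f f3 = 0" "val3 \<phi> (e 2) ?f f3 = 1"
    using p unfolding f1_def f2_def f3_def by (simp_all add: exp)
  have sh: "val3 \<phi> (e 0) f1 f2 = 0" "val3 \<phi> (e 0) f1 f3 = 0" "val3 \<phi> (e 1) f1 f2 = 0"
    using p unfolding f1_def f2_def f3_def by (simp_all add: exp pf)
  have zu: "val3 \<phi> (e i) (e j) u = 0" if "u \<in> U" "i < 3" "j < 3" "i \<noteq> j" for i j u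
  proof -
    have "val3 \<phi> (e 1) (e 0) u = 0" "val3 \<phi> (e 2) (e 0) u = 0" "val3 \<phi> (e 2) (e 1) u = 0"
      using zero[OF that(1)] alt(4)[of "e 1" "e 0" u] alt(4)[of "e 2" "e 0" u] alt(4)[of "e 2" "e 1" u] by auto
    then show ?thesis using that zero[OF that(1)] by (auto simp: less_Suc_eq eval_nat_numeral)
  qed
  have rel: "val3 \<phi> (e i) (e j) (e k) * val3 \<phi> (e i) g2 g3 = - 1 \<and> val3 \<phi> (e j) g2 g3 = val3 \<phi> (e i) g1 g3 \<and>
     span ((\<lambda>n. (e i ## e j ## e k ## ?f ## g1 ## g2 ## g3 ## (\<lambda>_. 0)) n) ` {..<7}) = UNIV"
    if ijk: "i < 3" "j < 3" "k < 3" "i \<noteq> j" "i \<noteq> k" "j \<noteq> k" and g: "g1 \<in> U" "g2 \<in> U" "g3 \<in> U"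
      and "val3 \<phi> (e i) ?f g1 = 1" "val3 \<phi> (e i) ?f g2 = 0" "val3 \<phi> (e i) ?f g3 = 0"
      "val3 \<phi> (e j) ?f g1 = 0" "val3 \<phi> (e j) ?f g2 = 1" "val3 \<phi> (e j) ?f g3 = 0"
      "val3 \<phi> (e k) ?f g1 = 0" "val3 \<phi> (e k) ?f g2 = 0" "val3 \<phi> (e k) ?f g3 = 1"
    for i j k g1 g2 g3
  proof -
    obtain D where D: "\<And>\<eta>. is_form 7 \<eta> \<Longrightarrow> \<eta> (e i ## e j ## e k ## ?f ## g1 ## g2 ## g3 ## (\<lambda>_. 0)) = D * top_coeff \<eta>"
        "D \<noteq> 0 \<longleftrightarrow> span ((e i ## e j ## e k ## ?f ## g1 ## g2 ## g3 ## (\<lambda>_. 0)) ` {..<7}) = UNIV"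
      using top_form_frame[OF index_bij_7, of "e i ## e j ## e k ## ?f ## g1 ## g2 ## g3 ## (\<lambda>_. 0)"] by auto
    have B: "bform \<phi> u v (e i ## e j ## e k ## ?f ## g1 ## g2 ## g3 ## (\<lambda>_. 0)) = D * b u v" for u v
      unfolding b_def by (rule D(1)[OF is_form_bform[OF \<phi>]])
    have "D = - 6" "val3 \<phi> (e i) (e j) (e k) * val3 \<phi> (e i) g2 g3 = - 1" "val3 \<phi> (e j) g2 g3 = val3 \<phi> (e i) g1 g3"
      by (rule split_frame_relations[OF \<phi> B]; use that eU zu chiU be in simp)+
    then show ?thesis using D(2) by simp
  qed
  \<comment> \<open>The same relations for the three cyclic relabellings of the triple and its dual
    vectors yield all remaining values.\<close>
  have r0: "val3 \<phi> (e 0) (e 1) (e 2) * val3 \<phi> (e 0) f2 f3 = - 1" "val3 \<phi> (e 1) f2 f3 = val3 \<phi> (e 0) f1 f3"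
    "span ((\<lambda>n. (e 0 ## e 1 ## e 2 ## ?f ## f1 ## f2 ## f3 ## (\<lambda>_. 0)) n) ` {..<7}) = UNIV"
    using rel[of 0 1 2 f1 f2 f3] fU dl by auto
  have r1: "val3 \<phi> (e 1) (e 2) (e 0) * val3 \<phi> (e 1) f3 f1 = - 1" "val3 \<phi> (e 2) f3 f1 = val3 \<phi> (e 1) f2 f1"
    using rel[of 1 2 0 f2 f3 f1] fU dl by auto
  have r2: "val3 \<phi> (e 2) (e 0) (e 1) * val3 \<phi> (e 2) f1 f2 = - 1" "val3 \<phi> (e 0) f1 f2 = val3 \<phi> (e 2) f3 f2"
    using rel[of 2 0 1 f3 f1 f2] fU dl by auto
  have lc: "val3 \<phi> (e 0) (e 1) (e 2) = l" "val3 \<phi> (e 1) (e 2) (e 0) = l" "val3 \<phi> (e 2) (e 0) (e 1) = l"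
    using alt(4,5) unfolding l_def by (metis minus_minus)+
  have sw: "val3 \<phi> w f3 f1 = - val3 \<phi> w f1 f3" "val3 \<phi> w f2 f1 = - val3 \<phi> w f1 f2" "val3 \<phi> w f3 f2 = - val3 \<phi> w f2 f3" for w
    by (rule alt)+
  have V: "val3 \<phi> (e 0) f2 f3 = - (1 / l)" "val3 \<phi> (e 1) f1 f3 = 1 / l" "val3 \<phi> (e 2) f1 f2 = - (1 / l)"
    using r0(1) r1(1) r2(1) l unfolding lc sw by (simp_all add: field_simps)
  have V0: "val3 \<phi> (e 1) f2 f3 = 0" "val3 \<phi> (e 2) f1 f3 = 0" "val3 \<phi> (e 2) f2 f3 = 0"
    using r0(2) r1(2) r2(2) sh unfolding sw by auto
  \<comment> \<open>Values on the triple scale by m^-3, values on one of it, \<open>?f\<close> and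
    one dual vector by m^-2 m^2, values on one of it and two dual vectors by m^-1 m^4. With m^3 = l
    all of them become 1, -1 or 0.\<close>
  define m where "m = root 3 l"
  have m: "m > 0" "l = m ^ 3" using l by (auto simp: m_def)
  \<comment> \<open>\<open>e 2\<close> takes the role of the t axis; the other six vectors are
    paired as x1, y1, x2, y2, x3, y3, and the sign of \<open>f2\<close> fits the table.\<close>
  define G where "G = (((1/m) *\<^sub>R e 0) ## ((1/m) *\<^sub>R e 1) ## ((1/m) *\<^sub>R ?f) ## (m\<^sup>2 *\<^sub>R f3) ## (m\<^sup>2 *\<^sub>R f1)
    ## ((- m\<^sup>2) *\<^sub>R f2) ## ((1/m) *\<^sub>R e 2) ## (\<lambda>_. 0))"
  have G: "G 0 = (1/m) *\<^sub>R e 0" "G (Suc 0) = (1/m) *\<^sub>R e 1" "G 2 = (1/m) *\<^sub>R ?f" "G 3 = m\<^sup>2 *\<^sub>R f3" "G 4 = m\<^sup>2 *\<^sub>R f1"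
    "G 5 = (- m\<^sup>2) *\<^sub>R f2" "G 6 = (1/m) *\<^sub>R e 2"
    by (simp_all add: G_def eval_nat_numeral)
  have "(\<lambda>n. (e 0 ## e 1 ## e 2 ## ?f ## f1 ## f2 ## f3 ## (\<lambda>_. 0)) n) ` {..<7} \<subseteq> span (G ` {..<7})"
  proof -
    have mem: "G i \<in> span (G ` {..<7})" if "i < 7" for i using that by (intro span_base) auto
    have "e 0 = m *\<^sub>R G 0" "e 1 = m *\<^sub>R G 1" "e 2 = m *\<^sub>R G 6" "?f = m *\<^sub>R G 2" "f1 = (1/m\<^sup>2) *\<^sub>R G 4"
      "f2 = (- 1/m\<^sup>2) *\<^sub>R G 5" "f3 = (1/m\<^sup>2) *\<^sub>R G 3"
      using m by (simp_all add: G)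
    moreover have "c *\<^sub>R G i \<in> span (G ` {..<7})" if "i < 7" for c i using mem[OF that] by (rule span_scale)
    ultimately have "e 0 \<in> span (G ` {..<7})" "e 1 \<in> span (G ` {..<7})" "e 2 \<in> span (G ` {..<7})"
      "?f \<in> span (G ` {..<7})" "f1 \<in> span (G ` {..<7})" "f2 \<in> span (G ` {..<7})" "f3 \<in> span (G ` {..<7})"
      by (simp_all add: span_neg)
    then have "{e 0, e 1, e 2, ?f, f1, f2, f3} \<subseteq> span (G ` {..<7})" by blast
    moreover have "(\<lambda>n. (e 0 ## e 1 ## e 2 ## ?f ## f1 ## f2 ## f3 ## (\<lambda>_. 0)) n) ` {..<7} = {e 0, e 1, e 2, ?f, f1, f2, f3}"
    proof -
      have "{..<7::nat} = {0, 1, 2, 3, 4, 5, 6}" by (rule set_eqI) (simp, presburger)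
      then show ?thesis by (simp add: eval_nat_numeral)
    qed
    ultimately show ?thesis by simp
  qed
  then have spG: "span (G ` {..<7}) = UNIV"
    using r0(3) span_minimal[OF _ subspace_span] by (metis top.extremum_uniqueI)
  have "\<forall>k<7. \<forall>j<k. \<forall>i<j. val3 \<phi> (G i) (G j) (G k) = g2c i j k"
  proof -
    have cy: "val3 \<phi> u v (e 2) = val3 \<phi> (e 2) u v" for u v using alt(4,5) by (metis minus_minus)
    have ze: "val3 \<phi> (e 0) (e 1) u = 0" "val3 \<phi> (e 2) (e 0) u = 0" "val3 \<phi> (e 2) (e 1) u = 0" if "u \<in> U" for u
      using zu[OF that] by simp_all
    note ze' = ze[OF eU(1)] ze[OF fU(1)] ze[OF fU(2)] ze[OF fU(3)]
    have ch: "val3 \<phi> ?f f2 f3 = 0" "val3 \<phi> ?f f1 f3 = 0" "val3 \<phi> ?f f3 f1 = 0" "val3 \<phi> ?f f3 f2 = 0" "val3 \<phi> ?f f1 f2 = 0" "val3 \<phi> f3 f1 f2 = 0"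
      using chiU eU(1) fU by auto
    note simps = exp linear_neg[OF lin(1)] linear_neg[OF lin(2)] linear_neg[OF lin(3)] cy ze' ch dl sh sw V V0 lc m(2)
    have "m \<noteq> 0" using m by simp
    then show ?thesis
      unfolding all_less_7
      by (simp add: G g2c_def simps simps[unfolded One_nat_def] power2_eq_square power3_eq_cube)
  qed
  then have "g2_frame \<phi> G" using spG \<phi> by (simp add: g2_frame_def)
  then show ?thesis using that by blast
qed

text \<open>Components of \<omega>^2 / 2 + Im(dz1 dz2 dz3) \<and> dt, the Hodge dual of the
  model.\<close>

definition g2d :: "nat \<Rightarrow> nat \<Rightarrow> nat \<Rightarrow> nat \<Rightarrow> real" where
  "g2d i j k l = (if (i, j, k, l) \<in> {(0,1,2,3), (0,1,4,5), (2,3,4,5), (1,2,4,6), (0,3,4,6), (0,2,5,6)} then 1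
     else if (i, j, k, l) = (1,3,5,6) then - 1 else 0)"

text \<open>Conditional rewriting that brings frame vectors into increasing order, where the table
  applies; the comparison of indices prevents loops.\<close>

lemma val3_sort:
  assumes "is_form 3 \<phi>"
  shows "j < i \<Longrightarrow> val3 \<phi> (e i) (e j) z = - val3 \<phi> (e j) (e i) z"
    "k < j \<Longrightarrow> val3 \<phi> x (e j) (e k) = - val3 \<phi> x (e k) (e j)"
  using val3_alt[OF assms] by blast+

lemma g2_frame_form: "g2_frame \<phi> e \<Longrightarrow> is_form 3 \<phi>"
  by (simp add: g2_frame_def)

lemma g2_frame_span: "g2_frame \<phi> e \<Longrightarrow> span (e ` {..<7}) = UNIV"
  by (simp add: g2_frame_def)

lemma g2_frame_values: "g2_frame \<phi> e \<Longrightarrow> \<forall>k<7. \<forall>j<k. \<forall>i<j. val3 \<phi> (e i) (e j) (e k) = g2c i j k"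
  by (simp add: g2_frame_def)

lemmas g2_table = g2_frame_values[unfolded all_less_7 g2c_def, simplified]

lemma sum_less_7: "(\<Sum>i<(7::nat). f i) = (f 0 + f 1 + f 2 + f 3 + f 4 + f 5 + f 6 :: real)"
  "(\<Sum>i<(6::nat). f i) = (f 0 + f 1 + f 2 + f 3 + f 4 + f 5 :: real)"
proof -
  have s: "(\<Sum>i<Suc n. f i) = (\<Sum>i<n. f i) + f n" for n by simp
  have 2: "(\<Sum>i<(2::nat). f i) = f 0 + f 1" by (simp add: numeral_2_eq_2)
  have 3: "(\<Sum>i<(3::nat). f i) = f 0 + f 1 + f 2" using s[of 2] 2 by simp
  have 4: "(\<Sum>i<(4::nat). f i) = f 0 + f 1 + f 2 + f 3" using s[of 3] 3 by simp
  have 5: "(\<Sum>i<(5::nat). f i) = f 0 + f 1 + f 2 + f 3 + f 4" using s[of 4] 4 by simp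
  show 6: "(\<Sum>i<(6::nat). f i) = f 0 + f 1 + f 2 + f 3 + f 4 + f 5" using s[of 5] 5 by simp
  show "(\<Sum>i<(7::nat). f i) = f 0 + f 1 + f 2 + f 3 + f 4 + f 5 + f 6" using s[of 6] 6 by simp
qed

lemma bform_frame:
  assumes "g2_frame \<phi> e"
  defines "W u v \<equiv> val4 (wedge 2 2 (interior_prod u \<phi>) (interior_prod v \<phi>))"
  shows "bform \<phi> u v e = W u v (e 0) (e 1) (e 2) (e 3) + W u v (e 0) (e 1) (e 4) (e 5) + W u v (e 2) (e 3) (e 4) (e 5)
    + W u v (e 1) (e 2) (e 4) (e 6) + W u v (e 0) (e 3) (e 4) (e 6) + W u v (e 0) (e 2) (e 5) (e 6)
    - W u v (e 1) (e 3) (e 5) (e 6)"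
proof -
  note \<phi> = g2_frame_form[OF assms(1)]
  show ?thesis
    unfolding seq7[OF is_form_bform[OF \<phi>], where e = e] W_def bform_eval[OF \<phi>]
      wedge_4_3_eval[OF is_form_wedge_2_2[OF is_form_interior_3[OF \<phi>] is_form_interior_3[OF \<phi>]] \<phi>]
    by (simp add: g2_table[OF assms(1)])
qed

text \<open>The value 6 is the origin of the constant in \<open>bform_metric\<close> and in the
  formula for the metric.\<close>

lemma bform_frame_values:
  assumes "g2_frame \<phi> e"
  shows "\<forall>i<7. \<forall>j<i. bform \<phi> (e j) (e i) e = 0" "\<forall>i<7. bform \<phi> (e i) (e i) e = 6"
proof -
  note \<phi> = g2_frame_form[OF assms]
  show "\<forall>i<7. \<forall>j<i. bform \<phi> (e j) (e i) e = 0" "\<forall>i<7. bform \<phi> (e i) (e i) e = 6"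
    unfolding all_less_7
    by (intro conjI; simp add: bform_frame[OF assms] val4_wedge[OF is_form_interior_3[OF \<phi>] is_form_interior_3[OF \<phi>]]
        val2_interior[OF \<phi>] g2_table[OF assms] val3_alt(1,2,3)[OF \<phi>] val3_sort[OF \<phi>, where e = e])+
qed

text \<open>Summing the squares of the contractions over an orthonormal frame gives six times the
  Hodge dual. This expression involves no definite description and is visibly natural under linear
  isomorphisms.\<close>

definition dual_form :: "(real ^ 7) form \<Rightarrow> (nat \<Rightarrow> real ^ 7) \<Rightarrow> (real ^ 7) form" where
  "dual_form \<phi> e = (\<lambda>v. (\<Sum>p<7. wedge 2 2 (interior_prod (e p) \<phi>) (interior_prod (e p) \<phi>) v) / 6)"

lemma is_form_dual_form: "is_form 3 \<phi> \<Longrightarrow> is_form 4 (dual_form \<phi> e)"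
  unfolding dual_form_def
  by (intro is_form_divide is_form_sum is_form_wedge_2_2 is_form_interior_3)

lemma dual_form_values:
  assumes "g2_frame \<phi> e"
  shows "\<forall>l<7. \<forall>k<l. \<forall>j<k. \<forall>i<j. val4 (dual_form \<phi> e) (e i) (e j) (e k) (e l) = g2d i j k l"
proof -
  note \<phi> = g2_frame_form[OF assms]
  have e: "val4 (dual_form \<phi> e) x y z w =
    (\<Sum>p<7. val4 (wedge 2 2 (interior_prod (e p) \<phi>) (interior_prod (e p) \<phi>)) x y z w) / 6" for x y z w
    by (simp add: val4_def dual_form_def)
  show ?thesis
    unfolding all_less_7
    by (intro conjI; simp add: e sum_less_7 g2d_def val4_wedge[OF is_form_interior_3[OF \<phi>] is_form_interior_3[OF \<phi>]]
        val2_interior[OF \<phi>] g2_table[OF assms] val3_alt(1,2,3)[OF \<phi>] val3_sort[OF \<phi>, where e = e])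
qed

text \<open>The classical contraction identity of the octonionic cross product, in components. Both
  sides alternate in each pair, so pairs with increasing indices suffice.\<close>

lemma g2_frame_dual_identity_basis:
  assumes "g2_frame \<phi> e"
  shows "\<forall>j<7. \<forall>i<j. \<forall>l<7. \<forall>k<l. val4 (dual_form \<phi> e) (e i) (e j) (e k) (e l) =
     (\<Sum>p<7. val3 \<phi> (e i) (e j) (e p) * val3 \<phi> (e p) (e k) (e l))
     - (if i = k then 1 else 0) * (if j = l then 1 else 0) + (if i = l then 1 else 0) * (if j = k then 1 else 0)"
proof -
  note \<phi> = g2_frame_form[OF assms]
  note \<psi> = is_form_dual_form[OF \<phi>, of e]
  note t = dual_form_values[OF assms, unfolded all_less_7 g2d_def, simplified]
  have s: "j < i \<Longrightarrow> val4 (dual_form \<phi> e) (e i) (e j) z w = - val4 (dual_form \<phi> e) (e j) (e i) z w"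
    "j < i \<Longrightarrow> val4 (dual_form \<phi> e) z (e i) (e j) w = - val4 (dual_form \<phi> e) z (e j) (e i) w"
    "j < i \<Longrightarrow> val4 (dual_form \<phi> e) z w (e i) (e j) = - val4 (dual_form \<phi> e) z w (e j) (e i)" for i j z w
    by (rule val4_alt[OF \<psi>])+
  show ?thesis
    unfolding all_less_7
    by (intro conjI; simp add: t s val4_alt(1-6)[OF \<psi>] sum_less_7 g2_table[OF assms]
       val3_alt(1,2,3)[OF \<phi>] val3_sort[OF \<phi>, where e = e])
qed

section \<open>The metric and the dual 4-form\<close>

lemma metric_facts:
  assumes "is_metric g"
  shows metric_sym: "g u v = g v u" and metric_linear: "linear (g u)" "linear (\<lambda>u. g u v)"
    and metric_pos: "u \<noteq> 0 \<Longrightarrow> 0 < g u u"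
proof -
  show "g u v = g v u" "linear (g u)" "u \<noteq> 0 \<Longrightarrow> 0 < g u u" for u v using assms by (simp_all add: is_metric_def)
  have "(\<lambda>u. g u v) = g v" by (rule ext) (use assms in \<open>simp add: is_metric_def\<close>)
  then show "linear (\<lambda>u. g u v)" using assms by (simp add: is_metric_def)
qed

lemma metric_eqI:
  assumes g: "is_metric g" and "\<And>w. g x w = g y w" shows "x = y"
proof (rule ccontr)
  assume "x \<noteq> y"
  then have "0 < g (x - y) (x - y)" using metric_pos[OF g] by simp
  then show False using assms(2) by (simp add: linear_diff[OF metric_linear(2)[OF g]])
qed

lemma orthonormal_expand:
  fixes g :: "real ^ 'n \<Rightarrow> real ^ 'n \<Rightarrow> real"
  assumes g: "is_metric g" and e: "orthonormal_frame g e"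
  shows "u = (\<Sum>i<CARD('n). g u (e i) *\<^sub>R e i)"
proof -
  have lin: "linear (\<lambda>u. \<Sum>i<CARD('n). g u (e i) *\<^sub>R e i)"
    using metric_linear(2)[OF g] by (intro linear_compose_sum) (auto simp: linear_iff scaleR_left_distrib)
  have "(\<Sum>i<CARD('n). g (e j) (e i) *\<^sub>R e i) = e j" if "j < CARD('n)" for j
  proof -
    have "(\<Sum>i<CARD('n). g (e j) (e i) *\<^sub>R e i) = (\<Sum>i<CARD('n). if i = j then e j else 0)"
      using e that by (intro sum.cong) (auto simp: orthonormal_frame_def)
    then show ?thesis using that by simp
  qed
  then have "x \<in> e ` {..<CARD('n)} \<Longrightarrow> id x = (\<Sum>i<CARD('n). g x (e i) *\<^sub>R e i)" for x by auto
  then have "id u = (\<Sum>i<CARD('n). g u (e i) *\<^sub>R e i)"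
    by (rule linear_eq_on_span[OF linear_id lin]) (use orthonormal_frame_span[OF g e] in auto)
  then show ?thesis by simp
qed

lemma metric_expand:
  fixes g :: "real ^ 'n \<Rightarrow> real ^ 'n \<Rightarrow> real"
  assumes g: "is_metric g" and e: "orthonormal_frame g e" and f: "linear f"
  shows "f u = (\<Sum>i<CARD('n). g u (e i) * f (e i))"
proof -
  have "f u = f (\<Sum>i<CARD('n). g u (e i) *\<^sub>R e i)" using orthonormal_expand[OF g e, of u] by simp
  then show ?thesis by (simp add: linear_sum[OF f] linear_scale[OF f])
qed

text \<open>The change between orthonormal frames is an orthogonal matrix. This makes the frame
  picked by \<open>SOME\<close> in traces and inner products immaterial.\<close>

lemma orthonormal_trace:
  fixes g :: "real ^ 'n \<Rightarrow> real ^ 'n \<Rightarrow> real"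
  assumes g: "is_metric g" and e: "orthonormal_frame g e" and e': "orthonormal_frame g e'"
    and B: "\<And>v. linear (\<lambda>u. B u v)" "\<And>u. linear (\<lambda>v. B u v :: real)"
  shows "(\<Sum>i<CARD('n). B (e' i) (e' i)) = (\<Sum>i<CARD('n). B (e i) (e i))"
proof -
  let ?N = "{..<CARD('n)}"
  have o: "(\<Sum>i\<in>?N. g (e' i) (e j) * g (e' i) (e k)) = (if j = k then 1 else 0)" if "j \<in> ?N" "k \<in> ?N" for j k
  proof -
    have "g (e k) (e j) = (\<Sum>i\<in>?N. g (e k) (e' i) * g (e' i) (e j))"
      by (rule metric_expand[OF g e' metric_linear(2)[OF g]])
    also have "\<dots> = (\<Sum>i\<in>?N. g (e' i) (e j) * g (e' i) (e k))"
      by (intro sum.cong refl) (simp add: metric_sym[OF g, of "e k"])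
    finally show ?thesis using that e by (auto simp: orthonormal_frame_def)
  qed
  have "(\<Sum>i\<in>?N. B (e' i) (e' i)) = (\<Sum>i\<in>?N. \<Sum>j\<in>?N. \<Sum>k\<in>?N. g (e' i) (e j) * g (e' i) (e k) * B (e j) (e k))"
  proof (rule sum.cong[OF refl])
    fix i
    have "B (e' i) (e' i) = (\<Sum>j\<in>?N. g (e' i) (e j) * B (e j) (e' i))"
      by (rule metric_expand[OF g e B(1)])
    also have "\<dots> = (\<Sum>j\<in>?N. g (e' i) (e j) * (\<Sum>k\<in>?N. g (e' i) (e k) * B (e j) (e k)))"
      by (intro sum.cong refl arg_cong2[where f = "(*)"] metric_expand[OF g e B(2)])
    finally show "B (e' i) (e' i) = (\<Sum>j\<in>?N. \<Sum>k\<in>?N. g (e' i) (e j) * g (e' i) (e k) * B (e j) (e k))"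
      by (simp add: sum_distrib_left mult.assoc)
  qed
  also have "\<dots> = (\<Sum>j\<in>?N. \<Sum>k\<in>?N. (\<Sum>i\<in>?N. g (e' i) (e j) * g (e' i) (e k)) * B (e j) (e k))"
    unfolding sum_distrib_right by (subst sum.swap) (intro sum.cong refl sum.swap)
  also have "\<dots> = (\<Sum>j\<in>?N. \<Sum>k\<in>?N. if j = k then B (e j) (e k) else 0)"
    by (intro sum.cong refl) (simp add: o)
  finally show ?thesis by simp
qed

lemma metric_trace_eq:
  fixes g :: "real ^ 'n \<Rightarrow> real ^ 'n \<Rightarrow> real"
  assumes "is_metric g" "orthonormal_frame g e" "\<And>v. linear (\<lambda>u. B u v)" "\<And>u. linear (\<lambda>v. B u v :: real)"
  shows "metric_trace g B = (\<Sum>i<CARD('n). B (e i) (e i))"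
proof -
  have "orthonormal_frame g (SOME e. orthonormal_frame g e)" by (rule someI[of _ e]) (rule assms)
  then show ?thesis
    using orthonormal_trace[OF assms(1,2) _ assms(3,4)] by (simp add: metric_trace_def Let_def)
qed

lemma sum_PiE_3:
  fixes f :: "'a \<Rightarrow> 'a \<Rightarrow> 'a \<Rightarrow> real"
  shows "(\<Sum>s\<in>{..<3::nat} \<rightarrow>\<^sub>E A. f (s 0) (s 1) (s 2)) = (\<Sum>i\<in>A. \<Sum>j\<in>A. \<Sum>k\<in>A. f i j k)"
proof -
  have "(\<Sum>s\<in>{..<3::nat} \<rightarrow>\<^sub>E A. f (s 0) (s 1) (s 2)) = (\<Sum>(i, j, k)\<in>A \<times> A \<times> A. f i j k)"
  proof (rule sum.reindex_bij_witness[where j = "\<lambda>s. (s 0, s 1, s 2)" and i = "\<lambda>(i, j, k). \<lambda>n\<in>{..<3}. [i, j, k] ! n"])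
    fix s assume s: "s \<in> {..<3::nat} \<rightarrow>\<^sub>E A"
    show "(case (s 0, s 1, s 2) of (i, j, k) \<Rightarrow> \<lambda>n\<in>{..<3}. [i, j, k] ! n) = s"
    proof
      fix n show "(case (s 0, s 1, s 2) of (i, j, k) \<Rightarrow> \<lambda>n\<in>{..<3}. [i, j, k] ! n) n = s n"
      proof (cases "n < 3")
        case True
        then have "n = 0 \<or> n = 1 \<or> n = 2" by linarith
        then show ?thesis by auto
      next
        case False
        then show ?thesis using s by (auto simp: PiE_def extensional_def)
      qed
    qed
    show "(s 0, s 1, s 2) \<in> A \<times> A \<times> A" using s by (auto simp: PiE_def Pi_def)
  next
    fix b assume b: "b \<in> A \<times> A \<times> A"
    then obtain i j k where bb: "b = (i, j, k)" "i \<in> A" "j \<in> A" "k \<in> A" by auto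
    have "[i, j, k] ! n \<in> A" if "n < 3" for n
    proof -
      have "n = 0 \<or> n = 1 \<or> n = 2" using that by linarith
      then show ?thesis using bb by auto
    qed
    then show "(case b of (i, j, k) \<Rightarrow> \<lambda>n\<in>{..<3}. [i, j, k] ! n) \<in> {..<3} \<rightarrow>\<^sub>E A" using bb by auto
    show "(\<lambda>s. (s 0, s 1, s 2)) (case b of (i, j, k) \<Rightarrow> \<lambda>n\<in>{..<3}. [i, j, k] ! n) = b" using bb by simp
  qed auto
  then show ?thesis by (simp add: sum.cartesian_product)
qed

text \<open>The product of two values is bilinear in each slot separately, so the frame is exchanged
  slot by slot with \<open>orthonormal_trace\<close>.\<close>

lemma form_inner_3:
  fixes g :: "real ^ 'n \<Rightarrow> real ^ 'n \<Rightarrow> real"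
  assumes g: "is_metric g" and e: "orthonormal_frame g e" and a: "is_form 3 \<alpha>" and b: "is_form 3 \<beta>"
  shows "form_inner g 3 \<alpha> \<beta> = (\<Sum>i<CARD('n). \<Sum>j<CARD('n). \<Sum>k<CARD('n).
    val3 \<alpha> (e i) (e j) (e k) * val3 \<beta> (e i) (e j) (e k)) / 6"
proof -
  define e' where "e' = (SOME e. orthonormal_frame g e)"
  have e': "orthonormal_frame g e'" unfolding e'_def by (rule someI[of _ e]) (rule e)
  let ?N = "{..<CARD('n)}"
  \<comment> \<open>One slot at a time, the others held fixed; the reorderings below serve to make
    the sum over the active slot innermost.\<close>
  have t: "(\<Sum>k\<in>?N. val3 \<alpha> x y (e' k) * val3 \<beta> x y (e' k)) = (\<Sum>k\<in>?N. val3 \<alpha> x y (e k) * val3 \<beta> x y (e k))"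
    "(\<Sum>k\<in>?N. val3 \<alpha> x (e' k) y * val3 \<beta> x (e' k) y) = (\<Sum>k\<in>?N. val3 \<alpha> x (e k) y * val3 \<beta> x (e k) y)"
    "(\<Sum>k\<in>?N. val3 \<alpha> (e' k) x y * val3 \<beta> (e' k) x y) = (\<Sum>k\<in>?N. val3 \<alpha> (e k) x y * val3 \<beta> (e k) x y)" for x y
    using orthonormal_trace[OF g e e', of "\<lambda>u v. val3 \<alpha> x y u * val3 \<beta> x y v"]
      orthonormal_trace[OF g e e', of "\<lambda>u v. val3 \<alpha> x u y * val3 \<beta> x v y"]
      orthonormal_trace[OF g e e', of "\<lambda>u v. val3 \<alpha> u x y * val3 \<beta> v x y"]
      val3_linear[OF a] val3_linear[OF b] by (simp_all add: linear_iff algebra_simps)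
  have "form_inner g 3 \<alpha> \<beta> = (\<Sum>s\<in>{..<3::nat} \<rightarrow>\<^sub>E ?N. val3 \<alpha> (e' (s 0)) (e' (s 1)) (e' (s 2)) * val3 \<beta> (e' (s 0)) (e' (s 1)) (e' (s 2))) / 6"
    by (simp add: form_inner_def Let_def e'_def[symmetric] form_val3[OF a] form_val3[OF b] fact_numeral)
  also have "\<dots> = (\<Sum>i\<in>?N. \<Sum>j\<in>?N. \<Sum>k\<in>?N. val3 \<alpha> (e' i) (e' j) (e' k) * val3 \<beta> (e' i) (e' j) (e' k)) / 6"
    by (subst sum_PiE_3[of "\<lambda>i j k. val3 \<alpha> (e' i) (e' j) (e' k) * val3 \<beta> (e' i) (e' j) (e' k)" ?N]) simp
  also have "(\<Sum>i\<in>?N. \<Sum>j\<in>?N. \<Sum>k\<in>?N. val3 \<alpha> (e' i) (e' j) (e' k) * val3 \<beta> (e' i) (e' j) (e' k))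
      = (\<Sum>i\<in>?N. \<Sum>j\<in>?N. \<Sum>k\<in>?N. val3 \<alpha> (e' i) (e' j) (e k) * val3 \<beta> (e' i) (e' j) (e k))"
    by (intro sum.cong refl t)
  also have "\<dots> = (\<Sum>i\<in>?N. \<Sum>k\<in>?N. \<Sum>j\<in>?N. val3 \<alpha> (e' i) (e' j) (e k) * val3 \<beta> (e' i) (e' j) (e k))"
    by (intro sum.cong refl sum.swap)
  also have "\<dots> = (\<Sum>i\<in>?N. \<Sum>k\<in>?N. \<Sum>j\<in>?N. val3 \<alpha> (e' i) (e j) (e k) * val3 \<beta> (e' i) (e j) (e k))"
    by (intro sum.cong refl t)
  also have "\<dots> = (\<Sum>k\<in>?N. \<Sum>j\<in>?N. \<Sum>i\<in>?N. val3 \<alpha> (e' i) (e j) (e k) * val3 \<beta> (e' i) (e j) (e k))"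
    by (subst sum.swap) (intro sum.cong refl sum.swap)
  also have "\<dots> = (\<Sum>k\<in>?N. \<Sum>j\<in>?N. \<Sum>i\<in>?N. val3 \<alpha> (e i) (e j) (e k) * val3 \<beta> (e i) (e j) (e k))"
    by (intro sum.cong refl t)
  also have "\<dots> = (\<Sum>i\<in>?N. \<Sum>j\<in>?N. \<Sum>k\<in>?N. val3 \<alpha> (e i) (e j) (e k) * val3 \<beta> (e i) (e j) (e k))"
    by (subst sum.swap, subst (2) sum.swap) (intro sum.cong refl sum.swap)
  finally show ?thesis .
qed

text \<open>Transport of the dot product by the inverse of the map that sends
  \<open>std_frame\<close> to \<open>e\<close>.\<close>

lemma frame_metric_exists:
  fixes e :: "nat \<Rightarrow> real ^ 7"
  assumes sp: "span (e ` {..<7}) = UNIV"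
  shows "\<exists>g. is_metric g \<and> orthonormal_frame g e"
proof -
  obtain L :: "real ^ 7 \<Rightarrow> real ^ 7" where L: "linear L" "\<And>k. k < 7 \<Longrightarrow> L (std_frame k) = e k"
    using frame_map[OF index_bij_7, of e] by auto
  have "range L = span (L ` std_frame ` {..<7})"
    using span_std_frame[OF index_bij_7] linear_span_image[OF L(1), of "std_frame ` {..<7}"] by simp
  also have "L ` std_frame ` {..<7} = e ` {..<7}" using L(2) by force
  finally have "surj L" using sp by simp
  then have inj: "inj L" using linear_surjective_imp_injective[OF L(1)] by simp
  obtain K where K: "linear K" "K \<circ> L = id" using linear_injective_left_inverse[OF L(1) inj] by auto
  have KL: "K (L x) = x" for x using fun_cong[OF K(2), of x] by simp
  have K0: "K u = 0 \<longleftrightarrow> u = 0" for u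
    using KL \<open>surj L\<close> by (metis K(1) L(1) linear_0 surjD)
  have ax: "(of_nat (Suc i) :: 7) = of_nat (Suc j) \<longleftrightarrow> i = j" if "i < 7" "j < 7" for i j
    using index_bij_7 that unfolding index_bij_def bij_betw_def inj_on_def by auto
  have "is_metric (\<lambda>u v. K u \<bullet> K v)"
    unfolding is_metric_def using K0 K(1) by (auto simp: linear_iff inner_simps inner_commute)
  moreover have "orthonormal_frame (\<lambda>u v. K u \<bullet> K v) e"
    unfolding orthonormal_frame_def using ax
    by (simp add: L(2)[symmetric] KL std_frame_def inner_axis_axis del: of_nat_Suc)
  ultimately show ?thesis by blast
qed

lemma is_form_2I:
  assumes "\<And>y. linear (\<lambda>x. f x y)" "\<And>x. linear (\<lambda>y. f x y)" "\<And>x. f x x = 0"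
  shows "is_form 2 (\<lambda>v. f (v 0) (v (Suc 0)))"
  unfolding is_form_def
proof (intro conjI allI impI)
  show "linear (\<lambda>x. f ((v(i := x)) 0) ((v(i := x)) (Suc 0)))" if "i < 2" for i v
  proof -
    have "i = 0 \<or> i = 1" using that by linarith
    then show ?thesis using assms by auto
  qed
  show "f (v 0) (v (Suc 0)) = 0" if "i < j \<and> j < 2 \<and> v i = v j" for v i j
  proof -
    have "i = 0" "j = Suc 0" using that by linarith+
    then have "v 0 = v (Suc 0)" using that by blast
    then show ?thesis using assms(3) by simp
  qed
qed auto

lemma alternating_bilinear_ext:
  fixes e :: "nat \<Rightarrow> 'v::real_vector" and n :: nat and f h :: "'v \<Rightarrow> 'v \<Rightarrow> real"
  assumes f: "\<And>y. linear (\<lambda>x. f x y)" "\<And>x. linear (\<lambda>y. f x y)" "\<And>x. f x x = 0"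
    and h: "\<And>y. linear (\<lambda>x. h x y)" "\<And>x. linear (\<lambda>y. h x y)" "\<And>x. h x x = 0"
    and sp: "span (e ` {..<n}) = UNIV" and eq: "\<forall>j<n. \<forall>i<j. f (e i) (e j) = h (e i) (e j)"
  shows "f x y = h x y"
proof -
  have "(\<lambda>v. f (v 0) (v (Suc 0))) = (\<lambda>v. h (v 0) (v (Suc 0)))"
    by (rule form2_ext[OF is_form_2I[of f, OF f] is_form_2I[of h, OF h] sp]) (use eq in \<open>simp add: val2_def\<close>)
  from fun_cong[OF this, of "x ## y ## (\<lambda>_. 0)"] show ?thesis by simp
qed

text \<open>The linear-algebraic substitute for the triple of a positive form, its metric and its
  Hodge dual. Orientation is kept out of it, since the algebra below does not see it.\<close>

definition g2_structure ::
    "(real ^ 7) form \<Rightarrow> (real ^ 7 \<Rightarrow> real ^ 7 \<Rightarrow> real) \<Rightarrow> (real ^ 7) form \<Rightarrow> (nat \<Rightarrow> real ^ 7) \<Rightarrow> bool" where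
  "g2_structure \<phi> g \<psi> e \<longleftrightarrow> g2_frame \<phi> e \<and> is_metric g \<and> orthonormal_frame g e \<and> \<psi> = dual_form \<phi> e"

lemma g2_structureD:
  assumes "g2_structure \<phi> g \<psi> e"
  shows "g2_frame \<phi> e" "is_metric g" "orthonormal_frame g e" "\<psi> = dual_form \<phi> e"
    "is_form 3 \<phi>" "is_form 4 \<psi>"
  using assms is_form_dual_form g2_frame_form by (auto simp: g2_structure_def)

lemma g2_identity_frame:
  assumes s: "g2_structure \<phi> g \<psi> e"
  shows "val4 \<psi> u v w z = (\<Sum>p<7. val3 \<phi> u v (e p) * val3 \<phi> (e p) w z) - g u w * g v z + g u z * g v w"
proof -
  note D = g2_structureD[OF s]
  define R where "R u v w z = (\<Sum>p<7. val3 \<phi> u v (e p) * val3 \<phi> (e p) w z) - g u w * g v z + g u z * g v w" for u v w z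
  note ml = metric_linear[OF D(2)] and vl = val3_linear[OF D(5)] and va = val3_alt[OF D(5)]
  have lR: "linear (\<lambda>u. R u v w z)" "linear (\<lambda>v. R u v w z)" "linear (\<lambda>w. R u v w z)" "linear (\<lambda>z. R u v w z)"
    for u v w z
    by (rule linearI; simp add: R_def linear_add[OF ml(1)] linear_add[OF ml(2)] linear_scale[OF ml(1)] linear_scale[OF ml(2)]
      linear_add[OF vl(1)] linear_add[OF vl(2)] linear_add[OF vl(3)] linear_scale[OF vl(1)] linear_scale[OF vl(2)]
      linear_scale[OF vl(3)] sum.distrib sum_distrib_left algebra_simps)+
  have alt: "R u u w z = 0" "R u v w w = 0" for u v w z
    unfolding R_def by (simp_all add: va(1-3))
  have ge: "g (e i) (e j) = (if i = j then 1 else 0)" if "i < 7" "j < 7" for i j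
    using D(3) that by (simp add: orthonormal_frame_def)
  have basis: "val4 \<psi> (e i) (e j) (e k) (e l) = R (e i) (e j) (e k) (e l)"
    if "i < j" "j < 7" "k < l" "l < 7" for i j k l
  proof -
    have "val4 (dual_form \<phi> e) (e i) (e j) (e k) (e l) =
     (\<Sum>p<7. val3 \<phi> (e i) (e j) (e p) * val3 \<phi> (e p) (e k) (e l))
     - (if i = k then 1 else 0) * (if j = l then 1 else 0) + (if i = l then 1 else 0) * (if j = k then 1 else 0)"
      using g2_frame_dual_identity_basis[OF D(1)] that by blast
    then show ?thesis using that by (simp add: R_def D(4) ge)
  qed
  have 1: "val4 \<psi> (e i) (e j) w z = R (e i) (e j) w z" if ij: "i < j" "j < 7" for i j w z
    by (rule alternating_bilinear_ext[OF val4_linear(3,4)[OF D(6)] val4_alt(3)[OF D(6)] lR(3,4) alt(2) g2_frame_span[OF D(1)]])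
      (use basis ij in auto)
  have "val4 \<psi> u v w z = R u v w z"
    by (rule alternating_bilinear_ext[where f = "\<lambda>u v. val4 \<psi> u v w z",
          OF val4_linear(1,2)[OF D(6)] val4_alt(1)[OF D(6)] lR(1,2) alt(1) g2_frame_span[OF D(1)]])
      (use 1 in auto)
  then show ?thesis by (simp add: R_def)
qed

text \<open>The vector that represents \<phi>(u, v, .) with respect to the metric; it exists by
  \<open>metric_riesz\<close> and is determined because the metric is nondegenerate.\<close>

definition cross :: "('v \<Rightarrow> 'v \<Rightarrow> real) \<Rightarrow> 'v::zero form \<Rightarrow> 'v \<Rightarrow> 'v \<Rightarrow> 'v" where
  "cross g \<phi> u v = (SOME x. \<forall>w. g x w = val3 \<phi> u v w)"

lemma metric_riesz:
  fixes g :: "real ^ 'n \<Rightarrow> real ^ 'n \<Rightarrow> real"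
  assumes g: "is_metric g" and f: "linear f"
  shows "\<exists>x. \<forall>w. g x w = f w"
proof -
  obtain e where e: "orthonormal_frame g e" using gram_schmidt_extend[OF g, of 0] by auto
  have "g (\<Sum>i<CARD('n). f (e i) *\<^sub>R e i) w = f w" for w
    using metric_expand[OF g e f, of w]
    by (simp add: linear_sum[OF metric_linear(2)[OF g]] linear_scale[OF metric_linear(2)[OF g]] metric_sym[OF g, of w] mult.commute)
  then show ?thesis by blast
qed

lemma cross:
  fixes g :: "real ^ 'n \<Rightarrow> real ^ 'n \<Rightarrow> real"
  assumes "is_metric g" "is_form 3 \<phi>"
  shows "g (cross g \<phi> u v) w = val3 \<phi> u v w"
  using someI_ex[OF metric_riesz[OF assms(1) val3_linear(3)[OF assms(2)]], of u v]
  by (simp add: cross_def)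

lemma g2_identity:
  assumes s: "g2_structure \<phi> g \<psi> e"
  shows "val4 \<psi> u v w z = val3 \<phi> (cross g \<phi> u v) w z - g u w * g v z + g u z * g v w"
proof -
  note D = g2_structureD[OF s]
  have "val3 \<phi> (cross g \<phi> u v) w z = (\<Sum>p<7. val3 \<phi> u v (e p) * val3 \<phi> (e p) w z)"
    using metric_expand[OF D(2,3) val3_linear(1)[OF D(5)], of "cross g \<phi> u v" w z]
    by (simp add: cross[OF D(2,5)])
  then show ?thesis by (simp add: g2_identity_frame[OF s])
qed

text \<open>\<open>g2_identity\<close> expresses either dual form by \<phi> and the metric alone, so
  the two agree.\<close>

lemma g2_structure_change_frame:
  assumes s: "g2_structure \<phi> g \<psi> e" and e': "g2_frame \<phi> e'" "orthonormal_frame g e'"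
  shows "g2_structure \<phi> g \<psi> e'"
proof -
  note D = g2_structureD[OF s]
  have s': "g2_structure \<phi> g (dual_form \<phi> e') e'" using e' D by (simp add: g2_structure_def)
  have "\<psi> = dual_form \<phi> e'"
    by (rule ext) (simp add: form_val4[OF D(6)] form_val4[OF is_form_dual_form[OF D(5)]]
      g2_identity[OF s] g2_identity[OF s'])
  then show ?thesis using s' by simp
qed

text \<open>Transitivity of G2 on unit vectors, made explicit. On the complement of \<nu> the map
  \<open>I\<close> = \<nu> \<times> . is a complex structure; a unit vector \<open>a\<close>, a unit
  vector \<open>b\<close> orthogonal to \<open>a\<close> and \<open>I a\<close>, and their product
  \<open>c\<close> form a complex basis in which \<phi> is standard.\<close>

lemma g2_frame_with_last:
  assumes s: "g2_structure \<phi> g \<psi> e" and \<nu>: "g \<nu> \<nu> = 1"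
  shows "\<exists>e'. g2_structure \<phi> g \<psi> e' \<and> e' 6 = \<nu>"
proof -
  note D = g2_structureD[OF s]
  note ml = metric_linear[OF D(2)] and vl = val3_linear[OF D(5)] and va = val3_alt[OF D(5)]
  have sym: "g u v = g v u" for u v by (rule metric_sym[OF D(2)])
  have gX: "g (cross g \<phi> u v) w = val3 \<phi> u v w" for u v w by (rule cross[OF D(2,5)])
  define I where "I u = cross g \<phi> \<nu> u" for u
  have rot: "val3 \<phi> u v w = val3 \<phi> v w u" for u v w using va(4,5) by (metis minus_minus)
  \<comment> \<open>The double cross product formula: \<open>g2_identity\<close> with a repeated
    vector, where the 4-form vanishes.\<close>
  have J: "val3 \<phi> (cross g \<phi> u v) v z = g u v * g v z - g u z * g v v" for u v z
    using g2_identity[OF s, of u v v z] val4_alt(2)[OF D(6)] by simp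
  have gI: "g (I u) w = val3 \<phi> \<nu> u w" for u w by (simp add: I_def gX)
  have Psi: "val3 \<phi> (I u) v w = val4 \<psi> \<nu> u v w" if "g \<nu> v = 0" "g \<nu> w = 0" for u v w
    using g2_identity[OF s, of \<nu> u v w] that by (simp add: I_def)
  have In: "g \<nu> (I u) = 0" for u using gI[of u \<nu>] va(3) sym by metis
  have Iu: "g (I u) u = 0" for u using gI[of u u] va(2) by metis
  \<comment> \<open>\<open>I\<close> squares to -1 on the complement of \<nu>; this is
    \<open>J\<close> with \<nu> as the repeated vector.\<close>
  have II: "g (I (I u)) w = - g u w" if "g \<nu> u = 0" for u w
  proof -
    have "g (I (I u)) w = val3 \<phi> \<nu> (cross g \<phi> \<nu> u) w" by (simp add: gI I_def[symmetric])
    also have "\<dots> = - val3 \<phi> (cross g \<phi> \<nu> u) \<nu> w" by (rule va(4))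
    also have "val3 \<phi> (cross g \<phi> \<nu> u) \<nu> w = - val3 \<phi> (cross g \<phi> u \<nu>) \<nu> w"
    proof -
      have "cross g \<phi> \<nu> u = - cross g \<phi> u \<nu>"
        by (rule metric_eqI[OF D(2)]) (simp add: gX linear_neg[OF ml(2)] va(4)[of \<nu> u])
      then show ?thesis by (simp add: linear_neg[OF vl(1)])
    qed
    finally show ?thesis using J[of u \<nu> w] that \<nu> sym[of u \<nu>] by simp
  qed
  have Iso: "g (I u) (I v) = g u v" if "g \<nu> u = 0" "g \<nu> v = 0" for u v
  proof -
    have "g (I u) (I v) = val3 \<phi> \<nu> u (I v)" by (rule gI)
    also have "\<dots> = - val3 \<phi> \<nu> (I v) u" by (rule va(5))
    also have "\<dots> = - g (I (I v)) u" by (simp add: gI)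
    finally show ?thesis using II[OF that(2)] sym[of v u] by simp
  qed
  have skew: "g (I u) v = - g (I v) u" for u v by (simp add: gI va(5)[of \<nu> u])
  obtain f where f: "orthonormal_frame g f" "f 0 = \<nu>"
    using gram_schmidt_extend[OF D(2), of 1 "\<lambda>_. \<nu>"] \<nu> by auto
  define a where "a = f 1"
  have a: "g a a = 1" "g \<nu> a = 0" using f by (auto simp: a_def orthonormal_frame_def)
  have "\<forall>i<3. \<forall>j<3. g ([\<nu>, a, I a] ! i) ([\<nu>, a, I a] ! j) = (if i = j then 1 else 0)"
    using \<nu> a In[of a] Iu[of a] Iso[OF a(2) a(2)] sym[of a \<nu>] sym[of "I a" \<nu>] sym[of a "I a"]
    by (simp add: all_less_7)
  then obtain f' where f': "orthonormal_frame g f'" "\<forall>i<3. f' i = [\<nu>, a, I a] ! i"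
    using gram_schmidt_extend[OF D(2), of 3 "\<lambda>i. [\<nu>, a, I a] ! i"] by auto
  define b where "b = f' 3"
  have f'': "f' 0 = \<nu>" "f' (Suc 0) = a" "f' 2 = I a" using f'(2) by (simp_all add: all_less_7)
  have "g (f' 3) (f' 3) = 1" "g (f' 0) (f' 3) = 0" "g (f' 1) (f' 3) = 0" "g (f' 2) (f' 3) = 0"
    using f'(1) by (simp_all add: orthonormal_frame_def)
  then have b: "g b b = 1" "g \<nu> b = 0" "g a b = 0" "g (I a) b = 0" unfolding b_def by (simp_all add: f'')
  define c where "c = cross g \<phi> a b"
  have gc: "g c w = val3 \<phi> a b w" for w by (simp add: c_def gX)
  have ab: "g b a = 0" "g (I b) a = 0" "g a (I b) = 0" "g b (I a) = 0"
    using b sym[of b a] skew[of b a] sym[of a "I b"] sym[of b "I a"] by auto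
  have c\<nu>: "g \<nu> c = 0" using gc[of \<nu>] sym[of c \<nu>] rot[of \<nu> a b] gI[of a b] b(4) by simp
  have ca: "g c a = 0" "g c b = 0" using gc[of a] gc[of b] va(2,3) by auto
  have cIa: "g c (I a) = 0"
  proof -
    have "val3 \<phi> a b (I a) = val3 \<phi> (I a) a b" using rot by metis
    also have "\<dots> = - val3 \<phi> (cross g \<phi> a \<nu>) a b"
    proof -
      have "I a = - cross g \<phi> a \<nu>"
        by (rule metric_eqI[OF D(2)]) (simp add: gI gX linear_neg[OF ml(2)] va(4)[of \<nu> a])
      then show ?thesis by (simp add: linear_neg[OF vl(1)])
    qed
    also have "val3 \<phi> (cross g \<phi> a \<nu>) a b = - val3 \<phi> (cross g \<phi> \<nu> a) a b"
    proof -
      have "cross g \<phi> a \<nu> = - cross g \<phi> \<nu> a"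
        by (rule metric_eqI[OF D(2)]) (simp add: gX linear_neg[OF ml(2)] va(4)[of \<nu> a])
      then show ?thesis by (simp add: linear_neg[OF vl(1)])
    qed
    finally show ?thesis using J[of \<nu> a b] a b gc by simp
  qed
  have cIb: "g c (I b) = 0"
  proof -
    have "val3 \<phi> a b (I b) = - val3 \<phi> (I b) b a" using rot va(4) by metis
    then show ?thesis using J[of \<nu> b a] a b gc by (simp add: I_def)
  qed
  have cc: "g c c = 1"
  proof -
    have "g c c = - val3 \<phi> c b a" using gc[of c] rot va(4) by metis
    then show ?thesis using J[of a b a] a b by (simp add: c_def)
  qed
  have Pbc: "val3 \<phi> b c w = g a w" for w
  proof -
    have "val3 \<phi> b c w = - val3 \<phi> c b w" by (rule va(4))
    then show ?thesis using J[of a b w] a b by (simp add: c_def)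
  qed
  have Iabc: "val3 \<phi> (I a) b c = 0" using Pbc[of "I a"] Iu[of a] sym[of a "I a"] rot[of "I a" b c] by simp
  note n0 = a(2) b(2) c\<nu> In
  note p = val4_alt[OF D(6)]
  \<comment> \<open>Both sides equal \<psi>(\<nu>, u, v, w) by alternation; it says that \<phi> is
    the real part of a complex trilinear form on the complement of \<nu>.\<close>
  have mv: "val3 \<phi> u (I v) w = val3 \<phi> (I u) v w" if "g \<nu> u = 0" "g \<nu> v = 0" "g \<nu> w = 0" for u v w
  proof -
    have "val3 \<phi> u (I v) w = - val3 \<phi> (I v) u w" by (rule va(4))
    also have "\<dots> = - val4 \<psi> \<nu> v u w" using that by (simp add: Psi)
    also have "\<dots> = val4 \<psi> \<nu> u v w" using p(8)[of \<nu> u v w] by simp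
    finally show ?thesis using that by (simp add: Psi)
  qed
  have mv': "val3 \<phi> u v (I w) = val3 \<phi> (I u) v w" if "g \<nu> u = 0" "g \<nu> v = 0" "g \<nu> w = 0" for u v w
    using mv[OF that(1,3,2)] va(5)[of u v "I w"] va(5)[of "I u" v w] by simp
  have sq: "val3 \<phi> (I (I u)) v w = - val3 \<phi> u v w" if "g \<nu> u = 0" for u v w
  proof -
    have "I (I u) = - u" by (rule metric_eqI[OF D(2)]) (simp add: II[OF that] linear_neg[OF ml(2)])
    then show ?thesis by (simp add: linear_neg[OF vl(1)])
  qed
  have pair: "val3 \<phi> u (I u) w = 0" if "g \<nu> u = 0" "g \<nu> w = 0" for u w
    using mv[of u u w] that Psi[of u w u] rot[of "I u" u w] by (simp add: Psi p)
  have pair2: "val3 \<phi> u w (I w) = 0" if "g \<nu> u = 0" "g \<nu> w = 0" for u w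
    using pair[OF that(2,1)] rot[of u w "I w"] by simp
  have abc: "val3 \<phi> a b c = 1" using gc cc by simp
  define G where "G = (a ## I a ## b ## I b ## c ## I c ## \<nu> ## (\<lambda>_. 0))"
  have G: "G 0 = a" "G (Suc 0) = I a" "G 2 = b" "G 3 = I b" "G 4 = c" "G 5 = I c" "G 6 = \<nu>"
    by (simp_all add: G_def eval_nat_numeral)
  have om: "val3 \<phi> u v \<nu> = g (I u) v" for u v using gI[of u v] rot[of \<nu> u v] by simp
  have sm: "g b a = 0" "g c a = 0" "g c b = 0" "g b c = 0" "g a c = 0" "g (I b) a = 0" "g (I a) b = 0" "g (I c) a = 0" "g (I a) c = 0"
    "g (I c) b = 0" "g (I b) c = 0" "g a (I b) = 0" "g b (I a) = 0" "g a (I c) = 0" "g c (I a) = 0" "g b (I c) = 0" "g c (I b) = 0"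
    "g a (I a) = 0" "g b (I b) = 0" "g c (I c) = 0" "g a \<nu> = 0" "g b \<nu> = 0" "g c \<nu> = 0" "g (I u) \<nu> = 0" for u
    using a b ab ca cIa cIb c\<nu> In Iu sym skew by (metis minus_zero)+
  have "orthonormal_frame g G"
  proof -
    have "\<forall>i<7. \<forall>j<7. g (G i) (G j) = (if i = j then 1 else 0)"
      unfolding all_less_7 by (simp add: G sm Iso n0 a b cc \<nu> Iu)
    then show ?thesis by (simp add: orthonormal_frame_def)
  qed
  moreover have "g2_frame \<phi> G"
  proof -
    have "\<forall>k<7. \<forall>j<k. \<forall>i<j. val3 \<phi> (G i) (G j) (G k) = g2c i j k"
      unfolding all_less_7
      by (simp add: G g2c_def om sm Iso II n0 a b cc pair pair2 mv mv' sq abc Iabc Iu va(1-3))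
    then show ?thesis using D(5) orthonormal_frame_span[OF D(2) calculation] by (simp add: g2_frame_def)
  qed
  ultimately have "g2_structure \<phi> g \<psi> G" using g2_structure_change_frame[OF s] by blast
  then show ?thesis using G(7) by blast
qed

lemma bilinear_frame_ext:
  fixes e :: "nat \<Rightarrow> 'v::real_vector" and n :: nat and f h :: "'v \<Rightarrow> 'v \<Rightarrow> real"
  assumes f: "\<And>y. linear (\<lambda>x. f x y)" "\<And>x. linear (\<lambda>y. f x y)"
    and h: "\<And>y. linear (\<lambda>x. h x y)" "\<And>x. linear (\<lambda>y. h x y)"
    and sp: "span (e ` {..<n}) = UNIV" and eq: "\<And>i j. i < n \<Longrightarrow> j < n \<Longrightarrow> f (e i) (e j) = h (e i) (e j)"
  shows "f x y = h x y"
proof -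
  have 1: "f (e i) y = h (e i) y" if "i < n" for i y
    by (rule linear_eq_on_span[OF f(2) h(2), of "e ` {..<n}"]) (use eq that sp in auto)
  show ?thesis
    by (rule linear_eq_on_span[OF f(1) h(1), of "e ` {..<n}"]) (use 1 sp in auto)
qed

section \<open>Agreement of the frame data with \<open>G2_metric\<close> and
  \<open>hodge\<close>\<close>

lemma bform_metric:
  assumes s: "g2_structure \<phi> g \<psi> e"
  shows "bform \<phi> u v e = 6 * g u v"
proof -
  note D = g2_structureD[OF s] and ml = metric_linear[OF g2_structureD(2)[OF s]]
  have ge: "g (e i) (e j) = (if i = j then 1 else 0)" if "i < 7" "j < 7" for i j
    using D(3) that by (simp add: orthonormal_frame_def)
  show ?thesis
  proof (rule bilinear_frame_ext[where f = "\<lambda>u v. bform \<phi> u v e" and e = e and n = 7])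
    fix i j :: nat assume ij: "i < 7" "j < 7"
    show "bform \<phi> (e i) (e j) e = 6 * g (e i) (e j)"
    proof (cases i j rule: linorder_cases)
      case less then show ?thesis using bform_frame_values(1)[OF D(1)] ij ge by auto
    next
      case equal then show ?thesis using bform_frame_values(2)[OF D(1)] ij ge by auto
    next
      case greater
      then show ?thesis
        using bform_frame_values(1)[OF D(1)] ij ge by (subst bform_commute[OF D(5), of "e i" "e j"]) auto
    qed
  qed (use bform_linear[OF D(5)] bform_linear_right[OF D(5)] ml g2_frame_span[OF D(1)] in
      \<open>auto simp: linear_iff\<close>)
qed

lemma form_inner_self:
  assumes s: "g2_structure \<phi> g \<psi> e"
  shows "form_inner g 3 \<phi> \<phi> = 7"
proof -
  note D = g2_structureD[OF s]
  show ?thesis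
    by (simp add: form_inner_3[OF D(2,3,5,5)] sum_less_7 g2_table[OF D(1)] val3_alt(1,2,3)[OF D(5)] val3_sort[OF D(5), where e = e])
qed

lemma g2_positive_iff:
  assumes s: "g2_structure \<phi> g \<psi> e" and o: "positively_oriented e"
  obtains d where "d > 0" "\<And>\<eta>. is_form 7 \<eta> \<Longrightarrow> \<eta> e = d * top_coeff \<eta>"
    "\<And>u v. g u v = d / 6 * top_coeff (bform \<phi> u v)"
proof -
  obtain d where d: "\<And>\<eta>. is_form 7 \<eta> \<Longrightarrow> \<eta> e = d * top_coeff \<eta>" "0 < d"
    using top_form_frame[OF index_bij_7, of e] o by auto
  moreover have "g u v = d / 6 * top_coeff (bform \<phi> u v)" for u v
    using bform_metric[OF s, of u v] d(1)[OF is_form_bform[OF g2_structureD(5)[OF s]], of u v] by simp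
  ultimately show ?thesis using that by blast
qed

lemma orthonormal_scale:
  assumes "orthonormal_frame g e" "is_metric g" "r > 0"
  shows "orthonormal_frame (\<lambda>u v. r * g u v) (\<lambda>i. (1 / sqrt r) *\<^sub>R e i)"
  using assms by (auto simp: orthonormal_frame_def linear_scale[OF metric_linear(1)] linear_scale[OF metric_linear(2)]
    simp flip: real_sqrt_mult)

text \<open>A competing metric in the conformal class is \<open>r\<close> times \<open>g\<close>.
  The square norm of a 3-form scales with the inverse third power of \<open>r\<close>, so the
  normalisation to 7 forces \<open>r = 1\<close>.\<close>

lemma G2_metric_eq:
  assumes s: "g2_structure \<phi> g \<psi> e" and o: "positively_oriented e"
  shows "G2_metric \<phi> = g"
  unfolding G2_metric_def
proof (rule the_equality)
  note D = g2_structureD[OF s]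
  obtain d where d: "d > 0" "\<And>u v. g u v = d / 6 * top_coeff (bform \<phi> u v)"
    using g2_positive_iff[OF s o] by metis
  show "is_metric g \<and> (\<exists>c>0. \<forall>u. g u u = c * top_coeff (positive_3form_density \<phi> u)) \<and> form_inner g 3 \<phi> \<phi> = 7"
    using D(2) form_inner_self[OF s] d by (auto simp: positive_3form_density_eq intro!: exI[of _ "d / 6"])
  fix g' assume g': "is_metric g' \<and> (\<exists>c>0. \<forall>u. g' u u = c * top_coeff (positive_3form_density \<phi> u)) \<and> form_inner g' 3 \<phi> \<phi> = 7"
  then obtain c where c: "c > 0" "\<And>u. g' u u = c * top_coeff (bform \<phi> u u)" by (auto simp: positive_3form_density_eq)
  define r where "r = c * 6 / d"
  have r: "r > 0" using c d by (simp add: r_def)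
  have diag: "g' u u = r * g u u" for u unfolding c(2) d(2)[of u u] using d(1) by (simp add: r_def)
  have "is_metric g'" using g' by simp
  note ml = metric_linear[OF D(2)] and ml' = metric_linear[OF \<open>is_metric g'\<close>]
  \<comment> \<open>Polarisation, as the defining condition fixes the diagonal only.\<close>
  have "g' u v = r * g u v" for u v
  proof -
    have "g' (u + v) (u + v) = r * g (u + v) (u + v)" by (rule diag)
    then have "g' u v + g' v u = r * (g u v + g v u)"
      using diag[of u] diag[of v]
      by (simp add: linear_add[OF ml(1)] linear_add[OF ml(2)] linear_add[OF ml'(1)] linear_add[OF ml'(2)] algebra_simps)
    then show ?thesis using metric_sym[OF D(2), of v u] metric_sym[OF \<open>is_metric g'\<close>, of v u] by simp
  qed
  then have g'r: "g' = (\<lambda>u v. r * g u v)" by (intro ext) auto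
  define e' where "e' i = (1 / sqrt r) *\<^sub>R e i" for i
  have e': "orthonormal_frame g' e'" unfolding g'r e'_def[abs_def] by (rule orthonormal_scale[OF D(3,2) r])
  have "form_inner g' 3 \<phi> \<phi> = (1 / sqrt r) ^ 6 * form_inner g 3 \<phi> \<phi>"
  proof -
    define k where "k = 1 / sqrt r"
    have t: "val3 \<phi> (k *\<^sub>R x) (k *\<^sub>R y) (k *\<^sub>R z) = k ^ 3 * val3 \<phi> x y z" for x y z
      by (simp add: linear_scale[OF val3_linear(1)[OF D(5)]] linear_scale[OF val3_linear(2)[OF D(5)]]
        linear_scale[OF val3_linear(3)[OF D(5)]] power3_eq_cube)
    have u: "k ^ 3 * x * (k ^ 3 * y) = k ^ 6 * (x * y)" for x y by algebra
    show ?thesis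
      unfolding form_inner_3[OF \<open>is_metric g'\<close> e' D(5,5)] form_inner_3[OF D(2,3,5,5)] e'_def k_def[symmetric] t u
        sum_distrib_left[symmetric] by simp
  qed
  then have "(1 / sqrt r) ^ 6 = 1" using g' form_inner_self[OF s] by simp
  then have "(1 / sqrt r) ^ 6 = 1 ^ 6" by simp
  then have "1 / sqrt r = 1" using r by (subst (asm) power_eq_iff_eq_base) auto
  then have "r = 1" by simp
  then show "g' = g" using g'r by simp
qed

text \<open>\<open>L\<close> carries the dot product to \<open>g\<close>. Conjugating the change of
  frame \<open>M\<close> by \<open>L\<close> therefore gives an orthogonal transformation of
  coordinate space with the same determinant, which is 1 or -1.\<close>

lemma det_orthonormal_change:
  fixes g :: "real ^ 7 \<Rightarrow> real ^ 7 \<Rightarrow> real"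
  assumes g: "is_metric g" and e: "orthonormal_frame g e" and e': "orthonormal_frame g e'"
    and \<eta>: "is_form 7 \<eta>"
  shows "\<eta> e' = \<eta> e \<or> \<eta> e' = - \<eta> e"
proof -
  note ml = metric_linear[OF g]
  obtain L :: "real ^ 7 \<Rightarrow> real ^ 7" where L: "linear L" "\<And>k. k < 7 \<Longrightarrow> L (std_frame k) = e k"
    using frame_map[OF index_bij_7, of e] by auto
  have ax: "(of_nat (Suc i) :: 7) = of_nat (Suc j) \<longleftrightarrow> i = j" if "i < 7" "j < 7" for i j
    using index_bij_7 that unfolding index_bij_def bij_betw_def inj_on_def by auto
  have gL: "g (L x) (L y) = x \<bullet> y" for x y
  proof (rule bilinear_frame_ext[where e = std_frame and n = 7 and f = "\<lambda>x y. g (L x) (L y)"])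
    show "span (std_frame ` {..<7}) = (UNIV :: (real ^ 7) set)" using span_std_frame[OF index_bij_7] by simp
    show "g (L (std_frame i)) (L (std_frame j)) = std_frame i \<bullet> (std_frame j :: real ^ 7)" if "i < 7" "j < 7" for i j
      unfolding L(2)[OF that(1)] L(2)[OF that(2)]
      using that e ax by (simp add: orthonormal_frame_def std_frame_def inner_axis_axis del: of_nat_Suc)
    show "linear (\<lambda>x. g (L x) (L y))" "linear (\<lambda>y. g (L x) (L y))" for x y
      using linear_compose[OF L(1) ml(2)] linear_compose[OF L(1) ml(1)] by (simp_all add: o_def)
    show "linear (\<lambda>x. x \<bullet> y)" "linear (\<lambda>y. x \<bullet> y)" for x y :: "real ^ 7" by (simp_all add: linear_iff inner_simps)
  qed
  have "L x = 0 \<Longrightarrow> x = 0" for x using gL[of x x] linear_0[OF ml(1)] by simp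
  then have inj: "inj L" by (simp add: linear_injective_0[OF L(1)])
  obtain K where K: "linear K" "L \<circ> K = id"
    using linear_surjective_right_inverse[OF L(1) linear_injective_imp_surjective[OF L(1) inj]] by auto
  have LK: "L (K x) = x" for x using fun_cong[OF K(2), of x] by simp
  define M where "M u = (\<Sum>i<7. g u (e i) *\<^sub>R e' i)" for u
  have M: "linear M" unfolding M_def
    by (intro linear_compose_sum) (auto simp: linear_iff scaleR_left_distrib linear_add[OF ml(2)] linear_scale[OF ml(2)])
  have Me: "M (e j) = e' j" if "j < 7" for j
  proof -
    have "M (e j) = (\<Sum>i<7. if i = j then e' j else 0)"
      unfolding M_def using e that by (intro sum.cong) (auto simp: orthonormal_frame_def)
    then show ?thesis using that by simp
  qed
  have gM: "g (M x) (M y) = g x y" for x y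
  proof (rule bilinear_frame_ext[where e = e and n = 7 and f = "\<lambda>x y. g (M x) (M y)"])
    show "span (e ` {..<7}) = UNIV" using orthonormal_frame_span[OF g e] by simp
    show "g (M (e i)) (M (e j)) = g (e i) (e j)" if "i < 7" "j < 7" for i j
      using that e e' by (simp add: Me orthonormal_frame_def)
    show "linear (\<lambda>x. g (M x) (M y))" "linear (\<lambda>y. g (M x) (M y))" for x y
      using linear_compose[OF M ml(2)] linear_compose[OF M ml(1)] by (simp_all add: o_def)
  qed (rule ml)+
  define A where "A = K \<circ> (M \<circ> L)"
  have A: "linear A" unfolding A_def by (intro linear_compose K L M)
  have "orthogonal_transformation A"
    unfolding orthogonal_transformation_def using A
    by (simp add: A_def gL[symmetric] LK gM)
  then have detA: "det (matrix A) = 1 \<or> det (matrix A) = - 1"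
    using det_orthogonal_matrix by (auto simp: orthogonal_transformation_matrix)
  have "L \<circ> A = M \<circ> L" by (auto simp: A_def LK fun_eq_iff)
  then have "matrix L ** matrix A = matrix M ** matrix L"
    using matrix_compose[OF A L(1)] matrix_compose[OF L(1) M] by simp
  then have "det (matrix L) * det (matrix A) = det (matrix M) * det (matrix L)"
    by (metis det_mul)
  moreover have "det (matrix L) \<noteq> 0" using det_nz_iff_inj[OF L(1)] inj by simp
  ultimately have "det (matrix M) = det (matrix A)" by simp
  moreover have "\<eta> e' = det (matrix M) * \<eta> e"
  proof -
    have "\<eta> e' = \<eta> (\<lambda>i. M (e i))" by (rule form_cong[OF \<eta>]) (simp add: Me)
    also have "\<dots> = det (matrix M) * \<eta> e" by (rule top_form_det[OF index_bij_7 _ M]) (use \<eta> in simp)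
    finally show ?thesis .
  qed
  ultimately show ?thesis using detA by auto
qed

text \<open>Orientation settles the sign left open by \<open>det_orthonormal_change\<close>, so
  \<eta> is 1 on every oriented orthonormal frame.\<close>

lemma volume_form_eq:
  fixes g :: "real ^ 7 \<Rightarrow> real ^ 7 \<Rightarrow> real"
  assumes g: "is_metric g" and e: "orthonormal_frame g e" and o: "positively_oriented e"
    and \<eta>: "is_form 7 \<eta>" "\<eta> e = 1"
  shows "volume_form g = \<eta>"
  unfolding volume_form_def
proof (rule the_equality)
  obtain d where d: "\<eta> e = d * top_coeff \<eta>" "0 < d"
    using top_form_frame[OF index_bij_7, of e] o \<eta> by auto
  have "0 < d * top_coeff \<eta>" using d(1)[symmetric] \<eta>(2) by linarith
  then have tp: "0 < top_coeff \<eta>" using d(2) zero_less_mult_pos by blast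
  have "\<eta> e' = 1" if e': "orthonormal_frame g e'" "positively_oriented e'" for e'
  proof -
    obtain d' where "\<eta> e' = d' * top_coeff \<eta>" "0 < d'"
      using top_form_frame[OF index_bij_7, of e'] e'(2) \<eta> by auto
    then have "0 < \<eta> e'" using tp by simp
    then show ?thesis using det_orthonormal_change[OF g e e'(1) \<eta>(1)] \<eta>(2) by auto
  qed
  then show "is_form CARD(7) \<eta> \<and> (\<forall>e. orthonormal_frame g e \<and> positively_oriented e \<longrightarrow> \<eta> e = 1)"
    using \<eta>(1) by simp
  show "\<eta>' = \<eta>" if "is_form CARD(7) \<eta>' \<and> (\<forall>e. orthonormal_frame g e \<and> positively_oriented e \<longrightarrow> \<eta>' e = 1)" for \<eta>'
    using that e o \<eta> orthonormal_frame_span[OF g e] by (intro top_form_ext[of 7 \<eta>' \<eta> e]) auto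
qed

lemma coordinate_3form:
  fixes g :: "real ^ 7 \<Rightarrow> real ^ 7 \<Rightarrow> real"
  assumes g: "is_metric g" and e: "orthonormal_frame g e" and abc: "a < b" "b < c" "c < (7::nat)"
  shows "\<exists>\<gamma>. is_form 3 \<gamma> \<and> (\<forall>i j k. i < j \<and> j < k \<and> k < 7 \<longrightarrow>
    val3 \<gamma> (e i) (e j) (e k) = (if i = a \<and> j = b \<and> k = c then 1 else 0))"
proof -
  define \<theta> where "\<theta> i v = g (e i) (v (0::nat))" for i v
  have \<theta>: "is_form (Suc 0) (\<theta> i)" for i
    unfolding \<theta>_def using is_form_1[OF metric_linear(1)[OF g]] by simp
  have w: "is_form (Suc (Suc 0)) (wedge (Suc 0) (Suc 0) (\<theta> i) (\<theta> j))" for i j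
    using is_form_wedge[OF \<theta> \<theta>] by simp
  define \<gamma> where "\<gamma> = wedge (Suc 0) (Suc (Suc 0)) (\<theta> a) (wedge (Suc 0) (Suc 0) (\<theta> b) (\<theta> c))"
  have f: "is_form 3 \<gamma>" unfolding \<gamma>_def using is_form_wedge[OF \<theta> w] by (simp add: numeral_3_eq_3)
  have ge: "g (e i) (e j) = (if i = j then 1 else 0)" if "i < 7" "j < 7" for i j
    using e that by (simp add: orthonormal_frame_def)
  have v: "val3 \<gamma> x y z = g (e a) x * (g (e b) y * g (e c) z - g (e b) z * g (e c) y)
      - g (e a) y * (g (e b) x * g (e c) z - g (e b) z * g (e c) x) + g (e a) z * (g (e b) x * g (e c) y - g (e b) y * g (e c) x)" for x y z
    unfolding val3_def \<gamma>_def
    by (simp add: wedge_vcons \<theta> w wedge_0_left wedge_0_right is_form_interior interior_prod_apply \<theta>_def[symmetric])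
      (simp add: \<theta>_def algebra_simps)
  have "val3 \<gamma> (e i) (e j) (e k) = (if i = a \<and> j = b \<and> k = c then 1 else 0)" if "i < j" "j < k" "k < 7" for i j k
    using that abc by (auto simp: v ge)
  then show ?thesis using f by blast
qed

text \<open>The defining equation is checked on the frame. For uniqueness, the difference of two
  candidates has zero wedge product with every 3-form, and the product with a coordinate 3-form
  isolates, up to sign, its component on the four complementary indices.\<close>

lemma hodge_eq:
  assumes s: "g2_structure \<phi> g \<psi> e" and o: "positively_oriented e"
  shows "hodge g 3 \<phi> = \<psi>"
  unfolding hodge_def
proof (rule the_equality)
  note D = g2_structureD[OF s]
  define \<eta> where "\<eta> v = bform \<phi> (e 0) (e 0) v / 6" for v
  have \<eta>: "is_form 7 \<eta>" "\<eta> e = 1"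
    unfolding \<eta>_def using is_form_divide[OF is_form_bform[OF D(5)]] bform_frame_values(2)[OF D(1)] by auto
  have vol: "volume_form g = \<eta>" by (rule volume_form_eq[OF D(2,3) o \<eta>])
  note pt = dual_form_values[OF D(1), folded D(4), unfolded all_less_7 g2d_def, simplified]
  have eval: "wedge 3 4 \<gamma> \<psi>' e = wedge 3 4 \<gamma> \<psi>' (e 0 ## e 1 ## e 2 ## e 3 ## e 4 ## e 5 ## e 6 ## (\<lambda>_. 0))"
    if "is_form 3 \<gamma>" "is_form 4 \<psi>'" for \<gamma> \<psi>'
    using seq7[of "wedge 3 4 \<gamma> \<psi>'" e] is_form_wedge[OF that] by simp
  have "wedge 3 4 \<gamma> \<psi> = (\<lambda>v. form_inner g 3 \<gamma> \<phi> * \<eta> v)" if \<gamma>: "is_form 3 \<gamma>" for \<gamma>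
  proof (rule top_form_ext[OF _ is_form_scale[OF \<eta>(1)] g2_frame_span[OF D(1)]])
    show "is_form 7 (wedge 3 4 \<gamma> \<psi>)" using is_form_wedge[OF \<gamma> D(6)] by simp
    show "wedge 3 4 \<gamma> \<psi> e = form_inner g 3 \<gamma> \<phi> * \<eta> e"
      unfolding eval[OF \<gamma> D(6)] wedge_3_4_eval[OF \<gamma> D(6)] form_inner_3[OF D(2,3) \<gamma> D(5)] \<eta>(2)
      by (simp add: pt sum_less_7 g2_table[OF D(1)] val3_alt(1,2,3)[OF D(5)] val3_sort[OF D(5), where e = e] val3_sort[OF \<gamma>, where e = e])
  qed
  then show "is_form (CARD(7) - 3) \<psi> \<and> (\<forall>\<gamma>. is_form 3 \<gamma> \<longrightarrow>
    wedge 3 (CARD(7) - 3) \<gamma> \<psi> = (\<lambda>v. form_inner g 3 \<gamma> \<phi> * volume_form g v))"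
    using D(6) by (simp add: vol)
  fix \<psi>' assume "is_form (CARD(7) - 3) \<psi>' \<and> (\<forall>\<gamma>. is_form 3 \<gamma> \<longrightarrow>
    wedge 3 (CARD(7) - 3) \<gamma> \<psi>' = (\<lambda>v. form_inner g 3 \<gamma> \<phi> * volume_form g v))"
  then have p: "is_form 4 \<psi>'" "\<And>\<gamma>. is_form 3 \<gamma> \<Longrightarrow> wedge 3 4 \<gamma> \<psi>' e = form_inner g 3 \<gamma> \<phi>"
    using \<eta>(2) by (simp_all add: vol)
  have q: "wedge 3 4 \<gamma> \<psi> e = form_inner g 3 \<gamma> \<phi>" if "is_form 3 \<gamma>" for \<gamma>
    using \<open>\<And>\<gamma>. is_form 3 \<gamma> \<Longrightarrow> wedge 3 4 \<gamma> \<psi> = _\<close>[OF that] \<eta>(2) by simp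
  define \<delta> where "\<delta> = (\<lambda>v. \<psi>' v - \<psi> v)"
  have \<delta>: "is_form 4 \<delta>" unfolding \<delta>_def by (rule is_form_diff[OF p(1) D(6)])
  have vd: "val4 \<delta> x y z w = val4 \<psi>' x y z w - val4 \<psi> x y z w" for x y z w by (simp add: val4_def \<delta>_def)
  have H: "wedge 3 4 \<gamma> \<delta> e = 0" if \<gamma>: "is_form 3 \<gamma>" for \<gamma>
    using p(2)[OF \<gamma>] q[OF \<gamma>] unfolding eval[OF \<gamma> p(1)] eval[OF \<gamma> D(6)] eval[OF \<gamma> \<delta>] wedge_3_4_eval[OF \<gamma> p(1)]
      wedge_3_4_eval[OF \<gamma> D(6)] wedge_3_4_eval[OF \<gamma> \<delta>] vd by (simp add: algebra_simps)
  have "\<exists>\<gamma>. a < b \<longrightarrow> b < c \<longrightarrow> c < 7 \<longrightarrow> is_form 3 \<gamma> \<and> (\<forall>i j k. i < j \<and> j < k \<and> k < 7 \<longrightarrow>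
    val3 \<gamma> (e i) (e j) (e k) = (if i = a \<and> j = b \<and> k = c then 1 else 0))" for a b c
    using coordinate_3form[OF D(2,3), of a b c] by blast
  then obtain \<Gamma> where \<Gamma>: "\<And>a b c. a < b \<longrightarrow> b < c \<longrightarrow> c < 7 \<longrightarrow> is_form 3 (\<Gamma> a b c) \<and> (\<forall>i j k. i < j \<and> j < k \<and> k < 7 \<longrightarrow>
    val3 (\<Gamma> a b c) (e i) (e j) (e k) = (if i = a \<and> j = b \<and> k = c then 1 else 0))"
    by metis
  then have \<Gamma>f: "is_form 3 (\<Gamma> a b c)" and \<Gamma>v: "i < j \<Longrightarrow> j < k \<Longrightarrow> k < 7 \<Longrightarrow>
    val3 (\<Gamma> a b c) (e i) (e j) (e k) = (if i = a \<and> j = b \<and> k = c then 1 else 0)"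
    if "a < b" "b < c" "c < 7" for a b c i j k
    using that by blast+
  have "\<forall>c<7. \<forall>b<c. \<forall>a<b. wedge 3 4 (\<Gamma> a b c) \<delta> (e 0 ## e 1 ## e 2 ## e 3 ## e 4 ## e 5 ## e 6 ## (\<lambda>_. 0)) = 0"
  proof (intro allI impI)
    fix a b c :: nat assume "c < 7" "b < c" "a < b"
    then have "is_form 3 (\<Gamma> a b c)" using \<Gamma>f by blast
    from H[OF this] eval[OF this \<delta>]
    show "wedge 3 4 (\<Gamma> a b c) \<delta> (e 0 ## e 1 ## e 2 ## e 3 ## e 4 ## e 5 ## e 6 ## (\<lambda>_. 0)) = 0" by (simp only:)
  qed
  then have z: "\<delta> = (\<lambda>_. 0)"
    unfolding all_less_7
    by (intro form4_ext[OF \<delta> is_form_zero g2_frame_span[OF D(1)]])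
      (simp add: all_less_7 wedge_3_4_eval[OF \<Gamma>f \<delta>] \<Gamma>v val4_def[of "\<lambda>_. 0"])
  show "\<psi>' = \<psi>"
  proof
    fix v show "\<psi>' v = \<psi> v" using fun_cong[OF z, of v] by (simp add: \<delta>_def)
  qed
qed

text \<open>The normal form knows nothing of orientation. Evaluating \<open>bform\<close> on one
  nonzero vector compares the metric with the density; both are positive there, hence so is the
  factor \<open>d\<close>.\<close>

lemma positive_3form_g2_structure:
  assumes "positive_3form \<phi>"
  shows "\<exists>e. g2_structure \<phi> (G2_metric \<phi>) (hodge (G2_metric \<phi>) 3 \<phi>) e \<and> positively_oriented e"
proof -
  obtain e where e: "g2_frame \<phi> e" using positive_normal_form[OF assms] by blast
  obtain g where g: "is_metric g" "orthonormal_frame g e" using frame_metric_exists[OF g2_frame_span[OF e]] by blast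
  then have s: "g2_structure \<phi> g (dual_form \<phi> e) e" using e by (simp add: g2_structure_def)
  obtain d where d: "\<And>\<eta>. is_form 7 \<eta> \<Longrightarrow> \<eta> e = d * top_coeff \<eta>" "0 < d \<longleftrightarrow> positively_oriented e"
    using top_form_frame[OF index_bij_7, of e] by auto
  have "std_frame 0 \<noteq> (0 :: real ^ 7)" by (simp add: std_frame_def axis_eq_0_iff)
  then have "0 < top_coeff (bform \<phi> (std_frame 0) (std_frame 0))" "0 < g (std_frame 0) (std_frame 0)"
    using assms metric_pos[OF g(1)] by (simp_all add: positive_3form_def positive_3form_density_eq)
  moreover have "6 * g (std_frame 0) (std_frame 0) = d * top_coeff (bform \<phi> (std_frame 0) (std_frame 0))"
    using bform_metric[OF s] d(1)[OF is_form_bform[OF g2_structureD(5)[OF s]]] by metis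
  ultimately have "0 < d * top_coeff (bform \<phi> (std_frame 0) (std_frame 0))" by linarith
  then have "0 < d" using \<open>0 < top_coeff _\<close> zero_less_mult_pos2 by blast
  then have o: "positively_oriented e" using d(2) by simp
  then show ?thesis using s G2_metric_eq[OF s o] hodge_eq[OF s o] by auto
qed

section \<open>Intrinsic torsion\<close>

text \<open>
  A 3-form that together with the structure form satisfies the linearised product identity lies in
  the image of the contraction map of the 4-form; the relations below say this in components.
\<close>

lemma linearised_relations:
  assumes f: "g2_frame \<phi> e" and \<kappa>: "is_form 3 \<kappa>"
    and rel: "\<And>i j l. i < 7 \<Longrightarrow> j < 7 \<Longrightarrow> l < 7 \<Longrightarrow> (\<Sum>p<7. val3 \<kappa> (e i) (e j) (e p) * val3 \<phi> (e p) (e j) (e l)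
      + val3 \<phi> (e i) (e j) (e p) * val3 \<kappa> (e p) (e j) (e l)) = 0"
  shows
    "val3 \<kappa> (e 0) (e 1) (e 6) = 0"
    "val3 \<kappa> (e 0) (e 2) (e 4) = 0"
    "val3 \<kappa> (e 0) (e 3) (e 5) = 0"
    "val3 \<kappa> (e 1) (e 2) (e 5) = 0"
    "val3 \<kappa> (e 1) (e 3) (e 4) = 0"
    "val3 \<kappa> (e 2) (e 3) (e 6) = 0"
    "val3 \<kappa> (e 4) (e 5) (e 6) = 0"
    "val3 \<kappa> (e 2) (e 5) (e 6) = val3 \<kappa> (e 1) (e 2) (e 3)"
    "val3 \<kappa> (e 3) (e 4) (e 6) = val3 \<kappa> (e 1) (e 2) (e 3)"
    "val3 \<kappa> (e 1) (e 4) (e 5) = val3 \<kappa> (e 1) (e 2) (e 3)"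
    "val3 \<kappa> (e 2) (e 4) (e 6) = - val3 \<kappa> (e 0) (e 2) (e 3)"
    "val3 \<kappa> (e 3) (e 5) (e 6) = val3 \<kappa> (e 0) (e 2) (e 3)"
    "val3 \<kappa> (e 0) (e 4) (e 5) = val3 \<kappa> (e 0) (e 2) (e 3)"
    "val3 \<kappa> (e 1) (e 4) (e 6) = - val3 \<kappa> (e 0) (e 1) (e 3)"
    "val3 \<kappa> (e 3) (e 4) (e 5) = val3 \<kappa> (e 0) (e 1) (e 3)"
    "val3 \<kappa> (e 0) (e 5) (e 6) = - val3 \<kappa> (e 0) (e 1) (e 3)"
    "val3 \<kappa> (e 1) (e 5) (e 6) = - val3 \<kappa> (e 0) (e 1) (e 2)"
    "val3 \<kappa> (e 2) (e 4) (e 5) = val3 \<kappa> (e 0) (e 1) (e 2)"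
    "val3 \<kappa> (e 0) (e 4) (e 6) = val3 \<kappa> (e 0) (e 1) (e 2)"
    "val3 \<kappa> (e 1) (e 2) (e 6) = val3 \<kappa> (e 0) (e 1) (e 5)"
    "val3 \<kappa> (e 0) (e 3) (e 6) = val3 \<kappa> (e 0) (e 1) (e 5)"
    "val3 \<kappa> (e 2) (e 3) (e 5) = val3 \<kappa> (e 0) (e 1) (e 5)"
    "val3 \<kappa> (e 1) (e 3) (e 6) = val3 \<kappa> (e 0) (e 1) (e 4)"
    "val3 \<kappa> (e 0) (e 2) (e 6) = - val3 \<kappa> (e 0) (e 1) (e 4)"
    "val3 \<kappa> (e 2) (e 3) (e 4) = val3 \<kappa> (e 0) (e 1) (e 4)"
    "val3 \<kappa> (e 1) (e 2) (e 4) = val3 \<kappa> (e 0) (e 2) (e 5)"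
    "val3 \<kappa> (e 0) (e 3) (e 4) = val3 \<kappa> (e 0) (e 2) (e 5)"
    "val3 \<kappa> (e 1) (e 3) (e 5) = - val3 \<kappa> (e 0) (e 2) (e 5)"
proof -
  note \<phi> = g2_frame_form[OF f]
  have s: "i < 7 \<Longrightarrow> j < 7 \<Longrightarrow> l < 7 \<Longrightarrow> val3 \<kappa> (e i) (e j) (e 0) * val3 \<phi> (e 0) (e j) (e l)
      + val3 \<phi> (e i) (e j) (e 0) * val3 \<kappa> (e 0) (e j) (e l) + (val3 \<kappa> (e i) (e j) (e 1) * val3 \<phi> (e 1) (e j) (e l)
      + val3 \<phi> (e i) (e j) (e 1) * val3 \<kappa> (e 1) (e j) (e l)) + (val3 \<kappa> (e i) (e j) (e 2) * val3 \<phi> (e 2) (e j) (e l)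
      + val3 \<phi> (e i) (e j) (e 2) * val3 \<kappa> (e 2) (e j) (e l)) + (val3 \<kappa> (e i) (e j) (e 3) * val3 \<phi> (e 3) (e j) (e l)
      + val3 \<phi> (e i) (e j) (e 3) * val3 \<kappa> (e 3) (e j) (e l)) + (val3 \<kappa> (e i) (e j) (e 4) * val3 \<phi> (e 4) (e j) (e l)
      + val3 \<phi> (e i) (e j) (e 4) * val3 \<kappa> (e 4) (e j) (e l)) + (val3 \<kappa> (e i) (e j) (e 5) * val3 \<phi> (e 5) (e j) (e l)
      + val3 \<phi> (e i) (e j) (e 5) * val3 \<kappa> (e 5) (e j) (e l)) + (val3 \<kappa> (e i) (e j) (e 6) * val3 \<phi> (e 6) (e j) (e l)
      + val3 \<phi> (e i) (e j) (e 6) * val3 \<kappa> (e 6) (e j) (e l)) = 0" for i j l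
    using rel[of i j l] unfolding sum_less_7 by simp
  note r = g2_table[OF f] val3_alt(1-3)[OF \<phi>] val3_alt(1-3)[OF \<kappa>] val3_sort[OF \<phi>, where e = e] val3_sort[OF \<kappa>, where e = e]
  show "val3 \<kappa> (e 0) (e 1) (e 6) = 0"
    using s[of 0 1 0] by (simp add: r)
  show "val3 \<kappa> (e 0) (e 2) (e 4) = 0"
    using s[of 0 2 0] by (simp add: r)
  show "val3 \<kappa> (e 0) (e 3) (e 5) = 0"
    using s[of 0 3 0] by (simp add: r)
  show "val3 \<kappa> (e 1) (e 2) (e 5) = 0"
    using s[of 1 2 1] by (simp add: r)
  show "val3 \<kappa> (e 1) (e 3) (e 4) = 0"
    using s[of 1 3 1] by (simp add: r)
  show "val3 \<kappa> (e 2) (e 3) (e 6) = 0"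
    using s[of 2 3 2] by (simp add: r)
  show "val3 \<kappa> (e 4) (e 5) (e 6) = 0"
    using s[of 4 5 4] by (simp add: r)
  show "val3 \<kappa> (e 2) (e 5) (e 6) = val3 \<kappa> (e 1) (e 2) (e 3)" "val3 \<kappa> (e 3) (e 4) (e 6) = val3 \<kappa> (e 1) (e 2) (e 3)" "val3 \<kappa> (e 1) (e 4) (e 5) = val3 \<kappa> (e 1) (e 2) (e 3)"
    using s[of 1 2 6] s[of 1 3 6] s[of 1 4 6] by (simp_all add: r)
  show "val3 \<kappa> (e 2) (e 4) (e 6) = - val3 \<kappa> (e 0) (e 2) (e 3)" "val3 \<kappa> (e 3) (e 5) (e 6) = val3 \<kappa> (e 0) (e 2) (e 3)" "val3 \<kappa> (e 0) (e 4) (e 5) = val3 \<kappa> (e 0) (e 2) (e 3)"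
    using s[of 0 2 6] s[of 0 3 6] s[of 0 4 6] by (simp_all add: r)
  show "val3 \<kappa> (e 1) (e 4) (e 6) = - val3 \<kappa> (e 0) (e 1) (e 3)" "val3 \<kappa> (e 3) (e 4) (e 5) = val3 \<kappa> (e 0) (e 1) (e 3)" "val3 \<kappa> (e 0) (e 5) (e 6) = - val3 \<kappa> (e 0) (e 1) (e 3)"
    using s[of 0 1 4] s[of 0 3 4] s[of 0 5 4] by (simp_all add: r)
  show "val3 \<kappa> (e 1) (e 5) (e 6) = - val3 \<kappa> (e 0) (e 1) (e 2)" "val3 \<kappa> (e 2) (e 4) (e 5) = val3 \<kappa> (e 0) (e 1) (e 2)" "val3 \<kappa> (e 0) (e 4) (e 6) = val3 \<kappa> (e 0) (e 1) (e 2)"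
    using s[of 0 1 5] s[of 0 2 5] s[of 0 4 5] by (simp_all add: r)
  show "val3 \<kappa> (e 1) (e 2) (e 6) = val3 \<kappa> (e 0) (e 1) (e 5)" "val3 \<kappa> (e 0) (e 3) (e 6) = val3 \<kappa> (e 0) (e 1) (e 5)" "val3 \<kappa> (e 2) (e 3) (e 5) = val3 \<kappa> (e 0) (e 1) (e 5)"
    using s[of 0 1 2] s[of 0 3 2] s[of 0 5 2] by (simp_all add: r)
  show "val3 \<kappa> (e 1) (e 3) (e 6) = val3 \<kappa> (e 0) (e 1) (e 4)" "val3 \<kappa> (e 0) (e 2) (e 6) = - val3 \<kappa> (e 0) (e 1) (e 4)" "val3 \<kappa> (e 2) (e 3) (e 4) = val3 \<kappa> (e 0) (e 1) (e 4)"
    using s[of 0 1 3] s[of 0 2 3] s[of 0 4 3] by (simp_all add: r)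
  show "val3 \<kappa> (e 1) (e 2) (e 4) = val3 \<kappa> (e 0) (e 2) (e 5)" "val3 \<kappa> (e 0) (e 3) (e 4) = val3 \<kappa> (e 0) (e 2) (e 5)" "val3 \<kappa> (e 1) (e 3) (e 5) = - val3 \<kappa> (e 0) (e 2) (e 5)"
    using s[of 0 2 1] s[of 0 4 1] s[of 0 3 1] by (simp_all add: r)
qed

text \<open>\<kappa> s and \<tau> s stand for the covariant derivatives of \<phi> and \<psi> in
  direction \<open>e s\<close>. The 28 linear relations leave seven free components of each \<kappa>
  s; on \<open>e 0\<close>, ..., \<open>e 5\<close> the form \<tau> 6 depends on only six of those
  of \<kappa> 6, which \<open>k0\<close> to \<open>k5\<close> show to vanish.\<close>

lemma closed_implies_parallel_normal:
  assumes f: "g2_frame \<phi> e" and \<kappa>: "\<And>s. is_form 3 (\<kappa> s)" and \<tau>: "\<And>s. is_form 4 (\<tau> s)"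
    and rel: "\<And>s i j k l. s < 7 \<Longrightarrow> i < 7 \<Longrightarrow> j < 7 \<Longrightarrow> k < 7 \<Longrightarrow> l < 7 \<Longrightarrow> val4 (\<tau> s) (e i) (e j) (e k) (e l) =
      (\<Sum>p<7. val3 (\<kappa> s) (e i) (e j) (e p) * val3 \<phi> (e p) (e k) (e l) + val3 \<phi> (e i) (e j) (e p) * val3 (\<kappa> s) (e p) (e k) (e l))"
    and c3: "\<And>a b c d. a < b \<Longrightarrow> b < c \<Longrightarrow> c < d \<Longrightarrow> d < 7 \<Longrightarrow> val3 (\<kappa> a) (e b) (e c) (e d) - val3 (\<kappa> b) (e a) (e c) (e d)
      + val3 (\<kappa> c) (e a) (e b) (e d) - val3 (\<kappa> d) (e a) (e b) (e c) = 0"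
    and c4: "\<And>a b c d h. a < b \<Longrightarrow> b < c \<Longrightarrow> c < d \<Longrightarrow> d < h \<Longrightarrow> h < 7 \<Longrightarrow> val4 (\<tau> a) (e b) (e c) (e d) (e h) - val4 (\<tau> b) (e a) (e c) (e d) (e h)
      + val4 (\<tau> c) (e a) (e b) (e d) (e h) - val4 (\<tau> d) (e a) (e b) (e c) (e h) + val4 (\<tau> h) (e a) (e b) (e c) (e d) = 0"
  shows "\<forall>l<6. \<forall>k<l. \<forall>j<k. \<forall>i<j. val4 (\<tau> 6) (e i) (e j) (e k) (e l) = 0"
proof -
  note \<phi> = g2_frame_form[OF f]
  \<comment> \<open>A repeated middle argument makes \<tau> zero; this turns the product rule into
    the hypothesis of \<open>linearised_relations\<close>.\<close>
  have rs: "(\<Sum>p<7. val3 (\<kappa> s) (e i) (e j) (e p) * val3 \<phi> (e p) (e j) (e l)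
      + val3 \<phi> (e i) (e j) (e p) * val3 (\<kappa> s) (e p) (e j) (e l)) = 0"
    if "s < 7" "i < 7" "j < 7" "l < 7" for s i j l
    using rel[OF that(1-3,3,4)] val4_alt(2)[OF \<tau>] by simp
  note lr = linearised_relations[OF f \<kappa> rs]
  note r = g2_table[OF f] val3_alt(1-3)[OF \<phi>] val3_alt(1-3)[OF \<kappa>] val3_sort[OF \<phi>, where e = e] val3_sort[OF \<kappa>, where e = e]
    lr lr[unfolded One_nat_def]
  note rel' = rel[unfolded sum_less_7]
  \<comment> \<open>Reduced to free components, the listed cases of the two closedness conditions
    form a linear system that forces this component to be zero; the others are treated
    alike.\<close>
  have k0: "val3 (\<kappa> 6) (e 1) (e 2) (e 3) = 0"
    using c3[of 0 1 2 4] c3[of 0 1 3 5] c3[of 1 2 3 6] c3[of 1 4 5 6]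
      c4[of 0 1 2 5 6] c4[of 0 1 3 4 6]
    by (simp add: r rel'; linarith)
  have k1: "val3 (\<kappa> 6) (e 0) (e 2) (e 3) = 0"
    using c3[of 0 1 2 5] c3[of 0 1 3 4] c3[of 0 2 3 6] c3[of 0 4 5 6]
      c4[of 0 1 2 4 6] c4[of 0 1 3 5 6]
    by (simp add: r rel'; linarith)
  have k2: "val3 (\<kappa> 6) (e 0) (e 1) (e 3) = 0"
    using c3[of 0 1 3 6] c3[of 0 2 3 4] c3[of 1 2 3 5] c3[of 3 4 5 6]
      c4[of 0 2 3 5 6] c4[of 1 2 3 4 6]
    by (simp add: r rel'; linarith)
  have k3: "val3 (\<kappa> 6) (e 0) (e 1) (e 2) = 0"
    using c3[of 0 1 2 6] c3[of 0 2 3 5] c3[of 1 2 3 4] c3[of 2 4 5 6]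
      c4[of 0 2 3 4 6] c4[of 1 2 3 5 6]
    by (simp add: r rel'; linarith)
  have k4: "val3 (\<kappa> 6) (e 0) (e 1) (e 5) = 0"
    using c3[of 0 1 5 6] c3[of 0 2 4 5] c3[of 1 3 4 5] c3[of 2 3 5 6]
      c4[of 0 3 4 5 6] c4[of 1 2 4 5 6]
    by (simp add: r rel'; linarith)
  have k5: "val3 (\<kappa> 6) (e 0) (e 1) (e 4) = 0"
    using c3[of 0 1 4 6] c3[of 0 3 4 5] c3[of 1 2 4 5] c3[of 2 3 4 6]
      c4[of 0 2 4 5 6] c4[of 1 3 4 5 6]
    by (simp add: r rel'; linarith)
  show ?thesis
    unfolding all_less_7
    by (simp add: r rel' k0 k1 k2 k3 k4 k5 k0[unfolded One_nat_def] k2[unfolded One_nat_def] k3[unfolded One_nat_def]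
        k4[unfolded One_nat_def] k5[unfolded One_nat_def])
qed

section \<open>Differentiability of forms and metrics\<close>

text \<open>Neighbourhoods in \<open>nhds x\<close> include \<open>x\<close> itself, so the values
  at the point agree too. Local expressions are known only on chart images, hence the passage to
  germs throughout.\<close>

lemma has_derivative_cong_ev:
  assumes "\<forall>\<^sub>F y in nhds x. f y = g y"
  shows "(f has_derivative D) (at x) \<longleftrightarrow> (g has_derivative D) (at x)"
proof -
  have e: "\<forall>\<^sub>F y in at x. f y = g y" and x: "f x = g x"
    using assms eventually_nhds_x_imp_x by (auto simp: eventually_at_filter elim: eventually_mono)
  have e': "\<forall>\<^sub>F y in at x. g y = f y" using e by (rule eventually_mono) simp
  show ?thesis
    using has_derivative_transform_eventually[OF _ e x] has_derivative_transform_eventually[OF _ e' x[symmetric]] by blast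
qed

lemma frechet_derivative_cong_ev:
  assumes "\<forall>\<^sub>F y in nhds x. f y = g y"
  shows "frechet_derivative f (at x) = frechet_derivative g (at x)"
  unfolding frechet_derivative_def has_derivative_cong_ev[OF assms] ..

lemma differentiable_cong_ev:
  assumes "\<forall>\<^sub>F y in nhds x. f y = g y"
  shows "f differentiable (at x) \<longleftrightarrow> g differentiable (at x)"
  unfolding differentiable_def has_derivative_cong_ev[OF assms] ..

lemma frechet_derivativeI: "(f has_derivative D) (at x) \<Longrightarrow> frechet_derivative f (at x) = D"
  by (rule frechet_derivative_at[symmetric])

lemma differentiableD: "f differentiable (at x) \<Longrightarrow> (f has_derivative frechet_derivative f (at x)) (at x)"
  by (simp add: frechet_derivative_works)

lemma linear_derivative_parameter:
  fixes Q :: "'a::real_normed_vector \<Rightarrow> 'b::real_vector \<Rightarrow> real"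
  assumes ev: "\<forall>\<^sub>F y in nhds y0. linear (Q y)"
    and d: "\<And>a. (\<lambda>y. Q y a) differentiable (at y0)"
  shows "linear (\<lambda>a. frechet_derivative (\<lambda>y. Q y a) (at y0) v)"
proof (rule linearI)
  fix a b
  have "((\<lambda>y. Q y a + Q y b) has_derivative (\<lambda>v. frechet_derivative (\<lambda>y. Q y a) (at y0) v + frechet_derivative (\<lambda>y. Q y b) (at y0) v)) (at y0)"
    by (intro has_derivative_add differentiableD d)
  then have "frechet_derivative (\<lambda>y. Q y a + Q y b) (at y0) v = frechet_derivative (\<lambda>y. Q y a) (at y0) v + frechet_derivative (\<lambda>y. Q y b) (at y0) v"
    by (simp add: frechet_derivativeI)
  moreover have "\<forall>\<^sub>F y in nhds y0. Q y (a + b) = Q y a + Q y b"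
    using ev by (rule eventually_mono) (rule linear_add)
  ultimately show "frechet_derivative (\<lambda>y. Q y (a + b)) (at y0) v = frechet_derivative (\<lambda>y. Q y a) (at y0) v + frechet_derivative (\<lambda>y. Q y b) (at y0) v"
    by (simp add: frechet_derivative_cong_ev)
next
  fix a and c :: real
  have "((\<lambda>y. c * Q y a) has_derivative (\<lambda>v. c * frechet_derivative (\<lambda>y. Q y a) (at y0) v)) (at y0)"
    by (intro has_derivative_mult_right differentiableD d)
  then have "frechet_derivative (\<lambda>y. c * Q y a) (at y0) v = c * frechet_derivative (\<lambda>y. Q y a) (at y0) v"
    by (simp add: frechet_derivativeI)
  moreover have "\<forall>\<^sub>F y in nhds y0. Q y (c *\<^sub>R a) = c * Q y a"
    using ev by (rule eventually_mono) (simp add: linear_scale)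
  ultimately show "frechet_derivative (\<lambda>y. Q y (c *\<^sub>R a)) (at y0) v = c *\<^sub>R frechet_derivative (\<lambda>y. Q y a) (at y0) v"
    by (simp add: frechet_derivative_cong_ev)
qed

text \<open>Product rule for one moving argument: a basis expansion leaves products of scalar
  functions. Several moving arguments are handled by iteration, the slots already treated being
  absorbed in \<open>Q\<close>.\<close>

lemma has_derivative_slot:
  fixes Q :: "'a::real_normed_vector \<Rightarrow> 'b::euclidean_space \<Rightarrow> real"
  assumes ev: "\<forall>\<^sub>F y in nhds y0. linear (Q y)"
    and d: "\<And>a. ((\<lambda>y. Q y a) has_derivative (\<lambda>v. Q' v a)) (at y0)"
    and Y: "(Y has_derivative Y') (at y0)"
  shows "((\<lambda>y. Q y (Y y)) has_derivative (\<lambda>v. Q' v (Y y0) + Q y0 (Y' v))) (at y0)"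
proof -
  have Q': "Q' v a = frechet_derivative (\<lambda>y. Q y a) (at y0) v" for v a
    using frechet_derivativeI[OF d] by simp
  have lin': "linear (Q' v)" for v
  proof -
    have "(\<lambda>y. Q y a) differentiable (at y0)" for a using d by (auto simp: differentiable_def)
    then show ?thesis
      using linear_derivative_parameter[OF ev, of v] by (simp add: Q'[abs_def] eta_contract_eq)
  qed
  have lin0: "linear (Q y0)" using ev eventually_nhds_x_imp_x by blast
  have ex: "F a = (\<Sum>i\<in>Basis. (a \<bullet> i) * F i)" if "linear F" for F :: "'b \<Rightarrow> real" and a
  proof -
    have "F a = F (\<Sum>i\<in>Basis. (a \<bullet> i) *\<^sub>R i)" by (simp add: euclidean_representation)
    then show ?thesis by (simp add: linear_sum[OF that] linear_scale[OF that])
  qed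
  have 1: "((\<lambda>y. \<Sum>i\<in>Basis. (Y y \<bullet> i) * Q y i) has_derivative
      (\<lambda>v. \<Sum>i\<in>Basis. (Y y0 \<bullet> i) * Q' v i + (Y' v \<bullet> i) * Q y0 i)) (at y0)"
    by (intro has_derivative_sum has_derivative_mult has_derivative_inner_left Y d)
  have 2: "(\<lambda>v. \<Sum>i\<in>Basis. (Y y0 \<bullet> i) * Q' v i + (Y' v \<bullet> i) * Q y0 i) = (\<lambda>v. Q' v (Y y0) + Q y0 (Y' v))"
    by (rule ext) (simp only: sum.distrib ex[OF lin', symmetric] ex[OF lin0, symmetric])
  have 3: "\<forall>\<^sub>F y in nhds y0. Q y (Y y) = (\<Sum>i\<in>Basis. (Y y \<bullet> i) * Q y i)"
    using ev by (rule eventually_mono) (rule ex)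
  show ?thesis unfolding has_derivative_cong_ev[OF 3] using 1 unfolding 2 .
qed

lemma is_form_3I:
  assumes l: "\<And>y z. linear (\<lambda>x. f x y z)" "\<And>x z. linear (\<lambda>y. f x y z)" "\<And>x y. linear (\<lambda>z. f x y z)"
    and a: "\<And>x z. f x x z = 0" "\<And>x z. f x z z = 0" "\<And>x z. f x z x = 0"
  shows "is_form 3 (\<lambda>v. f (v 0) (v (Suc 0)) (v 2))"
  unfolding is_form_def
proof (intro conjI allI impI)
  show "linear (\<lambda>x. f ((v(i := x)) 0) ((v(i := x)) (Suc 0)) ((v(i := x)) 2))" if "i < 3" for i v
  proof -
    have "i = 0 \<or> i = 1 \<or> i = 2" using that by linarith
    then show ?thesis using l by auto
  qed
  show "f (v 0) (v (Suc 0)) (v 2) = 0" if "i < j \<and> j < 3 \<and> v i = v j" for v i j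
  proof -
    have "i = 0 \<and> j = Suc 0 \<or> i = 0 \<and> j = 2 \<or> i = Suc 0 \<and> j = 2" using that by linarith
    then show ?thesis using that by (elim disjE) (auto simp: a)
  qed
qed auto

lemma is_form_4I:
  assumes l: "\<And>y z w. linear (\<lambda>x. f x y z w)" "\<And>x z w. linear (\<lambda>y. f x y z w)" "\<And>x y w. linear (\<lambda>z. f x y z w)"
      "\<And>x y z. linear (\<lambda>w. f x y z w)"
    and a: "\<And>x z w. f x x z w = 0" "\<And>x z w. f x z z w = 0" "\<And>x y z. f x y z z = 0"
      "\<And>x z w. f x z x w = 0" "\<And>x z w. f x z w x = 0" "\<And>x z w. f x z w z = 0"
  shows "is_form 4 (\<lambda>v. f (v 0) (v (Suc 0)) (v 2) (v 3))"
  unfolding is_form_def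
proof (intro conjI allI impI)
  show "linear (\<lambda>x. f ((v(i := x)) 0) ((v(i := x)) (Suc 0)) ((v(i := x)) 2) ((v(i := x)) 3))" if "i < 4" for i v
  proof -
    have "i = 0 \<or> i = 1 \<or> i = 2 \<or> i = 3" using that by linarith
    then show ?thesis using l by auto
  qed
  show "f (v 0) (v (Suc 0)) (v 2) (v 3) = 0" if "i < j \<and> j < 4 \<and> v i = v j" for v i j
  proof -
    have "i = 0 \<and> j = Suc 0 \<or> i = 0 \<and> j = 2 \<or> i = Suc 0 \<and> j = 2 \<or> i = 0 \<and> j = 3 \<or> i = Suc 0 \<and> j = 3 \<or> i = 2 \<and> j = 3"
      using that by linarith
    then show ?thesis using that by (elim disjE) (auto simp: a)
  qed
qed auto

section \<open>Differentiability of algebraic expressions and of the metric\<close>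

lemma differentiable_wedge:
  assumes "\<And>v. (\<lambda>x. \<alpha> x v) differentiable (at x0)" "\<And>v. (\<lambda>x. \<beta> x v) differentiable (at x0)"
  shows "(\<lambda>x. wedge k l (\<alpha> x) (\<beta> x) v) differentiable (at x0)"
  unfolding wedge_def divide_inverse
  by (intro differentiable_mult differentiable_sum differentiable_const ballI assms finite_permutations) auto

lemma differentiable_det:
  fixes A :: "'a::real_normed_vector \<Rightarrow> real ^ 'n ^ 'n"
  assumes "\<And>i j. (\<lambda>x. A x $ i $ j) differentiable (at x0)"
  shows "(\<lambda>x. det (A x)) differentiable (at x0)"
proof -
  have "(\<lambda>x. \<Prod>i\<in>UNIV. A x $ i $ p i) differentiable (at x0)" for p
  proof -
    have "((\<lambda>x. \<Prod>i\<in>UNIV. A x $ i $ p i) has_derivative (\<lambda>y. \<Sum>i\<in>UNIV.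
        frechet_derivative (\<lambda>x. A x $ i $ p i) (at x0) y * (\<Prod>j\<in>UNIV - {i}. A x0 $ j $ p j))) (at x0)"
      by (rule has_derivative_prod) (rule differentiableD[OF assms])
    then show ?thesis unfolding differentiable_def by blast
  qed
  then show ?thesis
    unfolding det_def by (intro differentiable_sum ballI differentiable_mult differentiable_const) auto
qed

lemma differentiable_root:
  assumes "f differentiable (at x0)" "0 < f x0" "0 < n"
  shows "(\<lambda>x. root n (f x)) differentiable (at x0)"
proof -
  have "(root n has_derivative (*) (inverse (real n * root n (f x0) ^ (n - Suc 0)))) (at (f x0))"
    using DERIV_real_root[OF assms(3,2)] by (simp add: has_field_derivative_def)
  from has_derivative_compose[OF differentiableD[OF assms(1)] this] show ?thesis
    unfolding differentiable_def by blast
qed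

lemma det_gram:
  fixes g :: "real ^ 'n \<Rightarrow> real ^ 'n \<Rightarrow> real"
  assumes g: "\<And>v. linear (\<lambda>u. g u v)" "\<And>u. linear (g u)" and L: "linear L"
  shows "det (\<chi> i j. g (L (axis i 1)) (L (axis j 1))) = (det (matrix L))\<^sup>2 * det (\<chi> i j. g (axis i 1) (axis j 1))"
proof -
  let ?M = "matrix L" and ?G = "\<chi> i j. g (axis i 1) (axis j 1)"
  have ex: "L (axis i 1) = (\<Sum>k\<in>UNIV. ?M $ k $ i *\<^sub>R axis k 1)" for i
    using basis_expansion[of "L (axis i 1)"] by (simp add: matrix_def scalar_mult_eq_scaleR)
  have "(\<chi> i j. g (L (axis i 1)) (L (axis j 1))) = Finite_Cartesian_Product.transpose ?M ** (?G ** ?M)"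
  proof (simp add: vec_eq_iff, intro allI)
    fix i j
    have "g (L (axis i 1)) (L (axis j 1)) = (\<Sum>k\<in>UNIV. \<Sum>l\<in>UNIV. ?M $ k $ i * (g (axis k 1) (axis l 1) * ?M $ l $ j))"
      unfolding ex[of i] ex[of j]
      by (simp add: linear_sum[OF g(1)] linear_sum[OF g(2)] linear_scale[OF g(1)] linear_scale[OF g(2)],
        subst sum.swap, simp add: sum_distrib_left mult_ac)
    then show "g (L (axis i 1)) (L (axis j 1)) = (Finite_Cartesian_Product.transpose ?M ** (?G ** ?M)) $ i $ j"
      by (simp add: matrix_matrix_mult_def Finite_Cartesian_Product.transpose_def sum_distrib_left)
  qed
  then show ?thesis by (simp add: det_mul det_transpose power2_eq_square)
qed

text \<open>An algebraic formula that makes the metric differentiable. For an orthonormal frame of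
  determinant \<open>d\<close> the Gram determinant is d^-2; since g = (d / 6) b, in dimension 7 it
  is also (d / 6)^7 det B. Hence d^9 det B = 6^7.\<close>

lemma g2_metric_formula:
  assumes s: "g2_structure \<phi> g \<psi> e" and o: "positively_oriented e"
  defines "B \<equiv> \<chi> i j. top_coeff (bform \<phi> (axis i 1) (axis j 1)) :: real ^ 7 ^ 7"
  shows "0 < det B" and "g u v = root 9 (6 ^ 7 / det B) / 6 * top_coeff (bform \<phi> u v)"
    and "det (\<chi> i j. g (axis i 1) (axis j 1)) \<noteq> 0"
proof -
  note D = g2_structureD[OF s]
  obtain d where d: "d > 0" "\<And>\<eta>. is_form 7 \<eta> \<Longrightarrow> \<eta> e = d * top_coeff \<eta>"
    "\<And>u v. g u v = d / 6 * top_coeff (bform \<phi> u v)"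
    using g2_positive_iff[OF s o] by metis
  obtain L :: "real ^ 7 \<Rightarrow> real ^ 7" where L: "linear L" "\<And>k. k < 7 \<Longrightarrow> L (std_frame k) = e k"
    using frame_map[OF index_bij_7, of e] by auto
  let ?\<eta> = "bform \<phi> (e 0) (e 0)"
  note \<eta> = is_form_bform[OF D(5), of "e 0" "e 0"]
  have "?\<eta> e = ?\<eta> (\<lambda>i. L (std_frame i))" by (rule form_cong[OF \<eta>]) (simp add: L)
  also have "\<dots> = det (matrix L) * top_coeff ?\<eta>"
    using top_form_det[OF index_bij_7 _ L(1), of ?\<eta> std_frame] \<eta> by (simp add: top_coeff_def)
  finally have "d * top_coeff ?\<eta> = det (matrix L) * top_coeff ?\<eta>" using d(2)[OF \<eta>] by simp
  moreover have "?\<eta> e = 6" using bform_frame_values(2)[OF D(1)] by simp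
  ultimately have dL: "det (matrix L) = d" using d(2)[OF \<eta>] by auto
  have "(\<chi> i j. g (L (axis i 1)) (L (axis j 1))) = mat 1"
  proof (simp add: vec_eq_iff mat_def, intro allI)
    fix i j :: 7
    have "axis i (1::real) \<in> std_frame ` {..<7}" "axis j (1::real) \<in> std_frame ` {..<7}"
      using std_frame_range[OF index_bij_7] by auto
    then obtain k l where kl: "k < 7" "axis i (1::real) = std_frame k" "l < 7" "axis j (1::real) = std_frame l" by auto
    have "k = l \<longleftrightarrow> i = j"
    proof
      show "i = j" if "k = l" using kl that by (metis axis_eq_axis zero_neq_one)
      show "k = l" if "i = j"
      proof -
        have "(of_nat (Suc k) :: 7) = of_nat (Suc l)"
          using kl that unfolding std_frame_def by (metis axis_eq_axis zero_neq_one)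
        then show ?thesis using index_bij_7 kl unfolding index_bij_def bij_betw_def inj_on_def by auto
      qed
    qed
    then show "(i = j \<longrightarrow> g (L (axis j 1)) (L (axis j 1)) = 1) \<and> (i \<noteq> j \<longrightarrow> g (L (axis i 1)) (L (axis j 1)) = 0)"
      using D(3) kl unfolding kl(2) kl(4) by (auto simp: L orthonormal_frame_def)
  qed
  then have gram: "1 = d\<^sup>2 * det (\<chi> i j. g (axis i 1) (axis j 1))"
    using det_gram[OF metric_linear(2,1)[OF D(2)] L(1)] by (simp add: dL)
  then show "det (\<chi> i j. g (axis i 1) (axis j 1)) \<noteq> 0" by auto
  have "(\<chi> i j. g (axis i 1) (axis j 1)) = (\<chi> i. (d / 6) *s (B $ i))"
    by (simp add: vec_eq_iff B_def d(3))
  then have dG: "det (\<chi> i j. g (axis i 1) (axis j 1)) = (d / 6) ^ 7 * det B"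
    using det_rows_mul[of "\<lambda>_. d / 6" "\<lambda>i. B $ i"] by simp
  have "1 = d\<^sup>2 * (d ^ 7 / 6 ^ 7 * det B)" using gram unfolding dG power_divide .
  also have "\<dots> = d ^ 9 * det B / 6 ^ 7"
  proof -
    have "d ^ 9 = d\<^sup>2 * d ^ 7" by (simp flip: power_add)
    then show ?thesis by simp
  qed
  finally have e: "d ^ 9 * det B = 6 ^ 7" by simp
  then have "0 < d ^ 9 * det B" by simp
  then show B: "0 < det B" using d(1) by (simp add: zero_less_mult_iff)
  have "6 ^ 7 / det B = d ^ 9" using e B by (simp add: field_simps)
  then have "root 9 (6 ^ 7 / det B) = d" using d(1) by (simp add: real_root_power_cancel)
  then show "g u v = root 9 (6 ^ 7 / det B) / 6 * top_coeff (bform \<phi> u v)" using d(3) by simp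
qed

section \<open>The Levi-Civita connection of a closed and coclosed structure\<close>

lemma val_germ:
  assumes "\<forall>\<^sub>F x in nhds x0. is_form 3 (\<Phi> x)"
  shows "\<forall>\<^sub>F x in nhds x0. \<Phi> x v = val3 (\<Phi> x) (v 0) (v 1) (v 2)"
  using assms by (rule eventually_mono) (rule form_val3)

lemma val4_germ:
  assumes "\<forall>\<^sub>F x in nhds x0. is_form 4 (\<Psi> x)"
  shows "\<forall>\<^sub>F x in nhds x0. \<Psi> x v = val4 (\<Psi> x) (v 0) (v 1) (v 2) (v 3)"
  using assms by (rule eventually_mono) (rule form_val4)

text \<open>A coordinate patch around \<open>x0\<close>. The frame in \<open>struct\<close> may
  depend on the point in any way, so regularity of the metric and of \<Psi> has to be derived from
  that of \<Phi>.\<close>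

locale g2_local =
  fixes S :: "(real ^ 7) set" and \<Phi> :: "real ^ 7 \<Rightarrow> (real ^ 7) form" and G :: "real ^ 7 \<Rightarrow> real ^ 7 \<Rightarrow> real ^ 7 \<Rightarrow> real"
    and \<Psi> :: "real ^ 7 \<Rightarrow> (real ^ 7) form" and x0 :: "real ^ 7"
  assumes S: "open S" "x0 \<in> S"
    and struct: "\<And>x. x \<in> S \<Longrightarrow> \<exists>e. g2_structure (\<Phi> x) (G x) (\<Psi> x) e \<and> positively_oriented e"
    and diff: "\<And>v. (\<lambda>x. \<Phi> x v) differentiable (at x0)"
begin

lemma ev: "(\<And>x. x \<in> S \<Longrightarrow> P x) \<Longrightarrow> \<forall>\<^sub>F x in nhds x0. P x"
  using S by (auto simp: eventually_nhds)

lemma facts: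
  assumes "x \<in> S"
  shows "is_form 3 (\<Phi> x)" "is_form 4 (\<Psi> x)" "is_metric (G x)"
  using struct[OF assms] g2_structureD by auto

lemma val3_diff: "(\<lambda>x. val3 (\<Phi> x) a b c) differentiable (at x0)"
  unfolding val3_def by (rule diff)

lemma bform_diff: "(\<lambda>x. top_coeff (bform (\<Phi> x) u v)) differentiable (at x0)"
  unfolding top_coeff_def bform_def
  by (intro differentiable_wedge diff) (simp_all add: interior_prod_apply diff)

lemma G_diff: "(\<lambda>x. G x u v) differentiable (at x0)"
proof -
  define B where "B x = (\<chi> i j. top_coeff (bform (\<Phi> x) (axis i 1) (axis j 1)) :: real ^ 7 ^ 7)" for x
  have B: "0 < det (B x)" "G x u v = root 9 (6 ^ 7 * inverse (det (B x))) * (inverse 6 * top_coeff (bform (\<Phi> x) u v))" if x: "x \<in> S" for x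
  proof -
    obtain e where e: "g2_structure (\<Phi> x) (G x) (\<Psi> x) e" "positively_oriented e" using struct[OF x] by blast
    show "0 < det (B x)" unfolding B_def by (rule g2_metric_formula(1)[OF e])
    show "G x u v = root 9 (6 ^ 7 * inverse (det (B x))) * (inverse 6 * top_coeff (bform (\<Phi> x) u v))"
      using g2_metric_formula(2)[OF e, of u v] unfolding B_def divide_inverse by (simp only: mult.assoc)
  qed
  have "(\<lambda>x. det (B x)) differentiable (at x0)"
    by (rule differentiable_det) (simp add: B_def bform_diff)
  then have "(\<lambda>x. inverse (det (B x))) differentiable (at x0)"
    using B(1)[OF S(2)] by (intro differentiable_inverse) auto
  then have "(\<lambda>x. root 9 (6 ^ 7 * inverse (det (B x))) * (inverse 6 * top_coeff (bform (\<Phi> x) u v))) differentiable (at x0)"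
    using B(1)[OF S(2)] by (intro differentiable_mult differentiable_root differentiable_const bform_diff) auto
  then show ?thesis
    using differentiable_cong_ev[OF ev[OF B(2)]] by simp
qed

text \<open>The components of the cross product solve a linear system with the Gram matrix, so
  Cramer's rule writes them as quotients of determinants.\<close>

lemma cross_diff: "(\<lambda>x. cross (G x) (\<Phi> x) u v) differentiable (at x0)"
proof -
  define A where "A x = (\<chi> i j. G x (axis i 1) (axis j 1) :: real ^ 7 ^ 7)" for x
  define C where "C x k = (\<chi> i j. if j = k then (\<chi> i. val3 (\<Phi> x) u v (axis i 1)) $ i else A x $ i $ j)" for x and k :: 7
  have "cross (G x) (\<Phi> x) u v = (\<Sum>k\<in>UNIV. (det (C x k) * inverse (det (A x))) *\<^sub>R axis k 1)" if x: "x \<in> S" for x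
  proof -
    obtain e where e: "g2_structure (\<Phi> x) (G x) (\<Psi> x) e" "positively_oriented e" using struct[OF x] by blast
    have det: "det (A x) \<noteq> 0" unfolding A_def by (rule g2_metric_formula(3)[OF e])
    let ?X = "cross (G x) (\<Phi> x) u v"
    note ml = metric_linear[OF facts(3)[OF x]]
    have "(A x *v ?X) $ i = val3 (\<Phi> x) u v (axis i 1)" for i
    proof -
      have "G x ?X (axis i 1) = G x (\<Sum>j\<in>UNIV. ?X $ j *\<^sub>R axis j 1) (axis i 1)"
        using basis_expansion[of ?X] by (simp add: scalar_mult_eq_scaleR)
      also have "\<dots> = (\<Sum>j\<in>UNIV. G x (axis i 1) (axis j 1) * ?X $ j)"
        by (simp add: linear_sum[OF ml(1)] linear_scale[OF ml(1)] metric_sym[OF facts(3)[OF x], of _ "axis i 1"] mult.commute)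
      finally show ?thesis
        using cross[OF facts(3)[OF x] facts(1)[OF x], of u v "axis i 1"] by (simp add: matrix_vector_mult_def A_def)
    qed
    then have "A x *v ?X = (\<chi> i. val3 (\<Phi> x) u v (axis i 1))" by (simp add: vec_eq_iff)
    then have X:  "?X = (\<chi> k. det (C x k) / det (A x))"
      unfolding C_def using cramer[OF det] by blast
    have "?X = (\<Sum>k\<in>UNIV. ?X $ k *\<^sub>R axis k 1)"
      using basis_expansion[of ?X] by (simp add: scalar_mult_eq_scaleR)
    moreover have "?X $ k = det (C x k) * inverse (det (A x))" for k
      by (subst X) (simp add: divide_inverse)
    ultimately show ?thesis by (simp only:)
  qed
  note e = this
  have dA: "(\<lambda>x. det (A x)) differentiable (at x0)"
    by (rule differentiable_det) (simp add: A_def G_diff)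
  obtain e0 where "g2_structure (\<Phi> x0) (G x0) (\<Psi> x0) e0" "positively_oriented e0" using struct[OF S(2)] by blast
  then have nz: "det (A x0) \<noteq> 0" unfolding A_def by (rule g2_metric_formula(3))
  have dC: "(\<lambda>x. det (C x k)) differentiable (at x0)" for k
  proof (rule differentiable_det)
    show "(\<lambda>x. C x k $ i $ j) differentiable (at x0)" for i j
      by (cases "j = k") (simp_all add: C_def A_def G_diff val3_diff)
  qed
  have "(\<lambda>x. \<Sum>k\<in>UNIV. (det (C x k) * inverse (det (A x))) *\<^sub>R axis k (1::real)) differentiable (at x0)"
    using nz by (intro differentiable_sum ballI differentiable_scaleR differentiable_mult differentiable_inverse dC dA differentiable_const) auto
  then show ?thesis using differentiable_cong_ev[OF ev[OF e]] by simp
qed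

section \<open>Derivatives of the structure at the base point\<close>

abbreviation "DP s a b c \<equiv> frechet_derivative (\<lambda>x. val3 (\<Phi> x) a b c) (at x0) s"
abbreviation "DG s a b \<equiv> frechet_derivative (\<lambda>x. G x a b) (at x0) s"

lemma val3_moving:
  assumes "(Y has_derivative Y') (at x0)"
  shows "((\<lambda>x. val3 (\<Phi> x) (Y x) b c) has_derivative (\<lambda>s. DP s (Y x0) b c + val3 (\<Phi> x0) (Y' s) b c)) (at x0)"
  by (rule has_derivative_slot[OF ev[OF val3_linear(1)[OF facts(1)]] differentiableD[OF val3_diff] assms])

lemma identity:
  assumes "x \<in> S"
  shows "val4 (\<Psi> x) a b c d = val3 (\<Phi> x) (cross (G x) (\<Phi> x) a b) c d - G x a c * G x b d + G x a d * G x b c"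
  using struct[OF assms] g2_identity by blast

definition "dX s a b = frechet_derivative (\<lambda>x. cross (G x) (\<Phi> x) a b) (at x0) s"

lemma val4_has_derivative:
  "((\<lambda>x. val4 (\<Psi> x) a b c d) has_derivative (\<lambda>s. DP s (cross (G x0) (\<Phi> x0) a b) c d + val3 (\<Phi> x0) (dX s a b) c d
     - (G x0 a c * DG s b d + DG s a c * G x0 b d) + (G x0 a d * DG s b c + DG s a d * G x0 b c))) (at x0)"
proof -
  have 1: "\<forall>\<^sub>F x in nhds x0. val4 (\<Psi> x) a b c d
      = val3 (\<Phi> x) (cross (G x) (\<Phi> x) a b) c d - G x a c * G x b d + G x a d * G x b c"
    by (rule ev) (rule identity)
  show ?thesis
    unfolding has_derivative_cong_ev[OF 1] dX_def
    by (intro has_derivative_add has_derivative_diff has_derivative_mult val3_moving differentiableD G_diff cross_diff)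
qed

abbreviation "DQ s a b c d \<equiv> frechet_derivative (\<lambda>x. val4 (\<Psi> x) a b c d) (at x0) s"

lemma DQ: "DQ s a b c d = DP s (cross (G x0) (\<Phi> x0) a b) c d + val3 (\<Phi> x0) (dX s a b) c d
     - (G x0 a c * DG s b d + DG s a c * G x0 b d) + (G x0 a d * DG s b c + DG s a d * G x0 b c)"
  using frechet_derivativeI[OF val4_has_derivative] by simp

lemma DG_cross: "DG s (cross (G x0) (\<Phi> x0) a b) c + G x0 (dX s a b) c = DP s a b c"
proof -
  have 1: "((\<lambda>x. G x (cross (G x) (\<Phi> x) a b) c) has_derivative
      (\<lambda>s. DG s (cross (G x0) (\<Phi> x0) a b) c + G x0 (dX s a b) c)) (at x0)"
    unfolding dX_def
    by (rule has_derivative_slot[OF ev[OF metric_linear(2)[OF facts(3)]] differentiableD[OF G_diff] differentiableD[OF cross_diff]])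
  have 2: "\<forall>\<^sub>F x in nhds x0. G x (cross (G x) (\<Phi> x) a b) c = val3 (\<Phi> x) a b c"
    by (rule ev) (rule cross[OF facts(3,1)])
  show ?thesis
    unfolding frechet_derivative_cong_ev[OF 2, symmetric] frechet_derivativeI[OF 1] ..
qed

lemma DP_linear: "linear (\<lambda>a. DP s a b c)" "linear (\<lambda>b. DP s a b c)" "linear (\<lambda>c. DP s a b c)"
  using linear_derivative_parameter[OF ev[OF val3_linear(1)[OF facts(1)]] val3_diff]
    linear_derivative_parameter[OF ev[OF val3_linear(2)[OF facts(1)]] val3_diff]
    linear_derivative_parameter[OF ev[OF val3_linear(3)[OF facts(1)]] val3_diff] by blast+

lemma DG_linear: "linear (\<lambda>a. DG s a b)" "linear (\<lambda>b. DG s a b)" "linear (\<lambda>s. DG s a b)"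
  using linear_derivative_parameter[OF ev[OF metric_linear(2)[OF facts(3)]] G_diff]
    linear_derivative_parameter[OF ev[OF metric_linear(1)[OF facts(3)]] G_diff]
    has_derivative_linear[OF differentiableD[OF G_diff]] by blast+

lemma zero_germ: "(\<And>x. x \<in> S \<Longrightarrow> f x = 0) \<Longrightarrow> frechet_derivative f (at x0) s = 0"
  using frechet_derivative_cong_ev[OF ev, of f "\<lambda>_. 0"] by simp

lemma DP_alt: "DP s a a c = 0" "DP s a b b = 0" "DP s a b a = 0"
  by (rule zero_germ, rule val3_alt[OF facts(1)], assumption)+

lemma DG_sym: "DG s a b = DG s b a"
proof -
  have 1: "\<forall>\<^sub>F x in nhds x0. G x a b = G x b a" by (rule ev) (rule metric_sym[OF facts(3)])
  show ?thesis unfolding frechet_derivative_cong_ev[OF 1] ..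
qed

section \<open>Levi-Civita connection and covariant derivatives\<close>

definition "Gam u v = christoffel G x0 u v"

text \<open>The right side is linear in \<open>z\<close> and the metric is nondegenerate, so the
  description in \<open>christoffel\<close> has exactly one solution.\<close>

lemma Gam: "2 * G x0 (Gam u v) z = DG u v z + DG v u z - DG z u v"
proof -
  have "linear (\<lambda>z. (DG u v z + DG v u z - DG z u v) / 2)"
    using DG_linear by (auto simp: linear_iff algebra_simps add_divide_distrib diff_divide_distrib)
  from metric_riesz[OF facts(3)[OF S(2)] this]
  obtain w where w: "\<And>z. G x0 w z = (DG u v z + DG v u z - DG z u v) / 2" by blast
  have "christoffel G x0 u v = w"
    unfolding christoffel_def
  proof (rule the_equality)
    show "\<forall>z. 2 * G x0 w z = DG u v z + DG v u z - DG z u v" by (simp add: w)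
    show "w' = w" if h: "\<forall>z. 2 * G x0 w' z = DG u v z + DG v u z - DG z u v" for w'
    proof (rule metric_eqI[OF facts(3)[OF S(2)]])
      show "G x0 w' z = G x0 w z" for z using h[rule_format, of z] w[of z] by simp
    qed
  qed
  then show ?thesis by (simp add: Gam_def w)
qed

lemma Gam_sym: "Gam u v = Gam v u"
proof (rule metric_eqI[OF facts(3)[OF S(2)]])
  fix z
  have "2 * G x0 (Gam u v) z = 2 * G x0 (Gam v u) z" unfolding Gam using DG_sym[where s = z and a = u and b = v] by linarith
  then show "G x0 (Gam u v) z = G x0 (Gam v u) z" by simp
qed

lemma Gam_linear: "linear (Gam u)"
proof (rule linearI)
  note ml = metric_linear(2)[OF facts(3)[OF S(2)]]
  show "Gam u (a + b) = Gam u a + Gam u b" for a b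
  proof (rule metric_eqI[OF facts(3)[OF S(2)]])
    fix z
    have "2 * G x0 (Gam u (a + b)) z = 2 * G x0 (Gam u a) z + 2 * G x0 (Gam u b) z"
      unfolding Gam by (simp add: linear_add[OF DG_linear(1)] linear_add[OF DG_linear(2)] linear_add[OF DG_linear(3)])
    then show "G x0 (Gam u (a + b)) z = G x0 (Gam u a + Gam u b) z" by (simp add: linear_add[OF ml])
  qed
  show "Gam u (c *\<^sub>R a) = c *\<^sub>R Gam u a" for c a
  proof (rule metric_eqI[OF facts(3)[OF S(2)]])
    fix z
    have "2 * G x0 (Gam u (c *\<^sub>R a)) z = c * (2 * G x0 (Gam u a) z)"
      unfolding Gam by (simp add: linear_scale[OF DG_linear(1)] linear_scale[OF DG_linear(2)] linear_scale[OF DG_linear(3)] algebra_simps)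
    then show "G x0 (Gam u (c *\<^sub>R a)) z = G x0 (c *\<^sub>R Gam u a) z" by (simp add: linear_scale[OF ml])
  qed
qed

lemma metric_compat: "DG s a b = G x0 (Gam s a) b + G x0 a (Gam s b)"
proof -
  have "2 * G x0 (Gam s a) b + 2 * G x0 (Gam s b) a = 2 * DG s a b"
    unfolding Gam using DG_sym[where s = s and a = a and b = b] by linarith
  then show ?thesis using metric_sym[OF facts(3)[OF S(2)], of "Gam s b" a] by simp
qed

text \<open>Covariant derivatives of \<Phi>, \<Psi> and the cross product on constant fields: the
  coordinate derivative with one Christoffel correction per slot.\<close>

definition "nabla3 s a b c = DP s a b c - val3 (\<Phi> x0) (Gam s a) b c - val3 (\<Phi> x0) a (Gam s b) c - val3 (\<Phi> x0) a b (Gam s c)"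
definition "nabla4 s a b c d = DQ s a b c d - val4 (\<Psi> x0) (Gam s a) b c d - val4 (\<Psi> x0) a (Gam s b) c d
   - val4 (\<Psi> x0) a b (Gam s c) d - val4 (\<Psi> x0) a b c (Gam s d)"
definition "nablaX s a b = dX s a b + Gam s (cross (G x0) (\<Phi> x0) a b) - cross (G x0) (\<Phi> x0) (Gam s a) b - cross (G x0) (\<Phi> x0) a (Gam s b)"

lemma nablaX: "G x0 (nablaX s a b) c = nabla3 s a b c"
proof -
  note m = facts(3)[OF S(2)] and p = facts(1)[OF S(2)]
  note ml = metric_linear(2)[OF m]
  show ?thesis
    unfolding nablaX_def nabla3_def
    using DG_cross[where s = s and a = a and b = b and c = c] metric_compat[where s = s and a = "cross (G x0) (\<Phi> x0) a b" and b = c] cross[OF m p, of a b "Gam s c"]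
    by (simp add: linear_add[OF ml] linear_diff[OF ml] cross[OF m p])
qed

text \<open>Covariant derivative of the product identity. The terms containing the metric drop out
  because it is parallel.\<close>

lemma nabla4: "nabla4 s a b c d = nabla3 s (cross (G x0) (\<Phi> x0) a b) c d + val3 (\<Phi> x0) (nablaX s a b) c d"
proof -
  note m = facts(3)[OF S(2)] and p = facts(1)[OF S(2)]
  note pl = val3_linear(1)[OF p]
  show ?thesis
    unfolding nablaX_def nabla3_def nabla4_def DQ identity[OF S(2)]
      metric_compat[where s = s and a = a and b = c] metric_compat[where s = s and a = b and b = d] metric_compat[where s = s and a = a and b = d] metric_compat[where s = s and a = b and b = c]
    by (simp add: linear_add[OF pl] linear_diff[OF pl] algebra_simps)
qed

text \<open>For a repeated argument the two Christoffel terms in the equal slots cancel and the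
  remaining terms vanish by themselves.\<close>

lemma nabla3_form: "is_form 3 (\<lambda>v. nabla3 s (v 0) (v (Suc 0)) (v 2))"
proof (rule is_form_3I)
  note p = facts(1)[OF S(2)]
  note pl = val3_linear[OF p] and pa = val3_alt[OF p]
  note la = linear_add[OF pl(1)] linear_add[OF pl(2)] linear_add[OF pl(3)] linear_scale[OF pl(1)] linear_scale[OF pl(2)] linear_scale[OF pl(3)]
    linear_add[OF DP_linear(1)] linear_add[OF DP_linear(2)] linear_add[OF DP_linear(3)] linear_scale[OF DP_linear(1)] linear_scale[OF DP_linear(2)]
    linear_scale[OF DP_linear(3)] linear_add[OF Gam_linear] linear_scale[OF Gam_linear]
  show "linear (\<lambda>x. nabla3 s x y z)" "linear (\<lambda>x. nabla3 s y x z)" "linear (\<lambda>x. nabla3 s y z x)" for y z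
    by (rule linearI; simp add: nabla3_def la algebra_simps)+
  show "nabla3 s x x z = 0" for x z
    using pa(4)[of x "Gam s x" z] unfolding nabla3_def DP_alt pa(1) by linarith
  show "nabla3 s x z z = 0" for x z
    using pa(5)[of x z "Gam s z"] unfolding nabla3_def DP_alt pa(2) by linarith
  show "nabla3 s x z x = 0" for x z
    using pa(5)[of x z "Gam s x"] pa(4)[of x "Gam s x" z] pa(5)[of "Gam s x" x z] unfolding nabla3_def DP_alt pa(3) by linarith
qed

lemma nabla4_form: "is_form 4 (\<lambda>v. nabla4 s (v 0) (v (Suc 0)) (v 2) (v 3))"
proof -
  note q = facts(2)[OF S(2)]
  note pl = val4_linear[OF q] and pa = val4_alt[OF q]
  have Qd: "(\<lambda>x. val4 (\<Psi> x) a b c d) differentiable (at x0)" for a b c d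
    using val4_has_derivative unfolding differentiable_def by blast
  have DQ_linear: "linear (\<lambda>a. DQ s a b c d)" "linear (\<lambda>b. DQ s a b c d)" "linear (\<lambda>c. DQ s a b c d)" "linear (\<lambda>d. DQ s a b c d)" for a b c d
    using linear_derivative_parameter[OF ev[OF val4_linear(1)[OF facts(2)]] Qd]
      linear_derivative_parameter[OF ev[OF val4_linear(2)[OF facts(2)]] Qd]
      linear_derivative_parameter[OF ev[OF val4_linear(3)[OF facts(2)]] Qd]
      linear_derivative_parameter[OF ev[OF val4_linear(4)[OF facts(2)]] Qd] by blast+
  have DQ_alt: "DQ s a a c d = 0" "DQ s a b b d = 0" "DQ s a b c c = 0" "DQ s a b a d = 0" "DQ s a b c b = 0" "DQ s a b c a = 0" for a b c d
    by (rule zero_germ, rule val4_alt[OF facts(2)], assumption)+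
  note la = linear_add[OF pl(1)] linear_add[OF pl(2)] linear_add[OF pl(3)] linear_add[OF pl(4)]
    linear_scale[OF pl(1)] linear_scale[OF pl(2)] linear_scale[OF pl(3)] linear_scale[OF pl(4)]
    linear_add[OF DQ_linear(1)] linear_add[OF DQ_linear(2)] linear_add[OF DQ_linear(3)] linear_add[OF DQ_linear(4)]
    linear_scale[OF DQ_linear(1)] linear_scale[OF DQ_linear(2)] linear_scale[OF DQ_linear(3)] linear_scale[OF DQ_linear(4)]
    linear_add[OF Gam_linear] linear_scale[OF Gam_linear]
  show ?thesis
  proof (rule is_form_4I)
    show "linear (\<lambda>x. nabla4 s x y z w)" "linear (\<lambda>x. nabla4 s y x z w)" "linear (\<lambda>x. nabla4 s y z x w)" "linear (\<lambda>x. nabla4 s y z w x)" for y z w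
      by (rule linearI; simp add: nabla4_def la algebra_simps)+
    show "nabla4 s x x z w = 0" for x z w
      using pa(7)[of x "Gam s x" z w] unfolding nabla4_def DQ_alt pa(1) by linarith
    show "nabla4 s x z z w = 0" for x z w
      using pa(8)[of x z "Gam s z" w] unfolding nabla4_def DQ_alt pa(2) by linarith
    show "nabla4 s x y z z = 0" for x y z
      using pa(9)[of x y z "Gam s z"] unfolding nabla4_def DQ_alt pa(3) by linarith
    show "nabla4 s x z x w = 0" for x z w
      using pa(8)[of x z "Gam s x" w] pa(7)[of x "Gam s x" z w] pa(8)[of "Gam s x" x z w] unfolding nabla4_def DQ_alt pa(4) by linarith
    show "nabla4 s x z w x = 0" for x z w
      using pa(9)[of x z w "Gam s x"] pa(8)[of x z "Gam s x" w] pa(7)[of x "Gam s x" z w] pa(9)[of "Gam s x" z w x]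
        pa(8)[of "Gam s x" z x w] pa(7)[of "Gam s x" x z w] unfolding nabla4_def DQ_alt pa(6) by linarith
    show "nabla4 s x z w z = 0" for x z w
      using pa(9)[of x z w "Gam s z"] pa(8)[of x z "Gam s z" w] pa(9)[of x "Gam s z" z w] unfolding nabla4_def DQ_alt pa(5) by linarith
  qed
qed

section \<open>Exterior derivatives through covariant derivatives\<close>

lemma ext_deriv_3:
  "ext_deriv_at 3 \<Phi> x0 (a ## b ## c ## d ## t) = DP a b c d - DP b a c d + DP c a b d - DP d a b c"
proof -
  have t: "frechet_derivative (\<lambda>x. \<Phi> x w) (at x0) s = DP s (w 0) (w 1) (w 2)" for w s
  proof -
    have 1: "\<forall>\<^sub>F x in nhds x0. \<Phi> x w = val3 (\<Phi> x) (w 0) (w 1) (w 2)" by (rule val_germ, rule ev, rule facts(1))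
    show ?thesis unfolding frechet_derivative_cong_ev[OF 1] ..
  qed
  show ?thesis unfolding ext_deriv_at_def t by (simp add: eval_nat_numeral)
qed

lemma ext_deriv_4:
  "ext_deriv_at 4 \<Psi> x0 (a ## b ## c ## d ## h ## t) = DQ a b c d h - DQ b a c d h + DQ c a b d h - DQ d a b c h + DQ h a b c d"
proof -
  have t: "frechet_derivative (\<lambda>x. \<Psi> x w) (at x0) s = DQ s (w 0) (w 1) (w 2) (w 3)" for w s
  proof -
    have 1: "\<forall>\<^sub>F x in nhds x0. \<Psi> x w = val4 (\<Psi> x) (w 0) (w 1) (w 2) (w 3)" by (rule val4_germ, rule ev, rule facts(2))
    show ?thesis unfolding frechet_derivative_cong_ev[OF 1] ..
  qed
  show ?thesis unfolding ext_deriv_at_def t by (simp add: eval_nat_numeral)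
qed

text \<open>The connection has no torsion: by symmetry of \<open>Gam\<close> the Christoffel terms
  cancel in the alternating sum, so partial derivatives may be replaced by covariant ones.\<close>

lemma closed3:
  assumes "ext_deriv_at 3 \<Phi> x0 = (\<lambda>_. 0)"
  shows "nabla3 a b c d - nabla3 b a c d + nabla3 c a b d - nabla3 d a b c = 0"
proof -
  have e: "DP a b c d - DP b a c d + DP c a b d - DP d a b c = 0" using fun_cong[OF assms] unfolding ext_deriv_3[where t = "\<lambda>_. 0", symmetric] by simp
  note pa = val3_alt[OF facts(1)[OF S(2)]]
  have sw: "val3 (\<Phi> x0) x (Gam s u) y = - val3 (\<Phi> x0) (Gam s u) x y" "val3 (\<Phi> x0) x y (Gam s u) = val3 (\<Phi> x0) (Gam s u) x y" for x y s u
    using pa(4,5) by (metis minus_minus)+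
  show ?thesis
    unfolding nabla3_def sw Gam_sym[of b a] Gam_sym[of c a] Gam_sym[of c b] Gam_sym[of d a] Gam_sym[of d b] Gam_sym[of d c]
    using e by linarith
qed

lemma closed4:
  assumes "ext_deriv_at 4 \<Psi> x0 = (\<lambda>_. 0)"
  shows "nabla4 a b c d h - nabla4 b a c d h + nabla4 c a b d h - nabla4 d a b c h + nabla4 h a b c d = 0"
proof -
  have e: "DQ a b c d h - DQ b a c d h + DQ c a b d h - DQ d a b c h + DQ h a b c d = 0"
    using fun_cong[OF assms] unfolding ext_deriv_4[where t = "\<lambda>_. 0", symmetric] by simp
  note pa = val4_alt[OF facts(2)[OF S(2)]]
  have sw: "val4 (\<Psi> x0) x (Gam s u) y z = - val4 (\<Psi> x0) (Gam s u) x y z" "val4 (\<Psi> x0) x y (Gam s u) z = val4 (\<Psi> x0) (Gam s u) x y z"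
    "val4 (\<Psi> x0) x y z (Gam s u) = - val4 (\<Psi> x0) (Gam s u) x y z" for x y z s u
    using pa(7,8,9) by (metis minus_minus)+
  show ?thesis
    unfolding nabla4_def sw Gam_sym[of b a] Gam_sym[of c a] Gam_sym[of c b] Gam_sym[of d a] Gam_sym[of d b] Gam_sym[of d c]
      Gam_sym[of h a] Gam_sym[of h b] Gam_sym[of h c] Gam_sym[of h d]
    using e by linarith
qed

lemma parallel_normal:
  assumes c: "ext_deriv_at 3 \<Phi> x0 = (\<lambda>_. 0)" "ext_deriv_at 4 \<Psi> x0 = (\<lambda>_. 0)"
    and e: "g2_structure (\<Phi> x0) (G x0) (\<Psi> x0) e"
  shows "\<forall>l<6. \<forall>k<l. \<forall>j<k. \<forall>i<j. nabla4 (e 6) (e i) (e j) (e k) (e l) = 0"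
proof -
  note D = g2_structureD[OF e]
  define \<kappa> where "\<kappa> s = (\<lambda>v. nabla3 (e s) (v 0) (v (Suc 0)) (v 2))" for s
  define \<tau> where "\<tau> s = (\<lambda>v. nabla4 (e s) (v 0) (v (Suc 0)) (v 2) (v 3))" for s
  have \<kappa>: "is_form 3 (\<kappa> s)" and \<tau>: "is_form 4 (\<tau> s)" for s
    unfolding \<kappa>_def \<tau>_def by (rule nabla3_form, rule nabla4_form)
  have v3: "val3 (\<kappa> s) a b c = nabla3 (e s) a b c" and v4: "val4 (\<tau> s) a b c d = nabla4 (e s) a b c d" for s a b c d
    by (simp_all add: val3_def \<kappa>_def val4_def \<tau>_def eval_nat_numeral)
  have l1: "linear (\<lambda>x. nabla3 s x y z)" for s y z
  proof -
    have "linear (\<lambda>x. val3 (\<lambda>v. nabla3 s (v 0) (v (Suc 0)) (v 2)) x y z)" by (rule val3_linear(1)[OF nabla3_form])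
    then show ?thesis by (simp add: val3_def eval_nat_numeral)
  qed
  \<comment> \<open>Expanding both cross products in the frame puts \<open>nabla4\<close> into
    component form.\<close>
  have rel: "val4 (\<tau> s) (e i) (e j) (e k) (e l) =
      (\<Sum>p<7. val3 (\<kappa> s) (e i) (e j) (e p) * val3 (\<Phi> x0) (e p) (e k) (e l) + val3 (\<Phi> x0) (e i) (e j) (e p) * val3 (\<kappa> s) (e p) (e k) (e l))"
    for s i j k l
  proof -
    have 1: "val3 (\<Phi> x0) (nablaX (e s) (e i) (e j)) (e k) (e l) = (\<Sum>p<7. nabla3 (e s) (e i) (e j) (e p) * val3 (\<Phi> x0) (e p) (e k) (e l))"
      using metric_expand[OF D(2,3) val3_linear(1)[OF D(5)], of "nablaX (e s) (e i) (e j)" "e k" "e l"] by (simp add: nablaX)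
    have 2: "nabla3 (e s) (cross (G x0) (\<Phi> x0) (e i) (e j)) (e k) (e l) = (\<Sum>p<7. val3 (\<Phi> x0) (e i) (e j) (e p) * nabla3 (e s) (e p) (e k) (e l))"
      using metric_expand[OF D(2,3) l1[of "e s"], where u = "cross (G x0) (\<Phi> x0) (e i) (e j)"] by (simp add: cross[OF D(2,5)])
    show ?thesis unfolding v3 v4 nabla4 1 2 by (simp add: sum.distrib)
  qed
  have "\<forall>l<6. \<forall>k<l. \<forall>j<k. \<forall>i<j. val4 (\<tau> 6) (e i) (e j) (e k) (e l) = 0"
    by (rule closed_implies_parallel_normal[of "\<Phi> x0" e \<kappa> \<tau>])
      (rule D(1) \<kappa> \<tau> rel | simp only: v3 v4 closed3[OF c(1)] closed4[OF c(2)])+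
  then show ?thesis by (simp add: v4)
qed

end

section \<open>Hypersurfaces: linear algebra\<close>

lemma val4_sort:
  assumes "is_form 4 \<psi>"
  shows "j < i \<Longrightarrow> val4 \<psi> (e i) (e j) z w = - val4 \<psi> (e j) (e i) z w"
    "j < i \<Longrightarrow> val4 \<psi> z (e i) (e j) w = - val4 \<psi> z (e j) (e i) w"
    "j < i \<Longrightarrow> val4 \<psi> z w (e i) (e j) = - val4 \<psi> z w (e j) (e i)"
  by (rule val4_alt[OF assms])+

lemma val3_pullback: "is_form 3 \<alpha> \<Longrightarrow> val3 (pullback L \<alpha>) x y z = val3 \<alpha> (L x) (L y) (L z)"
proof -
  assume a: "is_form 3 \<alpha>"
  have "val3 (pullback L \<alpha>) x y z = \<alpha> (\<lambda>i. L ((x ## y ## z ## (\<lambda>_. 0)) i))"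
    unfolding val3_def pullback_def ..
  then show ?thesis using form_val3[OF a, of "\<lambda>i. L ((x ## y ## z ## (\<lambda>_. 0)) i)"] by (simp add: numeral_2_eq_2)
qed

lemma val2_pullback: "is_form 2 \<alpha> \<Longrightarrow> val2 (pullback L \<alpha>) x y = val2 \<alpha> (L x) (L y)"
proof -
  assume a: "is_form 2 \<alpha>"
  have "val2 (pullback L \<alpha>) x y = \<alpha> (\<lambda>i. L ((x ## y ## (\<lambda>_. 0)) i))"
    unfolding val2_def pullback_def ..
  then show ?thesis using form_val2[OF a, of "\<lambda>i. L ((x ## y ## (\<lambda>_. 0)) i)"] by simp
qed

lemma wedge_2_4_commute:
  assumes "is_form 2 \<alpha>" "is_form 4 \<beta>"
  shows "wedge 2 4 \<alpha> \<beta> (a ## b ## c ## d ## e ## f ## t) = wedge 4 2 \<beta> \<alpha> (a ## b ## c ## d ## e ## f ## t)"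
  by (simp add: wedge_2_4_eval[OF assms] wedge_4_2_eval[OF assms(2,1)])

text \<open>\<open>J\<close> is the derivative of the inclusion and \<open>e 6\<close> the unit
  normal. Condition \<open>ori\<close> links the orientation of coordinate space to the normal; it
  is positivity of \<omega>^3.\<close>

locale g2_hyper =
  fixes \<phi> g \<psi> e and J :: "real ^ 6 \<Rightarrow> real ^ 7"
  assumes st: "g2_structure \<phi> g \<psi> e" and J: "linear J" "inj J" and normal: "\<And>u. g (e 6) (J u) = 0"
    and ori: "0 < top_coeff (wedge 4 2 (wedge 2 2 (pullback J (interior_prod (e 6) \<phi>)) (pullback J (interior_prod (e 6) \<phi>)))
      (pullback J (interior_prod (e 6) \<phi>)))"
begin

lemmas D = g2_structureD[OF st]
lemmas pt = dual_form_values[OF D(1), folded D(4), unfolded all_less_7 g2d_def, simplified]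
lemmas tables = pt val4_alt(1-6)[OF D(6)] val4_sort[OF D(6), where e = e] g2_table[OF D(1)]
  val3_alt(1-3)[OF D(5)] val3_sort[OF D(5), where e = e]

lemma ge: "i < 7 \<Longrightarrow> j < 7 \<Longrightarrow> g (e i) (e j) = (if i = j then 1 else 0)"
  using D(3) by (simp add: orthonormal_frame_def)

text \<open>\<open>J\<close> is injective with values in the complement of \<open>e 6\<close>, which
  has dimension at most 6; so its image is the whole complement.\<close>

lemma frame_exists: "\<exists>b. \<forall>i<6. J (b i) = e i"
proof -
  let ?W = "{x. g (e 6) x = 0}"
  note ml = metric_linear[OF D(2)]
  have sub: "subspace ?W" using ml(1) by (simp add: subspace_def linear_0 linear_add linear_scale)
  have "x \<in> span (e ` {..<6})" if "x \<in> ?W" for x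
  proof -
    have "x = (\<Sum>i<7. g x (e i) *\<^sub>R e i)" using orthonormal_expand[OF D(2,3), of x] by simp
    also have "\<dots> = (\<Sum>i<6. g x (e i) *\<^sub>R e i) + g x (e 6) *\<^sub>R e 6"
      using sum.lessThan_Suc[of "\<lambda>i. g x (e i) *\<^sub>R e i" 6] by simp
    also have "g x (e 6) = 0" using that metric_sym[OF D(2), of x "e 6"] by simp
    finally have "x = (\<Sum>i<6. g x (e i) *\<^sub>R e i)" by simp
    also have "\<dots> \<in> span (e ` {..<6})" by (intro span_sum span_scale span_base) auto
    finally show ?thesis .
  qed
  then have "dim ?W \<le> card (e ` {..<6})" by (intro dim_le_card) auto
  also have "\<dots> \<le> 6" using card_image_le[of "{..<6::nat}" e] by simp
  also have "6 = dim (range J)" using dim_image_eq[OF J(1), of UNIV] J(2) by (simp add: dim_UNIV)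
  finally have "range J = ?W"
    using normal sub linear_subspace_image[OF J(1), of UNIV] by (intro subspace_dim_equal) auto
  moreover have "e i \<in> ?W" if "i < 6" for i using that by (simp add: ge)
  ultimately have "\<forall>i. \<exists>u. i < 6 \<longrightarrow> J u = e i" by (metis (mono_tags, lifting) imageE)
  then show ?thesis by metis
qed

text \<open>Preimages of the tangential frame. In this frame the data on N are those of complex
  3-space, with \<open>b 0\<close>, \<open>b 2\<close>, \<open>b 4\<close> as real axes and
  \<open>b 1\<close>, \<open>b 3\<close>, \<open>b 5\<close> as imaginary ones.\<close>

definition "b = (SOME b. \<forall>i<6. J (b i) = e i)"
definition "h u v = g (J u) (J v)"
definition "\<rho> = pullback J \<phi>"
definition "\<omega> = pullback J (interior_prod (e 6) \<phi>)"
text \<open>The sign arises because dt stands last in Im(dz1 dz2 dz3) \<and> dt, so contraction with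
  the normal has to pass a 3-form.\<close>

definition "\<rho>t = (\<lambda>v. - pullback J (interior_prod (e 6) \<psi>) v)"
definition "I u = (\<Sum>i<6. h u (b i) *\<^sub>R [b 1, - b 0, b 3, - b 2, b 5, - b 4] ! i)"

lemma Jb: "i < 6 \<Longrightarrow> J (b i) = e i"
  using someI_ex[OF frame_exists] by (simp add: b_def)

lemma Jb': "J (b 0) = e 0" "J (b (Suc 0)) = e (Suc 0)" "J (b 2) = e 2" "J (b 3) = e 3" "J (b 4) = e 4" "J (b 5) = e 5"
  by (simp_all add: Jb)

lemma h_metric: "is_metric h"
  unfolding is_metric_def h_def
proof (intro conjI allI impI)
  show "linear (\<lambda>v. g (J u) (J v))" for u using linear_compose[OF J(1) metric_linear(1)[OF D(2)]] by (simp add: o_def)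
  show "g (J u) (J v) = g (J v) (J u)" for u v by (rule metric_sym[OF D(2)])
  show "0 < g (J u) (J u)" if "u \<noteq> 0" for u
    using that J linear_0[OF J(1)] metric_pos[OF D(2), of "J u"] by (metis injD)
qed

lemma b_orthonormal: "orthonormal_frame h b"
  by (auto simp: orthonormal_frame_def h_def Jb ge)

lemma b_span: "span (b ` {..<6}) = UNIV"
  using orthonormal_frame_span[OF h_metric b_orthonormal] by simp

lemma forms: "is_form 3 \<rho>" "is_form 2 \<omega>" "is_form 3 \<rho>t"
  unfolding \<rho>_def \<omega>_def \<rho>t_def
  by (intro is_form_pullback is_form_minus is_form_interior_3 is_form_interior_4 J D)+

lemma vals: "val3 \<rho> x y z = val3 \<phi> (J x) (J y) (J z)" "val2 \<omega> x y = val3 \<phi> (e 6) (J x) (J y)"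
    "val3 \<rho>t x y z = - val4 \<psi> (e 6) (J x) (J y) (J z)"
proof -
  show "val3 \<rho> x y z = val3 \<phi> (J x) (J y) (J z)" unfolding \<rho>_def by (rule val3_pullback[OF D(5)])
  show "val2 \<omega> x y = val3 \<phi> (e 6) (J x) (J y)"
    unfolding \<omega>_def val2_pullback[OF is_form_interior_3[OF D(5)]] by (rule val2_interior[OF D(5)])
  have "val3 \<rho>t x y z = - val3 (pullback J (interior_prod (e 6) \<psi>)) x y z" by (simp add: val3_def \<rho>t_def)
  then show "val3 \<rho>t x y z = - val4 \<psi> (e 6) (J x) (J y) (J z)"
    by (simp add: val3_pullback[OF is_form_interior_4[OF D(6)]] val3_interior[OF D(6)])
qed

lemma I_linear: "linear I"
  unfolding I_def using metric_linear(2)[OF h_metric]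
  by (intro linear_compose_sum) (auto simp: linear_iff scaleR_left_distrib)

lemma Ib: "I (b 0) = b 1" "I (b (Suc 0)) = - b 0" "I (b 2) = b 3" "I (b 3) = - b 2" "I (b 4) = b 5" "I (b 5) = - b 4"
proof -
  have hb: "h (b i) (b j) = (if i = j then 1 else 0)" if "i < 6" "j < 6" for i j
    using b_orthonormal that by (simp add: orthonormal_frame_def)
  have "I (b j) = [b 1, - b 0, b 3, - b 2, b 5, - b 4] ! j" if "j < 6" for j
  proof -
    have "I (b j) = (\<Sum>i<6. if i = j then [b 1, - b 0, b 3, - b 2, b 5, - b 4] ! j else 0)"
      unfolding I_def using that by (intro sum.cong) (auto simp: hb)
    then show ?thesis using that by simp
  qed
  from this[of 0] this[of 1] this[of 2] this[of 3] this[of 4] this[of 5]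
  show "I (b 0) = b 1" "I (b (Suc 0)) = - b 0" "I (b 2) = b 3" "I (b 3) = - b 2" "I (b 4) = b 5" "I (b 5) = - b 4"
    by simp_all
qed

lemma linear_b_ext:
  assumes "linear f" "linear f'" "\<forall>i<6. f (b i) = f' (b i)" shows "f u = f' u"
  by (rule linear_eq_on_span[OF assms(1,2), of "b ` {..<6}"]) (use assms(3) b_span in auto)

lemma II: "I (I u) = - u"
  by (rule linear_b_ext[of "\<lambda>u. I (I u)" uminus])
    (use linear_compose[OF I_linear I_linear] in \<open>simp_all add: o_def linear_neg[OF I_linear] all_less_7 Ib Ib[unfolded One_nat_def] module_hom_uminus linear_iff\<close>)

lemma negs: "val3 \<rho> (- x) y z = - val3 \<rho> x y z" "val3 \<rho> x (- y) z = - val3 \<rho> x y z" "val3 \<rho> x y (- z) = - val3 \<rho> x y z"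
    "val3 \<rho>t (- x) y z = - val3 \<rho>t x y z" "val3 \<rho>t x (- y) z = - val3 \<rho>t x y z" "val3 \<rho>t x y (- z) = - val3 \<rho>t x y z"
    "val2 \<omega> (- x) y = - val2 \<omega> x y" "val2 \<omega> x (- y) = - val2 \<omega> x y"
  using linear_neg[OF val3_linear(1)[OF forms(1)]] linear_neg[OF val3_linear(2)[OF forms(1)]] linear_neg[OF val3_linear(3)[OF forms(1)]]
    linear_neg[OF val3_linear(1)[OF forms(3)]] linear_neg[OF val3_linear(2)[OF forms(3)]] linear_neg[OF val3_linear(3)[OF forms(3)]]
    linear_neg[OF val2_linear(1)[OF forms(2)]] linear_neg[OF val2_linear(2)[OF forms(2)]] by auto

section \<open>The (3,0)-form and its complex structure\<close>

lemma rho_basis: "\<forall>k<6. \<forall>j<k. \<forall>i<6. val3 \<rho> (I (b i)) (b j) (b k) = - val3 \<rho>t (b i) (b j) (b k)"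
  unfolding all_less_7 by (intro conjI; simp add: Ib negs; simp add: vals Jb' tables)

lemma I_slot1: "val3 \<rho> (I x) y z = - val3 \<rho>t x y z"
proof -
  have 1: "val3 \<rho> (I (b i)) y z = - val3 \<rho>t (b i) y z" if "i < 6" for i y z
  proof (rule alternating_bilinear_ext[where f = "val3 \<rho> (I (b i))" and h = "\<lambda>y z. - val3 \<rho>t (b i) y z" and e = b and n = 6])
    show "linear (\<lambda>x. - val3 \<rho>t (b i) x y)" "linear (\<lambda>y. - val3 \<rho>t (b i) x y)" for x y
      using linear_compose_neg[OF val3_linear(2)[OF forms(3)]] linear_compose_neg[OF val3_linear(3)[OF forms(3)]] by auto
  qed (use rho_basis that val3_linear[OF forms(1)] val3_alt(2)[OF forms(1)] val3_alt(2)[OF forms(3)] b_span in auto)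
  show ?thesis
    by (rule linear_b_ext[of "\<lambda>x. val3 \<rho> (I x) y z" "\<lambda>x. - val3 \<rho>t x y z"])
      (use 1 linear_compose[OF I_linear val3_linear(1)[OF forms(1)]] linear_compose_neg[OF val3_linear(1)[OF forms(3)]] in \<open>auto simp: o_def\<close>)
qed

lemma I_slot1': "val3 \<rho>t (I x) y z = val3 \<rho> x y z"
  using I_slot1[of "I x" y z] by (simp add: II negs)

lemma I_slots: "val3 \<rho> x (I y) z = - val3 \<rho>t x y z" "val3 \<rho> x y (I z) = - val3 \<rho>t x y z"
    "val3 \<rho>t x (I y) z = val3 \<rho> x y z" "val3 \<rho>t x y (I z) = val3 \<rho> x y z"
proof -
  note a = val3_alt(4,5)[OF forms(1)] and a' = val3_alt(4,5)[OF forms(3)]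
  show 1: "val3 \<rho> x (I y) z = - val3 \<rho>t x y z" for x y z using a(1)[of x "I y" z] a'(1)[of x y z] I_slot1[of y x z] by simp
  show 2: "val3 \<rho>t x (I y) z = val3 \<rho> x y z" for x y z using a'(1)[of x "I y" z] a(1)[of x y z] I_slot1'[of y x z] by simp
  show "val3 \<rho> x y (I z) = - val3 \<rho>t x y z" using a(2)[of x y "I z"] a'(2)[of x y z] 1[of x z y] by simp
  show "val3 \<rho>t x y (I z) = val3 \<rho> x y z" using a'(2)[of x y "I z"] a(2)[of x y z] 2[of x z y] by simp
qed

lemma type: "type_3_0 I \<rho> \<rho>t"
  unfolding type_3_0_def
proof (intro conjI forms allI impI)
  fix j :: nat and v :: "nat \<Rightarrow> real ^ 6" assume "j < 3"
  then have "j = 0 \<or> j = 1 \<or> j = 2" by linarith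
  then show "Complex (\<rho> (v(j := I (v j)))) (\<rho>t (v(j := I (v j)))) = \<i> * Complex (\<rho> v) (\<rho>t v)"
    by (auto simp: form_val3[OF forms(1)] form_val3[OF forms(3)] I_slot1 I_slot1' I_slots complex_eq_iff)
qed

lemma rhos_basis: "val3 \<rho> (b 0) (b 2) (b 4) = 1"
  by (simp add: vals Jb' tables)

definition "\<kappa> = wedge 3 3 \<rho> \<rho>t"

lemma kappa_form: "is_form 6 \<kappa>"
  using is_form_wedge[OF forms(1,3)] by (simp add: \<kappa>_def)

lemma kappa_b: "\<kappa> b = 4"
  unfolding \<kappa>_def seq6[OF kappa_form[unfolded \<kappa>_def], where e = b] wedge_3_3_eval[OF forms(1,3)]
  by (simp add: vals Jb' tables)

lemma omega3_form: "is_form 6 (wedge 4 2 (wedge 2 2 \<omega> \<omega>) \<omega>)"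
  using is_form_wedge[OF is_form_wedge_2_2[OF forms(2,2)] forms(2)] by simp

lemma omega3_b: "wedge 4 2 (wedge 2 2 \<omega> \<omega>) \<omega> b = 6"
  unfolding seq6[OF omega3_form, of b] wedge_4_2_eval[OF is_form_wedge_2_2[OF forms(2,2)] forms(2)] val4_wedge[OF forms(2,2)]
  by (simp add: vals Jb' tables)

text \<open>\<omega>^3 is positive on \<open>b\<close> by computation and on coordinate space by
  \<open>ori\<close>, which makes \<open>b\<close> positively oriented.\<close>

lemma b_factor: "\<exists>d>0. (\<forall>\<eta>. is_form 6 \<eta> \<longrightarrow> \<eta> b = d * top_coeff \<eta>) \<and> positively_oriented b"
proof -
  obtain d where d: "\<And>\<eta>. is_form 6 \<eta> \<Longrightarrow> \<eta> b = d * top_coeff \<eta>" "0 < d \<longleftrightarrow> positively_oriented b"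
    using top_form_frame[OF index_bij_6, of b] by auto
  have "d * top_coeff (wedge 4 2 (wedge 2 2 \<omega> \<omega>) \<omega>) = 6" using d(1)[OF omega3_form] omega3_b by simp
  then have "0 < d * top_coeff (wedge 4 2 (wedge 2 2 \<omega> \<omega>) \<omega>)" by linarith
  then have "0 < d" using ori zero_less_mult_pos2 unfolding \<omega>_def by blast
  then show ?thesis using d by blast
qed

lemma I_compatible: "orientation_compatible I"
proof -
  have "positively_oriented (\<lambda>k. [b 0, I (b 0), b 2, I (b 2), b 4, I (b 4)] ! k)"
  proof -
    obtain L :: "real ^ 6 \<Rightarrow> real ^ 6" where L: "linear L" "\<And>k. k < 6 \<Longrightarrow> L (std_frame k) = b k" "0 < det (matrix L)"
      using b_factor unfolding positively_oriented_def by auto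
    have "\<forall>k<6. [b 0, I (b 0), b 2, I (b 2), b 4, I (b 4)] ! k = b k"
      unfolding all_less_7 by (simp add: Ib)
    then show ?thesis unfolding positively_oriented_def using L by auto
  qed
  then show ?thesis unfolding orientation_compatible_def by blast
qed

text \<open>\<rho>(I' x, y, z) must alternate in x and y, being -\<tau>. Linear algebra then gives
  I' = p + q I, the square -1 leaves I and -I, and orientation excludes -I.\<close>

lemma complex_structure_unique:
  assumes c: "complex_structure I'" and o: "orientation_compatible I'" and t: "type_3_0 I' \<rho> \<tau>"
  shows "I' = I"
proof -
  have lin: "linear I'" and sq: "I' (I' v) = - v" for v using c by (auto simp: complex_structure_def)
  have \<tau>: "is_form 3 \<tau>" using t by (simp add: type_3_0_def)
  have sl: "val3 \<rho> (I' x) y z = - val3 \<tau> x y z" for x y z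
  proof -
    have "Complex (\<rho> ((x ## y ## z ## (\<lambda>_. 0))(0 := I' ((x ## y ## z ## (\<lambda>_. 0)) 0))))
        (\<tau> ((x ## y ## z ## (\<lambda>_. 0))(0 := I' ((x ## y ## z ## (\<lambda>_. 0)) 0))))
        = \<i> * Complex (\<rho> (x ## y ## z ## (\<lambda>_. 0))) (\<tau> (x ## y ## z ## (\<lambda>_. 0)))"
      using t unfolding type_3_0_def by (meson zero_less_numeral)
    moreover have "(x ## y ## z ## (\<lambda>_. 0))(0 := I' x) = (I' x ## y ## z ## (\<lambda>_. 0))"
      by (auto split: nat.split)
    ultimately show ?thesis by (simp add: val3_def complex_eq_iff)
  qed
  define m where "m k j = h (I' (b j)) (b k)" for k j
  have ex: "I' (b j) = (\<Sum>k<6. m k j *\<^sub>R b k)" for j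
    using orthonormal_expand[OF h_metric b_orthonormal, of "I' (b j)"] by (simp add: m_def)
  have T: "val3 \<rho> (I' (b j)) y z = m 0 j * val3 \<rho> (b 0) y z + m 1 j * val3 \<rho> (b 1) y z + m 2 j * val3 \<rho> (b 2) y z
      + m 3 j * val3 \<rho> (b 3) y z + m 4 j * val3 \<rho> (b 4) y z + m 5 j * val3 \<rho> (b 5) y z" for j y z
  proof -
    have "val3 \<rho> (I' (b j)) y z = (\<Sum>k<6. m k j * val3 \<rho> (b k) y z)"
      by (simp add: ex linear_sum[OF val3_linear(1)[OF forms(1)]] linear_scale[OF val3_linear(1)[OF forms(1)]])
    then show ?thesis by (simp add: sum_less_7)
  qed
  \<comment> \<open>Each choice of basis vectors is a linear equation for the matrix
    \<open>m\<close> of \<open>I'\<close>.\<close>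
  have swap: "val3 \<rho> (I' (b j)) (b l) (b n) + val3 \<rho> (I' (b l)) (b j) (b n) = 0" for j l n
    unfolding sl using val3_alt(4)[OF \<tau>, of "b l" "b j" "b n"] by simp
  note s = swap[unfolded T]
  note r = vals(1) Jb' tables
  \<comment> \<open>Equal first two vectors isolate a single entry outside the 2x2 diagonal
    blocks.\<close>
  have off: "m 2 0 = 0" "m 3 0 = 0" "m 4 0 = 0" "m 5 0 = 0" "m 2 1 = 0" "m 3 1 = 0" "m 4 1 = 0" "m 5 1 = 0"
      "m 0 2 = 0" "m 1 2 = 0" "m 4 2 = 0" "m 5 2 = 0" "m 0 3 = 0" "m 1 3 = 0" "m 4 3 = 0" "m 5 3 = 0"
      "m 0 4 = 0" "m 1 4 = 0" "m 2 4 = 0" "m 3 4 = 0" "m 0 5 = 0" "m 1 5 = 0" "m 2 5 = 0" "m 3 5 = 0"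
    using s[of 0 0 4] s[of 0 0 5] s[of 0 0 2] s[of 0 0 3] s[of 1 1 4] s[of 1 1 5] s[of 1 1 2] s[of 1 1 3]
      s[of 2 2 4] s[of 2 2 5] s[of 2 2 0] s[of 2 2 1] s[of 3 3 4] s[of 3 3 5] s[of 3 3 0] s[of 3 3 1]
      s[of 4 4 0] s[of 4 4 1] s[of 4 4 2] s[of 4 4 3] s[of 5 5 0] s[of 5 5 1] s[of 5 5 2] s[of 5 5 3]
    by (simp_all add: r)
  \<comment> \<open>Different first two vectors make the three blocks equal and complex
    linear.\<close>
  have eq: "m 2 2 = m 0 0" "m 4 4 = m 0 0" "m 1 1 = m 0 0" "m 3 3 = m 0 0" "m 5 5 = m 0 0"
      "m 3 2 = m 1 0" "m 5 4 = m 1 0" "m 0 1 = - m 1 0" "m 2 3 = - m 1 0" "m 4 5 = - m 1 0"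
    using s[of 0 2 4] s[of 0 2 5] s[of 0 3 4] s[of 0 3 5] s[of 1 2 4] s[of 1 2 5] s[of 1 3 4] s[of 1 3 5]
      s[of 0 4 2] s[of 0 4 3] s[of 0 5 2] s[of 0 5 3] s[of 1 4 2] s[of 1 4 3] s[of 1 5 2] s[of 1 5 3]
    by (simp add: r off off[unfolded One_nat_def]; linarith)+
  have "I' (b i) = m 0 0 *\<^sub>R b i + m 1 0 *\<^sub>R I (b i)" if "i < 6" for i
  proof -
    have e6: "(\<Sum>k<6. F k) = F 0 + F 1 + F 2 + F 3 + F 4 + F 5" for F :: "nat \<Rightarrow> real ^ 6"
      by (simp add: eval_nat_numeral)
    have "\<forall>i<6. I' (b i) = m 0 0 *\<^sub>R b i + m 1 0 *\<^sub>R I (b i)"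
      unfolding all_less_7 ex e6 by (simp add: Ib off eq off[unfolded One_nat_def] eq[unfolded One_nat_def])
    then show ?thesis using that by blast
  qed
  then have I': "I' u = m 0 0 *\<^sub>R u + m 1 0 *\<^sub>R I u" for u
    by (intro linear_b_ext[OF lin]) (use I_linear in \<open>auto simp: linear_iff algebra_simps\<close>)
  have "b 0 \<noteq> 0" using rhos_basis linear_0[OF val3_linear(1)[OF forms(1)]] by auto
  have hb: "h (b 0) (b 0) = 1" "h (b 1) (b 0) = 0" "h (b 0) (b 1) = 0" "h (b 1) (b 1) = 1"
    using b_orthonormal by (simp_all add: orthonormal_frame_def)
  have "I' (I' (b 0)) = (m 0 0 * m 0 0 - m 1 0 * m 1 0) *\<^sub>R b 0 + (2 * m 0 0 * m 1 0) *\<^sub>R b 1"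
  proof -
    have "I' (b 0) = m 0 0 *\<^sub>R b 0 + m 1 0 *\<^sub>R b 1" using I'[of "b 0"] by (simp add: Ib)
    moreover have "I (m 0 0 *\<^sub>R b 0 + m 1 0 *\<^sub>R b 1) = m 0 0 *\<^sub>R b 1 + m 1 0 *\<^sub>R (- b 0)"
      by (simp add: linear_add[OF I_linear] linear_scale[OF I_linear] Ib)
    ultimately have "I' (I' (b 0)) = m 0 0 *\<^sub>R (m 0 0 *\<^sub>R b 0 + m 1 0 *\<^sub>R b 1) + m 1 0 *\<^sub>R (m 0 0 *\<^sub>R b 1 + m 1 0 *\<^sub>R (- b 0))"
      using I'[of "m 0 0 *\<^sub>R b 0 + m 1 0 *\<^sub>R b 1"] by (simp only:)
    then show ?thesis by (simp add: vec_eq_iff algebra_simps)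
  qed
  then have c0: "- b 0 = (m 0 0 * m 0 0 - m 1 0 * m 1 0) *\<^sub>R b 0 + (2 * m 0 0 * m 1 0) *\<^sub>R b 1" by (simp add: sq)
  note hl = metric_linear(2)[OF h_metric]
  have "m 0 0 * m 0 0 - m 1 0 * m 1 0 = - 1" "2 * m 0 0 * m 1 0 = 0"
    using arg_cong[OF c0, of "\<lambda>x. h x (b 0)"] arg_cong[OF c0, of "\<lambda>x. h x (b 1)"] hb
    by (simp_all add: linear_add[OF hl] linear_scale[OF hl] linear_neg[OF hl])
  then have m0: "m 0 0 = 0" and m1: "m 1 0 * m 1 0 = 1"
  proof -
    assume a: "m 0 0 * m 0 0 - m 1 0 * m 1 0 = - 1" "2 * m 0 0 * m 1 0 = 0"
    have "m 1 0 \<noteq> 0"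
    proof
      assume "m 1 0 = 0"
      then have "m 0 0 * m 0 0 = - 1" using a(1) by simp
      then show False using zero_le_square[of "m 0 0"] by linarith
    qed
    then show z: "m 0 0 = 0" using a(2) by simp
    then show "m 1 0 * m 1 0 = 1" using a(1) by simp
  qed
  \<comment> \<open>For -I the form \<kappa> would be -4 times a sum of two squares on the frame (x,
    I' x, y, I' y, z, I' z), although that frame is positively oriented and \<kappa> is a positive
    top form.\<close>
  have "m 1 0 \<noteq> - 1"
  proof
    assume "m 1 0 = - 1"
    then have neg: "I' u = - I u" for u using I' m0 by simp
    obtain x y z where xyz: "positively_oriented (\<lambda>k. [x, I' x, y, I' y, z, I' z] ! k)"
      using o unfolding orientation_compatible_def by blast
    obtain d where d: "\<And>\<eta>. is_form 6 \<eta> \<Longrightarrow> \<eta> (\<lambda>k. [x, I' x, y, I' y, z, I' z] ! k) = d * top_coeff \<eta>" "0 < d"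
      using top_form_frame[OF index_bij_6, of "\<lambda>k. [x, I' x, y, I' y, z, I' z] ! k"] xyz by auto
    obtain d' where d': "d' > 0" "\<kappa> b = d' * top_coeff \<kappa>" using b_factor kappa_form by blast
    have tk: "0 < top_coeff \<kappa>" using d' kappa_b by (metis zero_less_mult_pos zero_less_numeral)
    have "\<kappa> (\<lambda>k. [x, I' x, y, I' y, z, I' z] ! k) = \<kappa> (x ## I' x ## y ## I' y ## z ## I' z ## (\<lambda>_. 0))"
      unfolding seq6[OF kappa_form, of "\<lambda>k. [x, I' x, y, I' y, z, I' z] ! k"] by simp
    also have "\<dots> = - 4 * (val3 \<rho> x y z * val3 \<rho> x y z + val3 \<rho>t x y z * val3 \<rho>t x y z)"
      unfolding \<kappa>_def wedge_3_3_eval[OF forms(1,3)]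
      by (simp add: neg negs I_slot1 I_slot1' I_slots val3_alt(1-3)[OF forms(1)] val3_alt(1-3)[OF forms(3)] algebra_simps)
    also have "\<dots> \<le> 0" by simp
    finally have "d * top_coeff \<kappa> \<le> 0" using d(1)[OF kappa_form] by simp
    moreover have "0 < d * top_coeff \<kappa>" using d(2) tk by simp
    ultimately show False by simp
  qed
  then have "m 1 0 = 1" using m1 by (metis mult_minus1_right square_eq_1_iff mult.right_neutral power2_eq_square power2_eq_1_iff)
  then show ?thesis using I' m0 by auto
qed

lemma complex_structure_of: "complex_structure_of \<rho> = I"
  unfolding complex_structure_of_def
proof (rule the_equality)
  have "\<exists>v. Complex (\<rho> v) (\<rho>t v) \<noteq> 0"
    using rhos_basis by (auto simp: val3_def complex_eq_iff intro!: exI[of _ "b 0 ## b 2 ## b 4 ## (\<lambda>_. 0)"])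
  then show "complex_structure I \<and> orientation_compatible I \<and> (\<exists>\<tau>. type_3_0 I \<rho> \<tau> \<and> (\<exists>v. Complex (\<rho> v) (\<tau> v) \<noteq> 0))"
    using type I_compatible I_linear II by (auto simp: complex_structure_def)
qed (use complex_structure_unique in blast)

lemma tilde: "tilde \<rho> = \<rho>t"
  unfolding tilde_def complex_structure_of
proof (rule the_equality)
  fix \<tau> assume t: "type_3_0 I \<rho> \<tau>"
  show "\<tau> = \<rho>t"
  proof
    fix v
    have "Complex (\<rho> (v(0 := I (v 0)))) (\<tau> (v(0 := I (v 0)))) = \<i> * Complex (\<rho> v) (\<tau> v)"
      "Complex (\<rho> (v(0 := I (v 0)))) (\<rho>t (v(0 := I (v 0)))) = \<i> * Complex (\<rho> v) (\<rho>t v)"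
      using t type unfolding type_3_0_def by (meson zero_less_numeral)+
    then show "\<tau> v = \<rho>t v" by (simp add: complex_eq_iff)
  qed
qed (rule type)

end

context g2_hyper begin

section \<open>Volume form and positivity of \<omega>\<close>

lemma vol_b: "vol_3form \<rho> b = 1" and is_form_vol: "is_form 6 (vol_3form \<rho>)"
proof -
  have v: "vol_3form \<rho> = (\<lambda>v. \<kappa> v / 4)" by (simp add: vol_3form_def tilde \<kappa>_def)
  show "vol_3form \<rho> b = 1" by (simp add: v kappa_b)
  show "is_form 6 (vol_3form \<rho>)" unfolding v by (rule is_form_divide[OF kappa_form])
qed

lemma top_quotient_b:
  assumes "is_form 6 \<sigma>" shows "top_quotient \<sigma> (vol_3form \<rho>) = \<sigma> b"
proof -
  obtain d where d: "d > 0" "\<And>\<eta>. is_form 6 \<eta> \<Longrightarrow> \<eta> b = d * top_coeff \<eta>" using b_factor by blast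
  have "d * top_coeff (vol_3form \<rho>) = 1" using d(2)[OF is_form_vol] vol_b by simp
  then have "top_coeff (vol_3form \<rho>) = 1 / d" using d(1) by (simp add: field_simps)
  then show ?thesis using d(2)[OF assms] by (simp add: top_quotient_def)
qed

text \<open>In the adapted frame \<omega>(x, I y) is the induced metric \<open>h x y\<close>, whose
  positivity is inherited.\<close>

lemma omega_positive: "positive_1_1_form I \<omega>"
  unfolding positive_1_1_form_def
proof (intro conjI forms allI impI)
  have a: "\<forall>j<6. \<forall>i<j. val2 \<omega> (I (b i)) (I (b j)) = val2 \<omega> (b i) (b j)"
    unfolding all_less_7 by (intro conjI; simp add: Ib negs; simp add: vals Jb' tables)
  have lc: "linear (\<lambda>x. val2 \<omega> (I x) y)" "linear (\<lambda>x. val2 \<omega> y (I x))" for y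
    using linear_compose[OF I_linear val2_linear(1)[OF forms(2)]] linear_compose[OF I_linear val2_linear(2)[OF forms(2)]] by (simp_all add: o_def)
  have inv: "val2 \<omega> (I x) (I y) = val2 \<omega> x y" for x y
    by (rule alternating_bilinear_ext[where f = "\<lambda>x y. val2 \<omega> (I x) (I y)" and h = "val2 \<omega>" and e = b and n = 6])
      (rule lc val2_linear[OF forms(2)] val2_alt[OF forms(2)] b_span a)+
  then show "\<omega> (\<lambda>i. I (v i)) = \<omega> v" for v by (simp add: form_val2[OF forms(2)])
  have c: "\<forall>i<6. \<forall>j<6. val2 \<omega> (b i) (I (b j)) = (if i = j then 1 else 0)"
    unfolding all_less_7 by (intro conjI; simp add: Ib negs; simp add: vals Jb' tables)
  have hb: "h (b i) (b j) = (if i = j then 1 else 0)" if "i < 6" "j < 6" for i j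
    using b_orthonormal that by (simp add: orthonormal_frame_def)
  have "val2 \<omega> x (I y) = h x y" for x y
    by (rule bilinear_frame_ext[where f = "\<lambda>x y. val2 \<omega> x (I y)" and h = h and e = b and n = 6])
      (rule lc val2_linear[OF forms(2)] metric_linear[OF h_metric] b_span | simp add: c hb)+
  then show "0 < \<omega> (case_nat u (\<lambda>_. I u))" if "u \<noteq> 0" for u
    using metric_pos[OF h_metric that] by (simp add: form_val2[OF forms(2)])
qed

section \<open>The (1,1)-form of a symmetric bilinear form\<close>

context
  fixes B :: "real ^ 6 \<Rightarrow> real ^ 6 \<Rightarrow> real"
  assumes B: "\<And>v. linear (\<lambda>u. B u v)" "\<And>u. linear (B u)" "\<And>u v. B u v = B v u"
begin

definition "\<beta> = form_of_hermitian I (hermitian_part I B)"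

lemma beta_val: "val2 \<beta> x y = (B (I x) y - B x (I y)) / 2"
  by (simp add: \<beta>_def val2_def form_of_hermitian_def hermitian_part_def II linear_neg[OF B(1)])

lemma beta_form: "is_form 2 \<beta>"
proof -
  have "is_form 2 (\<lambda>v. (\<lambda>x y. (B (I x) y - B x (I y)) / 2) (v 0) (v (Suc 0)))"
    by (rule is_form_2I)
      (simp_all add: linear_iff linear_add[OF I_linear] linear_scale[OF I_linear] linear_add[OF B(1)] linear_add[OF B(2)]
        linear_scale[OF B(1)] linear_scale[OF B(2)] B(3)[of _ "I _"] algebra_simps add_divide_distrib diff_divide_distrib)
  moreover have "\<beta> = (\<lambda>v. (B (I (v 0)) (v (Suc 0)) - B (v 0) (I (v (Suc 0)))) / 2)"
    by (simp add: \<beta>_def form_of_hermitian_def hermitian_part_def II linear_neg[OF B(1)] fun_eq_iff)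
  ultimately show ?thesis by simp
qed

text \<open>
  \<open>shape_action\<close> is the derivation by the shape operator applied to the 4-form; the vectors \<open>e j\<close> with
  \<open>j < 6\<close> are an orthonormal basis of the image of \<open>J\<close>.
\<close>

definition "shape_action x y z w = (\<Sum>j<6. B x (b j) * val4 \<psi> (e j) (J y) (J z) (J w) - B y (b j) * val4 \<psi> (e j) (J x) (J z) (J w)
   + B z (b j) * val4 \<psi> (e j) (J x) (J y) (J w) - B w (b j) * val4 \<psi> (e j) (J x) (J y) (J z))"

lemma shape_action_form: "is_form 4 (\<lambda>v. shape_action (v 0) (v (Suc 0)) (v 2) (v 3))"
proof (rule is_form_4I)
  note p = val4_linear[OF D(6)] and a = val4_alt[OF D(6)]
  note la = linear_add[OF p(2)] linear_add[OF p(3)] linear_add[OF p(4)] linear_scale[OF p(2)] linear_scale[OF p(3)] linear_scale[OF p(4)]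
    linear_add[OF J(1)] linear_scale[OF J(1)] linear_add[OF B(1)] linear_scale[OF B(1)]
  show "linear (\<lambda>x. shape_action x y z w)" "linear (\<lambda>x. shape_action y x z w)" "linear (\<lambda>x. shape_action y z x w)" "linear (\<lambda>x. shape_action y z w x)" for y z w
    by (rule linearI; simp add: shape_action_def la sum_distrib_left flip: sum.distrib; intro sum.cong refl; simp add: algebra_simps)+
  show "shape_action x x z w = 0" "shape_action x z z w = 0" "shape_action x y z z = 0" for x y z w
    by (simp_all add: shape_action_def a(1-3))
  have s: "val4 \<psi> y z x w = - val4 \<psi> y x z w" "val4 \<psi> y z w x = val4 \<psi> y x z w" for x y z w
    using a(8)[of y z x w] a(8)[of y z x w] a(9)[of y z w x] by simp_all
  show "shape_action x z x w = 0" for x z w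
    unfolding shape_action_def s(1)[of _ "J z" "J x"] by (intro sum.neutral) (simp add: a(1-6))
  show "shape_action x z w x = 0" for x z w
    unfolding shape_action_def s(2)[of _ "J z" "J w" "J x"] by (intro sum.neutral) (simp add: a(1-6))
  show "shape_action x z w z = 0" for x z w
    unfolding shape_action_def s(2)[of _ "J x" "J w" "J z"] s(1)[of _ "J x" "J z"] by (intro sum.neutral) (simp add: a(1-6))
qed

text \<open>The 4-form restricts to \<omega>^2 / 2, whose derivation by the shape operator is its
  action on \<omega>, wedged with \<omega>. Since \<omega>(x, y) = h(I x, y), that action is B(I x,
  y) - B(x, I y), that is, 2 \<beta>; this is the factor 2.\<close>

lemma beta_omega: "2 * val4 (wedge 2 2 \<beta> \<omega>) x y z w = shape_action x y z w"
proof -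
  let ?a = "\<lambda>v. 2 * wedge 2 2 \<beta> \<omega> v" and ?s = "\<lambda>v. shape_action (v 0) (v (Suc 0)) (v 2) (v 3)"
  have sv: "val4 ?s x y z w = shape_action x y z w" "val4 ?a x y z w = 2 * val4 (wedge 2 2 \<beta> \<omega>) x y z w" for x y z w
    by (simp_all add: val4_def eval_nat_numeral)
  have ng: "B (- x) y = - B x y" "B x (- y) = - B x y" for x y using linear_neg[OF B(1)] linear_neg[OF B(2)] by auto
  have sB: "j < i \<Longrightarrow> B (b i) (b j) = B (b j) (b i)" for i j by (rule B(3))
  have "?a = ?s"
  proof (rule form4_ext[OF is_form_scale[OF is_form_wedge_2_2[OF beta_form forms(2)]] shape_action_form b_span])
    show "\<forall>l<6. \<forall>k<l. \<forall>j<k. \<forall>i<j. val4 ?a (b i) (b j) (b k) (b l) = val4 ?s (b i) (b j) (b k) (b l)"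
      unfolding all_less_7 sv val4_wedge[OF beta_form forms(2)]
      unfolding shape_action_def sum_less_7
      by (intro conjI; simp add: beta_val Ib ng; simp add: vals Jb' tables sB; (simp add: field_simps)?)
  qed
  from fun_cong[OF this, of "x ## y ## z ## w ## (\<lambda>_. 0)"] show ?thesis by (simp add: val4_def eval_nat_numeral)
qed

text \<open>Wedging with \<omega>^2 gives twice the sum of \<beta> over the three complex axes, and
  \<beta>(b 0, b 1) is half the sum of the diagonal entries of \<open>B\<close> at
  \<open>b 0\<close> and \<open>b 1\<close>.\<close>

lemma trace_b: "wedge 4 2 (wedge 2 2 \<beta> \<omega>) \<omega> b = metric_trace h B"
proof -
  have f: "is_form 6 (wedge 4 2 (wedge 2 2 \<beta> \<omega>) \<omega>)"
    using is_form_wedge[OF is_form_wedge_2_2[OF beta_form forms(2)] forms(2)] by simp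
  have ng: "B (- x) y = - B x y" "B x (- y) = - B x y" for x y using linear_neg[OF B(1)] linear_neg[OF B(2)] by auto
  have "wedge 4 2 (wedge 2 2 \<beta> \<omega>) \<omega> b = B (b 0) (b 0) + B (b 1) (b 1) + B (b 2) (b 2) + B (b 3) (b 3) + B (b 4) (b 4) + B (b 5) (b 5)"
    unfolding seq6[OF f, where e = b] wedge_4_2_eval[OF is_form_wedge_2_2[OF beta_form forms(2)] forms(2)] val4_wedge[OF beta_form forms(2)]
    by (simp add: beta_val Ib ng vals Jb' tables)
  then show ?thesis using metric_trace_eq[OF h_metric b_orthonormal B(1,2)] by (simp add: sum_less_7)
qed

lemma hypersurface_conclusion:
  assumes d: "\<And>v. d\<rho> v = shape_action (v 0) (v 1) (v 2) (v 3)"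
  shows "wedge 2 2 \<beta> \<omega> = (\<lambda>v. d\<rho> v / 2)"
    and "metric_trace h B = top_quotient (wedge 4 2 d\<rho> \<omega>) (vol_3form \<rho>) / 2"
    and "semi_positive \<rho> d\<rho> \<Longrightarrow> 0 < metric_trace h B"
proof -
  have fd: "is_form 4 d\<rho>"
  proof -
    have "d\<rho> = (\<lambda>v. shape_action (v 0) (v (Suc 0)) (v 2) (v 3))" by (simp add: d fun_eq_iff)
    then show ?thesis using shape_action_form by simp
  qed
  have bo: "is_form 4 (wedge 2 2 \<beta> \<omega>)" by (rule is_form_wedge_2_2[OF beta_form forms(2)])
  show 1: "wedge 2 2 \<beta> \<omega> = (\<lambda>v. d\<rho> v / 2)"
  proof
    fix v
    show "wedge 2 2 \<beta> \<omega> v = d\<rho> v / 2" using d[of v] beta_omega[of "v 0" "v 1" "v 2" "v 3"] form_val4[OF bo, of v] by simp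
  qed
  have dr: "d\<rho> = (\<lambda>v. 2 * wedge 2 2 \<beta> \<omega> v)" by (simp add: 1)
  have f: "is_form 6 (wedge 4 2 d\<rho> \<omega>)" using is_form_wedge[OF fd forms(2)] by simp
  have w: "wedge 4 2 d\<rho> \<omega> b = 2 * metric_trace h B"
    unfolding dr wedge_scale_left trace_b ..
  then show 2: "metric_trace h B = top_quotient (wedge 4 2 d\<rho> \<omega>) (vol_3form \<rho>) / 2"
    by (simp add: top_quotient_b[OF f])
  \<comment> \<open>Semi-positivity is tested on \<omega> itself.\<close>
  assume "semi_positive \<rho> d\<rho>"
  then have "0 < top_quotient (wedge 2 4 \<omega> d\<rho>) (vol_3form \<rho>)"
    unfolding semi_positive_def complex_structure_of using omega_positive by blast
  moreover have f': "is_form 6 (wedge 2 4 \<omega> d\<rho>)" using is_form_wedge[OF forms(2) fd] by simp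
  moreover have "wedge 2 4 \<omega> d\<rho> b = wedge 4 2 d\<rho> \<omega> b"
    unfolding seq6[OF f', where e = b] seq6[OF f, where e = b] by (rule wedge_2_4_commute[OF forms(2) fd])
  ultimately show "0 < metric_trace h B" using w by (simp add: top_quotient_b[OF f'])
qed

end

end

section \<open>Hypersurfaces: differentiation along a map\<close>

text \<open>
  The second difference quotient of \<open>f\<close> in the directions \<open>u\<close> and \<open>v\<close> tends to the mixed second derivative
  and is symmetric in \<open>u\<close> and \<open>v\<close>.
\<close>

lemma second_difference:
  fixes f :: "'a::real_normed_vector \<Rightarrow> real"
  assumes U: "open U" "y0 \<in> U" and f: "\<And>y. y \<in> U \<Longrightarrow> f differentiable (at y)"
    and P: "((\<lambda>y. frechet_derivative f (at y) u) has_derivative P') (at y0)" and e: "0 < e"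
  shows "\<exists>d>0. \<forall>h. 0 < h \<and> h < d \<longrightarrow>
    \<bar>f (y0 + h *\<^sub>R u + h *\<^sub>R v) - f (y0 + h *\<^sub>R u) - f (y0 + h *\<^sub>R v) + f y0 - h\<^sup>2 * P' v\<bar> \<le> e * h\<^sup>2"
proof -
  define c where "c = norm u + norm v + 1"
  have c: "0 < c" unfolding c_def by (smt (verit) norm_ge_zero)
  let ?P = "\<lambda>y. frechet_derivative f (at y) u"
  \<comment> \<open>The estimate will be used at two points at distance at most \<open>h * c\<close>
    from \<open>y0\<close>; each then contributes at most \<open>e * h / 2\<close>.\<close>
  have "0 < e / (2 * c)" using e c by simp
  then have "\<exists>d>0. \<forall>y. norm (y - y0) < d \<longrightarrow> norm (?P y - ?P y0 - P' (y - y0)) \<le> e / (2 * c) * norm (y - y0)"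
    using P unfolding has_derivative_at_alt by blast
  then obtain d1 where d1: "0 < d1" "\<And>y. norm (y - y0) < d1 \<Longrightarrow> norm (?P y - ?P y0 - P' (y - y0)) \<le> e / (2 * c) * norm (y - y0)"
    by blast
  obtain r where r: "0 < r" "\<And>y. norm (y - y0) < r \<Longrightarrow> y \<in> U"
    using U unfolding open_dist dist_norm by blast
  have lin: "linear P'" using P has_derivative_linear by blast
  show ?thesis
  proof (intro exI conjI allI impI)
    show "0 < min d1 r / c" using d1(1) r(1) c by simp
    fix h assume h: "0 < h \<and> h < min d1 r / c"
    have hc: "h * c < d1" "h * c < r" using h c by (simp_all add: pos_less_divide_eq)
    have nb: "norm (s *\<^sub>R u + t *\<^sub>R v) \<le> h * c" if "0 \<le> s" "s \<le> h" "0 \<le> t" "t \<le> h" for s t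
    proof -
      have "norm (s *\<^sub>R u + t *\<^sub>R v) \<le> s * norm u + t * norm v"
        using norm_triangle_ineq[of "s *\<^sub>R u" "t *\<^sub>R v"] that by simp
      also have "\<dots> \<le> h * norm u + h * norm v" using that by (intro add_mono mult_right_mono) auto
      also have "\<dots> \<le> h * c" using h by (simp add: c_def algebra_simps)
      finally show ?thesis .
    qed
    define p where "p s t = y0 + s *\<^sub>R u + t *\<^sub>R v" for s t
    have pd: "p s t - y0 = s *\<^sub>R u + t *\<^sub>R v" for s t by (simp add: p_def)
    have dp: "((\<lambda>s. f (p s t)) has_real_derivative ?P (p s t)) (at s)" if "0 \<le> s" "s \<le> h" "0 \<le> t" "t \<le> h" for s t
    proof -
      have "p s t \<in> U" using r(2)[of "p s t"] nb[OF that] hc unfolding pd by simp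
      then have fd: "(f has_derivative frechet_derivative f (at (p s t))) (at (p s t))" by (intro differentiableD f)
      note fd
      moreover have "((\<lambda>s. p s t) has_derivative (\<lambda>k. k *\<^sub>R u)) (at s)"
        unfolding p_def by (auto intro!: derivative_eq_intros)
      ultimately have 1: "((\<lambda>s. f (p s t)) has_derivative (\<lambda>k. frechet_derivative f (at (p s t)) (k *\<^sub>R u))) (at s)"
        by (rule has_derivative_compose[rotated])
      have "linear (frechet_derivative f (at (p s t)))" using fd has_derivative_linear by blast
      then have "(\<lambda>k. frechet_derivative f (at (p s t)) (k *\<^sub>R u)) = (*) (?P (p s t))"
        by (simp add: fun_eq_iff linear_scale)
      then show ?thesis using 1 by (simp add: has_field_derivative_def)
    qed
    \<comment> \<open>Seen as a function of \<open>s\<close>, the second difference is an ordinary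
      difference of \<open>f (p s h) - f (p s 0)\<close>, and the mean value theorem supplies one
      common intermediate \<open>z\<close>.\<close>
    have "\<exists>z>0. z < h \<and> (f (p h h) - f (p h 0)) - (f (p 0 h) - f (p 0 0)) = (h - 0) * (?P (p z h) - ?P (p z 0))"
      using h by (intro MVT2[of 0 h "\<lambda>s. f (p s h) - f (p s 0)" "\<lambda>s. ?P (p s h) - ?P (p s 0)"] DERIV_diff dp) auto
    then obtain z where z: "0 < z" "z < h"
      "(f (p h h) - f (p h 0)) - (f (p 0 h) - f (p 0 0)) = h * (?P (p z h) - ?P (p z 0))" by auto
    have est: "\<bar>?P (p z t) - ?P y0 - P' (z *\<^sub>R u + t *\<^sub>R v)\<bar> \<le> e / 2 * h" if "0 \<le> t" "t \<le> h" for t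
    proof -
      have n: "norm (z *\<^sub>R u + t *\<^sub>R v) \<le> h * c" using nb[of z t] z that by simp
      have "\<bar>?P (p z t) - ?P y0 - P' (z *\<^sub>R u + t *\<^sub>R v)\<bar> \<le> e / (2 * c) * norm (z *\<^sub>R u + t *\<^sub>R v)"
        using d1(2)[of "p z t"] n hc unfolding pd by simp
      also have "\<dots> \<le> e / (2 * c) * (h * c)" using n e c by (intro mult_left_mono) auto
      finally show ?thesis using c by simp
    qed
    have "\<bar>?P (p z h) - ?P y0 - (z * P' u + h * P' v)\<bar> \<le> (e * h) / 2" "\<bar>?P (p z 0) - ?P y0 - z * P' u\<bar> \<le> (e * h) / 2"
      using est[of h] est[of 0] h by (simp_all add: linear_add[OF lin] linear_scale[OF lin] linear_0[OF lin])
    then have "\<bar>(?P (p z h) - ?P (p z 0)) - h * P' v\<bar> \<le> e * h" by linarith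
    then have "h * \<bar>(?P (p z h) - ?P (p z 0)) - h * P' v\<bar> \<le> h * (e * h)" using h by simp
    moreover have "h * \<bar>(?P (p z h) - ?P (p z 0)) - h * P' v\<bar> = \<bar>h * ((?P (p z h) - ?P (p z 0)) - h * P' v)\<bar>"
      using h by (simp add: abs_mult)
    moreover have "h * ((?P (p z h) - ?P (p z 0)) - h * P' v) = h * (?P (p z h) - ?P (p z 0)) - h\<^sup>2 * P' v"
      by (simp add: power2_eq_square algebra_simps)
    ultimately show "\<bar>f (y0 + h *\<^sub>R u + h *\<^sub>R v) - f (y0 + h *\<^sub>R u) - f (y0 + h *\<^sub>R v) + f y0 - h\<^sup>2 * P' v\<bar> \<le> e * h\<^sup>2"
      using z(3) by (simp add: p_def power2_eq_square algebra_simps)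
  qed
qed

lemma second_derivative_symmetric_real:
  fixes f :: "'a::real_normed_vector \<Rightarrow> real"
  assumes U: "open U" "y0 \<in> U" and f: "\<And>y. y \<in> U \<Longrightarrow> f differentiable (at y)"
    and P: "\<And>u. ((\<lambda>y. frechet_derivative f (at y) u) has_derivative P' u) (at y0)"
  shows "P' u v = P' v u"
proof -
  have "\<bar>P' u v - P' v u\<bar> \<le> 0 + e" if e: "0 < e" for e
  proof -
    have e2: "0 < e / 2" using e by simp
    obtain d where d: "0 < d" "\<And>h. 0 < h \<and> h < d \<Longrightarrow>
        \<bar>f (y0 + h *\<^sub>R u + h *\<^sub>R v) - f (y0 + h *\<^sub>R u) - f (y0 + h *\<^sub>R v) + f y0 - h\<^sup>2 * P' u v\<bar> \<le> e / 2 * h\<^sup>2"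
      using second_difference[OF U f P[of u] e2, of v] by blast
    obtain d' where d': "0 < d'" "\<And>h. 0 < h \<and> h < d' \<Longrightarrow>
        \<bar>f (y0 + h *\<^sub>R v + h *\<^sub>R u) - f (y0 + h *\<^sub>R v) - f (y0 + h *\<^sub>R u) + f y0 - h\<^sup>2 * P' v u\<bar> \<le> e / 2 * h\<^sup>2"
      using second_difference[OF U f P[of v] e2, of u] by blast
    define h where "h = min d d' / 2"
    have h: "0 < h \<and> h < d" "0 < h \<and> h < d'" using d(1) d'(1) by (auto simp: h_def)
    have "y0 + h *\<^sub>R v + h *\<^sub>R u = y0 + h *\<^sub>R u + h *\<^sub>R v" by (simp add: algebra_simps)
    then have "\<bar>h\<^sup>2 * P' u v - h\<^sup>2 * P' v u\<bar> \<le> e / 2 * h\<^sup>2 + e / 2 * h\<^sup>2"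
      using d(2)[OF h(1)] d'(2)[OF h(2)] by (simp only:)
    moreover have "h\<^sup>2 * P' u v - h\<^sup>2 * P' v u = h\<^sup>2 * (P' u v - P' v u)" by (simp add: algebra_simps)
    moreover have "\<bar>h\<^sup>2 * (P' u v - P' v u)\<bar> = h\<^sup>2 * \<bar>P' u v - P' v u\<bar>" by (simp add: abs_mult)
    ultimately have "h\<^sup>2 * \<bar>P' u v - P' v u\<bar> \<le> h\<^sup>2 * e" by (simp add: algebra_simps)
    then show ?thesis using h(1) by simp
  qed
  then have "\<bar>P' u v - P' v u\<bar> \<le> 0" by (rule field_le_epsilon)
  then show ?thesis by simp
qed

lemma second_derivative_symmetric:
  fixes f :: "'a::real_normed_vector \<Rightarrow> real ^ 'n"
  assumes U: "open U" "y0 \<in> U" and f: "\<And>y. y \<in> U \<Longrightarrow> f differentiable (at y)"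
    and P: "\<And>u. (\<lambda>y. frechet_derivative f (at y) u) differentiable (at y0)"
  shows "frechet_derivative (\<lambda>y. frechet_derivative f (at y) u) (at y0) v = frechet_derivative (\<lambda>y. frechet_derivative f (at y) v) (at y0) u"
proof -
  have "frechet_derivative (\<lambda>y. frechet_derivative f (at y) u) (at y0) v $ i = frechet_derivative (\<lambda>y. frechet_derivative f (at y) v) (at y0) u $ i" for i
  proof (rule second_derivative_symmetric_real[OF U, where f = "\<lambda>y. f y $ i"])
    have c: "((\<lambda>y. f y $ i) has_derivative (\<lambda>u. frechet_derivative f (at y) u $ i)) (at y)" if "y \<in> U" for y
      by (rule bounded_linear.has_derivative[OF bounded_linear_vec_nth differentiableD[OF f[OF that]]])
    then show "(\<lambda>y. f y $ i) differentiable (at y)" if "y \<in> U" for y using that unfolding differentiable_def by blast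
    fix u
    have 1: "\<forall>\<^sub>F y in nhds y0. frechet_derivative (\<lambda>y. f y $ i) (at y) u = frechet_derivative f (at y) u $ i"
      using U frechet_derivativeI[OF c] by (auto simp: eventually_nhds)
    show "((\<lambda>y. frechet_derivative (\<lambda>y. f y $ i) (at y) u) has_derivative
        (\<lambda>v. frechet_derivative (\<lambda>y. frechet_derivative f (at y) u) (at y0) v $ i)) (at y0)"
      unfolding has_derivative_cong_ev[OF 1]
      by (rule bounded_linear.has_derivative[OF bounded_linear_vec_nth differentiableD[OF P]])
  qed
  then show ?thesis by (simp add: vec_eq_iff)
qed

text \<open>\<open>f\<close> is the inclusion and \<open>n\<close> the unit normal, both in
  coordinates. \<open>unit\<close> and \<open>normal\<close> hold on all of \<open>U\<close>, so
  they may be differentiated; the frame \<open>e\<close> is fixed at the base point only.\<close>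

locale g2_along = g2_local S \<Phi> G \<Psi> x0 for S \<Phi> G \<Psi> x0 +
  fixes U :: "(real ^ 6) set" and f n :: "real ^ 6 \<Rightarrow> real ^ 7" and y0 e J
  assumes U: "open U" "y0 \<in> U" and f: "\<And>y. y \<in> U \<Longrightarrow> f differentiable (at y)"
    and Df: "\<And>v. (\<lambda>y. frechet_derivative f (at y) v) differentiable (at y0)"
    and fS: "\<And>y. y \<in> U \<Longrightarrow> f y \<in> S" and x0: "f y0 = x0" and n: "n differentiable (at y0)"
    and unit: "\<And>y. y \<in> U \<Longrightarrow> G (f y) (n y) (n y) = 1"
    and normal: "\<And>y v. y \<in> U \<Longrightarrow> G (f y) (n y) (frechet_derivative f (at y) v) = 0"
    and closed: "ext_deriv_at 3 \<Phi> x0 = (\<lambda>_. 0)" "ext_deriv_at 4 \<Psi> x0 = (\<lambda>_. 0)"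
    and hyper: "g2_hyper (\<Phi> x0) (G x0) (\<Psi> x0) e J" and e6: "e 6 = n y0" and J: "J = frechet_derivative f (at y0)"
begin

sublocale H: g2_hyper "\<Phi> x0" "G x0" "\<Psi> x0" e J by (rule hyper)

lemma evU: "(\<And>y. y \<in> U \<Longrightarrow> P y) \<Longrightarrow> \<forall>\<^sub>F y in nhds y0. P y"
  using U by (auto simp: eventually_nhds)

abbreviation "V v \<equiv> (\<lambda>y. frechet_derivative f (at y) v)"

lemma Vy0: "V v y0 = J v" by (simp add: J)

lemma f_derivative: "(f has_derivative J) (at y0)"
  unfolding J by (rule differentiableD[OF f[OF U(2)]])

text \<open>Covariant derivatives along \<open>f\<close> of the field with constant components
  \<open>v\<close> in the chart of N and, next, of the normal.\<close>

definition "nabV u v = frechet_derivative (V v) (at y0) u + Gam (J u) (J v)"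
definition "nabN u = frechet_derivative n (at y0) u + Gam (J u) (n y0)"
definition "B u v = G x0 (nabV u v) (n y0)"

text \<open>Vanishing torsion along a map: symmetry of the second derivative together with that of
  \<open>Gam\<close>.\<close>

lemma nabV_sym: "nabV u v = nabV v u"
  unfolding nabV_def using second_derivative_symmetric[OF U f Df, of v u] Gam_sym[of "J u" "J v"] by simp

lemma nabV_linear: "linear (\<lambda>u. nabV u v)"
proof -
  have a: "linear (frechet_derivative (V v) (at y0))" using has_derivative_linear[OF differentiableD[OF Df]] .
  have b: "linear (\<lambda>u. Gam (J u) (J v))"
    unfolding Gam_sym[of _ "J v"] using linear_compose[OF H.J(1) Gam_linear] by (simp add: o_def)
  show ?thesis unfolding nabV_def using linear_compose_add[OF a b] by simp
qed

lemma B_bilinear: "linear (\<lambda>u. B u v)" "linear (B u)" "B u v = B v u"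
proof -
  show s: "B u v = B v u" for u v unfolding B_def nabV_sym[of u v] ..
  show l: "linear (\<lambda>u. B u v)" for v
    unfolding B_def using linear_compose[OF nabV_linear metric_linear(2)[OF facts(3)[OF S(2)]]] by (simp add: o_def)
  have "B u = (\<lambda>v. B v u)" using s by blast
  then show "linear (B u)" using l by simp
qed

lemma pull_derivative:
  assumes "(q has_derivative q') (at x0)"
  shows "((\<lambda>y. q (f y)) has_derivative (\<lambda>u. q' (J u))) (at y0)"
  using has_derivative_compose[OF f_derivative] assms unfolding x0 by blast

lemma G_along:
  assumes Y: "(Y has_derivative Y') (at y0)" and Z: "(Z has_derivative Z') (at y0)"
  shows "((\<lambda>y. G (f y) (Y y) (Z y)) has_derivative
    (\<lambda>u. G x0 (Y' u + Gam (J u) (Y y0)) (Z y0) + G x0 (Y y0) (Z' u + Gam (J u) (Z y0)))) (at y0)"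
proof -
  note ml = metric_linear[OF facts(3)]
  have 1: "((\<lambda>y. G (f y) (Y y) c) has_derivative (\<lambda>u. DG (J u) (Y y0) c + G (f y0) (Y' u) c)) (at y0)" for c
    by (rule has_derivative_slot[OF evU[OF ml(2)[OF fS]] pull_derivative[OF differentiableD[OF G_diff]] Y])
  have "((\<lambda>y. G (f y) (Y y) (Z y)) has_derivative
      (\<lambda>u. (DG (J u) (Y y0) (Z y0) + G (f y0) (Y' u) (Z y0)) + G (f y0) (Y y0) (Z' u))) (at y0)"
    by (rule has_derivative_slot[OF evU[OF ml(1)[OF fS]] 1 Z])
  then show ?thesis
    unfolding x0 metric_compat by (simp add: linear_add[OF ml(1)[OF S(2)]] linear_add[OF ml(2)[OF S(2)]] algebra_simps)
qed

lemma n_derivative: "(n has_derivative frechet_derivative n (at y0)) (at y0)"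
  by (rule differentiableD[OF n])

lemma V_derivative: "(V v has_derivative frechet_derivative (V v) (at y0)) (at y0)"
  by (rule differentiableD[OF Df])

lemma constant_along:
  assumes "(q has_derivative q') (at y0)" "\<And>y. y \<in> U \<Longrightarrow> q y = (c::real)"
  shows "q' u = 0"
proof -
  have "\<forall>\<^sub>F y in nhds y0. q y = c" by (rule evU) (rule assms(2))
  from frechet_derivative_cong_ev[OF this] have "q' = (\<lambda>_. 0)" unfolding frechet_derivativeI[OF assms(1)] by simp
  then show ?thesis by simp
qed

text \<open>Weingarten equation. Differentiating the unit length shows that the derivative is
  tangential; differentiating orthogonality to the coordinate fields identifies its
  components.\<close>

lemma nabN: "nabN u = (\<Sum>j<6. - B u (H.b j) *\<^sub>R e j)"
proof -
  note m = facts(3)[OF S(2)]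
  have "G x0 (nabN u) (n y0) + G x0 (n y0) (nabN u) = 0"
    unfolding nabN_def by (rule constant_along[OF G_along[OF n_derivative n_derivative]]) (rule unit)
  then have 1: "G x0 (nabN u) (e 6) = 0" using metric_sym[OF m, of "nabN u" "n y0"] by (simp add: e6)
  have "G x0 (nabN u) (J v) + G x0 (n y0) (nabV u v) = 0" for v
    using constant_along[OF G_along[OF n_derivative V_derivative[of v]], where c = 0 and u = u] normal unfolding nabN_def nabV_def Vy0 by blast
  then have 2: "G x0 (nabN u) (J v) = - B u v" for v
    unfolding B_def using metric_sym[OF m, of "nabV u v" "n y0"] by (metis add.inverse_unique add.commute minus_minus)
  have "nabN u = (\<Sum>j<7. G x0 (nabN u) (e j) *\<^sub>R e j)" using orthonormal_expand[OF H.D(2,3), of "nabN u"] by simp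
  also have "\<dots> = (\<Sum>j<6. G x0 (nabN u) (e j) *\<^sub>R e j)"
    using sum.lessThan_Suc[of "\<lambda>j. G x0 (nabN u) (e j) *\<^sub>R e j" 6] by (simp add: 1)
  also have "\<dots> = (\<Sum>j<6. - B u (H.b j) *\<^sub>R e j)" by (intro sum.cong refl) (simp add: H.Jb flip: 2)
  finally show ?thesis .
qed

text \<open>Leibniz rule slot by slot; the Christoffel terms contained in \<open>nabla4\<close> are
  exactly those that complete the derivatives of the moving arguments to covariant ones.\<close>

lemma Psi_along:
  "((\<lambda>y. val4 (\<Psi> (f y)) (n y) (V a y) (V b y) (V c y)) has_derivative
    (\<lambda>u. nabla4 (J u) (n y0) (J a) (J b) (J c) + val4 (\<Psi> x0) (nabN u) (J a) (J b) (J c) + val4 (\<Psi> x0) (n y0) (nabV u a) (J b) (J c)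
      + val4 (\<Psi> x0) (n y0) (J a) (nabV u b) (J c) + val4 (\<Psi> x0) (n y0) (J a) (J b) (nabV u c))) (at y0)"
proof -
  note pl = val4_linear[OF facts(2)]
  have Qd: "(\<lambda>x. val4 (\<Psi> x) a b c d) differentiable (at x0)" for a b c d
    using val4_has_derivative unfolding differentiable_def by blast
  note 1 = has_derivative_slot[OF evU[OF pl(1)[OF fS]] pull_derivative[OF differentiableD[OF Qd]] n_derivative]
  note 2 = has_derivative_slot[OF evU[OF pl(2)[OF fS]] 1 V_derivative]
  note 3 = has_derivative_slot[OF evU[OF pl(3)[OF fS]] 2 V_derivative]
  note 4 = has_derivative_slot[OF evU[OF pl(4)[OF fS]] 3 V_derivative]
  note la = linear_add[OF pl(1)[OF S(2)]] linear_add[OF pl(2)[OF S(2)]] linear_add[OF pl(3)[OF S(2)]] linear_add[OF pl(4)[OF S(2)]]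
  show ?thesis
  proof (rule has_derivative_eq_rhs[OF _ ext])
    show "((\<lambda>y. val4 (\<Psi> (f y)) (n y) (V a y) (V b y) (V c y)) has_derivative
        (\<lambda>u. DQ (J u) (n y0) (V a y0) (V b y0) (V c y0) + val4 (\<Psi> (f y0)) (frechet_derivative n (at y0) u) (V a y0) (V b y0) (V c y0)
          + val4 (\<Psi> (f y0)) (n y0) (frechet_derivative (V a) (at y0) u) (V b y0) (V c y0)
          + val4 (\<Psi> (f y0)) (n y0) (V a y0) (frechet_derivative (V b) (at y0) u) (V c y0)
          + val4 (\<Psi> (f y0)) (n y0) (V a y0) (V b y0) (frechet_derivative (V c) (at y0) u))) (at y0)"
      by (rule 4)
  next
    fix u
    show "DQ (J u) (n y0) (V a y0) (V b y0) (V c y0) + val4 (\<Psi> (f y0)) (frechet_derivative n (at y0) u) (V a y0) (V b y0) (V c y0)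
          + val4 (\<Psi> (f y0)) (n y0) (frechet_derivative (V a) (at y0) u) (V b y0) (V c y0)
          + val4 (\<Psi> (f y0)) (n y0) (V a y0) (frechet_derivative (V b) (at y0) u) (V c y0)
          + val4 (\<Psi> (f y0)) (n y0) (V a y0) (V b y0) (frechet_derivative (V c) (at y0) u)
      = nabla4 (J u) (n y0) (J a) (J b) (J c) + val4 (\<Psi> x0) (nabN u) (J a) (J b) (J c) + val4 (\<Psi> x0) (n y0) (nabV u a) (J b) (J c)
          + val4 (\<Psi> x0) (n y0) (J a) (nabV u b) (J c) + val4 (\<Psi> x0) (n y0) (J a) (J b) (nabV u c)"
      unfolding x0 Vy0 nabla4_def nabN_def nabV_def la by linarith
  qed
qed

lemma nabla4_normal: "nabla4 (n y0) (J a) (J b) (J c) (J d) = 0"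
proof -
  define \<alpha> where "\<alpha> = pullback J (\<lambda>v. nabla4 (n y0) (v 0) (v (Suc 0)) (v 2) (v 3))"
  have \<alpha>: "is_form 4 \<alpha>" unfolding \<alpha>_def by (rule is_form_pullback[OF H.J(1) nabla4_form])
  have v: "val4 \<alpha> a b c d = nabla4 (n y0) (J a) (J b) (J c) (J d)" for a b c d
    by (simp add: \<alpha>_def val4_def pullback_def eval_nat_numeral)
  have "\<alpha> = (\<lambda>_. 0)"
  proof (rule form4_ext[OF \<alpha> is_form_zero H.b_span])
    show "\<forall>l<6. \<forall>k<l. \<forall>j<k. \<forall>i<j. val4 \<alpha> (H.b i) (H.b j) (H.b k) (H.b l) = val4 (\<lambda>_. 0) (H.b i) (H.b j) (H.b k) (H.b l)"
      using parallel_normal[OF closed H.st] by (simp add: v H.Jb e6 val4_def[of "\<lambda>_. 0"])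
  qed
  then show ?thesis using v[of a b c d] by (simp add: val4_def)
qed

lemma ext_deriv_along:
  assumes R: "\<And>y v. y \<in> U \<Longrightarrow> R y v = - val4 (\<Psi> (f y)) (n y) (V (v 0) y) (V (v 1) y) (V (v 2) y)"
  shows "ext_deriv_at 3 R y0 v = H.shape_action B (v 0) (v 1) (v 2) (v 3)"
proof -
  let ?T = "\<lambda>u a b c. nabla4 (J u) (n y0) (J a) (J b) (J c) + val4 (\<Psi> x0) (nabN u) (J a) (J b) (J c) + val4 (\<Psi> x0) (n y0) (nabV u a) (J b) (J c)
      + val4 (\<Psi> x0) (n y0) (J a) (nabV u b) (J c) + val4 (\<Psi> x0) (n y0) (J a) (J b) (nabV u c)"
  have t: "frechet_derivative (\<lambda>y. R y w) (at y0) u = - ?T u (w 0) (w 1) (w 2)" for w u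
  proof -
    have 1: "\<forall>\<^sub>F y in nhds y0. R y w = - val4 (\<Psi> (f y)) (n y) (V (w 0) y) (V (w 1) y) (V (w 2) y)"
      by (rule evU) (rule R)
    show ?thesis unfolding frechet_derivative_cong_ev[OF 1]
      using frechet_derivativeI[OF has_derivative_minus[OF Psi_along]] by simp
  qed
  obtain a b c d where abcd: "v 0 = a" "v (Suc 0) = b" "v 2 = c" "v 3 = d" "v (Suc (Suc 0)) = c" "v (Suc (Suc (Suc 0))) = d"
    by (simp add: eval_nat_numeral)
  have n: "val4 (\<Psi> x0) (nabN u) x y z = - (\<Sum>j<6. B u (H.b j) * val4 (\<Psi> x0) (e j) x y z)" for u x y z
  proof -
    have L: "linear (\<lambda>w. val4 (\<Psi> x0) w x y z)" by (rule val4_linear(1)[OF H.D(6)])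
    show ?thesis unfolding nabN linear_sum[OF L] linear_scale[OF L] by (simp add: sum_negf)
  qed
  note pa = val4_alt[OF H.D(6)]
  \<comment> \<open>With \<open>nabV\<close> always in the second slot, terms that differ by
    exchanging its two arguments become visibly equal and cancel in pairs.\<close>
  have sw: "val4 (\<Psi> x0) w x (nabV s u) z = - val4 (\<Psi> x0) w (nabV s u) x z" "val4 (\<Psi> x0) w x y (nabV s u) = val4 (\<Psi> x0) w (nabV s u) x y" for w x y z s u
    using pa(8,9) by (metis minus_minus)+
  have "ext_deriv_at 3 R y0 v = - (?T a b c d - ?T b a c d + ?T c a b d - ?T d a b c)"
    unfolding ext_deriv_at_def t by (simp add: eval_nat_numeral abcd)
  \<comment> \<open>\<open>closed4\<close> with the normal as first vector trades the four
    tangential derivatives of the 4-form for the normal one, which is zero by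
    \<open>nabla4_normal\<close>.\<close>
  also have "\<dots> = - (val4 (\<Psi> x0) (nabN a) (J b) (J c) (J d) - val4 (\<Psi> x0) (nabN b) (J a) (J c) (J d)
      + val4 (\<Psi> x0) (nabN c) (J a) (J b) (J d) - val4 (\<Psi> x0) (nabN d) (J a) (J b) (J c))"
    using closed4[OF closed(2), of "n y0" "J a" "J b" "J c" "J d"] nabla4_normal[of a b c d]
    unfolding sw nabV_sym[of b a] nabV_sym[of c a] nabV_sym[of c b] nabV_sym[of d a] nabV_sym[of d b] nabV_sym[of d c]
    by linarith
  also have "\<dots> = H.shape_action B a b c d"
    unfolding n H.shape_action_def[OF B_bilinear] by (simp add: sum.distrib sum_subtractf)
  finally show ?thesis by (simp add: abcd)
qed

end

section \<open>Charts\<close>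

lemma val4_pullback: "is_form 4 \<alpha> \<Longrightarrow> val4 (pullback L \<alpha>) x y z w = val4 \<alpha> (L x) (L y) (L z) (L w)"
proof -
  assume a: "is_form 4 \<alpha>"
  have "val4 (pullback L \<alpha>) x y z w = \<alpha> (\<lambda>i. L ((x ## y ## z ## w ## (\<lambda>_. 0)) i))"
    unfolding val4_def pullback_def ..
  then show ?thesis using form_val4[OF a, of "\<lambda>i. L ((x ## y ## z ## w ## (\<lambda>_. 0)) i)"] by (simp add: eval_nat_numeral)
qed

text \<open>The frame is carried back by the inverse map. \<open>dual_form\<close> is natural, and a
  positive determinant preserves the orientation.\<close>

lemma g2_structure_pullback:
  assumes s: "g2_structure \<phi> g \<psi> e" and o: "positively_oriented e" and T: "linear T" "0 < det (matrix T)"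
  shows "\<exists>e'. g2_structure (pullback T \<phi>) (\<lambda>u v. g (T u) (T v)) (pullback T \<psi>) e' \<and> positively_oriented e'"
proof -
  note D = g2_structureD[OF s]
  have inj: "inj T" using T det_nz_iff_inj[OF T(1)] by simp
  obtain T' where T': "linear T'" "\<And>x. T' (T x) = x" "\<And>x. T (T' x) = x"
    using linear_injective_isomorphism[OF T(1) inj] by blast
  define e' where "e' i = T' (e i)" for i
  have Te: "T (e' i) = e i" for i by (simp add: e'_def T')
  have "span (e' ` {..<7}) = T' ` span (e ` {..<7})"
    using linear_span_image[OF T'(1), of "e ` {..<7}"] by (simp add: e'_def image_image)
  also have "\<dots> = UNIV" using D(1) T'(2) by (auto simp: g2_frame_def image_def) metis
  finally have sp: "span (e' ` {..<7}) = UNIV" .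
  have "g2_frame (pullback T \<phi>) e'"
    using D(1) is_form_pullback[OF T(1) D(5)] sp by (simp add: g2_frame_def val3_pullback[OF D(5)] Te)
  moreover have "is_metric (\<lambda>u v. g (T u) (T v))"
    unfolding is_metric_def
  proof (intro conjI allI impI)
    show "linear (\<lambda>v. g (T u) (T v))" for u using linear_compose[OF T(1) metric_linear(1)[OF D(2)]] by (simp add: o_def)
    show "g (T u) (T v) = g (T v) (T u)" for u v by (rule metric_sym[OF D(2)])
    show "0 < g (T u) (T u)" if "u \<noteq> 0" for u
      using that inj linear_0[OF T(1)] metric_pos[OF D(2), of "T u"] by (metis injD)
  qed
  moreover have "orthonormal_frame (\<lambda>u v. g (T u) (T v)) e'"
    using D(3) by (simp add: orthonormal_frame_def Te)
  moreover have "interior_prod (e' p) (pullback T \<phi>) = pullback T (interior_prod (e p) \<phi>)" for p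
  proof
    fix v
    have "(\<lambda>i. T (case_nat (e' p) v i)) = case_nat (e p) (\<lambda>i. T (v i))" by (auto simp: fun_eq_iff Te split: nat.split)
    then show "interior_prod (e' p) (pullback T \<phi>) v = pullback T (interior_prod (e p) \<phi>) v"
      by (simp add: interior_prod_def pullback_def)
  qed
  then have "pullback T \<psi> = dual_form (pullback T \<phi>) e'"
    unfolding D(4) dual_form_def by (simp add: pullback_def wedge_def)
  moreover have "positively_oriented e'"
  proof -
    obtain L :: "real ^ 7 \<Rightarrow> real ^ 7" where L: "linear L" "\<forall>k<7. L (std_frame k) = e k" "0 < det (matrix L)"
      using o by (auto simp: positively_oriented_def)
    have "T \<circ> T' = id" using T'(3) by auto
    then have "matrix T ** matrix T' = mat 1"
      using matrix_compose[OF T'(1) T(1)] by (simp add: matrix_id_mat_1)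
    then have "det (matrix T) * det (matrix T') = 1" by (metis det_mul det_I)
    then have "0 < det (matrix T')" using T(2) by (metis zero_less_mult_pos zero_less_one)
    then have "0 < det (matrix (T' \<circ> L))" using L(3) by (simp add: matrix_compose[OF L(1) T'(1)] det_mul)
    moreover have "linear (T' \<circ> L)" using L(1) T'(1) by (rule linear_compose)
    ultimately show ?thesis unfolding positively_oriented_def using L(2) by (intro exI[of _ "T' \<circ> L"]) (simp add: e'_def)
  qed
  ultimately show ?thesis unfolding g2_structure_def by blast
qed

lemma chart_inv_fun: "is_chart S c \<Longrightarrow> q \<in> chart_dom c \<Longrightarrow> chart_inv c (chart_fun c q) = q"
  by (simp add: is_chart_def homeomorphism_def)

lemma chart_openin: "is_chart S c \<Longrightarrow> openin (top_of_set S) (chart_dom c)"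
  by (simp add: is_chart_def)

lemma chart_image_open:
  assumes c: "is_chart S c" and W: "openin (top_of_set M) W" and S: "S \<subseteq> M"
  shows "open (chart_fun c ` (chart_dom c \<inter> W))"
proof -
  obtain O' where O': "open O'" "W = M \<inter> O'" using W by (auto simp: openin_open)
  have cd: "chart_dom c \<subseteq> S" using c openin_imp_subset unfolding is_chart_def by blast
  have "chart_dom c \<inter> W = chart_dom c \<inter> O'" using cd S O'(2) by blast
  then have 1: "openin (top_of_set (chart_dom c)) (chart_dom c \<inter> W)" using O'(1) by (auto simp: openin_open)
  have "openin (top_of_set (chart_fun c ` chart_dom c)) (chart_fun c ` (chart_dom c \<inter> W))"
    using c 1 unfolding is_chart_def by (metis homeomorphism_imp_open_map)
  then show ?thesis using c unfolding is_chart_def by (metis openin_open_eq)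
qed

text \<open>The factorisation is available on an open overlap only. As the charts may belong to
  different manifolds, the rule serves both coordinate changes and the inclusion.\<close>

lemma coord_map_chain:
  assumes a: "is_chart S a" and c: "is_chart T c" and q: "q \<in> chart_dom a" "q \<in> chart_dom c"
    and o: "open (chart_fun a ` (chart_dom a \<inter> chart_dom c))"
    and d1: "coord_map a c differentiable (at (chart_fun a q))" and d2: "coord_map c d differentiable (at (chart_fun c q))"
  shows "frechet_derivative (coord_map a d) (at (chart_fun a q)) u
    = frechet_derivative (coord_map c d) (at (chart_fun c q)) (frechet_derivative (coord_map a c) (at (chart_fun a q)) u)"
proof -
  have v: "coord_map a c (chart_fun a r) = chart_fun c r" if "r \<in> chart_dom a" for r
    using that by (simp add: coord_map_def chart_inv_fun[OF a])
  have "coord_map a d y = coord_map c d (coord_map a c y)" if "y \<in> chart_fun a ` (chart_dom a \<inter> chart_dom c)" for y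
    using that by (auto simp: coord_map_def chart_inv_fun[OF a] chart_inv_fun[OF c])
  then have 1: "\<forall>\<^sub>F y in nhds (chart_fun a q). coord_map a d y = coord_map c d (coord_map a c y)"
    using o q by (auto simp: eventually_nhds)
  have "((\<lambda>y. coord_map c d (coord_map a c y)) has_derivative
      (\<lambda>u. frechet_derivative (coord_map c d) (at (chart_fun c q)) (frechet_derivative (coord_map a c) (at (chart_fun a q)) u))) (at (chart_fun a q))"
    using has_derivative_compose[OF differentiableD[OF d1]] differentiableD[OF d2] unfolding v[OF q(1)] by blast
  then show ?thesis unfolding frechet_derivative_cong_ev[OF 1] by (simp add: frechet_derivativeI)
qed

lemma coord_map_self:
  assumes c: "is_chart S c" and q: "q \<in> chart_dom c"
  shows "frechet_derivative (coord_map c c) (at (chart_fun c q)) = (\<lambda>u. u)"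
proof -
  have "coord_map c c y = y" if "y \<in> chart_fun c ` chart_dom c" for y
    using that by (auto simp: coord_map_def chart_inv_fun[OF c])
  then have 1: "\<forall>\<^sub>F y in nhds (chart_fun c q). coord_map c c y = y"
    using c q by (auto simp: eventually_nhds is_chart_def)
  show ?thesis unfolding frechet_derivative_cong_ev[OF 1] by (rule frechet_derivativeI) (rule has_derivative_ident)
qed

lemma oriented_manifoldD:
  assumes "oriented_manifold S A"
  shows "c \<in> A \<Longrightarrow> is_chart S c" and "c \<in> A \<Longrightarrow> chart_dom c \<subseteq> S"
    and "p \<in> S \<Longrightarrow> chart_at A p \<in> A" "p \<in> S \<Longrightarrow> p \<in> chart_dom (chart_at A p)"
    and "c \<in> A \<Longrightarrow> d \<in> A \<Longrightarrow> smooth_on (chart_fun c ` (chart_dom c \<inter> chart_dom d)) (coord_map c d)"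
    and "c \<in> A \<Longrightarrow> d \<in> A \<Longrightarrow> p \<in> chart_dom c \<Longrightarrow> p \<in> chart_dom d \<Longrightarrow>
      0 < det (matrix (frechet_derivative (coord_map c d) (at (chart_fun c p))))"
proof -
  have u: "(\<Union>c\<in>A. chart_dom c) = S" using assms by (simp add: oriented_manifold_def)
  show "c \<in> A \<Longrightarrow> is_chart S c" "c \<in> A \<Longrightarrow> d \<in> A \<Longrightarrow> smooth_on (chart_fun c ` (chart_dom c \<inter> chart_dom d)) (coord_map c d)"
    "c \<in> A \<Longrightarrow> d \<in> A \<Longrightarrow> p \<in> chart_dom c \<Longrightarrow> p \<in> chart_dom d \<Longrightarrow>
      0 < det (matrix (frechet_derivative (coord_map c d) (at (chart_fun c p))))"
    using assms by (simp_all add: oriented_manifold_def)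
  show "chart_dom c \<subseteq> S" if "c \<in> A" using that u by blast
  assume "p \<in> S"
  then have "\<exists>c. c \<in> A \<and> p \<in> chart_dom c" using u by blast
  from someI_ex[OF this] show "chart_at A p \<in> A" "p \<in> chart_dom (chart_at A p)" by (simp_all add: chart_at_def)
qed

lemma smooth_on_differentiable: "smooth_on S f \<Longrightarrow> x \<in> S \<Longrightarrow> f differentiable (at x)"
  unfolding smooth_on_def by (metis Ck_on.simps(2))

lemma smooth_on_derivative_differentiable:
  assumes "smooth_on S f" "x \<in> S" shows "(\<lambda>x. frechet_derivative f (at x) v) differentiable (at x)"
proof -
  have "Ck_on (Suc (Suc 0)) S f" using assms(1) unfolding smooth_on_def by blast
  then show ?thesis using assms(2) by simp
qed

section \<open>From charts to coordinate patches\<close>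

locale g2_submanifold =
  fixes M N :: "'m::{t2_space,second_countable_topology} set"
    and AM :: "('m, 7) chart set" and AN :: "('m, 6) chart set"
    and \<phi> :: "'m \<Rightarrow> (real ^ 7) form" and g :: "'m \<Rightarrow> real ^ 7 \<Rightarrow> real ^ 7 \<Rightarrow> real" and \<nu> :: "'m \<Rightarrow> real ^ 7"
  assumes M: "oriented_manifold M AM" and torsion_free: "torsion_free_G2 M AM \<phi>" and g: "g = (\<lambda>p. G2_metric (\<phi> p))"
    and N: "embedded_submanifold N AN M AM" and normal: "unit_normal_field N AN AM g \<nu>"
    and orientation_N: "\<And>p. p \<in> N \<Longrightarrow> let \<omega> = pullback (incl_deriv AN AM p) (interior_prod (\<nu> p) (\<phi> p)) in
      0 < top_coeff (wedge 4 2 (wedge 2 2 \<omega> \<omega>) \<omega>)"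
begin

definition "\<psi> q = hodge (G2_metric (\<phi> q)) 3 (\<phi> q)"

abbreviation "incl \<equiv> incl_deriv AN AM"

lemma NM: "N \<subseteq> M" and N_manifold: "oriented_manifold N AN"
  using N by (auto simp: embedded_submanifold_def)

lemmas MD = oriented_manifoldD[OF M] and ND = oriented_manifoldD[OF N_manifold]

lemma structure_at: "q \<in> M \<Longrightarrow> \<exists>e. g2_structure (\<phi> q) (g q) (\<psi> q) e \<and> positively_oriented e"
  using torsion_free positive_3form_g2_structure unfolding torsion_free_G2_def g \<psi>_def by blast

lemma M_open: "c \<in> AM \<Longrightarrow> c' \<in> AM \<Longrightarrow> open (chart_fun c ` (chart_dom c \<inter> chart_dom c'))"
  by (rule chart_image_open[OF MD(1) chart_openin[OF MD(1)] order_refl])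

lemma N_open: "d \<in> AN \<Longrightarrow> d' \<in> AN \<Longrightarrow> open (chart_fun d ` (chart_dom d \<inter> chart_dom d'))"
  by (rule chart_image_open[OF ND(1) chart_openin[OF ND(1)] order_refl])

lemma NM_open: "d \<in> AN \<Longrightarrow> c \<in> AM \<Longrightarrow> open (chart_fun d ` (chart_dom d \<inter> chart_dom c))"
  by (rule chart_image_open[OF ND(1) chart_openin[OF MD(1)] NM])

lemma NM_smooth: "d \<in> AN \<Longrightarrow> c \<in> AM \<Longrightarrow> smooth_on (chart_fun d ` (chart_dom d \<inter> chart_dom c)) (coord_map d c)"
  using N by (simp add: embedded_submanifold_def)

lemma M_differentiable:
  "c \<in> AM \<Longrightarrow> c' \<in> AM \<Longrightarrow> q \<in> chart_dom c \<Longrightarrow> q \<in> chart_dom c' \<Longrightarrow> coord_map c c' differentiable (at (chart_fun c q))"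
  by (rule smooth_on_differentiable[OF MD(5)]) auto

lemma N_differentiable:
  "d \<in> AN \<Longrightarrow> d' \<in> AN \<Longrightarrow> q \<in> chart_dom d \<Longrightarrow> q \<in> chart_dom d' \<Longrightarrow> coord_map d d' differentiable (at (chart_fun d q))"
  by (rule smooth_on_differentiable[OF ND(5)]) auto

lemma NM_differentiable:
  "d \<in> AN \<Longrightarrow> c \<in> AM \<Longrightarrow> q \<in> chart_dom d \<Longrightarrow> q \<in> chart_dom c \<Longrightarrow> coord_map d c differentiable (at (chart_fun d q))"
  by (rule smooth_on_differentiable[OF NM_smooth]) auto

lemma tangent_linear:
  assumes "c \<in> AM" "q \<in> chart_dom c"
  shows "linear (tangent_coord AM c q)" "0 < det (matrix (tangent_coord AM c q))"
proof -
  have q: "q \<in> M" using assms MD(2) by blast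
  show "linear (tangent_coord AM c q)"
    unfolding tangent_coord_def
    by (rule has_derivative_linear[OF differentiableD[OF M_differentiable]]) (use assms MD(3,4)[OF q] in auto)
  show "0 < det (matrix (tangent_coord AM c q))"
    unfolding tangent_coord_def by (rule MD(6)) (use assms MD(3,4)[OF q] in auto)
qed

text \<open>Either side is the derivative of the coordinate map from \<open>d\<close> to the
  preferred chart of M, factored through \<open>c\<close> on the left and through the preferred
  chart of N on the right.\<close>

lemma tangent_coord_incl:
  assumes d: "d \<in> AN" "q \<in> chart_dom d" and c: "c \<in> AM" "q \<in> chart_dom c"
  shows "tangent_coord AM c q (frechet_derivative (coord_map d c) (at (chart_fun d q)) u) = incl q (tangent_coord AN d q u)"
proof -
  have q: "q \<in> N" "q \<in> M" using assms ND(2) NM by blast+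
  note mc = MD(3,4)[OF q(2)] and nc = ND(3,4)[OF q(1)]
  have "frechet_derivative (coord_map d (chart_at AM q)) (at (chart_fun d q)) u
      = tangent_coord AM c q (frechet_derivative (coord_map d c) (at (chart_fun d q)) u)"
    unfolding tangent_coord_def
    by (rule coord_map_chain[OF ND(1)[OF d(1)] MD(1)[OF c(1)] d(2) c(2) NM_open NM_differentiable M_differentiable]) (use d c mc in auto)
  moreover have "frechet_derivative (coord_map d (chart_at AM q)) (at (chart_fun d q)) u = incl q (tangent_coord AN d q u)"
    unfolding tangent_coord_def incl_deriv_def
    by (rule coord_map_chain[OF ND(1)[OF d(1)] ND(1)[OF nc(1)] d(2) nc(2) N_open N_differentiable NM_differentiable]) (use d mc nc in auto)
  ultimately show ?thesis by simp
qed

lemma hyper_at: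
  assumes q: "q \<in> N"
  shows "\<exists>e. g2_hyper (\<phi> q) (g q) (\<psi> q) e (incl q) \<and> e 6 = \<nu> q"
proof -
  have qM: "q \<in> M" using q NM by blast
  note mc = MD(3,4)[OF qM] and nc = ND(3,4)[OF q]
  obtain e0 where e0: "g2_structure (\<phi> q) (g q) (\<psi> q) e0" using structure_at[OF qM] by blast
  have nu: "g q (\<nu> q) (\<nu> q) = 1" "g q (\<nu> q) (incl q u) = 0" for u
    using normal q by (auto simp: unit_normal_field_def)
  obtain e where e: "g2_structure (\<phi> q) (g q) (\<psi> q) e" "e 6 = \<nu> q" using g2_frame_with_last[where \<nu> = "\<nu> q", OF e0 nu(1)] by blast
  have "g2_hyper (\<phi> q) (g q) (\<psi> q) e (incl q)"
  proof (rule g2_hyper.intro)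
    show "g2_structure (\<phi> q) (g q) (\<psi> q) e" by (rule e)
    show "linear (incl q)"
      unfolding incl_deriv_def by (rule has_derivative_linear[OF differentiableD[OF NM_differentiable]]) (use mc nc in auto)
    show "inj (incl q)" unfolding incl_deriv_def using N mc nc by (simp add: embedded_submanifold_def)
    show "g q (e 6) (incl q u) = 0" for u using nu(2) e(2) by simp
    show "0 < top_coeff (wedge 4 2 (wedge 2 2 (pullback (incl q) (interior_prod (e 6) (\<phi> q))) (pullback (incl q) (interior_prod (e 6) (\<phi> q))))
        (pullback (incl q) (interior_prod (e 6) (\<phi> q))))"
      using orientation_N[OF q] e(2) by (simp add: Let_def)
  qed
  then show ?thesis using e(2) by blast
qed

text \<open>The pointwise identification of \<open>tilde\<close>, rewritten in one fixed pair of
  charts so that it can be differentiated although the preferred charts may jump from point to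
  point.\<close>

lemma local_tilde:
  assumes d: "d \<in> AN" "q \<in> chart_dom d" and c: "c \<in> AM" "q \<in> chart_dom c"
  defines "D \<equiv> frechet_derivative (coord_map d c) (at (chart_fun d q))"
  shows "local_form AN d (\<lambda>p. tilde (restrict_form AN AM \<phi> p)) (chart_fun d q) v
    = - val4 (\<psi> q) (\<nu> q) (tangent_coord AM c q (D (v 0))) (tangent_coord AM c q (D (v 1))) (tangent_coord AM c q (D (v 2)))"
proof -
  have q: "q \<in> N" using d ND(2) by blast
  obtain e where e: "g2_hyper (\<phi> q) (g q) (\<psi> q) e (incl q)" "e 6 = \<nu> q" using hyper_at[OF q] by blast
  interpret H: g2_hyper "\<phi> q" "g q" "\<psi> q" e "incl q" by (rule e(1))
  have t: "tilde (restrict_form AN AM \<phi> q) = (\<lambda>v. - pullback (incl q) (interior_prod (\<nu> q) (\<psi> q)) v)"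
    using H.tilde by (simp add: restrict_form_def H.\<rho>_def H.\<rho>t_def e(2))
  show ?thesis
    unfolding D_def tangent_coord_incl[OF d c]
    by (simp add: local_form_def chart_inv_fun[OF ND(1)[OF d(1)] d(2)] t pullback_def interior_prod_def
        form_val4[OF H.D(6)] numeral_2_eq_2 numeral_3_eq_3)
qed

text \<open>Going from the preferred chart to \<open>c\<close> and back is the identity.\<close>

lemma normal_transport:
  assumes c: "c \<in> AM" "q \<in> chart_dom c"
  shows "tangent_coord AM c q (frechet_derivative (coord_map (chart_at AM q) c) (at (chart_fun (chart_at AM q) q)) v) = v"
proof -
  have q: "q \<in> M" using c MD(2) by blast
  note mc = MD(3,4)[OF q]
  have "frechet_derivative (coord_map (chart_at AM q) (chart_at AM q)) (at (chart_fun (chart_at AM q) q)) v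
      = tangent_coord AM c q (frechet_derivative (coord_map (chart_at AM q) c) (at (chart_fun (chart_at AM q) q)) v)"
    unfolding tangent_coord_def
    by (rule coord_map_chain[OF MD(1)[OF mc(1)] MD(1)[OF c(1)] mc(2) c(2) M_open M_differentiable M_differentiable]) (use c mc in auto)
  then show ?thesis using coord_map_self[OF MD(1)[OF mc(1)] mc(2)] by simp
qed

lemma local_g2:
  assumes c: "c \<in> AM" "p \<in> chart_dom c"
  shows "g2_local (chart_fun c ` chart_dom c) (local_form AM c \<phi>) (local_metric AM c g) (local_form AM c \<psi>) (chart_fun c p)"
proof
  note ic = MD(1)[OF c(1)]
  show "open (chart_fun c ` chart_dom c)" using ic by (simp add: is_chart_def)
  show "chart_fun c p \<in> chart_fun c ` chart_dom c" using c by blast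
  show "\<exists>e. g2_structure (local_form AM c \<phi> x) (local_metric AM c g x) (local_form AM c \<psi> x) e \<and> positively_oriented e"
    if x: "x \<in> chart_fun c ` chart_dom c" for x
  proof -
    obtain q where q: "q \<in> chart_dom c" "x = chart_fun c q" using x by blast
    have "q \<in> M" using q(1) c MD(2) by blast
    then obtain e where e: "g2_structure (\<phi> q) (g q) (\<psi> q) e" "positively_oriented e" using structure_at by blast
    have "local_metric AM c g x = (\<lambda>u v. g q (tangent_coord AM c q u) (tangent_coord AM c q v))"
      by (simp add: local_metric_def q chart_inv_fun[OF ic] fun_eq_iff)
    then show ?thesis
      using g2_structure_pullback[OF e tangent_linear[OF c(1) q(1)]] by (simp add: local_form_def q chart_inv_fun[OF ic])
  qed
  show "(\<lambda>x. local_form AM c \<phi> x v) differentiable (at (chart_fun c p))" for v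
    using torsion_free c by (intro smooth_on_differentiable[of "chart_fun c ` chart_dom c"]) (auto simp: torsion_free_G2_def smooth_form_field_def)
qed

text \<open>At \<open>p\<close> itself the charts \<open>c\<close> and \<open>d\<close> are the
  preferred ones, so local expressions there coincide with the given tensors; at neighbouring points
  they still carry the coordinate change.\<close>

lemma conclusion_at:
  assumes p: "p \<in> N"
  defines "\<rho> \<equiv> restrict_form AN AM \<phi>"
  defines "\<omega> \<equiv> restrict_form AN AM (\<lambda>p. interior_prod (\<nu> p) (\<phi> p))"
  defines "d\<rho> \<equiv> ext_deriv AN 3 (\<lambda>p. tilde (\<rho> p)) p" and "I \<equiv> complex_structure_of (\<rho> p)"
  shows "wedge 2 2 (form_of_hermitian I (hermitian_part I (second_fundamental_form AN AM g \<nu> p))) (\<omega> p) = (\<lambda>v. d\<rho> v / 2)"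
    and "mean_curvature AN AM g \<nu> p = top_quotient (wedge 4 2 d\<rho> (\<omega> p)) (vol_3form (\<rho> p)) / 2"
    and "semi_positive (\<rho> p) d\<rho> \<Longrightarrow> 0 < mean_curvature AN AM g \<nu> p"
proof -
  have pM: "p \<in> M" using p NM by blast
  define c where "c = chart_at AM p"
  define d where "d = chart_at AN p"
  have c: "c \<in> AM" "p \<in> chart_dom c" and d: "d \<in> AN" "p \<in> chart_dom d"
    unfolding c_def d_def by (rule MD(3,4)[OF pM] ND(3,4)[OF p])+
  note ic = MD(1)[OF c(1)] and id = ND(1)[OF d(1)]
  \<comment> \<open>The normal written in the single chart \<open>c\<close>; its components in the
    preferred charts need not vary continuously.\<close>
  define n where "n y = frechet_derivative (coord_map (chart_at AM (chart_inv d y)) c)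
    (at (chart_fun (chart_at AM (chart_inv d y)) (chart_inv d y))) (\<nu> (chart_inv d y))" for y
  let ?U = "chart_fun d ` (chart_dom d \<inter> chart_dom c)"
  have T: "tangent_coord AM c p = (\<lambda>u. u)"
    unfolding tangent_coord_def c_def[symmetric] by (rule coord_map_self[OF ic c(2)])
  have \<Phi>p: "local_form AM c \<alpha> (chart_fun c p) = \<alpha> p" for \<alpha>
    by (simp add: local_form_def chart_inv_fun[OF ic c(2)] T pullback_def)
  have Gp: "local_metric AM c g (chart_fun c p) = g p"
    by (simp add: local_metric_def chart_inv_fun[OF ic c(2)] T fun_eq_iff)
  have np: "n (chart_fun d p) = \<nu> p"
    by (simp add: n_def chart_inv_fun[OF id d(2)] coord_map_self[OF ic c(2)] flip: c_def)
  have J: "incl p = frechet_derivative (coord_map d c) (at (chart_fun d p))"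
    by (simp add: incl_deriv_def c_def d_def)
  have fp: "coord_map d c (chart_fun d q) = chart_fun c q" if "q \<in> chart_dom d" for q
    using that by (simp add: coord_map_def chart_inv_fun[OF id])
  have Tn: "tangent_coord AM c q (n (chart_fun d q)) = \<nu> q" if "q \<in> chart_dom d" "q \<in> chart_dom c" for q
    using normal_transport[OF c(1) that(2)] by (simp add: n_def chart_inv_fun[OF id that(1)])
  obtain e where e: "g2_hyper (\<phi> p) (g p) (\<psi> p) e (incl p)" "e 6 = \<nu> p" using hyper_at[OF p] by blast
  interpret L: g2_local "chart_fun c ` chart_dom c" "local_form AM c \<phi>" "local_metric AM c g" "local_form AM c \<psi>" "chart_fun c p"
    by (rule local_g2[OF c])
  interpret A: g2_along "chart_fun c ` chart_dom c" "local_form AM c \<phi>" "local_metric AM c g" "local_form AM c \<psi>" "chart_fun c p"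
    ?U "coord_map d c" n "chart_fun d p" e "incl p"
  proof (rule g2_along.intro, rule L.g2_local_axioms, rule g2_along_axioms.intro)
    show "open ?U" by (rule NM_open[OF d(1) c(1)])
    show pU: "chart_fun d p \<in> ?U" using c(2) d(2) by blast
    show "coord_map d c differentiable (at y)" if y: "y \<in> ?U" for y
      by (rule smooth_on_differentiable[OF NM_smooth[OF d(1) c(1)] y])
    show "(\<lambda>y. frechet_derivative (coord_map d c) (at y) v) differentiable (at (chart_fun d p))" for v
      by (rule smooth_on_derivative_differentiable[OF NM_smooth[OF d(1) c(1)] pU])
    show "coord_map d c y \<in> chart_fun c ` chart_dom c" if y: "y \<in> ?U" for y using y fp by auto
    show "coord_map d c (chart_fun d p) = chart_fun c p" by (rule fp[OF d(2)])
    have "smooth_on ?U n" using normal c(1) d(1) unfolding unit_normal_field_def n_def Let_def by blast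
    then show "n differentiable (at (chart_fun d p))" using pU by (rule smooth_on_differentiable)
    show "local_metric AM c g (coord_map d c y) (n y) (n y) = 1" if y: "y \<in> ?U" for y
    proof -
      obtain q where q: "q \<in> chart_dom d" "q \<in> chart_dom c" "y = chart_fun d q" using y by blast
      have "q \<in> N" using q(1) d ND(2) by blast
      then show ?thesis using normal by (simp add: local_metric_def q fp chart_inv_fun[OF ic] Tn unit_normal_field_def)
    qed
    show "local_metric AM c g (coord_map d c y) (n y) (frechet_derivative (coord_map d c) (at y) v) = 0" if y: "y \<in> ?U" for y v
    proof -
      obtain q where q: "q \<in> chart_dom d" "q \<in> chart_dom c" "y = chart_fun d q" using y by blast
      have "q \<in> N" using q(1) d ND(2) by blast
      then show ?thesis
        using normal by (simp add: local_metric_def q fp chart_inv_fun[OF ic] Tn tangent_coord_incl[OF d(1) q(1) c(1) q(2)] unit_normal_field_def)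
    qed
    show "ext_deriv_at 3 (local_form AM c \<phi>) (chart_fun c p) = (\<lambda>_. 0)" "ext_deriv_at 4 (local_form AM c \<psi>) (chart_fun c p) = (\<lambda>_. 0)"
      using torsion_free pM unfolding torsion_free_G2_def ext_deriv_def Let_def \<psi>_def[abs_def] c_def by blast+
    show "g2_hyper (local_form AM c \<phi> (chart_fun c p)) (local_metric AM c g (chart_fun c p)) (local_form AM c \<psi> (chart_fun c p)) e (incl p)"
      unfolding \<Phi>p Gp by (rule e)
    show "e 6 = n (chart_fun d p)" using e(2) np by simp
    show "incl p = frechet_derivative (coord_map d c) (at (chart_fun d p))" by (rule J)
  qed
  have R: "local_form AN d (\<lambda>p. tilde (\<rho> p)) y v = - val4 (local_form AM c \<psi> (coord_map d c y)) (n y)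
      (frechet_derivative (coord_map d c) (at y) (v 0)) (frechet_derivative (coord_map d c) (at y) (v 1)) (frechet_derivative (coord_map d c) (at y) (v 2))"
    if y: "y \<in> ?U" for y v
  proof -
    obtain q where q: "q \<in> chart_dom d" "q \<in> chart_dom c" "y = chart_fun d q" using y by blast
    have "q \<in> M" using q(1) d ND(2) NM by blast
    then have f: "is_form 4 (\<psi> q)" using structure_at g2_structureD(6) by blast
    have "local_form AM c \<psi> (coord_map d c y) = pullback (tangent_coord AM c q) (\<psi> q)"
      by (simp add: local_form_def q fp chart_inv_fun[OF ic])
    then show ?thesis
      using local_tilde[OF d(1) q(1) c(1) q(2), of v] by (simp add: \<rho>_def q val4_pullback[OF f] Tn)
  qed
  have d\<rho>: "d\<rho> v = A.H.shape_action A.B (v 0) (v 1) (v 2) (v 3)" for v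
    unfolding d\<rho>_def ext_deriv_def Let_def d_def[symmetric] by (rule A.ext_deriv_along[OF R])
  have B: "second_fundamental_form AN AM g \<nu> p = A.B"
  proof (intro ext)
    fix u v
    have "second_fundamental_form AN AM g \<nu> p u v = g p (frechet_derivative (A.V v) (at (chart_fun d p)) u
        + christoffel (local_metric AM c g) (chart_fun c p) (incl p u) (incl p v)) (\<nu> p)"
      by (simp add: second_fundamental_form_def covariant_deriv_along_def Let_def fp[OF d(2)] J flip: c_def d_def)
    also have "\<dots> = A.B u v" unfolding A.B_def A.nabV_def L.Gam_def Gp np ..
    finally show "second_fundamental_form AN AM g \<nu> p u v = A.B u v" .
  qed
  have \<rho>: "A.H.\<rho> = \<rho> p" "A.H.\<omega> = \<omega> p" "A.H.h = induced_metric AN AM g p"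
    unfolding A.H.\<rho>_def A.H.\<omega>_def A.H.h_def unfolding \<Phi>p Gp by (simp_all add: \<rho>_def \<omega>_def restrict_form_def e(2) induced_metric_def fun_eq_iff)
  have \<beta>: "A.H.\<beta> A.B = form_of_hermitian I (hermitian_part I A.B)"
    unfolding A.H.\<beta>_def[OF A.B_bilinear] I_def \<rho>(1)[symmetric] A.H.complex_structure_of ..
  note conclusion = A.H.hypersurface_conclusion[OF A.B_bilinear d\<rho>, unfolded \<rho> \<beta>, folded B]
  show "wedge 2 2 (form_of_hermitian I (hermitian_part I (second_fundamental_form AN AM g \<nu> p))) (\<omega> p) = (\<lambda>v. d\<rho> v / 2)"
    by (rule conclusion(1))
  show "mean_curvature AN AM g \<nu> p = top_quotient (wedge 4 2 d\<rho> (\<omega> p)) (vol_3form (\<rho> p)) / 2"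
    unfolding mean_curvature_def by (rule conclusion(2))
  show "semi_positive (\<rho> p) d\<rho> \<Longrightarrow> 0 < mean_curvature AN AM g \<nu> p"
    unfolding mean_curvature_def by (rule conclusion(3))
qed

end

theorem proposition1:
  fixes M N :: "'m::{t2_space,second_countable_topology} set"
    and AM :: "('m, 7) chart set" and AN :: "('m, 6) chart set"
    and \<phi> :: "'m \<Rightarrow> (real ^ 7) form" and g :: "'m \<Rightarrow> real ^ 7 \<Rightarrow> real ^ 7 \<Rightarrow> real"
    and \<nu> :: "'m \<Rightarrow> real ^ 7"
    and \<rho> \<rho>t \<omega> \<beta> :: "'m \<Rightarrow> (real ^ 6) form"
    and B :: "'m \<Rightarrow> real ^ 6 \<Rightarrow> real ^ 6 \<Rightarrow> real" and \<mu> :: "'m \<Rightarrow> real"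
  assumes "oriented_manifold M AM"
    and "torsion_free_G2 M AM \<phi>"
    and g: "g = (\<lambda>p. G2_metric (\<phi> p))"
    and "embedded_submanifold N AN M AM"
    and "unit_normal_field N AN AM g \<nu>"
    and \<rho>: "\<rho> = restrict_form AN AM \<phi>"
    and \<rho>t: "\<rho>t = (\<lambda>p. tilde (\<rho> p))"
    and \<omega>: "\<omega> = restrict_form AN AM (\<lambda>p. interior_prod (\<nu> p) (\<phi> p))"
    and orientation_N: "\<forall>p\<in>N. 0 < top_coeff (wedge 4 2 (wedge 2 2 (\<omega> p) (\<omega> p)) (\<omega> p))"
    and B: "B = second_fundamental_form AN AM g \<nu>"
    and \<beta>: "\<beta> = (\<lambda>p. let I = complex_structure_of (\<rho> p) in
                   form_of_hermitian I (hermitian_part I (B p)))"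
    and \<mu>: "\<mu> = mean_curvature AN AM g \<nu>"
  shows "(\<forall>p\<in>N. wedge 2 2 (\<beta> p) (\<omega> p) = (\<lambda>v. ext_deriv AN 3 \<rho>t p v / 2)) \<and>
         (\<forall>p\<in>N. \<mu> p = top_quotient (wedge 4 2 (ext_deriv AN 3 \<rho>t p) (\<omega> p)) (vol_3form (\<rho> p)) / 2) \<and>
         (mean_convex N AN \<rho> \<longrightarrow> (\<forall>p\<in>N. 0 < \<mu> p))"
proof -
  interpret S: g2_submanifold M N AM AN \<phi> g \<nu>
    using assms(1-2,4-5) g orientation_N by unfold_locales (simp_all add: \<omega> restrict_form_def)
  note c = S.conclusion_at
  have 1: "wedge 2 2 (\<beta> p) (\<omega> p) = (\<lambda>v. ext_deriv AN 3 \<rho>t p v / 2)" if "p \<in> N" for p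
    unfolding \<beta> B Let_def \<omega> \<rho>t \<rho> by (rule c(1)[OF that])
  have 2: "\<mu> p = top_quotient (wedge 4 2 (ext_deriv AN 3 \<rho>t p) (\<omega> p)) (vol_3form (\<rho> p)) / 2" if "p \<in> N" for p
    unfolding \<mu> \<omega> \<rho>t \<rho> by (rule c(2)[OF that])
  have 3: "0 < \<mu> p" if "mean_convex N AN \<rho>" "p \<in> N" for p
    unfolding \<mu> by (rule c(3)[OF that(2)]) (use that in \<open>simp add: mean_convex_def \<rho>\<close>)
  show ?thesis using 1 2 3 by blast
qed

end
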